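(* Let $\{G_n\}$ be a sequence of random intersection graphs where the underlying bipartite graphs are $H_n=(V^1,V^2,F)$ with $V^1=V^1(n)$, $V^2=V^2(n)$, $F=F(n)$. For $i=1,2$ let $v_i^*=v_i^*(n)$ be a uniformly random element of $V^i$, $n_i=n_i(n)=|V^i|$ and $X^{(i)}=X^{(i)}(n)=X_{v_i^*}$. Suppose $\{n_1\},\{n_2\}$ are sequences of positive integers such that $n_1,n_2\to\infty$, $n_2/n_1\to\beta\in(0,\infty)$ and one of the following holds: (i) $G_n$, $n=1,2,\dots$, is an active random intersection graph and there is a random variable $D_1$ with $\mathbb{E} D_1\in(0,\infty)$ such that $\mathbb{E} X^{(1)}\to\mathbb{E} D_1$ and $$X^{(1)}\xrightarrow{d}D_1;\qquad (1)$$ in this case let $D_2\sim Po(\beta^{-1}\mathbb{E} D_1)$; (ii) $G_n$, $n=1,2,\dots$, is a passive random intersection graph and there is a random variable $D_2$ with $\mathbb{E} D_2\in(0,\infty)$ such that $\mathbb{E} X^{(2)}\to\mathbb{E} D_2$ and $$X^{(2)}\xrightarrow{d}D_2;\qquad (2)$$ in this case let $D_1\sim Po(\beta\,\mathbb{E} D_2)$; (iii) $G_n=G^{inhomog}(n_1,n_2,\xi^{(1)},\xi^{(2)})$, $n=1,2,\dots$, where for $i=1,2$, $0<\mathbb{E}\xi^{(i)}<\infty$ and $\xi^{(i)}$ does not depend on $n$; in this case let $D_1\sim Po(\beta^{1/2}\xi^{(1)}\mathbb{E}\xi^{(2)})$ and $D_2\sim Po(\beta^{-1/2}\xi^{(2)}\mathbb{E}\xi^{(1)})$;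 (iv) $G_n=G^{conf}(d_1,d_2)$, $n=1,2,\dots$, where $d_1=d_1(n)$, $d_2=d_2(n)$ are non-random and, for $i=1,2$, $\mathbb{E}\, d_{i,v_i^*}\to\mathbb{E} D_i$ and $d_{i,v_i^*}\xrightarrow{d}D_i$, where $D_1,D_2$ are random variables on $\{0,1,2,\dots\}$ with $\mathbb{E} D_1,\mathbb{E} D_2\in(0,\infty)$. Then both (1) and (2) hold, and $\mathcal{L}((G_n,v_1^* )|G_n)\xrightarrow{p}\mathcal{L}(G_{\mathcal{T}})$ with $\mathcal{T}=\mathcal{T}(D_1,D_2)$.
   Context: Rooted graphs and convergence. A rooted graph is a graph with a distinguished vertex (root). $B_r(G,v)$ is the subgraph of $G$ induced on the vertices at distance at most $r$ from $v$, rooted at $v$ (and $B_r(G)=B_r(G,\mathrm{root}(G))$ for rooted $G$); $\cong$ is root-preserving isomorphism. $\mathcal{G}_*$ is the space of connected locally finite rooted graphs up to $\cong$ with metric $d_{loc}(G_1,G_2)=2^{-\sup\{r:\,B_r(G_1)\cong B_r(G_2)\}}$. For a finite graph $G$ with $|V(G)|\ge 1$ and a connected rooted graph $H$ let $p_r(G,H)=|V(G)|^{-1}|\{v\in V(G):B_r(G,v)\cong H\}|$. For finite random graphs $G_n$ with $v_n^*$ uniformly random in $V(G_n)$ given $G_n$, and a random element $G^*$ of $\mathcal{G}_*$, $\mathcal{L}((G_n,v_n^* )|G_n)\xrightarrow{p}\mathcal{L}(G^* )$ means: for each integer $r\ge0$ and each connected rooted graph $H$, $p_r(G_n,H)\to\mathbb{P}(B_r(G^*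 )\cong H)$ in probability. $\xrightarrow{d}$ for random variables is convergence in distribution, and $\sim$ is equality in distribution. All limits are as $n\to\infty$. Random intersection graphs. For a bipartite (multi)graph $H=(V^1,V^2,E)$, the intersection graph $G(H)$ has vertex set $V^1$ and edges $uv$ ($u\ne v$) whenever there is $w\in V^2$ adjacent in $H$ to both $u$ and $v$. $V^i$ consists of the first $n_i$ elements of a fixed countable set $\mathcal{V}^i$, with $\mathcal{V}^1\cap\mathcal{V}^2=\emptyset$. For a vertex $v$ of $H$, $S_v$ is its set of neighbours in $H$ and $X_v=|S_v|$. The models (all distributions may depend on $n$ unless stated otherwise): - Active: each $v\in V^1$ independently draws $X_v$ from a distribution $P$ on $\{0,\dots,n_2\}$ and then its neighbour set $S_v$ as a uniformly random subset of $V^2$ of size $X_v$, independently of other vertices. - Passive: each $v\in V^2$ independently draws $X_v$ from a distribution $P$ on $\{0,\dots,n_1\}$ and then its neighbour set $S_v$ as a uniformly random subset of $V^1$ of size $X_v$, independently of other vertices. - Inhomogeneous, $G^{inhomog}(n_1,n_2,\xi^{(1)},\xi^{(2)})$: the vertices $v\in V^i$, $i=1,2$, get independent non-negative random weights $\xi_v^{(i)}\sim\xi^{(i)}$; given the weights, each edge $vw$, $v\in V^1,w\in V^2$, is present in $H$ independently with probability $\min\big(\xi_v^{(1)}\xi_w^{(2)}/\sqrt{n_1n_2},\,1\big)$. - Configuration, $G^{conf}(d_1,d_2)$: $d_1=\{d_{1,u},u\in V^1\}$, $d_2=\{d_{2,v},v\in V^2\}$ are sequences of non-negative integers with $\sum_u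 d_{1,u}=\sum_v d_{2,v}$. Vertex $v\in V^i$ receives $d_{i,v}$ half-edges, a uniformly random perfect matching between the half-edges of $V^1$ and those of $V^2$ is chosen, and each matched pair of half-edges gives an edge between the corresponding vertices (multiedges allowed); this gives a bipartite multigraph $H$, and the model is $G(H)$. Distributions. For a non-negative random variable $X$, $Po(X)$ denotes the mixed Poisson distribution: value $k$ has probability $\mathbb{E} e^{-X}X^k/k!$, $k=0,1,\dots$. For a non-negative integer valued $Z$ with $0<\mathbb{E}Z<\infty$, $Z^*$ denotes a random variable with the size-biased distribution $\mathbb{P}(Z^*=k)=k\,\mathbb{P}(Z=k)/\mathbb{E}Z$. Clique tree. For random variables $D_1,D_2$ on $\{0,1,2,\dots\}$ with means in $(0,\infty)$, $\mathcal{T}(D_1,D_2)$ is the Galton-Watson tree with a root (generation 0) having a number of offspring distributed as $D_1$; each node in an odd generation has a number of offspring distributed as $D_2^*-1$, each node in an even generation $\ge2$ has a number of offspring distributed as $D_1^*-1$, all independent. Regard $\mathcal{T}$ as a bipartite graph whose part $V^1$ consists of the even generations and part $V^2$ of the odd generations. The uncorrelated random clique tree $G_{\mathcal{T}}$ is the intersection graph of $\mathcal{T}$, rooted at the root of $\mathcal{T}$. *)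

theory Defs
  imports "HOL-Probability.Probability"
begin

section \<open>Rooted graphs and local convergence in probability\<close>

record 'a graph =
  verts :: "'a set"
  adj :: "('a \<times> 'a) set"

record 'a rooted_graph = "'a graph" +
  rroot :: 'a

definition wf_graph :: "('a, 'x) graph_scheme \<Rightarrow> bool" where
  "wf_graph G \<longleftrightarrow> adj G \<subseteq> verts G \<times> verts G \<and> sym (adj G) \<and> irrefl (adj G)"

definition connected_rooted_graph :: "'a rooted_graph \<Rightarrow> bool" where
  "connected_rooted_graph G \<longleftrightarrow>
     wf_graph G \<and> rroot G \<in> verts G \<and> (\<forall>u\<in>verts G. (rroot G, u) \<in> (adj G)\<^sup>*)"

definition dist_le :: "('a, 'x) graph_scheme \<Rightarrow> nat \<Rightarrow> 'a \<Rightarrow> 'a \<Rightarrow> bool" where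
  "dist_le G r u v \<longleftrightarrow> (\<exists>k\<le>r. (u, v) \<in> adj G ^^ k)"

definition nball :: "nat \<Rightarrow> ('a, 'x) graph_scheme \<Rightarrow> 'a \<Rightarrow> 'a rooted_graph" where
  "nball r G v =
     (let U = {u \<in> verts G. dist_le G r v u}
      in \<lparr>verts = U, adj = adj G \<inter> U \<times> U, rroot = v\<rparr>)"

definition rooted_iso :: "'a rooted_graph \<Rightarrow> 'b rooted_graph \<Rightarrow> bool" (infix \<open>\<cong>\<^sub>r\<close> 50) where
  "G \<cong>\<^sub>r K \<longleftrightarrow> (\<exists>f. bij_betw f (verts G) (verts K) \<and> f (rroot G) = rroot K \<and>
     (\<forall>u\<in>verts G. \<forall>v\<in>verts G. (u, v) \<in> adj G \<longleftrightarrow> (f u, f v) \<in> adj K))"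

definition ball_frequency :: "nat \<Rightarrow> 'a graph \<Rightarrow> 'b rooted_graph \<Rightarrow> real" where
  "ball_frequency r G K = real (card {v \<in> verts G. nball r G v \<cong>\<^sub>r K}) / real (card (verts G))"

definition conv_in_prob :: "(nat \<Rightarrow> 'w measure) \<Rightarrow> (nat \<Rightarrow> 'w \<Rightarrow> real) \<Rightarrow> real \<Rightarrow> bool" where
  "conv_in_prob M Y c \<longleftrightarrow>
     (\<forall>\<epsilon>>0. (\<lambda>n. measure (M n) {\<omega> \<in> space (M n). \<epsilon> < \<bar>Y n \<omega> - c\<bar>}) \<longlonglongrightarrow> 0)"

text \<open>
  The random finite graphs \<open>G n\<close> live on the probability spaces \<open>M n\<close>, the random rooted limit
  \<open>Gs\<close> on \<open>Ms\<close>. The vertex type \<open>'h\<close> of the test graphs is a parameter, so that a theorem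
  about \<open>TYPE('h)\<close> covers connected rooted test graphs over every type.
\<close>
definition local_conv_in_prob ::
  "'h itself \<Rightarrow> (nat \<Rightarrow> 'w measure) \<Rightarrow> (nat \<Rightarrow> 'w \<Rightarrow> 'a graph) \<Rightarrow>
     's measure \<Rightarrow> ('s \<Rightarrow> 'b rooted_graph) \<Rightarrow> bool" where
  "local_conv_in_prob _ M G Ms Gs \<longleftrightarrow>
     (\<forall>r. \<forall>K :: 'h rooted_graph. connected_rooted_graph K \<longrightarrow>
        conv_in_prob M (\<lambda>n \<omega>. ball_frequency r (G n \<omega>) K)
          (measure Ms {\<omega> \<in> space Ms. nball r (Gs \<omega>) (rroot (Gs \<omega>)) \<cong>\<^sub>r K}))"


section \<open>Bipartite multigraphs and intersection graphs\<close>

text \<open>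
  The two sides have separate vertex types, so \<open>part1\<close> and \<open>part2\<close> are disjoint by construction,
  even where both types are the same. \<open>mult H u w\<close> is the number of edges between
  \<open>u \<in> part1 H\<close> and \<open>w \<in> part2 H\<close>.
\<close>
record ('a, 'b) bigraph =
  part1 :: "'a set"
  part2 :: "'b set"
  mult :: "'a \<Rightarrow> 'b \<Rightarrow> nat"

definition nbrs1 :: "('a, 'b) bigraph \<Rightarrow> 'a \<Rightarrow> 'b set" where
  "nbrs1 H v = {w \<in> part2 H. mult H v w > 0}"

definition nbrs2 :: "('a, 'b) bigraph \<Rightarrow> 'b \<Rightarrow> 'a set" where
  "nbrs2 H w = {v \<in> part1 H. mult H v w > 0}"

definition intersection_graph :: "('a, 'b) bigraph \<Rightarrow> 'a graph" where
  "intersection_graph H =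
     \<lparr>verts = part1 H,
      adj = {(u, v). u \<in> part1 H \<and> v \<in> part1 H \<and> u \<noteq> v \<and>
               (\<exists>w\<in>part2 H. mult H u w > 0 \<and> mult H v w > 0)}\<rparr>"

definition simple_bigraph :: "'a set \<Rightarrow> 'b set \<Rightarrow> ('a \<times> 'b) set \<Rightarrow> ('a, 'b) bigraph" where
  "simple_bigraph V1 V2 E = \<lparr>part1 = V1, part2 = V2, mult = (\<lambda>u w. of_bool ((u, w) \<in> E))\<rparr>"


section \<open>The four models\<close>

text \<open>
  Each model is given by the law of the underlying bipartite graph, with vertex sets
  \<open>V1 = {..<n1}\<close> and \<open>V2 = {..<n2}\<close>.
\<close>
definition uniform_subset :: "nat \<Rightarrow> nat \<Rightarrow> nat set pmf" where
  "uniform_subset m k = pmf_of_set {S. S \<subseteq> {..<m} \<and> card S = k}"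

definition active_law :: "nat \<Rightarrow> nat \<Rightarrow> nat pmf \<Rightarrow> (nat, nat) bigraph pmf" where
  "active_law n1 n2 P =
     map_pmf (\<lambda>S. simple_bigraph {..<n1} {..<n2} {(v, w). v < n1 \<and> w \<in> S v})
       (Pi_pmf {..<n1} {} (\<lambda>_. bind_pmf P (uniform_subset n2)))"

definition passive_law :: "nat \<Rightarrow> nat \<Rightarrow> nat pmf \<Rightarrow> (nat, nat) bigraph pmf" where
  "passive_law n1 n2 P =
     map_pmf (\<lambda>S. simple_bigraph {..<n1} {..<n2} {(v, w). w < n2 \<and> v \<in> S w})
       (Pi_pmf {..<n2} {} (\<lambda>_. bind_pmf P (uniform_subset n1)))"

definition weighted_law ::
  "nat \<Rightarrow> nat \<Rightarrow> (nat \<Rightarrow> real) \<Rightarrow> (nat \<Rightarrow> real) \<Rightarrow> (nat, nat) bigraph pmf" where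
  "weighted_law n1 n2 x y =
     map_pmf (\<lambda>e. simple_bigraph {..<n1} {..<n2} {vw. e vw})
       (Pi_pmf ({..<n1} \<times> {..<n2}) False
          (\<lambda>(v, w). bernoulli_pmf (min (x v * y w / sqrt (real n1 * real n2)) 1)))"

text \<open>\<open>\<mu>1\<close> and \<open>\<mu>2\<close> are the distributions of the weights.\<close>
definition inhomog_law ::
  "nat \<Rightarrow> nat \<Rightarrow> real measure \<Rightarrow> real measure \<Rightarrow> (nat, nat) bigraph measure" where
  "inhomog_law n1 n2 \<mu>1 \<mu>2 =
     (\<Pi>\<^sub>M v\<in>{..<n1}. \<mu>1) \<Otimes>\<^sub>M (\<Pi>\<^sub>M w\<in>{..<n2}. \<mu>2)
       \<bind> (\<lambda>(x, y). measure_pmf (weighted_law n1 n2 x y))"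

lemma
  assumes "prob_space \<mu>1" "prob_space \<mu>2" "sets \<mu>1 = sets borel" "sets \<mu>2 = sets borel"
  shows prob_space_inhomog_law: "prob_space (inhomog_law n1 n2 \<mu>1 \<mu>2)"
    and sets_inhomog_law: "sets (inhomog_law n1 n2 \<mu>1 \<mu>2) = UNIV"
proof -
  note [measurable_cong] = assms(3,4)
  let ?N = "(\<Pi>\<^sub>M v\<in>{..<n1}. \<mu>1) \<Otimes>\<^sub>M (\<Pi>\<^sub>M w\<in>{..<n2}. \<mu>2)"
  interpret pair_prob_space "\<Pi>\<^sub>M v\<in>{..<n1}. \<mu>1" "\<Pi>\<^sub>M w\<in>{..<n2}. \<mu>2"
    using assms(1,2) by (simp add: pair_prob_space_def pair_sigma_finite_def prob_space_PiM
        prob_space_imp_sigma_finite)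
  let ?I = "{..<n1} \<times> {..<n2}"
  let ?q = "\<lambda>x y (v, w). bernoulli_pmf (min (x v * y w / sqrt (real n1 * real n2)) 1)"
  let ?F = "\<lambda>x y. Pi_pmf ?I False (?q x y)"
  let ?E = "{e. \<forall>vw. vw \<notin> ?I \<longrightarrow> e vw = False}"
  let ?g = "\<lambda>e. simple_bigraph {..<n1} {..<n2} {vw. e vw}"
  have fin: "finite ?E"
    using finite_PiE_dflt[of ?I "\<lambda>_. UNIV :: bool set" False]
    by (simp add: PiE_dflt_def)
  have eq: "emeasure (measure_pmf (weighted_law n1 n2 x y)) A
      = (\<Sum>e\<in>?E \<inter> ?g -` A. ennreal (\<Prod>vw\<in>?I. pmf (?q x y vw) (e vw)))" for x y A
  proof -
    have sub: "set_pmf (?F x y) \<subseteq> ?E"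
      by (rule set_Pi_pmf_subset) simp
    have "emeasure (measure_pmf (weighted_law n1 n2 x y)) A = emeasure (?F x y) (?g -` A)"
      by (simp add: weighted_law_def)
    also have "\<dots> = emeasure (?F x y) (?E \<inter> ?g -` A)"
      using sub by (intro emeasure_eq_AE) (auto simp: AE_measure_pmf_iff)
    also have "\<dots> = (\<Sum>e\<in>?E \<inter> ?g -` A. ennreal (pmf (?F x y) e))"
      using fin by (subst emeasure_measure_pmf_finite) auto
    also have "\<dots> = (\<Sum>e\<in>?E \<inter> ?g -` A. ennreal (\<Prod>vw\<in>?I. pmf (?q x y vw) (e vw)))"
      by (intro sum.cong refl) (subst pmf_Pi, auto)
    finally show ?thesis .
  qed
  have pb: "pmf (bernoulli_pmf p) b =
      (if b then min 1 (max 0 p) else 1 - min 1 (max 0 p))" for p b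
    by (simp add: bernoulli_pmf.rep_eq pmf_bernoulli_True)
  have meas: "(\<lambda>(x, y). measure_pmf (weighted_law n1 n2 x y))
      \<in> ?N \<rightarrow>\<^sub>M subprob_algebra (count_space UNIV)"
  proof (rule measurable_subprob_algebra)
    fix A :: "(nat, nat) bigraph set"
    have [measurable]: "(\<lambda>p. p i) \<in> borel_measurable (\<Pi>\<^sub>M v\<in>{..<m}. borel :: real measure)"
      if "i < m" for i m :: nat
      using that by (intro measurable_component_singleton) auto
    have "(\<lambda>p. pmf (?q (fst p) (snd p) vw) b) \<in> borel_measurable ?N"
      if vw: "vw \<in> ?I" for vw b
    proof -
      obtain v w where [simp]: "vw = (v, w)" "v < n1" "w < n2"
        using vw by auto
      have [measurable]: "(\<lambda>p. fst p v) \<in> borel_measurable ?N" "(\<lambda>p. snd p w) \<in> borel_measurable ?N"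
        by measurable
      show ?thesis
        by (simp add: pb) measurable
    qed
    then show "(\<lambda>p. emeasure (case p of (x, y) \<Rightarrow> measure_pmf (weighted_law n1 n2 x y)) A)
        \<in> borel_measurable ?N"
      unfolding case_prod_beta eq
      by (intro borel_measurable_sum measurable_compose[OF _ measurable_ennreal]
          borel_measurable_prod) auto
  qed (auto intro: prob_space_imp_subprob_space measure_pmf.prob_space_axioms)
  show "prob_space (inhomog_law n1 n2 \<mu>1 \<mu>2)"
    unfolding inhomog_law_def
    by (intro P.prob_space_bind[OF _ meas]) (auto simp: measure_pmf.prob_space_axioms)
  show "sets (inhomog_law n1 n2 \<mu>1 \<mu>2) = UNIV"
    unfolding inhomog_law_def
    by (subst sets_bind[where N = "count_space UNIV"]) (auto simp: P.not_empty)
qed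

definition half_edges :: "nat \<Rightarrow> (nat \<Rightarrow> nat) \<Rightarrow> (nat \<times> nat) set" where
  "half_edges m d = (SIGMA v:{..<m}. {..<d v})"

definition perfect_matchings :: "'a set \<Rightarrow> 'b set \<Rightarrow> ('a \<times> 'b) set set" where
  "perfect_matchings A B =
     {m. m \<subseteq> A \<times> B \<and> (\<forall>a\<in>A. \<exists>!b. (a, b) \<in> m) \<and> (\<forall>b\<in>B. \<exists>!a. (a, b) \<in> m)}"

lemma
  assumes "finite A" "finite B" "card A = card B"
  shows finite_perfect_matchings: "finite (perfect_matchings A B)"
    and perfect_matchings_nonempty: "perfect_matchings A B \<noteq> {}"
proof -
  show "finite (perfect_matchings A B)"
    by (rule finite_subset[of _ "Pow (A \<times> B)"]) (use assms in \<open>auto simp: perfect_matchings_def\<close>)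
  obtain f where f: "bij_betw f A B"
    using finite_same_card_bij assms by blast
  have "{(a, f a) |a. a \<in> A} \<in> perfect_matchings A B"
    using f unfolding perfect_matchings_def bij_betw_def inj_on_def by auto
  then show "perfect_matchings A B \<noteq> {}"
    by blast
qed

definition config_law ::
  "nat \<Rightarrow> nat \<Rightarrow> (nat \<Rightarrow> nat) \<Rightarrow> (nat \<Rightarrow> nat) \<Rightarrow> (nat, nat) bigraph pmf" where
  "config_law n1 n2 d1 d2 =
     map_pmf (\<lambda>m. \<lparr>part1 = {..<n1}, part2 = {..<n2},
                   mult = (\<lambda>u w. card {(i, j). ((u, i), (w, j)) \<in> m})\<rparr>)
       (pmf_of_set (perfect_matchings (half_edges n1 d1) (half_edges n2 d2)))"


section \<open>Distributions\<close>

abbreviation mean :: "nat pmf \<Rightarrow> real" where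
  "mean D \<equiv> measure_pmf.expectation D real"

definition has_pos_finite_mean :: "nat pmf \<Rightarrow> bool" where
  "has_pos_finite_mean D \<longleftrightarrow> integrable (measure_pmf D) real \<and> mean D > 0"

definition real_law :: "nat pmf \<Rightarrow> real measure" where
  "real_law D = distr (measure_pmf D) borel real"

text \<open>
  The law of \<open>X\<^sub>v\<close> for a uniformly random vertex \<open>v\<close> of \<open>V1\<close> (respectively \<open>V2\<close>), chosen
  independently of the random bipartite graph with law \<open>L\<close>.
\<close>
definition X1_law :: "nat \<Rightarrow> (nat, nat) bigraph measure \<Rightarrow> real measure" where
  "X1_law n1 L = distr (L \<Otimes>\<^sub>M measure_pmf (pmf_of_set {..<n1})) borel
     (\<lambda>(H, v). real (card (nbrs1 H v)))"

definition X2_law :: "nat \<Rightarrow> (nat, nat) bigraph measure \<Rightarrow> real measure" where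
  "X2_law n2 L = distr (L \<Otimes>\<^sub>M measure_pmf (pmf_of_set {..<n2})) borel
     (\<lambda>(H, w). real (card (nbrs2 H w)))"

text \<open>The mixed Poisson distribution \<open>Po(X)\<close>, where \<open>\<mu>\<close> is the distribution of \<open>X\<close>.\<close>
definition mixed_poisson :: "real measure \<Rightarrow> nat pmf" where
  "mixed_poisson \<mu> = embed_pmf (\<lambda>k. \<integral>x. exp (- x) * x ^ k / fact k \<partial>\<mu>)"

definition size_biased :: "nat pmf \<Rightarrow> nat pmf" where
  "size_biased Z = embed_pmf (\<lambda>k. real k * pmf Z k / mean Z)"

lemma pmf_size_biased:
  assumes "has_pos_finite_mean Z"
  shows "pmf (size_biased Z) k = real k * pmf Z k / mean Z"
proof -
  have i: "integrable (measure_pmf Z) real" and p: "mean Z > 0"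
    using assms by (auto simp: has_pos_finite_mean_def)
  have "(\<integral>\<^sup>+k. ennreal (real k * pmf Z k / mean Z) \<partial>count_space UNIV)
      = (\<integral>\<^sup>+k. ennreal (pmf Z k) * ennreal (real k / mean Z) \<partial>count_space UNIV)"
    using p by (intro nn_integral_cong) (simp add: ennreal_mult'[symmetric] mult.commute)
  also have "\<dots> = (\<integral>\<^sup>+k. ennreal (real k / mean Z) \<partial>measure_pmf Z)"
    by (simp add: nn_integral_measure_pmf)
  also have "\<dots> = ennreal (\<integral>k. real k / mean Z \<partial>measure_pmf Z)"
    using p i by (intro nn_integral_eq_integral) auto
  also have "\<dots> = 1"
    using p by simp
  finally show ?thesis
    unfolding size_biased_def using p by (intro pmf_embed_pmf) auto
qed

lemma pmf_mixed_poisson: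
  assumes "prob_space \<mu>" "sets \<mu> = sets borel" "AE x in \<mu>. 0 \<le> x"
  shows "pmf (mixed_poisson \<mu>) k = (\<integral>x. exp (- x) * x ^ k / fact k \<partial>\<mu>)"
proof -
  interpret prob_space \<mu> by fact
  note [measurable_cong] = assms(2)
  let ?f = "\<lambda>k x::real. exp (- x) * x ^ k / fact k"
  have sums: "(\<lambda>k. ?f k x) sums 1" for x
    using sums_mult[OF exp_converges[of x], of "exp (- x)"]
    by (simp add: field_simps exp_minus scaleR_conv_of_real)
  have le1: "?f k x \<le> 1" if "0 \<le> x" for k x
  proof -
    have "(\<Sum>k\<in>{k}. ?f k x) \<le> (\<Sum>k. ?f k x)"
      using that by (intro sum_le_suminf sums_summable[OF sums]) auto
    then show ?thesis
      using sums_unique[OF sums, of x] by simp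
  qed
  have int: "integrable \<mu> (?f k)" for k
    by (rule integrable_const_bound[where B = 1]) (use assms(3) le1 in \<open>auto elim!: eventually_mono\<close>)
  have "(\<integral>\<^sup>+k. ennreal (\<integral>x. ?f k x \<partial>\<mu>) \<partial>count_space UNIV)
      = (\<integral>\<^sup>+k. (\<integral>\<^sup>+x. ennreal (?f k x) \<partial>\<mu>) \<partial>count_space UNIV)"
    using assms(3) by (intro nn_integral_cong nn_integral_eq_integral[symmetric] int) auto
  also have "\<dots> = (\<integral>\<^sup>+x. (\<Sum>k. ennreal (?f k x)) \<partial>\<mu>)"
    by (simp add: nn_integral_count_space_nat nn_integral_suminf)
  also have "\<dots> = (\<integral>\<^sup>+x. 1 \<partial>\<mu>)"
    using assms(3)
    by (intro nn_integral_cong_AE)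
       (auto elim!: eventually_mono simp: suminf_ennreal2[OF _ sums_summable[OF sums]]
          sums_unique[OF sums, symmetric])
  also have "\<dots> = 1"
    by (simp add: emeasure_space_1)
  finally show ?thesis
    unfolding mixed_poisson_def using assms(3)
    by (intro pmf_embed_pmf integral_nonneg_AE) auto
qed


section \<open>The uncorrelated random clique tree\<close>

text \<open>
  Galton--Watson trees in Ulam--Harris coding: the nodes are lists of natural numbers, the root is
  \<open>[]\<close>, the generation of a node is its length, and the children of \<open>x\<close> are \<open>x @ [j]\<close> with
  \<open>j < c x\<close>, where \<open>c x\<close> is the number of offspring of \<open>x\<close>. The numbers \<open>c x\<close> are drawn
  independently for all lists \<open>x\<close>.
\<close>
definition offspring_law :: "nat pmf \<Rightarrow> nat pmf \<Rightarrow> nat \<Rightarrow> nat pmf" where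
  "offspring_law D1 D2 g =
     (if g = 0 then D1
      else if odd g then map_pmf (\<lambda>k. k - 1) (size_biased D2)
      else map_pmf (\<lambda>k. k - 1) (size_biased D1))"

definition gw_space :: "nat pmf \<Rightarrow> nat pmf \<Rightarrow> (nat list \<Rightarrow> nat) measure" where
  "gw_space D1 D2 = (\<Pi>\<^sub>M x\<in>UNIV. measure_pmf (offspring_law D1 D2 (length x)))"

definition gw_nodes :: "(nat list \<Rightarrow> nat) \<Rightarrow> nat list set" where
  "gw_nodes c = {x. \<forall>i<length x. x ! i < c (take i x)}"

definition gw_bigraph :: "(nat list \<Rightarrow> nat) \<Rightarrow> (nat list, nat list) bigraph" where
  "gw_bigraph c =
     simple_bigraph {x \<in> gw_nodes c. even (length x)} {x \<in> gw_nodes c. odd (length x)}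
       {(u, w). \<exists>j. w = u @ [j] \<or> u = w @ [j]}"

definition clique_tree :: "(nat list \<Rightarrow> nat) \<Rightarrow> nat list rooted_graph" where
  "clique_tree c =
     (let G = intersection_graph (gw_bigraph c) in \<lparr>verts = verts G, adj = adj G, rroot = []\<rparr>)"

end

theory Submission
  imports Defs
begin

text \<open>
  Exploring a bipartite graph from a vertex by non-backtracking walks gives an ordered tree, and the
  ball around the vertex is determined by this tree as soon as the covering map is injective down to
  a suitable depth. Fix the first generations of two such trees. It is enough to bound from
  below the expected number of pairs of vertices that have these trees, with disjoint images: the
  limits of the lower bounds are products of Galton--Watson probabilities, which sum up to one, so
  they must be the limits, and the product form says that the frequencies have vanishing variance.
  No upper bound is ever needed, which allows truncating the degrees and using Fatou's lemma.

  For the active, passive and inhomogeneous models the lower bound reduces, by exchangeability, to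
  the probability that prescribed vertices have prescribed neighbourhoods; for the configuration
  model, embeddings are counted together with the half-edges they use.
\<close>

section \<open>Exploration trees\<close>

text \<open>Only first moments of the degrees are controlled, while the offspring laws below the
  root are size-biased and may have infinite mean; counting copies of subgraphs could therefore
  diverge. Counting vertices with a completely specified tree cannot, since frequencies are at most
  one. An order on the neighbours of each vertex makes this tree unique, so different trees are
  exclusive events whose frequencies add, and no automorphism groups enter. Any order will do:
  increasing labels in the simple models, at the price of factorials for the orders of siblings, and
  the order of the half-edges in the configuration model. Nodes of the last generation are reached
  but not explored. Their free degrees contribute a sum of \<open>k\<close> times the probability of
  \<open>k\<close>, which in full is the mean and cancels the normalisation of the edge above the
  leaf. Two depths occur: one for degree laws, and \<open>2 * r + 1\<close> for balls of radius
  \<open>r\<close>, because a step in an intersection graph is two steps in the bipartite graph and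
  common neighbours of boundary vertices must be seen as well.\<close>

lemma gw_nodes_Nil [simp]: "[] \<in> gw_nodes c"
  by (simp add: gw_nodes_def)

lemma gw_nodes_snoc [simp]: "x @ [j] \<in> gw_nodes c \<longleftrightarrow> x \<in> gw_nodes c \<and> j < c x"
  by (auto simp: gw_nodes_def nth_append less_Suc_eq)

lemma gw_nodes_Cons: "i # x \<in> gw_nodes c \<longleftrightarrow> i < c [] \<and> x \<in> gw_nodes (\<lambda>y. c (i # y))"
proof (induction x rule: rev_induct)
  case Nil
  show ?case
    using gw_nodes_snoc[of "[]" i c] by simp
next
  case (snoc j x)
  show ?case
    using snoc.IH gw_nodes_snoc[of "i # x" j c] by auto
qed

lemma finite_gw_nodes: "finite {x \<in> gw_nodes c. length x \<le> k}"
proof (induction k)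
  case 0
  have "{x \<in> gw_nodes c. length x \<le> 0} = {[]}" by auto
  then show ?case by simp
next
  case (Suc k)
  let ?T = "{x \<in> gw_nodes c. length x \<le> k}"
  have "{x \<in> gw_nodes c. length x \<le> Suc k} \<subseteq> insert [] (\<Union>x\<in>?T. (\<lambda>j. x @ [j]) ` {..<c x})"
  proof
    fix x assume "x \<in> {x \<in> gw_nodes c. length x \<le> Suc k}"
    then show "x \<in> insert [] (\<Union>x\<in>?T. (\<lambda>j. x @ [j]) ` {..<c x})"
      by (cases x rule: rev_cases) auto
  qed
  then show ?case
    by (rule finite_subset) (use Suc in auto)
qed

text \<open>Only nodes of \<open>c\<close> in generations below \<open>R\<close> are inspected, so
  values outside the tree never matter. Equal offspring numbers there force equal node sets down to
  generation \<open>R\<close>, which is why this one-sided condition is an equivalence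
  relation.\<close>

definition agree :: "nat \<Rightarrow> (nat list \<Rightarrow> nat) \<Rightarrow> (nat list \<Rightarrow> nat) \<Rightarrow> bool" where
  "agree R c c' \<longleftrightarrow> (\<forall>x\<in>gw_nodes c. length x < R \<longrightarrow> c' x = c x)"

lemma agree_nodes:
  assumes "agree R c c'" "length x \<le> R"
  shows "x \<in> gw_nodes c' \<longleftrightarrow> x \<in> gw_nodes c"
  using assms(2)
proof (induction x rule: rev_induct)
  case (snoc j x)
  then show ?case
    using assms(1) by (auto simp: agree_def)
qed simp

lemma agree_sym: "agree R c c' \<Longrightarrow> agree R c' c"
  using agree_nodes[of R c c'] by (auto simp: agree_def)

lemma agree_trans: "agree R c c' \<Longrightarrow> agree R c' c'' \<Longrightarrow> agree R c c''"
  using agree_nodes[of R c c'] by (auto simp: agree_def)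

definition children :: "(nat list \<Rightarrow> nat) \<Rightarrow> (nat list \<Rightarrow> 'v) \<Rightarrow> nat list \<Rightarrow> 'v list" where
  "children c \<phi> x = map (\<lambda>j. \<phi> (x @ [j])) [0..<c x]"

lemma length_children [simp]: "length (children c \<phi> x) = c x"
  by (simp add: children_def)

lemma nth_children: "j < c x \<Longrightarrow> children c \<phi> x ! j = \<phi> (x @ [j])"
  by (simp add: children_def)

lemma set_children: "set (children c \<phi> x) = (\<lambda>j. \<phi> (x @ [j])) ` {..<c x}"
  by (auto simp: children_def)

text \<open>
  The sides of a bipartite graph are tagged by Booleans, \<open>True\<close> for \<open>part1\<close>. An ordering \<open>nb s u\<close>
  lists the neighbours of the vertex \<open>u\<close> of side \<open>s\<close>; it makes the non-backtracking walks from a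
  vertex into an ordered tree, and \<open>tree_emb\<close> says that \<open>\<phi>\<close> is the covering map from the tree \<open>c\<close>,
  and that it is injective down to depth \<open>R\<close>.
\<close>
definition tree_emb ::
  "(bool \<Rightarrow> nat \<Rightarrow> nat list) \<Rightarrow> bool \<Rightarrow> nat \<Rightarrow> (nat list \<Rightarrow> nat) \<Rightarrow> (nat list \<Rightarrow> nat) \<Rightarrow> bool" where
  "tree_emb nb s R c \<phi> \<longleftrightarrow>
     inj_on (\<lambda>x. (even (length x), \<phi> x)) {x \<in> gw_nodes c. length x \<le> R} \<and>
     (\<forall>x\<in>gw_nodes c. length x < R \<longrightarrow>
        (let l = nb (s = even (length x)) (\<phi> x)
         in if x = [] then l = children c \<phi> x
            else \<phi> (butlast x) \<in> set l \<and> remove1 (\<phi> (butlast x)) l = children c \<phi> x))"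

text \<open>
  A forest is coded as the tree obtained by joining its roots \<open>[i]\<close> to an additional node \<open>[]\<close>.
\<close>
definition forest_nodes :: "nat \<Rightarrow> (nat list \<Rightarrow> nat) \<Rightarrow> nat list set" where
  "forest_nodes R c = {x \<in> gw_nodes c. x \<noteq> [] \<and> length x \<le> Suc R}"

text \<open>The additional node shifts every depth by one, so these nodes have depth below
  \<open>R\<close> in their own trees. Their offspring numbers are prescribed, in contrast to the
  nodes of depth exactly \<open>R\<close>.\<close>

definition forest_inner :: "nat \<Rightarrow> (nat list \<Rightarrow> nat) \<Rightarrow> nat list set" where
  "forest_inner R c = {x \<in> gw_nodes c. x \<noteq> [] \<and> length x \<le> R}"

text \<open>The parity is \<open>odd\<close> where \<open>tree_emb\<close> has \<open>even\<close>
  because of the same shift. Injectivity is required on all trees together, which makes their images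
  disjoint.\<close>

definition forest_emb ::
  "(bool \<Rightarrow> nat \<Rightarrow> nat list) \<Rightarrow> bool \<Rightarrow> nat \<Rightarrow> (nat list \<Rightarrow> nat) \<Rightarrow> (nat list \<Rightarrow> nat) \<Rightarrow> bool" where
  "forest_emb nb s R c \<phi> \<longleftrightarrow>
     inj_on (\<lambda>x. (odd (length x), \<phi> x)) (forest_nodes R c) \<and>
     (\<forall>x\<in>forest_inner R c.
        (let l = nb (s = odd (length x)) (\<phi> x)
         in if length x = 1 then l = children c \<phi> x
            else \<phi> (butlast x) \<in> set l \<and> remove1 (\<phi> (butlast x)) l = children c \<phi> x))"

lemma finite_forest_nodes: "finite (forest_nodes R c)"
  by (rule finite_subset[OF _ finite_gw_nodes[of c "Suc R"]]) (auto simp: forest_nodes_def)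

lemma finite_forest_inner: "finite (forest_inner R c)"
  by (rule finite_subset[OF _ finite_gw_nodes[of c "Suc R"]]) (auto simp: forest_inner_def)

lemma forest_emb_imp_tree_emb:
  assumes "forest_emb nb s R c \<phi>" "i < c []"
  shows "tree_emb nb s R (\<lambda>x. c (i # x)) (\<lambda>x. \<phi> (i # x))"
proof -
  have inj: "inj_on (\<lambda>x. (odd (length x), \<phi> x)) (forest_nodes R c)"
    and st: "\<And>x. x \<in> forest_inner R c \<Longrightarrow>
        (let l = nb (s = odd (length x)) (\<phi> x)
         in if length x = 1 then l = children c \<phi> x
            else \<phi> (butlast x) \<in> set l \<and> remove1 (\<phi> (butlast x)) l = children c \<phi> x)"
    using assms by (auto simp: forest_emb_def)
  have "inj_on (\<lambda>x. (even (length x), \<phi> (i # x))) {x \<in> gw_nodes (\<lambda>x. c (i # x)). length x \<le> R}"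
  proof (rule inj_onI)
    fix x y
    assume "x \<in> {x \<in> gw_nodes (\<lambda>x. c (i # x)). length x \<le> R}"
      "y \<in> {x \<in> gw_nodes (\<lambda>x. c (i # x)). length x \<le> R}"
      "(even (length x), \<phi> (i # x)) = (even (length y), \<phi> (i # y))"
    then show "x = y"
      using inj_onD[OF inj, of "i # x" "i # y"] assms(2)
      by (auto simp: forest_nodes_def gw_nodes_Cons)
  qed
  moreover have "let l = nb (s = even (length x)) (\<phi> (i # x))
         in if x = [] then l = children (\<lambda>x. c (i # x)) (\<lambda>x. \<phi> (i # x)) x
            else \<phi> (i # butlast x) \<in> set l \<and>
              remove1 (\<phi> (i # butlast x)) l = children (\<lambda>x. c (i # x)) (\<lambda>x. \<phi> (i # x)) x"
    if "x \<in> gw_nodes (\<lambda>x. c (i # x))" "length x < R" for x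
    using st[of "i # x"] that assms(2)
    by (cases "x = []") (auto simp: forest_inner_def gw_nodes_Cons Let_def children_def)
  ultimately show ?thesis
    unfolding tree_emb_def by auto
qed

text \<open>Induction away from the root: the image of a node fixes its ordered list of neighbours,
  and deleting the image of the parent leaves the images of the children in order, hence also their
  number. Thus a vertex carries at most one tree up to agreement.\<close>

lemma tree_emb_unique:
  assumes e: "tree_emb nb s R c \<phi>" "tree_emb nb s R c' \<phi>'" and r: "\<phi> [] = \<phi>' []"
  shows "agree R c c'" and "\<And>x. x \<in> gw_nodes c \<Longrightarrow> length x \<le> R \<Longrightarrow> \<phi>' x = \<phi> x"
proof -
  define l where "l x = nb (s = even (length x)) (\<phi> x)" for x
  define l' where "l' x = nb (s = even (length x)) (\<phi>' x)" for x
  have l: "if x = [] then l x = children c \<phi> x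
            else \<phi> (butlast x) \<in> set (l x) \<and> remove1 (\<phi> (butlast x)) (l x) = children c \<phi> x"
    if "x \<in> gw_nodes c" "length x < R" for x
    using e(1) that unfolding tree_emb_def l_def by (auto simp: Let_def)
  have l': "if x = [] then l' x = children c' \<phi>' x
            else \<phi>' (butlast x) \<in> set (l' x) \<and> remove1 (\<phi>' (butlast x)) (l' x) = children c' \<phi>' x"
    if "x \<in> gw_nodes c'" "length x < R" for x
    using e(2) that unfolding tree_emb_def l'_def by (auto simp: Let_def)
  have main: "x \<in> gw_nodes c' \<and> \<phi>' x = \<phi> x \<and> (length x < R \<longrightarrow> children c' \<phi>' x = children c \<phi> x)"
    if "x \<in> gw_nodes c" "length x \<le> R" for x
    using that
  proof (induction x rule: rev_induct)
    case Nil
    then show ?case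
      using l[of "[]"] l'[of "[]"] r by (auto simp: l_def l'_def)
  next
    case (snoc j x)
    then have x: "x \<in> gw_nodes c" "j < c x" "length x < R" by auto
    with snoc have IH: "x \<in> gw_nodes c'" "\<phi>' x = \<phi> x" "children c' \<phi>' x = children c \<phi> x"
      by auto
    have cc: "c' x = c x"
      using IH(3) length_children by metis
    have "\<phi>' (x @ [j]) = \<phi> (x @ [j])"
      using IH(3) x(2) cc nth_children[of j c x \<phi>] nth_children[of j c' x \<phi>'] by simp
    moreover from this have "children c' \<phi>' (x @ [j]) = children c \<phi> (x @ [j])"
      if "Suc (length x) < R"
      using l[of "x @ [j]"] l'[of "x @ [j]"] that x IH cc by (auto simp: l_def l'_def)
    ultimately show ?case
      using IH x cc by auto
  qed
  show "agree R c c'"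
    unfolding agree_def using main length_children by (metis less_imp_le)
  show "\<phi>' x = \<phi> x" if "x \<in> gw_nodes c" "length x \<le> R" for x
    using main that by blast
qed

section \<open>Balls in intersection graphs\<close>

definition nbrs :: "(nat, nat) bigraph \<Rightarrow> bool \<Rightarrow> nat \<Rightarrow> nat set" where
  "nbrs H s u = (if s then nbrs1 H u else nbrs2 H u)"

definition tree_adj :: "nat list \<Rightarrow> nat list \<Rightarrow> bool" where
  "tree_adj x y \<longleftrightarrow> (\<exists>j. y = x @ [j] \<or> x = y @ [j])"

lemma tree_adj_sym: "tree_adj x y \<longleftrightarrow> tree_adj y x"
  by (auto simp: tree_adj_def)

lemma tree_adj_length: "tree_adj x y \<Longrightarrow> length y = Suc (length x) \<or> length x = Suc (length y)"
  by (auto simp: tree_adj_def)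

lemma tree_adj_nodes:
  assumes "x \<in> gw_nodes c"
  shows "{y \<in> gw_nodes c. tree_adj x y} = (\<lambda>j. x @ [j]) ` {..<c x} \<union> (if x = [] then {} else {butlast x})"
proof -
  have "{y \<in> gw_nodes c. \<exists>j. y = x @ [j]} = (\<lambda>j. x @ [j]) ` {..<c x}"
    using assms gw_nodes_snoc[of x _ c] by auto
  moreover have "{y \<in> gw_nodes c. \<exists>j. x = y @ [j]} = (if x = [] then {} else {butlast x})"
    using assms by (cases x rule: rev_cases) auto
  ultimately show ?thesis
    unfolding tree_adj_def by blast
qed

lemma tree_emb_nbrs:
  assumes e: "tree_emb nb s R c \<phi>" and x: "x \<in> gw_nodes c" "length x < R"
  shows "set (nb (s = even (length x)) (\<phi> x)) = \<phi> ` {y \<in> gw_nodes c. tree_adj x y}"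
proof -
  define l where "l = nb (s = even (length x)) (\<phi> x)"
  have l: "if x = [] then l = children c \<phi> x
            else \<phi> (butlast x) \<in> set l \<and> remove1 (\<phi> (butlast x)) l = children c \<phi> x"
    using e x unfolding tree_emb_def l_def by (auto simp: Let_def)
  have "set l = set (children c \<phi> x) \<union> (if x = [] then {} else {\<phi> (butlast x)})"
  proof (cases "x = []")
    case False
    \<comment> \<open>The parent occurs in the list, so \<open>remove1\<close> deletes exactly one
      copy of it; as multisets, putting it back recovers the list.\<close>
    then have "mset l = add_mset (\<phi> (butlast x)) (mset (children c \<phi> x))"
      using l by (metis mset_remove1 insert_DiffM set_mset_mset)
    then have "set_mset (mset l) = insert (\<phi> (butlast x)) (set_mset (mset (children c \<phi> x)))"
      by simp
    then show ?thesis
      using False by simp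
  qed (use l in simp)
  then show ?thesis
    unfolding l_def tree_adj_nodes[OF x(1)] by (auto simp: set_children)
qed

lemma dist_le_Suc: "dist_le G (Suc r) a w \<longleftrightarrow> dist_le G r a w \<or> (\<exists>z. dist_le G r a z \<and> (z, w) \<in> adj G)"
proof
  assume "dist_le G (Suc r) a w"
  then obtain k where k: "k \<le> Suc r" "(a, w) \<in> adj G ^^ k"
    by (auto simp: dist_le_def)
  show "dist_le G r a w \<or> (\<exists>z. dist_le G r a z \<and> (z, w) \<in> adj G)"
  proof (cases "k \<le> r")
    case True
    then show ?thesis using k by (auto simp: dist_le_def)
  next
    case False
    then have "k = Suc r" using k by simp
    then show ?thesis using k(2) unfolding dist_le_def by auto
  qed
next
  assume "dist_le G r a w \<or> (\<exists>z. dist_le G r a z \<and> (z, w) \<in> adj G)"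
  then show "dist_le G (Suc r) a w"
  proof
    assume "\<exists>z. dist_le G r a z \<and> (z, w) \<in> adj G"
    then obtain k z where "k \<le> r" "(a, z) \<in> adj G ^^ k" "(z, w) \<in> adj G"
      by (auto simp: dist_le_def)
    then show ?thesis
      unfolding dist_le_def by (intro exI[of _ "Suc k"]) auto
  qed (use le_Suc_eq in \<open>auto simp: dist_le_def\<close>)
qed

text \<open>Balls grow by adding the neighbours of the previous ball. The recursion for
  \<open>W\<close> is required only below radius \<open>r\<close>, since a covering map controls the
  graph only that far.\<close>

lemma ball_layers:
  assumes "W 0 = {a}" "\<And>k. k < r \<Longrightarrow> W (Suc k) = W k \<union> adj G `` W k"
  shows "{w. dist_le G r a w} = W r"
  using assms(2)
proof (induction r)
  case 0
  show ?case
    using assms(1) by (auto simp: dist_le_def)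
next
  case (Suc r)
  have "{w. dist_le G (Suc r) a w} = {w. dist_le G r a w} \<union> adj G `` {w. dist_le G r a w}"
    by (auto simp: dist_le_Suc)
  then show ?case
    using Suc by simp
qed

text \<open>A step in the clique tree passes through a node of odd generation and covers at most two
  generations; hence the factor two, which makes these sets the balls around the root.\<close>

definition even_nodes :: "(nat list \<Rightarrow> nat) \<Rightarrow> nat \<Rightarrow> nat list set" where
  "even_nodes c k = {x \<in> gw_nodes c. even (length x) \<and> length x \<le> 2 * k}"

lemma verts_clique_tree: "verts (clique_tree c) = {x \<in> gw_nodes c. even (length x)}"
  by (simp add: clique_tree_def Let_def intersection_graph_def gw_bigraph_def simple_bigraph_def)

lemma rroot_clique_tree [simp]: "rroot (clique_tree c) = []"
  by (simp add: clique_tree_def Let_def)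

lemma adj_clique_tree:
  "(x, y) \<in> adj (clique_tree c) \<longleftrightarrow>
     x \<in> gw_nodes c \<and> even (length x) \<and> y \<in> gw_nodes c \<and> even (length y) \<and> x \<noteq> y \<and>
     (\<exists>w\<in>gw_nodes c. tree_adj x w \<and> tree_adj y w)"
proof -
  have "odd (length w)" if "tree_adj x w" "even (length x)" for w
    using tree_adj_length[OF that(1)] that(2) by auto
  moreover have "(x, y) \<in> adj (clique_tree c) \<longleftrightarrow>
     (x \<in> gw_nodes c \<and> even (length x)) \<and> (y \<in> gw_nodes c \<and> even (length y)) \<and> x \<noteq> y \<and>
     (\<exists>w. (w \<in> gw_nodes c \<and> odd (length w)) \<and> tree_adj x w \<and> tree_adj y w)"
    unfolding clique_tree_def Let_def intersection_graph_def gw_bigraph_def simple_bigraph_def tree_adj_def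
    by simp
  ultimately show ?thesis
    by blast
qed

text \<open>A node of generation \<open>2 * k + 2\<close> is joined to its grandparent through its
  parent, and an edge of the clique tree raises the generation by at most two.\<close>

lemma even_nodes_Suc: "even_nodes c (Suc k) = even_nodes c k \<union> adj (clique_tree c) `` even_nodes c k"
proof (intro equalityI subsetI)
  fix y assume y: "y \<in> even_nodes c (Suc k)"
  show "y \<in> even_nodes c k \<union> adj (clique_tree c) `` even_nodes c k"
  proof (cases "length y \<le> 2 * k")
    case True
    then show ?thesis using y by (auto simp: even_nodes_def)
  next
    case False
    with y have ly: "length y = Suc (Suc (2 * k))"
      unfolding even_nodes_def by (auto simp: le_Suc_eq)
    then obtain z j where z: "y = z @ [j]"
      by (cases y rule: rev_cases) auto
    moreover obtain x i where "z = x @ [i]"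
      using ly z by (cases z rule: rev_cases) auto
    ultimately have "y = (x @ [i]) @ [j]"
      by simp
    moreover from this have "x \<in> gw_nodes c \<and> i < c x"
      using y gw_nodes_snoc[of "x @ [i]" j c] by (auto simp: even_nodes_def)
    ultimately have "x \<in> even_nodes c k" "(x, y) \<in> adj (clique_tree c)"
      using y ly by (auto simp: even_nodes_def adj_clique_tree tree_adj_def
         intro!: bexI[of _ "x @ [i]"])
    then show ?thesis by auto
  qed
next
  fix y assume "y \<in> even_nodes c k \<union> adj (clique_tree c) `` even_nodes c k"
  then show "y \<in> even_nodes c (Suc k)"
    by (auto simp: even_nodes_def adj_clique_tree dest!: tree_adj_length)
qed

lemma clique_tree_layers: "{w. dist_le (clique_tree c) r [] w} = even_nodes c r"
proof (rule ball_layers)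
  show "even_nodes c 0 = {[]}"
    by (auto simp: even_nodes_def)
qed (rule even_nodes_Suc)

lemma nball_clique_tree:
  "nball r (clique_tree c) [] =
     \<lparr>verts = even_nodes c r, adj = adj (clique_tree c) \<inter> even_nodes c r \<times> even_nodes c r, rroot = []\<rparr>"
proof -
  have "{u \<in> verts (clique_tree c). dist_le (clique_tree c) r [] u} = even_nodes c r"
    using clique_tree_layers[of c r] by (auto simp: verts_clique_tree even_nodes_def)
  then show ?thesis
    by (simp add: nball_def Let_def)
qed

text \<open>Adjacency inside the ball is decided by common neighbours of nodes of generation at most
  \<open>2 * r\<close>. These have generation at most \<open>2 * r + 1\<close>, hence the strict
  inequality.\<close>

lemma nball_clique_tree_agree:
  assumes "agree R c c'" "2 * r < R"
  shows "nball r (clique_tree c') [] = nball r (clique_tree c) []"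
proof -
  have n: "x \<in> gw_nodes c' \<longleftrightarrow> x \<in> gw_nodes c" if "length x \<le> R" for x
    using agree_nodes[OF assms(1)] that by blast
  have W: "even_nodes c' r = even_nodes c r"
    using n assms(2) by (auto simp: even_nodes_def)
  have "(x, y) \<in> adj (clique_tree c') \<longleftrightarrow> (x, y) \<in> adj (clique_tree c)"
    if "x \<in> even_nodes c r" "y \<in> even_nodes c r" for x y
  proof -
    have "w \<in> gw_nodes c' \<longleftrightarrow> w \<in> gw_nodes c" if "tree_adj x w" for w
      using tree_adj_length[OF that] \<open>x \<in> even_nodes c r\<close> assms(2)
      by (intro n) (auto simp: even_nodes_def)
    then show ?thesis
      using that W n unfolding adj_clique_tree by (auto simp: even_nodes_def)
  qed
  then show ?thesis
    unfolding nball_clique_tree W by auto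
qed

text \<open>Injectivity excludes every coincidence that could distort the ball. Neighbours of
  explored images are images of tree neighbours, so a vertex of \<open>part2\<close> shared by two
  ball vertices comes from two nodes of odd generation with the same image, and these are the same
  node.\<close>

lemma tree_emb_nball:
  assumes e: "tree_emb nb True R c \<phi>" and R: "R = Suc (2 * r)"
    and nb: "\<And>s u. u \<in> (if s then part1 H else part2 H) \<Longrightarrow> set (nb s u) = nbrs H s u"
    and root: "\<phi> [] \<in> part1 H"
  shows "nball r (clique_tree c) [] \<cong>\<^sub>r nball r (intersection_graph H) (\<phi> [])"
proof -
  let ?G = "intersection_graph H"
  let ?side = "\<lambda>x. if even (length x) then part1 H else part2 H"
  have inj: "inj_on (\<lambda>x. (even (length x), \<phi> x)) {x \<in> gw_nodes c. length x \<le> R}"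
    using e by (simp add: tree_emb_def)
  have side: "\<phi> x \<in> ?side x" if "x \<in> gw_nodes c" "length x \<le> R" for x
    using that
  proof (induction x rule: rev_induct)
    case (snoc j x)
    then have "\<phi> x \<in> ?side x" by simp
    then have "set (nb (even (length x)) (\<phi> x)) = nbrs H (even (length x)) (\<phi> x)"
      using nb[of "\<phi> x" "even (length x)"] by simp
    moreover have "\<phi> (x @ [j]) \<in> set (nb (even (length x)) (\<phi> x))"
      using tree_emb_nbrs[OF e, of x] snoc.prems by (auto simp: tree_adj_def)
    ultimately show ?case
      by (auto simp: nbrs_def nbrs1_def nbrs2_def split: if_splits)
  qed (use root in simp)
  have N: "nbrs H (even (length x)) (\<phi> x) = \<phi> ` {y \<in> gw_nodes c. tree_adj x y}"
    if "x \<in> gw_nodes c" "length x < R" for x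
    using tree_emb_nbrs[OF e that] nb[of "\<phi> x" "even (length x)"] side[of x] that
    by simp
  have N1: "w \<in> part2 H \<and> mult H (\<phi> x) w > 0 \<longleftrightarrow> (\<exists>y\<in>gw_nodes c. tree_adj x y \<and> w = \<phi> y)"
    if "x \<in> even_nodes c r" for x w
    using N[of x] that R by (auto simp: nbrs_def nbrs1_def even_nodes_def set_eq_iff)
  have N2: "u \<in> part1 H \<and> mult H u (\<phi> y) > 0 \<longleftrightarrow> (\<exists>x\<in>gw_nodes c. tree_adj y x \<and> u = \<phi> x)"
    if "y \<in> gw_nodes c" "odd (length y)" "length y < R" for u y
    using N[of y] that R by (auto simp: nbrs_def nbrs2_def set_eq_iff)
  have even_inj: "x = y" if "x \<in> even_nodes c r" "y \<in> even_nodes c r" "\<phi> x = \<phi> y" for x y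
    using inj_onD[OF inj, of x y] that R by (auto simp: even_nodes_def)
  have adj_G: "(u, v) \<in> adj ?G \<longleftrightarrow> u \<in> part1 H \<and> v \<in> part1 H \<and> u \<noteq> v \<and>
      (\<exists>w\<in>part2 H. mult H u w > 0 \<and> mult H v w > 0)" for u v
    by (simp add: intersection_graph_def)
  have part1: "\<phi> x \<in> part1 H" if "x \<in> even_nodes c r" for x
    using side[of x] that R by (auto simp: even_nodes_def)
  have edge: "(\<phi> x, \<phi> y) \<in> adj ?G \<longleftrightarrow> (x, y) \<in> adj (clique_tree c)"
    if xy: "x \<in> even_nodes c r" "y \<in> even_nodes c r" for x y
  proof
    assume "(\<phi> x, \<phi> y) \<in> adj ?G"
    then obtain w where ne: "\<phi> x \<noteq> \<phi> y" and "w \<in> part2 H" "mult H (\<phi> x) w > 0" "mult H (\<phi> y) w > 0"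
      by (auto simp: adj_G)
    then obtain z z' where z: "z \<in> gw_nodes c" "tree_adj x z" "w = \<phi> z" 
        "z' \<in> gw_nodes c" "tree_adj y z'" "w = \<phi> z'"
      using N1[OF xy(1), of w] N1[OF xy(2), of w] by auto
    \<comment> \<open>Here depth \<open>2 * r + 1\<close> enters: a common neighbour of two vertices
      on the sphere of radius \<open>r\<close> may come from a generation below both of
      them.\<close>
    have "odd (length z) \<and> length z \<le> R" "odd (length z') \<and> length z' \<le> R"
      using tree_adj_length[OF z(2)] tree_adj_length[OF z(5)] xy R by (auto simp: even_nodes_def)
    then have "z = z'"
      using inj_onD[OF inj, of z z'] z by auto
    then show "(x, y) \<in> adj (clique_tree c)"
      using xy z ne by (auto simp: adj_clique_tree even_nodes_def)
  next
    assume "(x, y) \<in> adj (clique_tree c)"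
    then obtain z where "x \<noteq> y" "z \<in> gw_nodes c" "tree_adj x z" "tree_adj y z"
      by (auto simp: adj_clique_tree)
    then show "(\<phi> x, \<phi> y) \<in> adj ?G"
      using N1[OF xy(1), of "\<phi> z"] N1[OF xy(2), of "\<phi> z"] even_inj[OF xy] part1 xy
      by (auto simp: adj_G)
  qed
  have layers: "{w. dist_le ?G r (\<phi> []) w} = \<phi> ` even_nodes c r"
  proof (rule ball_layers)
    show "\<phi> ` even_nodes c 0 = {\<phi> []}"
      by (auto simp: even_nodes_def)
    fix k assume k: "k < r"
    have mono: "even_nodes c k \<subseteq> even_nodes c r" "even_nodes c (Suc k) \<subseteq> even_nodes c r"
      using k by (auto simp: even_nodes_def)
    note E = even_nodes_Suc[of c k]
    show "\<phi> ` even_nodes c (Suc k) = \<phi> ` even_nodes c k \<union> adj ?G `` \<phi> ` even_nodes c k"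
    proof (intro equalityI subsetI)
      fix u assume "u \<in> \<phi> ` even_nodes c (Suc k)"
      then obtain x where x: "x \<in> even_nodes c (Suc k)" "u = \<phi> x"
        by auto
      show "u \<in> \<phi> ` even_nodes c k \<union> adj ?G `` \<phi> ` even_nodes c k"
      proof (cases "x \<in> even_nodes c k")
        case False
        then obtain y where y: "y \<in> even_nodes c k" "(y, x) \<in> adj (clique_tree c)"
          using x E by blast
        then have "(\<phi> y, \<phi> x) \<in> adj ?G"
          using edge x mono by blast
        then show ?thesis
          using x y by blast
      qed (use x in auto)
    next
      fix v assume "v \<in> \<phi> ` even_nodes c k \<union> adj ?G `` \<phi> ` even_nodes c k"
      moreover have "v \<in> \<phi> ` even_nodes c (Suc k)" if x: "x \<in> even_nodes c k" and v: "(\<phi> x, v) \<in> adj ?G" for x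
      proof -
        obtain w where w: "v \<in> part1 H" "\<phi> x \<noteq> v" "w \<in> part2 H" "mult H (\<phi> x) w > 0" "mult H v w > 0"
          using v by (auto simp: adj_G)
        then obtain y where y: "y \<in> gw_nodes c" "tree_adj x y" "w = \<phi> y"
          using N1[of x w] x mono by auto
        \<comment> \<open>Since \<open>k < r\<close>, the node \<open>y\<close> is still explored,
          so all neighbours of its image are images of tree nodes.\<close>
        have ly: "odd (length y)" "length y < R"
          using tree_adj_length[OF y(2)] x k R by (auto simp: even_nodes_def)
        then obtain z where z: "z \<in> gw_nodes c" "tree_adj y z" "v = \<phi> z"
          using N2[OF y(1) ly, of v] w y by auto
        have "z \<in> even_nodes c (Suc k)"
          using tree_adj_length[OF y(2)] tree_adj_length[OF z(2)] x z(1) by (auto simp: even_nodes_def)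
        then show ?thesis using z by auto
      qed
      moreover have "even_nodes c k \<subseteq> even_nodes c (Suc k)"
        by (auto simp: even_nodes_def)
      ultimately show "v \<in> \<phi> ` even_nodes c (Suc k)"
        by auto
    qed
  qed
  have V: "{u \<in> verts ?G. dist_le ?G r (\<phi> []) u} = \<phi> ` even_nodes c r"
    using layers part1 by (auto simp: intersection_graph_def)
  have "bij_betw \<phi> (even_nodes c r) (\<phi> ` even_nodes c r)"
    using even_inj by (auto simp: bij_betw_def inj_on_def)
  then show ?thesis
    unfolding nball_clique_tree unfolding rooted_iso_def nball_def V Let_def
    using edge by (intro exI[of _ \<phi>]) auto
qed

lemma rooted_iso_sym:
  assumes "G \<cong>\<^sub>r K" "rroot G \<in> verts G"
  shows "K \<cong>\<^sub>r G"
proof -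
  obtain f where f: "bij_betw f (verts G) (verts K)" "f (rroot G) = rroot K"
    "\<forall>u\<in>verts G. \<forall>v\<in>verts G. (u, v) \<in> adj G \<longleftrightarrow> (f u, f v) \<in> adj K"
    using assms by (auto simp: rooted_iso_def)
  let ?g = "inv_into (verts G) f"
  have "bij_betw ?g (verts K) (verts G)"
    using f(1) by (rule bij_betw_inv_into)
  moreover have "?g (rroot K) = rroot G"
    using f assms(2) by (metis bij_betw_inv_into_left)
  moreover have "(u, v) \<in> adj K \<longleftrightarrow> (?g u, ?g v) \<in> adj G" if "u \<in> verts K" "v \<in> verts K" for u v
  proof -
    have "?g u \<in> verts G" "?g v \<in> verts G" "f (?g u) = u" "f (?g v) = v"
      using that f(1) by (auto simp: bij_betw_def inv_into_into f_inv_into_f)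
    then show ?thesis using f(3) by metis
  qed
  ultimately show ?thesis
    unfolding rooted_iso_def by blast
qed

lemma rooted_iso_trans:
  assumes "G \<cong>\<^sub>r K" "K \<cong>\<^sub>r J"
  shows "G \<cong>\<^sub>r J"
proof -
  obtain f where f: "bij_betw f (verts G) (verts K)" "f (rroot G) = rroot K"
    "\<forall>u\<in>verts G. \<forall>v\<in>verts G. (u, v) \<in> adj G \<longleftrightarrow> (f u, f v) \<in> adj K"
    using assms by (auto simp: rooted_iso_def)
  obtain g where g: "bij_betw g (verts K) (verts J)" "g (rroot K) = rroot J"
    "\<forall>u\<in>verts K. \<forall>v\<in>verts K. (u, v) \<in> adj K \<longleftrightarrow> (g u, g v) \<in> adj J"
    using assms by (auto simp: rooted_iso_def)
  have "\<And>u. u \<in> verts G \<Longrightarrow> f u \<in> verts K"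
    using f(1) by (auto simp: bij_betw_def)
  then show ?thesis
    unfolding rooted_iso_def using f g bij_betw_trans[OF f(1) g(1)]
    by (intro exI[of _ "g \<circ> f"]) auto
qed

section \<open>The Galton--Watson measure\<close>

definition cyl_weight :: "nat pmf \<Rightarrow> nat pmf \<Rightarrow> nat \<Rightarrow> (nat list \<Rightarrow> nat) \<Rightarrow> real" where
  "cyl_weight D1 D2 R c =
     (\<Prod>x\<in>{x \<in> gw_nodes c. length x < R}. pmf (offspring_law D1 D2 (length x)) (c x))"

lemma space_gw [simp]: "space (gw_space D1 D2) = UNIV"
  by (simp add: gw_space_def space_PiM)

lemma prob_space_gw: "prob_space (gw_space D1 D2)"
  unfolding gw_space_def by (intro prob_space_PiM) (rule measure_pmf.prob_space_axioms)

text \<open>The event prescribes finitely many coordinates of a product measure. Coordinates are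
  indexed by all lists, so they are independent although it is random which lists are nodes.\<close>

lemma
  shows sets_agree: "{c'. agree R c c'} \<in> sets (gw_space D1 D2)"
    and measure_agree: "measure (gw_space D1 D2) {c'. agree R c c'} = cyl_weight D1 D2 R c"
proof -
  interpret P: product_prob_space "\<lambda>x. measure_pmf (offspring_law D1 D2 (length x))" UNIV
    by (intro product_prob_spaceI measure_pmf.prob_space_axioms)
  let ?J = "{x \<in> gw_nodes c. length x < R}"
  have fin: "finite ?J"
    by (rule finite_subset[OF _ finite_gw_nodes[of c R]]) auto
  have eq: "{c'. agree R c c'} = {c' \<in> space (gw_space D1 D2). \<forall>x\<in>?J. c' x \<in> {c x}}"
    by (auto simp: agree_def)
  show "{c'. agree R c c'} \<in> sets (gw_space D1 D2)"
    unfolding eq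
  proof (intro sets.sets_Collect_finite_All fin)
    fix x
    have "(\<lambda>c'. c' x) \<in> measurable (gw_space D1 D2) (measure_pmf (offspring_law D1 D2 (length x)))"
      unfolding gw_space_def by (rule measurable_component_singleton) simp
    then have "(\<lambda>c'. c' x) -` {c x} \<inter> space (gw_space D1 D2) \<in> sets (gw_space D1 D2)"
      by (rule measurable_sets) simp
    also have "(\<lambda>c'. c' x) -` {c x} \<inter> space (gw_space D1 D2) = {c' \<in> space (gw_space D1 D2). c' x \<in> {c x}}"
      by auto
    finally show "{c' \<in> space (gw_space D1 D2). c' x \<in> {c x}} \<in> sets (gw_space D1 D2)" .
  qed
  have "emeasure (gw_space D1 D2) {c'. agree R c c'} =
      (\<Prod>x\<in>?J. emeasure (measure_pmf (offspring_law D1 D2 (length x))) {c x})"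
    unfolding eq unfolding gw_space_def
    by (rule P.emeasure_PiM_Collect) (use fin in auto)
  also have "\<dots> = ennreal (cyl_weight D1 D2 R c)"
    unfolding cyl_weight_def
    by (subst prod_ennreal[symmetric]) (auto simp: emeasure_pmf_single)
  finally show "measure (gw_space D1 D2) {c'. agree R c c'} = cyl_weight D1 D2 R c"
    by (simp add: measure_def cyl_weight_def prod_nonneg)
qed

lemma measure_gw_root: "measure (gw_space D1 D2) {c. P (c [])} = measure_pmf.prob D1 {k. P k}"
  and sets_gw_root: "{c. P (c [])} \<in> sets (gw_space D1 D2)"
proof -
  interpret P: product_prob_space "\<lambda>x. measure_pmf (offspring_law D1 D2 (length x))" UNIV
    by (intro product_prob_spaceI measure_pmf.prob_space_axioms)
  have m: "(\<lambda>c. c []) \<in> measurable (gw_space D1 D2) (measure_pmf D1)"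
    using measurable_component_singleton[of "[]" UNIV "\<lambda>x. measure_pmf (offspring_law D1 D2 (length x))"]
    by (simp add: gw_space_def offspring_law_def)
  have eq: "{c. P (c [])} = (\<lambda>c. c []) -` {k. P k} \<inter> space (gw_space D1 D2)"
    by auto
  show "{c. P (c [])} \<in> sets (gw_space D1 D2)"
    unfolding eq by (rule measurable_sets[OF m]) simp
  have "distr (gw_space D1 D2) (measure_pmf D1) (\<lambda>c. c []) = measure_pmf D1"
    using P.PiM_component[of "[]"] by (simp add: gw_space_def offspring_law_def)
  moreover have "measure (distr (gw_space D1 D2) (measure_pmf D1) (\<lambda>c. c [])) {k. P k} =
      measure (gw_space D1 D2) {c. P (c [])}"
    unfolding eq by (rule measure_distr[OF m]) simp
  ultimately show "measure (gw_space D1 D2) {c. P (c [])} = measure_pmf.prob D1 {k. P k}"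
    by (simp only:)
qed

text \<open>Canonical representative of an agreement class: the zeros turn agreement into equality,
  so \<open>range (trunc R)\<close> indexes the possible initial trees without repetition.\<close>

definition trunc :: "nat \<Rightarrow> (nat list \<Rightarrow> nat) \<Rightarrow> nat list \<Rightarrow> nat" where
  "trunc R c = (\<lambda>x. if x \<in> gw_nodes c \<and> length x < R then c x else 0)"

lemma agree_trunc: "agree R c (trunc R c)"
  by (auto simp: agree_def trunc_def)

lemma trunc_eq_iff: "trunc R c = trunc R c' \<longleftrightarrow> agree R c c'"
proof
  assume "trunc R c = trunc R c'"
  then show "agree R c c'"
    using agree_trunc[of R c] agree_trunc[of R c'] agree_sym agree_trans by metis
next
  assume "agree R c c'"
  then show "trunc R c = trunc R c'"
    using agree_nodes[of R c c'] by (fastforce simp: trunc_def agree_def)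
qed

lemma trunc_trunc [simp]: "trunc R (trunc R c) = trunc R c"
  using agree_trunc agree_sym trunc_eq_iff by metis

text \<open>A truncated tree has finite support, so it is coded by a finite set of pairs of a node
  and a nonzero number.\<close>

lemma countable_range_trunc: "countable (range (trunc R))"
proof -
  let ?g = "\<lambda>t. {(x, t x) |x. t x \<noteq> 0} :: (nat list \<times> nat) set"
  have "inj ?g"
  proof (rule injI, rule ext)
    fix t t' :: "nat list \<Rightarrow> nat" and x
    assume "?g t = ?g t'"
    then have "(x, t x) \<in> ?g t \<longleftrightarrow> (x, t x) \<in> ?g t'" "(x, t' x) \<in> ?g t \<longleftrightarrow> (x, t' x) \<in> ?g t'"
      by auto
    then show "t x = t' x" by auto
  qed
  moreover have "?g ` range (trunc R) \<subseteq> Collect finite"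
  proof safe
    fix c :: "nat list \<Rightarrow> nat"
    have "{(x, trunc R c x) |x. trunc R c x \<noteq> 0} \<subseteq>
        (\<lambda>x. (x, trunc R c x)) ` {x \<in> gw_nodes c. length x \<le> R}"
      by (auto simp: trunc_def)
    then show "finite {(x, trunc R c x) |x. trunc R c x \<noteq> 0}"
      using finite_gw_nodes finite_subset by blast
  qed
  then have "countable (?g ` range (trunc R))"
    by (rule countable_subset) (rule countable_Collect_finite)
  ultimately show ?thesis
    using countable_image_inj_on[OF _ inj_on_subset[of ?g UNIV]] by blast
qed

text \<open>A property decided by the first \<open>R\<close> generations is a countable union of
  cylinders, one for each truncated tree that has it.\<close>

lemma sets_agree_closed:
  assumes "\<And>c c'. agree R c c' \<Longrightarrow> c \<in> A \<longleftrightarrow> c' \<in> A"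
  shows "A \<in> sets (gw_space D1 D2)"
proof -
  have A: "c \<in> (\<Union>t\<in>trunc R ` A. {c. agree R t c}) \<longleftrightarrow> c \<in> A" for c
  proof
    assume "c \<in> (\<Union>t\<in>trunc R ` A. {c. agree R t c})"
    then obtain c' where "c' \<in> A" "agree R (trunc R c') c"
      by auto
    then show "c \<in> A"
      using agree_trans[OF agree_trunc] assms by blast
  next
    assume "c \<in> A"
    then show "c \<in> (\<Union>t\<in>trunc R ` A. {c. agree R t c})"
      using agree_sym[OF agree_trunc[of R c]] by blast
  qed
  then have "A = (\<Union>t\<in>trunc R ` A. {c. agree R t c})"
    by blast
  moreover have "countable (trunc R ` A)"
    using countable_range_trunc by (rule countable_subset[rotated]) auto
  ultimately show ?thesis
    using sets_agree sets.countable_UN'[of "trunc R ` A" "\<lambda>t. {c. agree R t c}" "gw_space D1 D2"]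
    by force
qed

text \<open>Offspring numbers are finite, so every tree lies in one of countably many cylinders, and
  continuity of the measure leaves a finite subfamily with almost all the mass. That no mass escapes
  is what turns lower bounds into limits.\<close>

lemma finite_trees_exhaust:
  assumes "0 < \<epsilon>"
  obtains S where "finite S" "S \<subseteq> range (trunc R)" "1 - \<epsilon> < (\<Sum>t\<in>S. cyl_weight D1 D2 R t)"
proof -
  interpret prob_space "gw_space D1 D2" by (rule prob_space_gw)
  let ?e = "from_nat_into (range (trunc R))"
  let ?C = "\<lambda>t. {c. agree R t c}"
  let ?U = "\<lambda>n. \<Union>i\<in>{..<n}. ?C (?e i)"
  have U: "(\<Union>n. ?U n) = UNIV"
  proof -
    have "c \<in> (\<Union>n. ?U n)" for c
    proof -
      obtain i where "?e i = trunc R c"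
        using from_nat_into_surj[OF countable_range_trunc[of R], of "trunc R c"] by auto
      then have "c \<in> ?C (?e i)"
        using agree_trunc agree_sym by auto
      then show ?thesis by blast
    qed
    then show ?thesis by blast
  qed
  have "(\<lambda>n. prob (?U n)) \<longlonglongrightarrow> prob (\<Union>n. ?U n)"
    by (rule finite_Lim_measure_incseq)
       (auto intro!: sets.finite_UN sets_agree simp: incseq_def lessThan_subset_iff intro: order_less_le_trans)
  then have "(\<lambda>n. prob (?U n)) \<longlonglongrightarrow> 1"
    using U prob_space by simp
  then have "eventually (\<lambda>n. 1 - \<epsilon> < prob (?U n)) sequentially"
    using assms by (intro order_tendstoD) auto
  then obtain n where n: "1 - \<epsilon> < prob (?U n)"
    by (auto simp: eventually_sequentially)
  let ?S = "?e ` {..<n}"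
  have "prob (?U n) = prob (\<Union>t\<in>?S. ?C t)"
    by simp
  also have "\<dots> \<le> (\<Sum>t\<in>?S. prob (?C t))"
    by (rule finite_measure_subadditive_finite) (auto intro: sets_agree)
  finally have "1 - \<epsilon> < (\<Sum>t\<in>?S. cyl_weight D1 D2 R t)"
    using n by (simp add: measure_agree)
  moreover have "?S \<subseteq> range (trunc R)"
    using from_nat_into[of "range (trunc R)"] by auto
  ultimately show thesis
    using that[of ?S] by blast
qed

text \<open>Distinct truncated trees have disjoint cylinders, so their weights add up inside
  \<open>A\<close>.\<close>

lemma cyl_weight_sum_le:
  assumes "finite S" "S \<subseteq> range (trunc R)" "A \<in> sets (gw_space D1 D2)"
    "\<And>t c. t \<in> S \<Longrightarrow> agree R t c \<Longrightarrow> c \<in> A"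
  shows "(\<Sum>t\<in>S. cyl_weight D1 D2 R t) \<le> measure (gw_space D1 D2) A"
proof -
  interpret prob_space "gw_space D1 D2" by (rule prob_space_gw)
  have "disjoint_family_on (\<lambda>t. {c. agree R t c}) S"
    unfolding disjoint_family_on_def
  proof (intro ballI impI)
    fix t t' assume t: "t \<in> S" "t' \<in> S" "t \<noteq> t'"
    then have "trunc R t = t" "trunc R t' = t'"
      using assms(2) by auto
    then show "{c. agree R t c} \<inter> {c. agree R t' c} = {}"
      using t(3) agree_sym agree_trans trunc_eq_iff by (metis (no_types, lifting) disjoint_iff mem_Collect_eq)
  qed
  then have "(\<Sum>t\<in>S. cyl_weight D1 D2 R t) = prob (\<Union>t\<in>S. {c. agree R t c})"
    using assms(1) by (subst finite_measure_finite_Union) (auto simp: measure_agree sets_agree)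
  also have "\<dots> \<le> prob A"
    using assms(3,4) by (intro finite_measure_mono) auto
  finally show ?thesis .
qed

section \<open>The second moment argument\<close>

text \<open>Extensional functions, so that the candidates are finite in number and each is counted
  once.\<close>

definition forest_maps :: "(bool \<Rightarrow> nat) \<Rightarrow> bool \<Rightarrow> nat \<Rightarrow> (nat list \<Rightarrow> nat) \<Rightarrow> (nat list \<Rightarrow> nat) set" where
  "forest_maps N s R c = (\<Pi>\<^sub>E x\<in>forest_nodes R c. {..<N (s = odd (length x))})"

text \<open>A lower limit spelled out with every smaller \<open>a\<close>: the normalised expected
  number of embedded pairs is asymptotically at least the product of the two tree probabilities.
  Here \<open>length x - 1\<close> is the generation of \<open>x\<close> in its own tree. All four
  models are reduced to this statement; it is quantified over \<open>s\<close> because degrees in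
  \<open>part2\<close> require trees rooted there.\<close>

definition forest_bound ::
  "(nat \<Rightarrow> 'w measure) \<Rightarrow> (nat \<Rightarrow> 'w \<Rightarrow> bool \<Rightarrow> nat \<Rightarrow> nat list) \<Rightarrow> (nat \<Rightarrow> bool \<Rightarrow> nat) \<Rightarrow>
     (bool \<Rightarrow> nat pmf) \<Rightarrow> bool" where
  "forest_bound M nb N D \<longleftrightarrow>
     (\<forall>s R c a. 0 < R \<longrightarrow> c [] = 2 \<longrightarrow>
        a < (\<Prod>x\<in>forest_inner R c. pmf (offspring_law (D s) (D (\<not> s)) (length x - 1)) (c x)) \<longrightarrow>
        (\<forall>\<^sub>F n in sequentially.
           a < (\<Sum>\<phi>\<in>forest_maps (N n) s R c. measure (M n) {\<omega>. forest_emb (nb n \<omega>) s R c \<phi>})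
                 / (real (N n s))\<^sup>2))"

definition join2 :: "(nat list \<Rightarrow> nat) \<Rightarrow> (nat list \<Rightarrow> nat) \<Rightarrow> nat list \<Rightarrow> nat" where
  "join2 c1 c2 x = (case x of [] \<Rightarrow> 2 | i # y \<Rightarrow> if i = 0 then c1 y else c2 y)"

lemma join2_simps [simp]:
  "join2 c1 c2 [] = 2" "join2 c1 c2 (0 # y) = c1 y" "join2 c1 c2 (Suc i # y) = c2 y"
  by (simp_all add: join2_def)

lemma gw_nodes_join2:
  "x \<in> gw_nodes (join2 c1 c2) \<longleftrightarrow>
     x = [] \<or> (\<exists>y. x = 0 # y \<and> y \<in> gw_nodes c1) \<or> (\<exists>y. x = 1 # y \<and> y \<in> gw_nodes c2)"
proof (cases x)
  case (Cons i y)
  have "i < 2 \<longleftrightarrow> i = 0 \<or> i = 1" by auto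
  then show ?thesis
    unfolding Cons gw_nodes_Cons by auto
qed simp

text \<open>The nodes of the joined tree other than its root split by their first entry. This
  factorisation makes the limiting weight of a pair a product, as independence of two random
  vertices demands.\<close>

lemma prod_join2:
  "(\<Prod>x\<in>forest_inner R (join2 c1 c2). pmf (offspring_law D1 D2 (length x - 1)) (join2 c1 c2 x))
     = cyl_weight D1 D2 R c1 * cyl_weight D1 D2 R c2"
proof -
  let ?S1 = "{x \<in> gw_nodes c1. length x < R}" and ?S2 = "{x \<in> gw_nodes c2. length x < R}"
  have fin: "finite ?S1" "finite ?S2"
    by (rule finite_subset[OF _ finite_gw_nodes[of _ R]], auto)+
  have "forest_inner R (join2 c1 c2) = (#) 0 ` ?S1 \<union> (#) 1 ` ?S2"
    unfolding forest_inner_def gw_nodes_join2 by auto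
  then have "(\<Prod>x\<in>forest_inner R (join2 c1 c2). pmf (offspring_law D1 D2 (length x - 1)) (join2 c1 c2 x))
     = (\<Prod>x\<in>(#) 0 ` ?S1. pmf (offspring_law D1 D2 (length x - 1)) (join2 c1 c2 x)) *
       (\<Prod>x\<in>(#) 1 ` ?S2. pmf (offspring_law D1 D2 (length x - 1)) (join2 c1 c2 x))"
    using fin by (simp only:) (rule prod.union_disjoint, auto)
  also have "\<dots> = cyl_weight D1 D2 R c1 * cyl_weight D1 D2 R c2"
    unfolding cyl_weight_def by (subst (1 2) prod.reindex) (auto simp: inj_on_def)
  finally show ?thesis .
qed

definition tree_roots :: "(bool \<Rightarrow> nat \<Rightarrow> nat list) \<Rightarrow> bool \<Rightarrow> nat \<Rightarrow> nat \<Rightarrow> (nat list \<Rightarrow> nat) \<Rightarrow> nat set" where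
  "tree_roots nb s n R c = {u. u < n \<and> (\<exists>\<phi>. tree_emb nb s R c \<phi> \<and> \<phi> [] = u)}"

text \<open>As a vertex carries at most one tree, an embedded pair is determined by the images of
  its two roots. A lower bound on embedded pairs is therefore a lower bound on the product of the
  two vertex counts.\<close>

lemma card_forest_emb_le:
  "card {\<phi> \<in> forest_maps N s R (join2 c1 c2). forest_emb nb s R (join2 c1 c2) \<phi>}
     \<le> card (tree_roots nb s (N s) R c1) * card (tree_roots nb s (N s) R c2)"
proof -
  let ?c = "join2 c1 c2"
  let ?F = "{\<phi> \<in> forest_maps N s R ?c. forest_emb nb s R ?c \<phi>}"
  have fin: "finite (tree_roots nb s (N s) R c)" for c
    by (rule finite_subset[of _ "{..<N s}"]) (auto simp: tree_roots_def)
  have t1: "tree_emb nb s R c1 (\<lambda>x. \<phi> (0 # x))" if "forest_emb nb s R ?c \<phi>" for \<phi>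
    using forest_emb_imp_tree_emb[OF that, of 0] by simp
  have t2: "tree_emb nb s R c2 (\<lambda>x. \<phi> (1 # x))" if "forest_emb nb s R ?c \<phi>" for \<phi>
    using forest_emb_imp_tree_emb[OF that, of 1] by (simp add: One_nat_def)
  have roots: "[0] \<in> forest_nodes R ?c" "[1] \<in> forest_nodes R ?c"
    by (auto simp: forest_nodes_def gw_nodes_join2)
  have "card ?F \<le> card (tree_roots nb s (N s) R c1 \<times> tree_roots nb s (N s) R c2)"
  proof (rule card_inj_on_le[where f = "\<lambda>\<phi>. (\<phi> [0], \<phi> [1])"])
    show "finite (tree_roots nb s (N s) R c1 \<times> tree_roots nb s (N s) R c2)"
      using fin by simp
    show "(\<lambda>\<phi>. (\<phi> [0], \<phi> [1])) ` ?F \<subseteq> tree_roots nb s (N s) R c1 \<times> tree_roots nb s (N s) R c2"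
    proof (rule image_subsetI)
      fix \<phi> assume \<phi>: "\<phi> \<in> ?F"
      then have "\<phi> [0] < N s" "\<phi> [1] < N s"
        using roots[THEN PiE_mem[of \<phi> "forest_nodes R ?c" "\<lambda>x. {..<N (s = odd (length x))}", rotated]]
        by (auto simp: forest_maps_def)
      then show "(\<phi> [0], \<phi> [1]) \<in> tree_roots nb s (N s) R c1 \<times> tree_roots nb s (N s) R c2"
        using t1[of \<phi>] t2[of \<phi>] \<phi> by (auto simp: tree_roots_def)
    qed
    show "inj_on (\<lambda>\<phi>. (\<phi> [0], \<phi> [1])) ?F"
    proof (rule inj_onI)
      fix \<phi> \<psi> assume p: "\<phi> \<in> ?F" "\<psi> \<in> ?F" "(\<phi> [0], \<phi> [1]) = (\<psi> [0], \<psi> [1])"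
      have "\<phi> x = \<psi> x" if "x \<in> forest_nodes R ?c" for x
      proof -
        have "x \<noteq> []" "x \<in> gw_nodes ?c" "length x \<le> Suc R"
          using that by (auto simp: forest_nodes_def)
        then consider y where "x = 0 # y" "y \<in> gw_nodes c1" "length y \<le> R"
          | y where "x = 1 # y" "y \<in> gw_nodes c2" "length y \<le> R"
          by (auto simp: gw_nodes_join2)
        then show ?thesis
          using p tree_emb_unique(2)[OF t1 t1, of \<psi> \<phi>] tree_emb_unique(2)[OF t2 t2, of \<psi> \<phi>]
          by cases auto
      qed
      then show "\<phi> = \<psi>"
        using p by (intro PiE_ext[where k = "forest_nodes R ?c"]) (auto simp: forest_maps_def)
    qed
  qed
  then show ?thesis
    by (simp add: card_cartesian_product)
qed

text \<open>Multiplying the two lower bounds is legitimate when both are nonnegative; otherwise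
  \<open>a * b\<close> is itself at most \<open>\<epsilon>\<close> and the claim is trivial.\<close>

lemma prod_ge_approx:
  fixes x y a b \<epsilon> :: real
  assumes "0 \<le> x" "0 \<le> y" "a - \<epsilon> \<le> x" "b - \<epsilon> \<le> y" "0 \<le> a" "a \<le> 1" "0 \<le> b" "b \<le> 1" "0 < \<epsilon>"
  shows "a * b - 2 * \<epsilon> \<le> x * y"
proof (cases "\<epsilon> \<le> a \<and> \<epsilon> \<le> b")
  case True
  then have "(a - \<epsilon>) * (b - \<epsilon>) \<le> x * y"
    using assms by (intro mult_mono) auto
  moreover have "a * b - 2 * \<epsilon> \<le> (a - \<epsilon>) * (b - \<epsilon>)"
  proof -
    have "\<epsilon> * (a + b) \<le> \<epsilon> * 2"
      using assms by (intro mult_left_mono) auto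
    moreover have "(a - \<epsilon>) * (b - \<epsilon>) = a * b - \<epsilon> * (a + b) + \<epsilon> * \<epsilon>"
      by (simp add: algebra_simps)
    ultimately show ?thesis
      using zero_le_square[of \<epsilon>] by linarith
  qed
  ultimately show ?thesis by linarith
next
  case False
  then have "a * b \<le> \<epsilon>"
    using assms mult_mono[of a 1 b \<epsilon>] mult_mono[of a \<epsilon> b 1] by auto
  moreover have "0 \<le> x * y" using assms by simp
  ultimately show ?thesis using assms by linarith
qed

text \<open>For a random \<open>Y\<close> in the unit interval, \<open>ea\<close>,
  \<open>eab\<close> and \<open>eb\<close> stand for the expectations of the square of
  \<open>Y\<close>, of \<open>Y * (1 - Y)\<close>, and of the square of \<open>1 - Y\<close>. Their
  weighted sum is one, and so is that of the targets, so lower bounds on two of them bound the third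
  from above. The quadratic form is then the mean square of \<open>Y - a\<close>; the constant is
  \<open>9 + 9 + 6\<close>.\<close>

lemma second_moment_from_lower_bounds:
  fixes a b ea eb eab \<epsilon> :: real
  assumes "a + b = 1" "0 \<le> a" "0 \<le> b" "0 \<le> \<epsilon>"
    and "a * a - 3 * \<epsilon> \<le> ea" "b * b - 3 * \<epsilon> \<le> eb" "a * b - 3 * \<epsilon> \<le> eab" "ea + 2 * eab + eb = 1"
  shows "b\<^sup>2 * ea - 2 * a * b * eab + a\<^sup>2 * eb \<le> 24 * \<epsilon>"
proof -
  have ab: "a \<le> 1" "b \<le> 1" using assms by auto
  have one: "a * a + 2 * (a * b) + b * b = 1"
  proof -
    have "a * a + 2 * (a * b) + b * b = (a + b) * (a + b)"
      by (simp add: algebra_simps)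
    then show ?thesis
      using assms(1) by simp
  qed
  \<comment> \<open>The slack is \<open>3 * \<epsilon>\<close> from the other square and
    \<open>6 * \<epsilon>\<close> from the mixed term, which counts twice.\<close>
  have "ea \<le> a * a + 9 * \<epsilon>" "eb \<le> b * b + 9 * \<epsilon>"
    using assms one by linarith+
  then have "b\<^sup>2 * ea \<le> b\<^sup>2 * (a * a + 9 * \<epsilon>)" "a\<^sup>2 * eb \<le> a\<^sup>2 * (b * b + 9 * \<epsilon>)"
    by (auto intro!: mult_left_mono)
  moreover have "(2 * a * b) * (a * b - 3 * \<epsilon>) \<le> (2 * a * b) * eab"
    using assms by (intro mult_left_mono) auto
  moreover have "b\<^sup>2 * (9 * \<epsilon>) \<le> 1 * (9 * \<epsilon>)" "a\<^sup>2 * (9 * \<epsilon>) \<le> 1 * (9 * \<epsilon>)"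
    using assms ab by (intro mult_right_mono power_le_one; simp)+
  moreover have "(a * b) * (6 * \<epsilon>) \<le> 1 * (6 * \<epsilon>)"
    using assms ab by (intro mult_right_mono mult_le_one) auto
  ultimately show ?thesis
    by (simp add: algebra_simps power2_eq_square)
qed

text \<open>The frequency \<open>Y\<close> dominates the total frequency of any finite family of
  trees in \<open>Q\<close>, and \<open>1 - Y\<close> that of trees outside \<open>Q\<close>.
  Summing the bounds for pairs of trees bounds all three second-order expectations from below by
  products of limiting probabilities, and these expectations determine the mean square deviation.
  Vertices whose tree is not listed may count on either side.\<close>

lemma exploration_concentration:
  fixes M :: "nat \<Rightarrow> 'w measure" and N :: "nat \<Rightarrow> bool \<Rightarrow> nat" and A :: "nat \<Rightarrow> 'w \<Rightarrow> nat \<Rightarrow> bool"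
  assumes prob: "\<And>n. prob_space (M n)" and sets: "\<And>n. sets (M n) = UNIV"
    and pos: "\<And>n. 0 < N n s" and R: "0 < R"
    and lb: "forest_bound M nb N D"
    and closed: "\<And>c c'. agree R c c' \<Longrightarrow> c \<in> Q \<longleftrightarrow> c' \<in> Q"
    and A: "\<And>n. AE \<omega> in M n. \<forall>c \<phi>. tree_emb (nb n \<omega>) s R c \<phi> \<longrightarrow> \<phi> [] < N n s \<longrightarrow> (A n \<omega> (\<phi> []) \<longleftrightarrow> c \<in> Q)"
  shows "(\<lambda>n. \<integral>\<omega>. (real (card {u. u < N n s \<and> A n \<omega> u}) / real (N n s)
            - measure (gw_space (D s) (D (\<not> s))) Q)\<^sup>2 \<partial>M n) \<longlonglongrightarrow> 0"
proof -
  let ?gw = "gw_space (D s) (D (\<not> s))"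
  let ?P = "cyl_weight (D s) (D (\<not> s)) R"
  define a where "a = measure ?gw Q"
  define z where "z n \<omega> t = real (card (tree_roots (nb n \<omega>) s (N n s) R t)) / real (N n s)" for n \<omega> t
  define Y where "Y n \<omega> = real (card {u. u < N n s \<and> A n \<omega> u}) / real (N n s)" for n \<omega>
  interpret gw: prob_space ?gw by (rule prob_space_gw)
  have P_nonneg: "0 \<le> ?P t" for t
    by (auto simp: cyl_weight_def intro!: prod_nonneg)
  have Q_sets: "Q \<in> sets ?gw"
    by (rule sets_agree_closed[of R]) (rule closed)
  have a01: "0 \<le> a" "a \<le> 1" by (auto simp: a_def)
  have sp: "space (M n) = UNIV" for n
    using sets[of n] by (metis sets.top sets_eq_imp_space_eq sets.sets_into_space top.extremum_uniqueI UNIV_I)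
  have meas: "f \<in> borel_measurable (M n)" for f :: "'w \<Rightarrow> real" and n
    by (auto simp: measurable_def sets sp)
  have int: "integrable (M n) f" if "\<And>\<omega>. \<bar>f \<omega>\<bar> \<le> B" for f :: "'w \<Rightarrow> real" and n B
  proof -
    interpret prob_space "M n" by (rule prob)
    show ?thesis
      by (rule integrable_const_bound[of _ B]) (use that meas in auto)
  qed
  have card_le: "card {u. u < N n s \<and> B u} \<le> N n s" for B n
    using card_mono[of "{..<N n s}" "{u. u < N n s \<and> B u}"] by auto
  have z01: "0 \<le> z n \<omega> t" "z n \<omega> t \<le> 1" for n \<omega> t
    unfolding z_def tree_roots_def using card_le pos by (auto simp: divide_le_eq)
  have Y01: "0 \<le> Y n \<omega>" "Y n \<omega> \<le> 1" for n \<omega>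
    unfolding Y_def using card_le pos by (auto simp: divide_le_eq)
  have pair: "\<forall>\<^sub>F n in sequentially. b < (\<integral>\<omega>. z n \<omega> t * z n \<omega> t' \<partial>M n)"
    if b: "b < ?P t * ?P t'" for b t t'
  proof -
    let ?c = "join2 t t'"
    have "\<forall>\<^sub>F n in sequentially. b < (\<Sum>\<phi>\<in>forest_maps (N n) s R ?c.
        measure (M n) {\<omega>. forest_emb (nb n \<omega>) s R ?c \<phi>}) / (real (N n s))\<^sup>2"
      using lb[unfolded forest_bound_def, rule_format, of R ?c b s] R b prod_join2[where R = R and ?c1.0 = t and ?c2.0 = t'] by simp
    then show ?thesis
    proof eventually_elim
      case (elim n)
      interpret M: prob_space "M n" by (rule prob)
      let ?Phi = "forest_maps (N n) s R ?c"
      let ?E = "\<lambda>\<phi>. {\<omega>. forest_emb (nb n \<omega>) s R ?c \<phi>}"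
      have fin: "finite ?Phi"
        unfolding forest_maps_def by (intro finite_PiE finite_forest_nodes) auto
      have "(\<Sum>\<phi>\<in>?Phi. measure (M n) (?E \<phi>)) = (\<integral>\<omega>. (\<Sum>\<phi>\<in>?Phi. indicator (?E \<phi>) \<omega>) \<partial>M n)"
        by (subst Bochner_Integration.integral_sum)
           (auto intro!: int[of _ 1] simp: sets sp indicator_def)
      also have "\<dots> \<le> (\<integral>\<omega>. (real (N n s))\<^sup>2 * (z n \<omega> t * z n \<omega> t') \<partial>M n)"
      proof (rule integral_mono)
        show "integrable (M n) (\<lambda>\<omega>. \<Sum>\<phi>\<in>?Phi. indicat_real (?E \<phi>) \<omega>)"
          by (intro Bochner_Integration.integrable_sum int[of _ 1]) (auto simp: indicator_def)
        show "integrable (M n) (\<lambda>\<omega>. (real (N n s))\<^sup>2 * (z n \<omega> t * z n \<omega> t'))"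
          using z01 by (intro integrable_mult_right int[of _ 1]) (auto simp: abs_mult mult_le_one)
        fix \<omega>
        have "(\<Sum>\<phi>\<in>?Phi. indicat_real (?E \<phi>) \<omega>) = real (card {\<phi> \<in> ?Phi. forest_emb (nb n \<omega>) s R ?c \<phi>})"
          using fin by (simp add: indicator_def sum.If_cases Int_def)
        also have "\<dots> \<le> real (card (tree_roots (nb n \<omega>) s (N n s) R t) * card (tree_roots (nb n \<omega>) s (N n s) R t'))"
          by (rule of_nat_mono) (rule card_forest_emb_le)
        also have "\<dots> = (real (N n s))\<^sup>2 * (z n \<omega> t * z n \<omega> t')"
          using pos[of n] by (simp add: z_def power2_eq_square)
        finally show "(\<Sum>\<phi>\<in>?Phi. indicat_real (?E \<phi>) \<omega>) \<le> (real (N n s))\<^sup>2 * (z n \<omega> t * z n \<omega> t')" .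
      qed
      also have "\<dots> = (real (N n s))\<^sup>2 * (\<integral>\<omega>. z n \<omega> t * z n \<omega> t' \<partial>M n)"
        by simp
      finally have "(\<Sum>\<phi>\<in>?Phi. measure (M n) (?E \<phi>)) / (real (N n s))\<^sup>2 \<le> (\<integral>\<omega>. z n \<omega> t * z n \<omega> t' \<partial>M n)"
        using pos[of n] by (simp add: divide_le_eq mult.commute)
      with elim show ?case by linarith
    qed
  qed
  have sums: "\<forall>\<^sub>F n in sequentially.
      (\<Sum>t\<in>U. ?P t) * (\<Sum>t\<in>V. ?P t) - \<epsilon> \<le> (\<integral>\<omega>. (\<Sum>t\<in>U. z n \<omega> t) * (\<Sum>t\<in>V. z n \<omega> t) \<partial>M n)"
    if fin: "finite U" "finite V" and e: "0 < \<epsilon>" for U V \<epsilon>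
  proof -
    define k where "k = real (card U * card V)"
    \<comment> \<open>Distributes the error over the pairs of trees; the \<open>+ 1\<close> keeps
      the denominator positive when a family is empty.\<close>
    define \<delta> where "\<delta> = \<epsilon> / (k + 1)"
    have k: "0 \<le> k" by (simp add: k_def)
    then have "0 < \<delta>" "k * \<delta> \<le> \<epsilon>"
      using e by (auto simp: \<delta>_def pos_divide_le_eq algebra_simps)
    then have \<delta>: "0 < \<delta>" "real (card U * card V) * \<delta> \<le> \<epsilon>"
      by (auto simp: k_def)
    have "\<forall>\<^sub>F n in sequentially. \<forall>t\<in>U. \<forall>t'\<in>V. ?P t * ?P t' - \<delta> < (\<integral>\<omega>. z n \<omega> t * z n \<omega> t' \<partial>M n)"
      using fin \<delta>(1) by (intro eventually_ball_finite ballI pair) auto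
    then show ?thesis
    proof eventually_elim
      case (elim n)
      have "(\<Sum>t\<in>U. ?P t) * (\<Sum>t\<in>V. ?P t) - \<epsilon> \<le> (\<Sum>t\<in>U. \<Sum>t'\<in>V. ?P t * ?P t' - \<delta>)"
        using \<delta>(2) by (simp add: sum_product sum_subtractf)
      also have "\<dots> \<le> (\<Sum>t\<in>U. \<Sum>t'\<in>V. (\<integral>\<omega>. z n \<omega> t * z n \<omega> t' \<partial>M n))"
        using elim by (intro sum_mono) (auto intro: less_imp_le)
      also have "\<dots> = (\<integral>\<omega>. (\<Sum>t\<in>U. z n \<omega> t) * (\<Sum>t\<in>V. z n \<omega> t) \<partial>M n)"
        unfolding sum_product using z01
        by (subst Bochner_Integration.integral_sum, 
            intro Bochner_Integration.integrable_sum int[of _ 1], simp add: abs_mult mult_le_one,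
            intro sum.cong refl, subst Bochner_Integration.integral_sum)
           (auto intro!: int[of _ 1] simp: abs_mult mult_le_one)
      finally show ?case .
    qed
  qed
  have main: "\<forall>\<^sub>F n in sequentially. (\<integral>\<omega>. (Y n \<omega> - a)\<^sup>2 \<partial>M n) \<le> 24 * \<epsilon>" if e: "0 < \<epsilon>" for \<epsilon>
  proof -
    obtain S where S: "finite S" "S \<subseteq> range (trunc R)" "1 - \<epsilon> < (\<Sum>t\<in>S. ?P t)"
      using finite_trees_exhaust[OF e] by metis
    define U where "U = {t \<in> S. t \<in> Q}"
    define V where "V = {t \<in> S. t \<notin> Q}"
    have fin: "finite U" "finite V" and UV: "U \<subseteq> range (trunc R)" "V \<subseteq> range (trunc R)"
      using S by (auto simp: U_def V_def)
    let ?p = "\<Sum>t\<in>U. ?P t" and ?q = "\<Sum>t\<in>V. ?P t"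
    have "S = U \<union> V" "U \<inter> V = {}"
      by (auto simp: U_def V_def)
    then have pq: "1 - \<epsilon> < ?p + ?q"
      using S(3) sum.union_disjoint[OF fin] by metis
    have p: "?p \<le> a"
      unfolding a_def using closed by (intro cyl_weight_sum_le fin UV Q_sets) (auto simp: U_def)
    have "?q \<le> measure ?gw (UNIV - Q)"
      using closed Q_sets sets.compl_sets[OF Q_sets]
      by (intro cyl_weight_sum_le fin UV) (auto simp: V_def)
    also have "\<dots> = 1 - a"
      using gw.prob_compl[OF Q_sets] by (simp add: a_def)
    finally have q: "?q \<le> 1 - a" .
    have p0: "0 \<le> ?p" "0 \<le> ?q" by (auto intro: sum_nonneg P_nonneg)
    \<comment> \<open>Each of \<open>?p\<close> and \<open>?q\<close> is bounded above by its
      target, and their sum exceeds \<open>1 - \<epsilon>\<close>, so each is within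
      \<open>\<epsilon>\<close> of its target.\<close>
    have pp: "a * a - 2 * \<epsilon> \<le> ?p * ?p" "a * (1 - a) - 2 * \<epsilon> \<le> ?p * ?q" "(1 - a) * (1 - a) - 2 * \<epsilon> \<le> ?q * ?q"
      using p q pq p0 a01 e by (auto intro!: prod_ge_approx)
    show ?thesis
      using sums[OF fin(1) fin(1) e] sums[OF fin(1) fin(2) e] sums[OF fin(2) fin(2) e]
    proof eventually_elim
      case (elim n)
      interpret M: prob_space "M n" by (rule prob)
      let ?zU = "\<lambda>\<omega>. \<Sum>t\<in>U. z n \<omega> t" and ?zV = "\<lambda>\<omega>. \<Sum>t\<in>V. z n \<omega> t"
      have sum_z: "(\<Sum>t\<in>W. z n \<omega> t) \<le> real (card {u. u < N n s \<and> B u}) / real (N n s)"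
        if W: "finite W" "W \<subseteq> range (trunc R)"
          and B: "\<And>t u. t \<in> W \<Longrightarrow> u \<in> tree_roots (nb n \<omega>) s (N n s) R t \<Longrightarrow> B u" for W B \<omega>
      proof -
        let ?Z = "tree_roots (nb n \<omega>) s (N n s) R"
        have fz: "finite (?Z t)" for t
          by (rule finite_subset[of _ "{..<N n s}"]) (auto simp: tree_roots_def)
        \<comment> \<open>One vertex cannot carry two different truncated trees, so the counts add
          up without overlap.\<close>
        have disj: "?Z t \<inter> ?Z t' = {}" if t: "t \<in> W" "t' \<in> W" "t \<noteq> t'" for t t'
        proof (rule ccontr)
          assume "?Z t \<inter> ?Z t' \<noteq> {}"
          then obtain u where "u \<in> ?Z t" "u \<in> ?Z t'"
            by blast
          then obtain \<phi> \<phi>' where "tree_emb (nb n \<omega>) s R t \<phi>" "\<phi> [] = u" "tree_emb (nb n \<omega>) s R t' \<phi>'" "\<phi>' [] = u"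
            unfolding tree_roots_def by blast
          then have "trunc R t = trunc R t'"
            using tree_emb_unique(1) trunc_eq_iff by metis
          moreover have "trunc R t = t" "trunc R t' = t'"
            using t W by auto
          ultimately show False using t(3) by simp
        qed
        have "(\<Sum>t\<in>W. card (?Z t)) = card (\<Union>t\<in>W. ?Z t)"
          using W(1) fz disj by (intro card_UN_disjoint[symmetric]) auto
        also have "\<dots> \<le> card {u. u < N n s \<and> B u}"
          using B by (intro card_mono) (auto simp: tree_roots_def)
        finally have "real (\<Sum>t\<in>W. card (?Z t)) \<le> real (card {u. u < N n s \<and> B u})"
          by (rule of_nat_mono)
        then show ?thesis
          using pos[of n] by (simp add: z_def sum_divide_distrib[symmetric] divide_right_mono)
      qed
      have ae: "AE \<omega> in M n. ?zU \<omega> \<le> Y n \<omega> \<and> ?zV \<omega> \<le> 1 - Y n \<omega>"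
        using A[of n]
      proof eventually_elim
        case (elim \<omega>)
        have "?zU \<omega> \<le> Y n \<omega>"
          unfolding Y_def by (rule sum_z[OF fin(1) UV(1)]) (use elim in \<open>auto simp: tree_roots_def U_def\<close>)
        moreover have "?zV \<omega> \<le> real (card {u. u < N n s \<and> \<not> A n \<omega> u}) / real (N n s)"
          by (rule sum_z[OF fin(2) UV(2)]) (use elim in \<open>auto simp: tree_roots_def V_def\<close>)
        moreover have "card {u. u < N n s \<and> A n \<omega> u} + card {u. u < N n s \<and> \<not> A n \<omega> u} = N n s"
        proof -
          have "card ({u. u < N n s \<and> A n \<omega> u} \<union> {u. u < N n s \<and> \<not> A n \<omega> u}) = card {..<N n s}"
            by (rule arg_cong[of _ _ card]) auto
          then show ?thesis
            by (subst (asm) card_Un_disjoint) auto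
        qed
        then have "real (card {u. u < N n s \<and> \<not> A n \<omega> u}) / real (N n s) = 1 - Y n \<omega>"
          unfolding Y_def using pos[of n] by (simp add: field_simps flip: of_nat_add)
        ultimately show ?case by simp
      qed
      have zUV: "0 \<le> ?zU \<omega>" "0 \<le> ?zV \<omega>" "?zU \<omega> \<le> real (card U)" "?zV \<omega> \<le> real (card V)" for \<omega>
        using sum_mono[of U "z n \<omega>" "\<lambda>_. 1"] sum_mono[of V "z n \<omega>" "\<lambda>_. 1"] z01
        by (auto intro: sum_nonneg)
      have iz: "integrable (M n) (\<lambda>\<omega>. ?zU \<omega> * ?zU \<omega>)" "integrable (M n) (\<lambda>\<omega>. ?zU \<omega> * ?zV \<omega>)"
          "integrable (M n) (\<lambda>\<omega>. ?zV \<omega> * ?zV \<omega>)"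
        by (rule int[of _ "real (card U) * real (card U)"], use zUV in \<open>auto intro!: mult_mono simp: abs_mult\<close>,
            rule int[of _ "real (card U) * real (card V)"], use zUV in \<open>auto intro!: mult_mono simp: abs_mult\<close>,
            rule int[of _ "real (card V) * real (card V)"], use zUV in \<open>auto intro!: mult_mono simp: abs_mult\<close>)
      have iY: "integrable (M n) (\<lambda>\<omega>. Y n \<omega> * Y n \<omega>)" "integrable (M n) (\<lambda>\<omega>. Y n \<omega> * (1 - Y n \<omega>))"
          "integrable (M n) (\<lambda>\<omega>. (1 - Y n \<omega>) * (1 - Y n \<omega>))"
        using Y01 by (auto intro!: int[of _ 1] simp: abs_mult mult_le_one)
      let ?ea = "\<integral>\<omega>. Y n \<omega> * Y n \<omega> \<partial>M n" and ?eab = "\<integral>\<omega>. Y n \<omega> * (1 - Y n \<omega>) \<partial>M n"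
        and ?eb = "\<integral>\<omega>. (1 - Y n \<omega>) * (1 - Y n \<omega>) \<partial>M n"
      have "(\<integral>\<omega>. ?zU \<omega> * ?zU \<omega> \<partial>M n) \<le> ?ea"
        by (rule integral_mono_AE[OF iz(1) iY(1)], rule eventually_mono[OF ae], intro mult_mono, use zUV Y01 in auto)
      moreover have "(\<integral>\<omega>. ?zU \<omega> * ?zV \<omega> \<partial>M n) \<le> ?eab"
        by (rule integral_mono_AE[OF iz(2) iY(2)], rule eventually_mono[OF ae], intro mult_mono, use zUV Y01 in auto)
      moreover have "(\<integral>\<omega>. ?zV \<omega> * ?zV \<omega> \<partial>M n) \<le> ?eb"
        by (rule integral_mono_AE[OF iz(3) iY(3)], rule eventually_mono[OF ae], intro mult_mono, use zUV Y01 in auto)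
      \<comment> \<open>Of the loss \<open>3 * \<epsilon>\<close>, two parts come from replacing the
        full law by the finite family \<open>S\<close> and one from the limit in
        \<open>n\<close>.\<close>
      ultimately have lower: "a * a - 3 * \<epsilon> \<le> ?ea" "(1 - a) * (1 - a) - 3 * \<epsilon> \<le> ?eb" "a * (1 - a) - 3 * \<epsilon> \<le> ?eab"
        using elim pp by linarith+
      have "?ea + 2 * ?eab + ?eb = (\<integral>\<omega>. Y n \<omega> * Y n \<omega> + 2 * (Y n \<omega> * (1 - Y n \<omega>)) + (1 - Y n \<omega>) * (1 - Y n \<omega>) \<partial>M n)"
        using iY by simp
      also have "\<dots> = 1"
        by (simp add: algebra_simps M.prob_space)
      finally have one: "?ea + 2 * ?eab + ?eb = 1" .
      \<comment> \<open>Since \<open>Y - a = (1 - a) * Y - a * (1 - Y)\<close>, squaring expresses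
        the deviation by the three expectations.\<close>
      have "(\<integral>\<omega>. (Y n \<omega> - a)\<^sup>2 \<partial>M n) = (\<integral>\<omega>. (1 - a)\<^sup>2 * (Y n \<omega> * Y n \<omega>) - 2 * a * (1 - a) * (Y n \<omega> * (1 - Y n \<omega>))
          + a\<^sup>2 * ((1 - Y n \<omega>) * (1 - Y n \<omega>)) \<partial>M n)"
        by (intro Bochner_Integration.integral_cong refl) (simp add: algebra_simps power2_eq_square)
      also have "\<dots> = (1 - a)\<^sup>2 * ?ea - 2 * a * (1 - a) * ?eab + a\<^sup>2 * ?eb"
        using iY by simp
      also have "\<dots> \<le> 24 * \<epsilon>"
        by (rule second_moment_from_lower_bounds) (use a01 lower one e in auto)
      finally show ?case .
    qed
  qed
  have "(\<lambda>n. \<integral>\<omega>. (Y n \<omega> - a)\<^sup>2 \<partial>M n) \<longlonglongrightarrow> 0"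
  proof (rule tendstoI)
    fix e :: real assume e: "0 < e"
    \<comment> \<open>Dividing by 25 instead of 24 makes the final bound strict.\<close>
    then have "0 < e / 25" by simp
    from main[OF this] show "\<forall>\<^sub>F n in sequentially. dist (\<integral>\<omega>. (Y n \<omega> - a)\<^sup>2 \<partial>M n) 0 < e"
    proof eventually_elim
      case (elim n)
      have "0 \<le> (\<integral>\<omega>. (Y n \<omega> - a)\<^sup>2 \<partial>M n)" by simp
      then show ?case using elim e by (simp add: dist_real_def)
    qed
  qed
  then show ?thesis
    unfolding Y_def a_def .
qed

section \<open>Consequences of the concentration of frequencies\<close>

text \<open>Nonnegativity of the variance of \<open>Y n - a\<close> controls the mean, and Markov's
  inequality for the square controls the deviation probabilities.\<close>

lemma mean_tendsto_of_variation:
  fixes Y :: "nat \<Rightarrow> 'w \<Rightarrow> real"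
  assumes prob: "\<And>n. prob_space (M n)" and meas: "\<And>n. Y n \<in> borel_measurable (M n)"
    and bd: "\<And>n \<omega>. 0 \<le> Y n \<omega> \<and> Y n \<omega> \<le> 1"
    and lim: "(\<lambda>n. \<integral>\<omega>. (Y n \<omega> - a)\<^sup>2 \<partial>M n) \<longlonglongrightarrow> 0"
  shows "(\<lambda>n. \<integral>\<omega>. Y n \<omega> \<partial>M n) \<longlonglongrightarrow> a"
    and "0 < \<epsilon> \<Longrightarrow> (\<lambda>n. measure (M n) {\<omega> \<in> space (M n). \<epsilon> < \<bar>Y n \<omega> - a\<bar>}) \<longlonglongrightarrow> 0"
proof -
  have int: "integrable (M n) (\<lambda>\<omega>. Y n \<omega> - a)" "integrable (M n) (\<lambda>\<omega>. (Y n \<omega> - a)\<^sup>2)" for n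
  proof -
    interpret prob_space "M n" by (rule prob)
    have b: "\<bar>Y n \<omega> - a\<bar> \<le> 1 + \<bar>a\<bar>" for \<omega>
      using bd[of n \<omega>] by linarith
    show "integrable (M n) (\<lambda>\<omega>. Y n \<omega> - a)"
      by (rule integrable_const_bound[of _ "1 + \<bar>a\<bar>"]) (use b meas in auto)
    have "(Y n \<omega> - a)\<^sup>2 \<le> (1 + \<bar>a\<bar>)\<^sup>2" for \<omega>
      using b[of \<omega>] by (intro abs_le_square_iff[THEN iffD1]) auto
    then show "integrable (M n) (\<lambda>\<omega>. (Y n \<omega> - a)\<^sup>2)"
      by (intro integrable_const_bound[of _ "(1 + \<bar>a\<bar>)\<^sup>2"]) (use meas in auto)
  qed
  have "((\<integral>\<omega>. Y n \<omega> \<partial>M n) - a)\<^sup>2 \<le> (\<integral>\<omega>. (Y n \<omega> - a)\<^sup>2 \<partial>M n)" for n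
  proof -
    interpret prob_space "M n" by (rule prob)
    have "integrable (M n) (Y n)"
      by (rule integrable_const_bound[of _ 1]) (use bd meas in auto)
    then have "expectation (\<lambda>\<omega>. Y n \<omega> - a) = expectation (Y n) - a"
      using prob_space by simp
    moreover have "0 \<le> expectation (\<lambda>\<omega>. (Y n \<omega> - a)\<^sup>2) - (expectation (\<lambda>\<omega>. Y n \<omega> - a))\<^sup>2"
      using variance_positive[of "\<lambda>\<omega>. Y n \<omega> - a"] unfolding variance_eq[OF int] .
    ultimately show ?thesis
      by simp
  qed
  then have "(\<lambda>n. ((\<integral>\<omega>. Y n \<omega> \<partial>M n) - a)\<^sup>2) \<longlonglongrightarrow> 0"
    by (intro tendsto_sandwich[OF always_eventually always_eventually tendsto_const lim]) auto
  then have "(\<lambda>n. \<bar>(\<integral>\<omega>. Y n \<omega> \<partial>M n) - a\<bar>) \<longlonglongrightarrow> 0"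
    using tendsto_real_sqrt by fastforce
  then show "(\<lambda>n. \<integral>\<omega>. Y n \<omega> \<partial>M n) \<longlonglongrightarrow> a"
    by (simp add: tendsto_rabs_zero_iff LIM_zero_iff)
  assume e: "0 < \<epsilon>"
  have le: "measure (M n) {\<omega> \<in> space (M n). \<epsilon> < \<bar>Y n \<omega> - a\<bar>} \<le> (\<integral>\<omega>. (Y n \<omega> - a)\<^sup>2 \<partial>M n) / \<epsilon>\<^sup>2" for n
  proof -
    interpret prob_space "M n" by (rule prob)
    have [measurable]: "Y n \<in> borel_measurable (M n)" by (rule meas)
    have "\<epsilon>\<^sup>2 \<le> (Y n \<omega> - a)\<^sup>2" if "\<epsilon> < \<bar>Y n \<omega> - a\<bar>" for \<omega>
      using that e by (intro abs_le_square_iff[THEN iffD1]) auto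
    then have "prob {\<omega> \<in> space (M n). \<epsilon> < \<bar>Y n \<omega> - a\<bar>} \<le> prob {\<omega> \<in> space (M n). (Y n \<omega> - a)\<^sup>2 \<ge> \<epsilon>\<^sup>2}"
      by (intro finite_measure_mono) auto
    also have "\<dots> \<le> (\<integral>\<omega>. (Y n \<omega> - a)\<^sup>2 \<partial>M n) / \<epsilon>\<^sup>2"
      by (rule integral_Markov_inequality_measure[where A = "{}"]) (use e int(2) in auto)
    finally show ?thesis .
  qed
  have "(\<lambda>n. (\<integral>\<omega>. (Y n \<omega> - a)\<^sup>2 \<partial>M n) / \<epsilon>\<^sup>2) \<longlonglongrightarrow> 0"
    using tendsto_divide[OF lim tendsto_const[of "\<epsilon>\<^sup>2"]] e by simp
  then show "(\<lambda>n. measure (M n) {\<omega> \<in> space (M n). \<epsilon> < \<bar>Y n \<omega> - a\<bar>}) \<longlonglongrightarrow> 0"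
    by (rule tendsto_sandwich[OF always_eventually[OF allI[OF measure_nonneg]] always_eventually[OF allI[OF le]] tendsto_const])
qed

section \<open>Degrees of uniformly random vertices\<close>

definition degree_law :: "bool \<Rightarrow> nat \<Rightarrow> (nat, nat) bigraph measure \<Rightarrow> real measure" where
  "degree_law s n L = distr (L \<Otimes>\<^sub>M measure_pmf (pmf_of_set {..<n})) borel
     (\<lambda>(H, u). real (card (nbrs H s u)))"

lemma X1_law_eq: "X1_law n L = degree_law True n L"
  and X2_law_eq: "X2_law n L = degree_law False n L"
  by (simp_all add: X1_law_def X2_law_def degree_law_def nbrs_def)

text \<open>Fubini: for a fixed graph, a uniform vertex has degree at most \<open>x\<close> with
  probability equal to the fraction of such vertices.\<close>

lemma
  fixes L :: "(nat, nat) bigraph measure"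
  assumes "prob_space L" "sets L = UNIV" "0 < n"
  shows cdf_degree_law: "cdf (degree_law s n L) x =
      (\<integral>H. real (card {u. u < n \<and> real (card (nbrs H s u)) \<le> x}) / real n \<partial>L)" (is ?cdf)
    and measurable_degree: "(\<lambda>(H, u). real (card (nbrs H s u)))
      \<in> borel_measurable (L \<Otimes>\<^sub>M measure_pmf (pmf_of_set {..<n}))" (is ?meas)
proof -
  interpret L: prob_space L by fact
  let ?U = "measure_pmf (pmf_of_set {..<n})"
  let ?f = "\<lambda>(H, u). real (card (nbrs H s u))"
  have sp: "space L = UNIV"
    using assms(2) by (metis UNIV_I sets.sets_into_space top.extremum_uniqueI)
  have meas_L: "g \<in> borel_measurable L" for g :: "(nat, nat) bigraph \<Rightarrow> real"
    by (auto simp: measurable_def assms(2) sp)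
  \<comment> \<open>All sets of graphs are measurable, but there are uncountably many graphs;
    countability of the vertex factor reduces joint measurability to sections.\<close>
  have "(\<lambda>(u, H). ?f (H, u)) \<in> borel_measurable (count_space UNIV \<Otimes>\<^sub>M L)"
    by (rule measurable_pair_measure_countable1) (auto intro: meas_L)
  from measurable_pair_swap[OF this]
  have "?f \<in> borel_measurable (L \<Otimes>\<^sub>M count_space UNIV)"
    by (simp add: case_prod_unfold)
  moreover have "sets (L \<Otimes>\<^sub>M ?U) = sets (L \<Otimes>\<^sub>M count_space UNIV)"
    by (rule sets_pair_measure_cong) auto
  ultimately show meas: ?meas
    using measurable_cong_sets by blast
  let ?X = "?f -` {..x} \<inter> space (L \<Otimes>\<^sub>M ?U)"
  have X: "?X \<in> sets (L \<Otimes>\<^sub>M ?U)"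
    by (rule measurable_sets[OF meas]) simp
  have "emeasure ?U (Pair H -` ?X) = ennreal (real (card {u. u < n \<and> real (card (nbrs H s u)) \<le> x}) / real n)" for H
  proof -
    have "{..<n} \<inter> Pair H -` ?X = {u. u < n \<and> real (card (nbrs H s u)) \<le> x}"
      by (auto simp: space_pair_measure sp)
    then show ?thesis
      using assms(3) by (subst emeasure_pmf_of_set) (auto simp: lessThan_empty_iff)
  qed
  then have "emeasure (L \<Otimes>\<^sub>M ?U) ?X =
      (\<integral>\<^sup>+H. ennreal (real (card {u. u < n \<and> real (card (nbrs H s u)) \<le> x}) / real n) \<partial>L)"
    by (subst measure_pmf.emeasure_pair_measure_alt[OF X]) simp
  also have "\<dots> = ennreal (\<integral>H. real (card {u. u < n \<and> real (card (nbrs H s u)) \<le> x}) / real n \<partial>L)"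
  proof (rule nn_integral_eq_integral)
    have "card {u. u < n \<and> real (card (nbrs H s u)) \<le> x} \<le> n" for H
      using card_mono[of "{..<n}" "{u. u < n \<and> real (card (nbrs H s u)) \<le> x}"] by auto
    then show "integrable L (\<lambda>H. real (card {u. u < n \<and> real (card (nbrs H s u)) \<le> x}) / real n)"
      using assms(3) by (intro L.integrable_const_bound[of _ 1] meas_L) (auto simp: divide_le_eq)
  qed simp
  finally have "measure (L \<Otimes>\<^sub>M ?U) ?X = (\<integral>H. real (card {u. u < n \<and> real (card (nbrs H s u)) \<le> x}) / real n \<partial>L)"
    by (simp add: measure_def)
  then show ?cdf
    unfolding cdf_def degree_law_def by (subst measure_distr[OF meas]) auto
qed

lemma cdf_real_law: "cdf (real_law D) x = measure_pmf.prob D {k. real k \<le> x}"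
  unfolding cdf_def real_law_def by (subst measure_distr) (auto simp: vimage_def)

text \<open>The degree counts distinct neighbours, whereas a neighbour list may contain repetitions;
  injectivity at depth one rules these out.\<close>

lemma tree_emb_root_degree:
  assumes "tree_emb nb s (Suc 0) c \<phi>" "set (nb s (\<phi> [])) = nbrs H s (\<phi> [])"
  shows "card (nbrs H s (\<phi> [])) = c []"
proof -
  have inj: "inj_on (\<lambda>x. (even (length x), \<phi> x)) {x \<in> gw_nodes c. length x \<le> Suc 0}"
    and "nb s (\<phi> []) = children c \<phi> []"
    using assms(1) unfolding tree_emb_def by (auto simp: Let_def dest: bspec[of _ _ "[]"])
  then have "nbrs H s (\<phi> []) = (\<lambda>j. \<phi> [j]) ` {..<c []}"
    using assms(2) by (simp add: set_children)
  moreover have "inj_on (\<lambda>j. \<phi> [j]) {..<c []}"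
  proof (rule inj_onI)
    fix i j assume "i \<in> {..<c []}" "j \<in> {..<c []}" "\<phi> [i] = \<phi> [j]"
    then show "i = j"
      using inj_onD[OF inj, of "[i]" "[j]"] by (simp add: gw_nodes_Cons)
  qed
  ultimately show ?thesis
    by (simp add: card_image)
qed

text \<open>\<open>M n\<close> may carry more randomness than the graph, such as a matching, and
  \<open>h n\<close> forgets it. Degrees use trees of depth one and the expected frequency; balls of
  radius \<open>r\<close> use depth \<open>2 * r + 1\<close> and the deviation probabilities of the
  frequency.\<close>

lemma local_limit:
  fixes M :: "nat \<Rightarrow> 'w measure" and h :: "nat \<Rightarrow> 'w \<Rightarrow> (nat, nat) bigraph"
  assumes prob: "\<And>n. prob_space (M n)" and sets: "\<And>n. sets (M n) = UNIV"
    and pos: "\<And>n s. 0 < N n s"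
    and lb: "forest_bound M nb N D"
    and L: "\<And>n. L n = distr (M n) (count_space UNIV) (h n)"
    and graph: "\<And>n. AE \<omega> in M n. part1 (h n \<omega>) = {..<N n True} \<and> part2 (h n \<omega>) = {..<N n False} \<and>
      (\<forall>s u. u < N n s \<longrightarrow> set (nb n \<omega> s u) = nbrs (h n \<omega>) s u)"
  shows "weak_conv_m (\<lambda>n. X1_law (N n True) (L n)) (real_law (D True))"
    and "weak_conv_m (\<lambda>n. X2_law (N n False) (L n)) (real_law (D False))"
    and "local_conv_in_prob TYPE('h) L (\<lambda>_. intersection_graph) (gw_space (D True) (D False)) clique_tree"
proof -
  have sp: "space (M n) = UNIV" for n
    using sets[of n] by (metis UNIV_I sets.sets_into_space top.extremum_uniqueI)
  have meas: "f \<in> measurable (M n) K" if "\<And>\<omega>. f \<omega> \<in> space K" for f :: "'w \<Rightarrow> 'k" and K n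
    using that by (auto simp: measurable_def sets sp)
  have meas_real: "f \<in> borel_measurable (M n)" for f :: "'w \<Rightarrow> real" and n
    by (rule meas) simp
  have hm: "h n \<in> measurable (M n) (count_space UNIV)" for n
    by (rule meas) simp
  have L_prob: "prob_space (L n)" and L_sets: "sets (L n) = UNIV" for n
    unfolding L using prob_space.prob_space_distr[OF prob hm] by auto
  have freq: "0 \<le> real (card {u. u < N n s \<and> B u}) / real (N n s) \<and> real (card {u. u < N n s \<and> B u}) / real (N n s) \<le> 1"
    for n s B
    using card_mono[of "{..<N n s}" "{u. u < N n s \<and> B u}"] pos[of n s] by (auto simp: divide_le_eq)
  have degree: "weak_conv_m (\<lambda>n. degree_law s (N n s) (L n)) (real_law (D s))" for s
    unfolding weak_conv_m_def weak_conv_def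
  proof (intro allI impI)
    fix x :: real
    let ?Q = "{c. real (c []) \<le> x} :: (nat list \<Rightarrow> nat) set"
    let ?A = "\<lambda>n \<omega> u. real (card (nbrs (h n \<omega>) s u)) \<le> x"
    have "(\<lambda>n. \<integral>\<omega>. (real (card {u. u < N n s \<and> ?A n \<omega> u}) / real (N n s)
            - measure (gw_space (D s) (D (\<not> s))) ?Q)\<^sup>2 \<partial>M n) \<longlonglongrightarrow> 0"
    proof (rule exploration_concentration[OF prob sets pos _ lb, of "Suc 0"])
      show "c \<in> ?Q \<longleftrightarrow> c' \<in> ?Q" if "agree (Suc 0) c c'" for c c'
        using that by (auto simp: agree_def)
      show "AE \<omega> in M n. \<forall>c \<phi>. tree_emb (nb n \<omega>) s (Suc 0) c \<phi> \<longrightarrow> \<phi> [] < N n s \<longrightarrow> (?A n \<omega> (\<phi> []) \<longleftrightarrow> c \<in> ?Q)" for n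
        using graph[of n] by eventually_elim (auto simp: tree_emb_root_degree)
    qed simp
    from mean_tendsto_of_variation(1)[OF prob meas_real freq this]
    have "(\<lambda>n. \<integral>\<omega>. real (card {u. u < N n s \<and> ?A n \<omega> u}) / real (N n s) \<partial>M n)
         \<longlonglongrightarrow> measure (gw_space (D s) (D (\<not> s))) ?Q"
      .
    moreover have "cdf (degree_law s (N n s) (L n)) x = (\<integral>\<omega>. real (card {u. u < N n s \<and> ?A n \<omega> u}) / real (N n s) \<partial>M n)" for n
      unfolding cdf_degree_law[OF L_prob L_sets pos] unfolding L
      by (rule integral_distr[OF hm]) simp
    moreover have "measure (gw_space (D s) (D (\<not> s))) ?Q = cdf (real_law (D s)) x"
      unfolding cdf_real_law by (rule measure_gw_root)
    ultimately show "(\<lambda>n. cdf (degree_law s (N n s) (L n)) x) \<longlonglongrightarrow> cdf (real_law (D s)) x"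
      by simp
  qed
  show "weak_conv_m (\<lambda>n. X1_law (N n True) (L n)) (real_law (D True))"
    unfolding X1_law_eq by (rule degree)
  show "weak_conv_m (\<lambda>n. X2_law (N n False) (L n)) (real_law (D False))"
    unfolding X2_law_eq by (rule degree)
  show "local_conv_in_prob TYPE('h) L (\<lambda>_. intersection_graph) (gw_space (D True) (D False)) clique_tree"
    unfolding local_conv_in_prob_def conv_in_prob_def
  proof (intro allI impI)
    fix r and K :: "'h rooted_graph" and \<epsilon> :: real
    assume e: "0 < \<epsilon>"
    let ?R = "Suc (2 * r)"
    let ?Q = "{c. nball r (clique_tree c) [] \<cong>\<^sub>r K}"
    let ?A = "\<lambda>n \<omega> u. nball r (intersection_graph (h n \<omega>)) u \<cong>\<^sub>r K"
    let ?p = "measure (gw_space (D True) (D False)) ?Q"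
    have "(\<lambda>n. \<integral>\<omega>. (real (card {u. u < N n True \<and> ?A n \<omega> u}) / real (N n True)
            - measure (gw_space (D True) (D (\<not> True))) ?Q)\<^sup>2 \<partial>M n) \<longlonglongrightarrow> 0"
    proof (rule exploration_concentration[OF prob sets pos _ lb, of ?R])
      show "c \<in> ?Q \<longleftrightarrow> c' \<in> ?Q" if "agree ?R c c'" for c c'
        using nball_clique_tree_agree[OF that, of r] by simp
      show "AE \<omega> in M n. \<forall>c \<phi>. tree_emb (nb n \<omega>) True ?R c \<phi> \<longrightarrow> \<phi> [] < N n True \<longrightarrow> (?A n \<omega> (\<phi> []) \<longleftrightarrow> c \<in> ?Q)" for n
        using graph[of n]
      proof eventually_elim
        case (elim \<omega>)
        show ?case
        proof (intro allI impI)
          fix c \<phi> assume c: "tree_emb (nb n \<omega>) True ?R c \<phi>" "\<phi> [] < N n True"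
          have iso: "nball r (clique_tree c) [] \<cong>\<^sub>r nball r (intersection_graph (h n \<omega>)) (\<phi> [])"
            by (rule tree_emb_nball[OF c(1) refl]) (use elim c in \<open>auto split: if_splits\<close>)
          moreover have "rroot (nball r (clique_tree c) []) \<in> verts (nball r (clique_tree c) [])"
            by (simp add: nball_clique_tree even_nodes_def del: One_nat_def)
          ultimately have "nball r (intersection_graph (h n \<omega>)) (\<phi> []) \<cong>\<^sub>r nball r (clique_tree c) []"
            by (rule rooted_iso_sym)
          then show "?A n \<omega> (\<phi> []) \<longleftrightarrow> c \<in> ?Q"
            using rooted_iso_trans[OF iso, of K] rooted_iso_trans[of _ "nball r (clique_tree c) []" K] by auto
        qed
      qed
    qed simp
    from mean_tendsto_of_variation(2)[OF prob meas_real freq this e]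
    have "(\<lambda>n. measure (M n) {\<omega> \<in> space (M n). \<epsilon> < \<bar>real (card {u. u < N n True \<and> ?A n \<omega> u}) / real (N n True) - ?p\<bar>}) \<longlonglongrightarrow> 0"
      by simp
    moreover have "measure (L n) {H \<in> space (L n). \<epsilon> < \<bar>ball_frequency r (intersection_graph H) K - c\<bar>}
      = measure (M n) {\<omega> \<in> space (M n). \<epsilon> < \<bar>real (card {u. u < N n True \<and> ?A n \<omega> u}) / real (N n True) - c\<bar>}" for n c
    proof -
      interpret prob_space "M n" by (rule prob)
      have "measure (L n) {H \<in> space (L n). \<epsilon> < \<bar>ball_frequency r (intersection_graph H) K - c\<bar>} =
          measure (M n) {\<omega>. \<epsilon> < \<bar>ball_frequency r (intersection_graph (h n \<omega>)) K - c\<bar>}"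
        unfolding L by (subst measure_distr[OF hm]) (auto simp: sp vimage_def)
      also have "\<dots> = measure (M n) {\<omega>. \<epsilon> < \<bar>real (card {u. u < N n True \<and> ?A n \<omega> u}) / real (N n True) - c\<bar>}"
      proof (rule measure_eq_AE)
        show "AE \<omega> in M n. (\<omega> \<in> {\<omega>. \<epsilon> < \<bar>ball_frequency r (intersection_graph (h n \<omega>)) K - c\<bar>}) \<longleftrightarrow>
          (\<omega> \<in> {\<omega>. \<epsilon> < \<bar>real (card {u. u < N n True \<and> ?A n \<omega> u}) / real (N n True) - c\<bar>})"
          using graph[of n]
        proof eventually_elim
          case (elim \<omega>)
          then have "verts (intersection_graph (h n \<omega>)) = {..<N n True}"
            by (simp add: intersection_graph_def)
          then show ?case
            by (simp add: ball_frequency_def)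
        qed
      qed (auto simp: sets)
      finally show ?thesis by (simp add: sp)
    qed
    ultimately show "(\<lambda>n. measure (L n) {H \<in> space (L n). \<epsilon> < \<bar>ball_frequency r (intersection_graph H) K -
        measure (gw_space (D True) (D False)) {c \<in> space (gw_space (D True) (D False)).
          nball r (clique_tree c) (rroot (clique_tree c)) \<cong>\<^sub>r K}\<bar>}) \<longlonglongrightarrow> 0"
      by simp
  qed
qed

section \<open>Counting injective maps\<close>

text \<open>Greedy choice: each node treated earlier blocks at most \<open>K\<close> options of the
  next one, because at most that many options lead to the same vertex. Truncated subtraction makes
  the bound vacuous when there are too few options.\<close>

lemma card_inj_choices_ge:
  fixes A :: "'x \<Rightarrow> 'a set" and v :: "'x \<Rightarrow> 'a \<Rightarrow> 'v"
  assumes "finite T" "\<And>x. x \<in> T \<Longrightarrow> finite (A x)"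
    "\<And>x w. x \<in> T \<Longrightarrow> card {a \<in> A x. v x a = w} \<le> K" "K * card T \<le> B"
  shows "(\<Prod>x\<in>T. card (A x) - B) \<le> card {\<psi> \<in> PiE T A. inj_on (\<lambda>x. v x (\<psi> x)) T}"
  using assms
proof (induction T rule: finite_induct)
  case empty
  then show ?case by simp
next
  case (insert x T)
  let ?S = "\<lambda>T. {\<psi> \<in> PiE T A. inj_on (\<lambda>x. v x (\<psi> x)) T}"
  let ?C = "\<lambda>\<psi>. {a \<in> A x. v x a \<notin> (\<lambda>y. v y (\<psi> y)) ` T}"
  have fin: "finite (?S T)" "finite (?S (insert x T))"
    by (rule finite_subset[of _ "PiE T A"], blast, intro finite_PiE; use insert.hyps insert.prems(1) in simp)
       (rule finite_subset[of _ "PiE (insert x T) A"], blast, intro finite_PiE; use insert.hyps insert.prems(1) in blast)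
  have finA: "finite (A x)" using insert.prems(1) by simp
  have C: "card (A x) - B \<le> card (?C \<psi>)" for \<psi>
  proof -
    let ?D = "\<Union>y\<in>T. {a \<in> A x. v x a = v y (\<psi> y)}"
    have "card ?D \<le> (\<Sum>y\<in>T. card {a \<in> A x. v x a = v y (\<psi> y)})"
      using insert.hyps by (intro card_UN_le) auto
    also have "\<dots> \<le> (\<Sum>y\<in>T. K)"
      using insert.prems(2) by (intro sum_mono) auto
    also have "\<dots> \<le> B"
      using insert.prems(3) insert.hyps by (simp add: mult.commute)
    finally have "card ?D \<le> B" .
    moreover have "?C \<psi> = A x - ?D"
      by auto
    moreover have "card (A x) - card ?D \<le> card (A x - ?D)"
      by (rule diff_card_le_card_Diff) (use finA insert.hyps in auto)
    ultimately show ?thesis by simp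
  qed
  have "(\<Prod>y\<in>insert x T. card (A y) - B) = (card (A x) - B) * (\<Prod>y\<in>T. card (A y) - B)"
    using insert.hyps by simp
  also have "\<dots> \<le> (card (A x) - B) * card (?S T)"
    using insert by (intro mult_left_mono) auto
  also have "\<dots> = (\<Sum>\<psi>\<in>?S T. card (A x) - B)"
    by simp
  also have "\<dots> \<le> (\<Sum>\<psi>\<in>?S T. card (?C \<psi>))"
    by (intro sum_mono C)
  also have "\<dots> = card (SIGMA \<psi>:?S T. ?C \<psi>)"
    using fin(1) finA by (intro card_SigmaI[symmetric]) auto
  also have "\<dots> \<le> card (?S (insert x T))"
  proof (rule card_inj_on_le[where f = "\<lambda>(\<psi>, a). \<psi>(x := a)"])
    show "inj_on (\<lambda>(\<psi>, a). \<psi>(x := a)) (SIGMA \<psi>:?S T. ?C \<psi>)"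
    proof (rule inj_onI, clarify)
      fix \<psi> a \<psi>' a'
      assume p: "\<psi> \<in> PiE T A" "\<psi>' \<in> PiE T A" and eq: "\<psi>(x := a) = \<psi>'(x := a')"
      have "\<psi> y = \<psi>' y" if "y \<in> T" for y
        using fun_cong[OF eq, of y] that insert.hyps by (auto split: if_splits)
      then show "\<psi> = \<psi>' \<and> a = a'"
        using p fun_cong[OF eq, of x] by (auto intro: PiE_ext)
    qed
    show "(\<lambda>(\<psi>, a). \<psi>(x := a)) ` (SIGMA \<psi>:?S T. ?C \<psi>) \<subseteq> ?S (insert x T)"
    proof (rule image_subsetI, clarify)
      fix \<psi> a
      assume p: "\<psi> \<in> PiE T A" "inj_on (\<lambda>x. v x (\<psi> x)) T" "a \<in> A x" "v x a \<notin> (\<lambda>y. v y (\<psi> y)) ` T"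
      have "\<psi>(x := a) \<in> PiE (insert x T) A"
        using p by (intro PiE_fun_upd) auto
      moreover have "inj_on (\<lambda>y. v y ((\<psi>(x := a)) y)) (insert x T)"
      proof -
        have "inj_on (\<lambda>y. v y ((\<psi>(x := a)) y)) T = inj_on (\<lambda>x. v x (\<psi> x)) T"
          using insert.hyps by (intro inj_on_cong) auto
        moreover have "(\<lambda>y. v y ((\<psi>(x := a)) y)) ` (T - {x}) = (\<lambda>y. v y (\<psi> y)) ` T"
          using insert.hyps by (intro image_cong) auto
        ultimately show ?thesis
          using p by (simp add: inj_on_insert)
      qed
      ultimately show "\<psi>(x := a) \<in> PiE (insert x T) A \<and> inj_on (\<lambda>y. v y ((\<psi>(x := a)) y)) (insert x T)"
        by blast
    qed
  qed (rule fin(2))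
  finally show ?case .
qed

lemma tendsto_diff_ratio:
  assumes "filterlim N at_top sequentially"
  shows "(\<lambda>n. real (N n - k) / real (N n)) \<longlonglongrightarrow> 1"
proof -
  have N: "filterlim (\<lambda>n. real (N n)) at_top sequentially"
    using assms by (rule filterlim_compose[OF filterlim_real_sequentially])
  have "(\<lambda>n. real k / real (N n)) \<longlonglongrightarrow> 0"
    by (rule real_tendsto_divide_at_top[OF tendsto_const N])
  then have "(\<lambda>n. 1 - real k / real (N n)) \<longlonglongrightarrow> 1 - 0"
    by (intro tendsto_diff tendsto_const)
  moreover have "\<forall>\<^sub>F n in sequentially. real (N n - k) / real (N n) = 1 - real k / real (N n)"
    using filterlim_at_top[THEN iffD1, OF assms, rule_format, of "Suc k"]
    by eventually_elim (auto simp: of_nat_diff field_simps)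
  ultimately show ?thesis
    by (simp add: tendsto_cong)
qed

section \<open>Exchangeable bipartite graphs\<close>

text \<open>What is kept of a forest once its placement is fixed: the sides \<open>sd\<close>, the
  symmetric neighbour relation \<open>nb\<close>, inner nodes \<open>I\<close> whose neighbourhoods
  are prescribed completely, and leaves attached to a single inner node.\<close>

locale pattern =
  fixes T I :: "nat list set" and nb :: "nat list \<Rightarrow> nat list set" and sd :: "nat list \<Rightarrow> bool"
  assumes fin: "finite T" and IT: "I \<subseteq> T"
    and nb_T: "\<And>x. x \<in> T \<Longrightarrow> nb x \<subseteq> T"
    and nb_sym: "\<And>x y. x \<in> T \<Longrightarrow> y \<in> nb x \<Longrightarrow> x \<in> nb y"
    and nb_side: "\<And>x y. x \<in> T \<Longrightarrow> y \<in> nb x \<Longrightarrow> sd y \<longleftrightarrow> \<not> sd x"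
    and leaf: "\<And>x. x \<in> T - I \<Longrightarrow> \<exists>y\<in>I. nb x = {y}"
begin

definition edges :: nat where
  "edges = (\<Sum>x\<in>{x \<in> T. sd x}. card (nb x))"

text \<open>Target for the probability of an exact placement times the \<open>edges\<close>-th power
  of the number of graph edges. The factorial at an inner node counts the orders in which its edges
  can be assigned; the degree of a leaf is free, so the sum of \<open>k\<close> times the
  probability of \<open>k\<close> replaces a single term.\<close>

definition weight :: "(bool \<Rightarrow> nat pmf) \<Rightarrow> real" where
  "weight D = (\<Prod>x\<in>I. fact (card (nb x)) * pmf (D (sd x)) (card (nb x))) * (\<Prod>x\<in>T - I. mean (D (sd x)))"

definition exact :: "(nat, nat) bigraph \<Rightarrow> (nat list \<Rightarrow> nat) \<Rightarrow> bool" where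
  "exact H \<phi> \<longleftrightarrow> (\<forall>x\<in>I. nbrs H (sd x) (\<phi> x) = \<phi> ` nb x)"

definition admissible :: "(bool \<Rightarrow> nat) \<Rightarrow> (nat list \<Rightarrow> nat) \<Rightarrow> bool" where
  "admissible N \<phi> \<longleftrightarrow> (\<forall>x\<in>T. \<phi> x < N (sd x)) \<and> inj_on (\<lambda>x. (sd x, \<phi> x)) T"

lemma finite_nb: "x \<in> T \<Longrightarrow> finite (nb x)"
  using nb_T fin finite_subset by blast

text \<open>Each edge has one end on either side, so it may be counted from either end.\<close>

lemma edges_eq: "edges = (\<Sum>x\<in>{x \<in> T. \<not> sd x}. card (nb x))"
proof -
  have "edges = card (SIGMA x:{x \<in> T. sd x}. nb x)"
    unfolding edges_def using fin finite_nb by (intro card_SigmaI[symmetric]) auto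
  also have "\<dots> = card (prod.swap ` (SIGMA x:{x \<in> T. sd x}. nb x))"
    by (simp add: card_image)
  also have swap: "prod.swap ` (SIGMA x:{x \<in> T. sd x}. nb x) = (SIGMA x:{x \<in> T. \<not> sd x}. nb x)"
  proof -
    have "x \<in> T \<and> sd x \<and> y \<in> nb x \<longleftrightarrow> y \<in> T \<and> \<not> sd y \<and> x \<in> nb y" for x y
      using nb_T nb_sym nb_side by blast
    then show ?thesis
      by (auto simp: set_eq_iff simp del: swap_simp)
  qed
  also have "card (SIGMA x:{x \<in> T. \<not> sd x}. nb x) = (\<Sum>x\<in>{x \<in> T. \<not> sd x}. card (nb x))"
    using fin finite_nb by (intro card_SigmaI) auto
  finally show ?thesis .
qed

end

text \<open>
  The numbers of edges of the graphs are asymptotic to \<open>N n True * mean (D True)\<close>.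
\<close>
definition pattern_bound ::
  "(nat \<Rightarrow> (nat, nat) bigraph measure) \<Rightarrow> (nat \<Rightarrow> bool \<Rightarrow> nat) \<Rightarrow> (bool \<Rightarrow> nat pmf) \<Rightarrow> bool" where
  "pattern_bound L N D \<longleftrightarrow>
     (\<forall>T I nb sd. pattern T I nb sd \<longrightarrow> (\<forall>a < pattern.weight T I nb sd D.
        \<forall>\<^sub>F n in sequentially. \<forall>\<phi>. pattern.admissible T sd (N n) \<phi> \<longrightarrow>
          a < measure (L n) {H. pattern.exact I nb sd H \<phi>} *
              (real (N n True) * mean (D True)) ^ pattern.edges T nb sd))"

lemma pmf_offspring:
  assumes "has_pos_finite_mean D1" "has_pos_finite_mean D2"
  shows "pmf (offspring_law D1 D2 g) k =
    (if g = 0 then pmf D1 k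
     else real (Suc k) * pmf (if odd g then D2 else D1) (Suc k) / mean (if odd g then D2 else D1))"
proof -
  have "pmf (map_pmf (\<lambda>k. k - 1) (size_biased Z)) k = real (Suc k) * pmf Z (Suc k) / mean Z"
    if "has_pos_finite_mean Z" for Z
  proof -
    \<comment> \<open>Truncated subtraction sends both zero and one to zero, but the size-biased law
      has no mass at zero.\<close>
    have "(\<lambda>k. k - 1) -` {k} = (if k = 0 then {0, 1} else {Suc k})"
      by auto
    then show ?thesis
      using that by (simp add: pmf_map measure_measure_pmf_finite pmf_size_biased)
  qed
  then show ?thesis
    using assms by (simp add: offspring_law_def)
qed

section \<open>Forests as patterns, and the factor lost by sorting siblings\<close>

context
  fixes R :: nat and c :: "nat list \<Rightarrow> nat" and s :: bool
  assumes R: "0 < R" and c2: "c [] = 2"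
begin

abbreviation (input) "FT \<equiv> forest_nodes R c"
abbreviation (input) "FI \<equiv> forest_inner R c"
abbreviation (input) "fnb x \<equiv> {y \<in> FT. tree_adj x y}"
abbreviation (input) "fsd x \<equiv> (s = odd (length x))"

lemma forest_inner_subset: "FI \<subseteq> FT"
  by (auto simp: forest_inner_def forest_nodes_def)

lemma child_in_forest: "x \<in> FI \<Longrightarrow> x @ [j] \<in> FT \<longleftrightarrow> j < c x"
  by (auto simp: forest_inner_def forest_nodes_def)

lemma parent_in_forest: "x \<in> FT \<Longrightarrow> length x \<noteq> 1 \<Longrightarrow> butlast x \<in> FI"
  by (cases x rule: rev_cases) (auto simp: forest_inner_def forest_nodes_def)

lemma fnb_inner:
  assumes "x \<in> FI"
  shows "fnb x = (\<lambda>j. x @ [j]) ` {..<c x} \<union> (if length x = 1 then {} else {butlast x})"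
proof -
  have x: "x \<in> gw_nodes c" "x \<noteq> []" "length x \<le> R"
    using assms by (auto simp: forest_inner_def)
  have "fnb x = {y \<in> gw_nodes c. tree_adj x y} - {[]}"
    using x by (auto simp: forest_nodes_def dest: tree_adj_length)
  also have "\<dots> = (\<lambda>j. x @ [j]) ` {..<c x} \<union> (if length x = 1 then {} else {butlast x})"
    unfolding tree_adj_nodes[OF x(1)] using x(2) by (cases x rule: rev_cases) auto
  finally show ?thesis .
qed

lemma card_fnb_inner:
  assumes "x \<in> FI"
  shows "card (fnb x) = (if length x = 1 then c x else Suc (c x))"
proof -
  have "butlast x \<notin> (\<lambda>j. x @ [j]) ` {..<c x}"
  proof
    assume "butlast x \<in> (\<lambda>j. x @ [j]) ` {..<c x}"
    then obtain j where "butlast x = x @ [j]" by blast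
    then have "length (butlast x) = length (x @ [j])" by (rule arg_cong)
    then show False by simp
  qed
  moreover have "card ((\<lambda>j. x @ [j]) ` {..<c x}) = c x"
    by (subst card_image) (auto simp: inj_on_def)
  ultimately show ?thesis
    unfolding fnb_inner[OF assms] by (auto simp: card_Un_disjoint)
qed

lemma fnb_leaf:
  assumes "x \<in> FT - FI"
  shows "fnb x = {butlast x}" "butlast x \<in> FI" "length x \<noteq> 1"
proof -
  have x: "x \<in> gw_nodes c" "x \<noteq> []" "length x = Suc R"
    using assms by (auto simp: forest_inner_def forest_nodes_def)
  then show l: "length x \<noteq> 1" using R by simp
  have "x \<in> FT" using assms by simp
  then show b: "butlast x \<in> FI"
    using l by (rule parent_in_forest)
  have "fnb x \<subseteq> {y \<in> gw_nodes c. tree_adj x y} - (\<lambda>j. x @ [j]) ` {..<c x}"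
    using x by (auto simp: forest_nodes_def)
  also have "\<dots> \<subseteq> {butlast x}"
    unfolding tree_adj_nodes[OF x(1)] using x by auto
  finally have "fnb x \<subseteq> {butlast x}" .
  moreover have "butlast x \<in> fnb x"
    using b forest_inner_subset x(2) unfolding tree_adj_def by (auto intro!: exI[of _ "last x"])
  ultimately show "fnb x = {butlast x}" by auto
qed

lemma forest_pattern: "pattern FT FI (\<lambda>x. fnb x) (\<lambda>x. fsd x)"
proof
  show "finite FT" by (rule finite_forest_nodes)
  show "FI \<subseteq> FT" by (rule forest_inner_subset)
  show "x \<in> fnb y" if "x \<in> FT" "y \<in> fnb x" for x y
    using that tree_adj_sym by auto
  show "fsd y \<longleftrightarrow> \<not> fsd x" if "y \<in> fnb x" for x y
    using that by (auto dest: tree_adj_length)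
  show "\<exists>y\<in>FI. fnb x = {y}" if "x \<in> FT - FI" for x
    using fnb_leaf[OF that] by blast
qed auto

text \<open>An edge corresponds to its deeper end, and every node except the two roots is the deeper
  end of exactly one edge.\<close>

lemma forest_edges: "pattern.edges FT (\<lambda>x. fnb x) (\<lambda>x. fsd x) = card {x \<in> FT. length x \<noteq> 1}"
proof -
  interpret pattern FT FI "\<lambda>x. fnb x" "\<lambda>x. fsd x" by (rule forest_pattern)
  have "edges = card (SIGMA x:{x \<in> FT. fsd x}. fnb x)"
    unfolding edges_def using fin by (intro card_SigmaI[symmetric]) auto
  also have "\<dots> = card {x \<in> FT. length x \<noteq> 1}"
  proof (rule bij_betw_same_card)
    show "bij_betw (\<lambda>(x, y). if length x < length y then y else x)
      (SIGMA x:{x \<in> FT. fsd x}. fnb x) {x \<in> FT. length x \<noteq> 1}"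
    proof (rule bij_betwI[of _ _ _ "\<lambda>z. if fsd z then (z, butlast z) else (butlast z, z)"])
      have len: "length x \<noteq> 0" if "x \<in> FT" for x
        using that by (auto simp: forest_nodes_def)
      show "(\<lambda>(x, y). if length x < length y then y else x)
        \<in> (SIGMA x:{x \<in> FT. fsd x}. fnb x) \<rightarrow> {x \<in> FT. length x \<noteq> 1}"
        using len by (fastforce dest: tree_adj_length)
      have p: "butlast z \<in> FT" "length z = Suc (length (butlast z))" "tree_adj z (butlast z)" "tree_adj (butlast z) z"
        if z: "z \<in> FT" "length z \<noteq> 1" for z
      proof -
        show "butlast z \<in> FT"
          using parent_in_forest[OF z] forest_inner_subset by blast
        show "length z = Suc (length (butlast z))"
          using len[OF z(1)] by simp
        have "z = butlast z @ [last z]"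
          using len[OF z(1)] by simp
        then show "tree_adj z (butlast z)" "tree_adj (butlast z) z"
          unfolding tree_adj_def by metis+
      qed
      show "(\<lambda>z. if fsd z then (z, butlast z) else (butlast z, z))
        \<in> {x \<in> FT. length x \<noteq> 1} \<rightarrow> (SIGMA x:{x \<in> FT. fsd x}. fnb x)"
        using p by fastforce
      fix z assume "z \<in> {x \<in> FT. length x \<noteq> 1}"
      then show "(case if fsd z then (z, butlast z) else (butlast z, z) of
          (x, y) \<Rightarrow> if length x < length y then y else x) = z"
        using p(2)[of z] by auto
    next
      fix xy assume "xy \<in> (SIGMA x:{x \<in> FT. fsd x}. fnb x)"
      then obtain x y where [simp]: "xy = (x, y)" and xy: "x \<in> FT" "fsd x" "y \<in> FT" "tree_adj x y"
        by auto
      from xy(4) consider j where "y = x @ [j]" | j where "x = y @ [j]"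
        by (auto simp: tree_adj_def)
      then show "(if fsd (case xy of (x, y) \<Rightarrow> if length x < length y then y else x)
          then (case xy of (x, y) \<Rightarrow> if length x < length y then y else x,
            butlast (case xy of (x, y) \<Rightarrow> if length x < length y then y else x))
          else (butlast (case xy of (x, y) \<Rightarrow> if length x < length y then y else x),
            case xy of (x, y) \<Rightarrow> if length x < length y then y else x)) = xy"
        using xy by cases auto
    qed
  qed
  finally show ?thesis .
qed

text \<open>Neighbour lists in the simple models are sorted, so an exact placement is an embedding
  only if siblings are placed in increasing order.\<close>

definition sorted_maps :: "(bool \<Rightarrow> nat) \<Rightarrow> (nat list \<Rightarrow> nat) set" where
  "sorted_maps N = {\<phi> \<in> forest_maps N s R c.
     inj_on (\<lambda>x. (odd (length x), \<phi> x)) FT \<and> (\<forall>x\<in>FI. sorted (children c \<phi> x))}"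

text \<open>Vertices are permuted within each group of siblings, by position; subtrees are not
  carried along, so the groups are sorted independently of one another.\<close>

definition sort_map :: "(nat list \<Rightarrow> nat) \<Rightarrow> nat list \<Rightarrow> nat" where
  "sort_map \<phi> = (\<lambda>x\<in>FT. if length x = 1 then \<phi> x else sort (children c \<phi> (butlast x)) ! last x)"

lemma distinct_children:
  assumes "inj_on (\<lambda>x. (odd (length x), \<phi> x)) FT" "x \<in> FI"
  shows "distinct (children c \<phi> x)"
  unfolding children_def distinct_map
proof (intro conjI inj_onI)
  fix i j assume "i \<in> set [0..<c x]" "j \<in> set [0..<c x]" "\<phi> (x @ [i]) = \<phi> (x @ [j])"
  then show "i = j"
    using inj_onD[OF assms(1), of "x @ [i]" "x @ [j]"] child_in_forest[OF assms(2)] by auto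
qed simp

lemma children_sort_map:
  assumes "x \<in> FI"
  shows "children c (sort_map \<phi>) x = sort (children c \<phi> x)"
proof (rule nth_equalityI)
  fix j assume "j < length (children c (sort_map \<phi>) x)"
  then have "j < c x" by simp
  then show "children c (sort_map \<phi>) x ! j = sort (children c \<phi> x) ! j"
    using child_in_forest[OF assms, of j] assms
    by (auto simp: nth_children sort_map_def forest_inner_def)
qed simp

lemma sort_map_sibling:
  assumes "x \<in> FT"
  obtains y where "y \<in> FT" "length y = length x" "butlast y = butlast x" "sort_map \<phi> x = \<phi> y"
    "length x = 1 \<Longrightarrow> y = x"
proof (cases "length x = 1")
  case True
  then show thesis
    using that[of x] assms by (simp add: sort_map_def)
next
  case False
  have "x \<noteq> []" using assms by (auto simp: forest_nodes_def)
  then obtain z j where x: "x = z @ [j]" by (cases x rule: rev_cases) auto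
  have z: "z \<in> FI" "j < c z"
    using parent_in_forest[OF assms False] child_in_forest[of z j] assms x by auto
  have "sort_map \<phi> x = sort (children c \<phi> z) ! j"
    using False assms x by (simp add: sort_map_def)
  also have "\<dots> \<in> set (children c \<phi> z)"
    using z(2) by (metis length_children length_sort nth_mem set_sort)
  finally obtain i where "i < c z" "sort_map \<phi> x = \<phi> (z @ [i])"
    by (auto simp: set_children)
  then show thesis
    using that[of "z @ [i]"] child_in_forest[OF z(1)] x False by auto
qed

lemma sort_map_in:
  assumes "\<phi> \<in> forest_maps N s R c" and inj: "inj_on (\<lambda>x. (odd (length x), \<phi> x)) FT"
  shows "sort_map \<phi> \<in> sorted_maps N"
proof -
  have "sort_map \<phi> x < N (fsd x)" if x: "x \<in> FT" for x
  proof -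
    obtain y where "y \<in> FT" "length y = length x" "sort_map \<phi> x = \<phi> y"
      using sort_map_sibling[OF x] by metis
    then show ?thesis
      using assms(1) PiE_mem[of \<phi> FT "\<lambda>x. {..<N (fsd x)}" y] by (auto simp: forest_maps_def)
  qed
  then have "sort_map \<phi> \<in> forest_maps N s R c"
    unfolding forest_maps_def by (auto simp: sort_map_def)
  moreover have "inj_on (\<lambda>x. (odd (length x), sort_map \<phi> x)) FT"
  proof (rule inj_onI)
    fix x y assume x: "x \<in> FT" and y: "y \<in> FT"
      and eq: "(odd (length x), sort_map \<phi> x) = (odd (length y), sort_map \<phi> y)"
    obtain x' where x': "x' \<in> FT" "length x' = length x" "butlast x' = butlast x"
      "sort_map \<phi> x = \<phi> x'" "length x = 1 \<Longrightarrow> x' = x"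
      using sort_map_sibling[OF x] by metis
    obtain y' where y': "y' \<in> FT" "length y' = length y" "butlast y' = butlast y"
      "sort_map \<phi> y = \<phi> y'" "length y = 1 \<Longrightarrow> y' = y"
      using sort_map_sibling[OF y] by metis
    have same: "x' = y'"
      using inj_onD[OF inj, of x' y'] x' y' eq by auto
    show "x = y"
    proof (cases "length x = 1")
      case True
      then show ?thesis using same x' y' by simp
    next
      case False
      have ne: "x \<noteq> []" "y \<noteq> []"
        using x y by (auto simp: forest_nodes_def)
      define z where "z = butlast x"
      have xz: "x = z @ [last x]" and yz: "y = z @ [last y]"
        using ne same x' y' by (auto simp: z_def) (metis append_butlast_last_id)
      have z: "z \<in> FI"
        unfolding z_def by (rule parent_in_forest[OF x False])
      have l: "last x < c z" "last y < c z"
        using child_in_forest[OF z] x y xz yz by metis+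
      have "length y \<noteq> 1" using same x' y' False by simp
      then have "sort (children c \<phi> z) ! last x = sort (children c \<phi> z) ! last y"
        using eq False x y same x' y' by (auto simp: sort_map_def z_def)
      moreover have "distinct (sort (children c \<phi> z))"
        using distinct_children[OF inj z] by simp
      ultimately have "last x = last y"
        using l by (simp add: nth_eq_iff_index_eq)
      then show ?thesis using xz yz by simp
    qed
  qed
  ultimately show ?thesis
    unfolding sorted_maps_def using children_sort_map by auto
qed

text \<open>An injective placement is recovered from its sorted form together with the original
  order of every sibling group, so sorting is at most \<open>fact (c x)\<close> to one at each inner
  node. The left side counts injective placements by the greedy bound.\<close>

lemma card_sorted_maps:
  "(\<Prod>x\<in>FT. N (fsd x) - card FT) \<le> (\<Prod>x\<in>FI. fact (c x)) * card (sorted_maps N)"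
proof -
  let ?A = "{\<phi> \<in> forest_maps N s R c. inj_on (\<lambda>x. (odd (length x), \<phi> x)) FT}"
  let ?P = "\<lambda>\<psi>. PiE FI (\<lambda>x. permutations_of_set (set (children c \<psi> x)))"
  have fin: "finite (forest_maps N s R c)"
    unfolding forest_maps_def by (intro finite_PiE finite_forest_nodes) auto
  then have fin_s: "finite (sorted_maps N)"
    by (rule finite_subset[rotated]) (auto simp: sorted_maps_def)
  have fin_P: "finite (?P \<psi>)" for \<psi>
    by (intro finite_PiE finite_forest_inner) auto
  have "(\<Prod>x\<in>FT. card {..<N (fsd x)} - card FT) \<le> card ?A"
    unfolding forest_maps_def
  proof (rule card_inj_choices_ge[where K = 1])
    show "card {a \<in> {..<N (fsd x)}. (odd (length x), a) = w} \<le> 1" for x w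
      by (rule card_le_Suc0_iff_eq[THEN iffD2, unfolded One_nat_def[symmetric]]) auto
  qed (auto intro: finite_forest_nodes)
  also have "card ?A \<le> card (SIGMA \<psi>:sorted_maps N. ?P \<psi>)"
  proof (rule card_inj_on_le[where f = "\<lambda>\<phi>. (sort_map \<phi>, \<lambda>x\<in>FI. children c \<phi> x)"])
    show "finite (SIGMA \<psi>:sorted_maps N. ?P \<psi>)"
      using fin_s fin_P by auto
    show "(\<lambda>\<phi>. (sort_map \<phi>, \<lambda>x\<in>FI. children c \<phi> x)) ` ?A \<subseteq> (SIGMA \<psi>:sorted_maps N. ?P \<psi>)"
    proof (rule image_subsetI)
      fix \<phi> assume \<phi>: "\<phi> \<in> ?A"
      have "children c \<phi> x \<in> permutations_of_set (set (children c (sort_map \<phi>) x))" if "x \<in> FI" for x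
        using distinct_children[of \<phi> x] \<phi> that children_sort_map[OF that, of \<phi>]
        by (auto intro: permutations_of_setI)
      then show "(sort_map \<phi>, \<lambda>x\<in>FI. children c \<phi> x) \<in> (SIGMA \<psi>:sorted_maps N. ?P \<psi>)"
        using sort_map_in[of \<phi> N] \<phi> by auto
    qed
    show "inj_on (\<lambda>\<phi>. (sort_map \<phi>, \<lambda>x\<in>FI. children c \<phi> x)) ?A"
    proof (rule inj_onI)
      fix \<phi> \<psi> assume p: "\<phi> \<in> ?A" "\<psi> \<in> ?A"
        and eq: "(sort_map \<phi>, \<lambda>x\<in>FI. children c \<phi> x) = (sort_map \<psi>, \<lambda>x\<in>FI. children c \<psi> x)"
      have "\<phi> x = \<psi> x" if x: "x \<in> FT" for x
      proof (cases "length x = 1")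
        case True
        then show ?thesis
          using fun_cong[OF arg_cong[OF eq, of fst], of x] x by (simp add: sort_map_def)
      next
        case False
        have ne: "x \<noteq> []" using x by (auto simp: forest_nodes_def)
        have z: "butlast x \<in> FI" by (rule parent_in_forest[OF x False])
        then have "children c \<phi> (butlast x) = children c \<psi> (butlast x)"
          using fun_cong[OF arg_cong[OF eq, of snd], of "butlast x"] by simp
        moreover have "last x < c (butlast x)"
          using child_in_forest[OF z, of "last x"] x ne by simp
        ultimately show ?thesis
          using ne nth_children[of "last x" c "butlast x"] by (metis append_butlast_last_id)
      qed
      then show "\<phi> = \<psi>"
        using p by (intro PiE_ext[where k = FT]) (auto simp: forest_maps_def)
    qed
  qed
  also have "\<dots> = (\<Sum>\<psi>\<in>sorted_maps N. card (?P \<psi>))"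
    using fin_s fin_P by (intro card_SigmaI) auto
  also have "\<dots> = (\<Sum>\<psi>\<in>sorted_maps N. \<Prod>x\<in>FI. fact (c x))"
  proof (intro sum.cong refl)
    fix \<psi> assume "\<psi> \<in> sorted_maps N"
    then have "distinct (children c \<psi> x)" if "x \<in> FI" for x
      using distinct_children[of \<psi> x] that by (auto simp: sorted_maps_def)
    then show "card (?P \<psi>) = (\<Prod>x\<in>FI. fact (c x))"
      by (subst card_PiE) (auto intro!: finite_forest_inner prod.cong simp: distinct_card)
  qed
  finally show ?thesis
    by (simp add: mult.commute)
qed

text \<open>At an inner node below a root, the neighbours of the image are the parent and the
  children, all distinct; deleting the parent from the sorted list leaves the children, which are
  already in order.\<close>

lemma sorted_exact_imp_forest_emb:
  assumes "\<phi> \<in> sorted_maps N" "pattern.exact FI (\<lambda>x. fnb x) (\<lambda>x. fsd x) H \<phi>"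
  shows "forest_emb (\<lambda>s u. sorted_list_of_set (nbrs H s u)) s R c \<phi>"
proof -
  interpret pattern FT FI "\<lambda>x. fnb x" "\<lambda>x. fsd x" by (rule forest_pattern)
  have inj: "inj_on (\<lambda>x. (odd (length x), \<phi> x)) FT" and srt: "\<And>x. x \<in> FI \<Longrightarrow> sorted (children c \<phi> x)"
    using assms(1) by (auto simp: sorted_maps_def)
  have step: "let l = sorted_list_of_set (nbrs H (fsd x) (\<phi> x))
         in if length x = 1 then l = children c \<phi> x
            else \<phi> (butlast x) \<in> set l \<and> remove1 (\<phi> (butlast x)) l = children c \<phi> x"
    if x: "x \<in> FI" for x
  proof -
    have N: "nbrs H (fsd x) (\<phi> x) = set (children c \<phi> x) \<union> (if length x = 1 then {} else {\<phi> (butlast x)})"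
    proof -
      have "nbrs H (fsd x) (\<phi> x) = \<phi> ` fnb x"
        using assms(2) x unfolding exact_def by blast
      then show ?thesis
        unfolding fnb_inner[OF x] by (auto simp: set_children)
    qed
    have L: "sorted_list_of_set (set (children c \<phi> x)) = children c \<phi> x"
      using srt[OF x] distinct_children[OF inj x]
      by (simp add: sorted_list_of_set_sort_remdups distinct_remdups_id sorted_sort_id)
    show ?thesis
    proof (cases "length x = 1")
      case False
      have xT: "x \<in> FT" using x forest_inner_subset by blast
      have "butlast x \<in> FT"
        using parent_in_forest[OF xT False] forest_inner_subset by blast
      have "\<phi> (butlast x) \<notin> set (children c \<phi> x)"
      proof
        assume "\<phi> (butlast x) \<in> set (children c \<phi> x)"
        then obtain j where j: "j < c x" "\<phi> (butlast x) = \<phi> (x @ [j])"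
          by (auto simp: set_children)
        have "x \<noteq> []" using x by (auto simp: forest_inner_def)
        then have "butlast x = x @ [j]"
          using inj_onD[OF inj, of "butlast x" "x @ [j]"] j child_in_forest[OF x] \<open>butlast x \<in> FT\<close>
          by (auto simp: even_diff_nat)
        then have "length (butlast x) = length (x @ [j])" by simp
        then show False by simp
      qed
      then have "remove1 (\<phi> (butlast x)) (sorted_list_of_set (insert (\<phi> (butlast x)) (set (children c \<phi> x)))) = children c \<phi> x"
        using L by (subst sorted_list_of_set_remove[symmetric]) auto
      then show ?thesis
        using False unfolding N by (simp add: Let_def set_insort_key)
    qed (use N L in \<open>simp add: Let_def\<close>)
  qed
  then show ?thesis
    unfolding forest_emb_def using inj by blast
qed

text \<open>At an inner node other than a root, dividing \<open>fact (Suc k)\<close> by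
  \<open>fact k\<close> and by the mean turns the weight into a size-biased probability. The mean
  contributed by a leaf cancels the reciprocal mean at the same leaf, so the last product may run
  over all nodes that are not roots.\<close>

lemma prod_offspring_eq:
  assumes D: "\<And>b. has_pos_finite_mean (D b)"
  shows "(\<Prod>x\<in>FI. pmf (offspring_law (D s) (D (\<not> s)) (length x - 1)) (c x)) =
    pattern.weight FT FI (\<lambda>x. fnb x) (\<lambda>x. fsd x) D / (\<Prod>x\<in>FI. fact (c x)) *
    (\<Prod>x\<in>{x \<in> FT. length x \<noteq> 1}. 1 / mean (D (fsd x)))"
proof -
  interpret pattern FT FI "\<lambda>x. fnb x" "\<lambda>x. fsd x" by (rule forest_pattern)
  let ?w = "\<lambda>x. fact (card (fnb x)) * pmf (D (fsd x)) (card (fnb x))"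
  let ?m = "\<lambda>x. mean (D (fsd x))"
  have m: "?m x > 0" for x
    using D by (auto simp: has_pos_finite_mean_def)
  have "pmf (offspring_law (D s) (D (\<not> s)) (length x - 1)) (c x) =
      ?w x / fact (c x) * (if length x = 1 then 1 else 1 / ?m x)" if x: "x \<in> FI" for x
  proof (cases "length x = 1")
    case True
    then show ?thesis
      using pmf_offspring[OF D D] card_fnb_inner[OF x] by simp
  next
    case False
    then have "length x > 1" using x by (cases "length x") (auto simp: forest_inner_def)
    then have "fsd x \<longleftrightarrow> (if odd (length x - 1) then \<not> s else s)" "length x - 1 \<noteq> 0"
      by auto
    then have "D (fsd x) = (if odd (length x - 1) then D (\<not> s) else D s)" "length x - 1 \<noteq> 0"
      by auto
    then show ?thesis
      using False pmf_offspring[OF D D, of s "\<not> s" "length x - 1" "c x"] card_fnb_inner[OF x]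
      by (simp add: field_simps del: of_nat_Suc)
  qed
  then have "(\<Prod>x\<in>FI. pmf (offspring_law (D s) (D (\<not> s)) (length x - 1)) (c x)) =
      (\<Prod>x\<in>FI. ?w x) / (\<Prod>x\<in>FI. fact (c x)) * (\<Prod>x\<in>FI. if length x = 1 then 1 else 1 / ?m x)"
    by (simp add: prod.distrib prod_dividef)
  also have "(\<Prod>x\<in>FI. if length x = 1 then 1 else 1 / ?m x) = (\<Prod>x\<in>{x \<in> FI. length x \<noteq> 1}. 1 / ?m x)"
    by (rule prod.mono_neutral_cong_right) (auto intro: finite_forest_inner)
  also have "\<dots> = (\<Prod>x\<in>FT - FI. ?m x) * (\<Prod>x\<in>{x \<in> FT. length x \<noteq> 1}. 1 / ?m x)"
  proof -
    have "{x \<in> FT. length x \<noteq> 1} = {x \<in> FI. length x \<noteq> 1} \<union> (FT - FI)"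
      using fnb_leaf(3) forest_inner_subset by auto
    then have "(\<Prod>x\<in>{x \<in> FT. length x \<noteq> 1}. 1 / ?m x) =
        (\<Prod>x\<in>{x \<in> FI. length x \<noteq> 1}. 1 / ?m x) * (\<Prod>x\<in>FT - FI. 1 / ?m x)"
      using fin finite_forest_inner by (simp only:) (rule prod.union_disjoint, auto)
    moreover have "(\<Prod>x\<in>FT - FI. ?m x) * (\<Prod>x\<in>FT - FI. 1 / ?m x) = 1"
      unfolding prod.distrib[symmetric] using m by (intro prod.neutral) (auto simp: less_le)
    ultimately show ?thesis
      by (simp add: mult.assoc mult.left_commute)
  qed
  finally show ?thesis
    by (simp add: weight_def)
qed

lemma forest_roots: "{x \<in> FT. length x = 1} = {[0], [1]}"
proof -
  have "[i] \<in> FT \<longleftrightarrow> i = 0 \<or> i = 1" for i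
    using gw_nodes_snoc[of "[]" i c] c2 less_2_cases_iff[of i] by (simp add: forest_nodes_def)
  moreover have "length x = 1 \<longleftrightarrow> (\<exists>i. x = [i])" for x :: "nat list"
    by (cases x) auto
  ultimately show ?thesis
    by (simp add: set_eq_iff) blast
qed

lemma prod_forest_nodes:
  "(\<Prod>x\<in>FT. f (fsd x)) = (f s)\<^sup>2 * (\<Prod>x\<in>{x \<in> FT. length x \<noteq> 1}. f (fsd x))"
  for f :: "bool \<Rightarrow> real"
proof -
  have "FT = {x \<in> FT. length x = 1} \<union> {x \<in> FT. length x \<noteq> 1}"
    by auto
  then have "(\<Prod>x\<in>FT. f (fsd x)) = (\<Prod>x\<in>{x \<in> FT. length x = 1}. f (fsd x)) * (\<Prod>x\<in>{x \<in> FT. length x \<noteq> 1}. f (fsd x))"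
    using finite_forest_nodes[of R c]
    by (metis (mono_tags, lifting) prod.union_disjoint finite_Un disjoint_iff mem_Collect_eq)
  then show ?thesis
    unfolding forest_roots by (simp add: power2_eq_square)
qed

end

text \<open>Sorted placements number asymptotically at least the product of the vertex counts over
  the sibling factorials, and each is exact with probability about \<open>weight D\<close> over the
  \<open>edges\<close>-th power of the number of graph edges. The factors combine to the product of
  offspring probabilities.\<close>

theorem forest_bound_of_pattern_bound:
  assumes prob: "\<And>n. prob_space (L n)" and sets: "\<And>n. sets (L n) = UNIV"
    and pos: "\<And>n s. 0 < N n s" and lim: "\<And>s. filterlim (\<lambda>n. N n s) at_top sequentially"
    and ratio: "(\<lambda>n. real (N n False) / real (N n True)) \<longlonglongrightarrow> mean (D True) / mean (D False)"
    and D: "\<And>s. has_pos_finite_mean (D s)"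
    and pb: "pattern_bound L N D"
  shows "forest_bound L (\<lambda>n H s u. sorted_list_of_set (nbrs H s u)) N D"
  unfolding forest_bound_def
proof (intro allI impI)
  fix s R and c :: "nat list \<Rightarrow> nat" and a
  assume R: "0 < R" and c2: "c [] = 2"
    and a: "a < (\<Prod>x\<in>forest_inner R c. pmf (offspring_law (D s) (D (\<not> s)) (length x - 1)) (c x))"
  let ?T = "forest_nodes R c" and ?I = "forest_inner R c"
  let ?nb = "\<lambda>x. {y \<in> ?T. tree_adj x y}" and ?sd = "\<lambda>x. s = odd (length x)"
  let ?nr = "{x \<in> ?T. length x \<noteq> 1}"
  let ?P = "\<lambda>n \<phi>. measure (L n) {H. forest_emb (\<lambda>s u. sorted_list_of_set (nbrs H s u)) s R c \<phi>}"
  interpret pattern ?T ?I ?nb ?sd by (rule forest_pattern[of R c, OF R c2])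
  have m: "0 < mean (D b)" for b
    using D by (auto simp: has_pos_finite_mean_def)
  have finm: "finite (forest_maps (N n) s R c)" for n
    unfolding forest_maps_def by (intro finite_PiE finite_forest_nodes) auto
  show "\<forall>\<^sub>F n in sequentially. a < (\<Sum>\<phi>\<in>forest_maps (N n) s R c. ?P n \<phi>) / (real (N n s))\<^sup>2"
  \<comment> \<open>For nonnegative \<open>a\<close> the auxiliary bound \<open>a'\<close> is
    positive, so it may be multiplied into inequalities between counts.\<close>
  proof (cases "a < 0")
    case True
    then show ?thesis
      by (intro always_eventually allI order_less_le_trans[OF True] divide_nonneg_nonneg sum_nonneg) auto
  next
    case False
    define F :: real where "F = (\<Prod>x\<in>?I. fact (c x))"
    \<comment> \<open>Limiting lower bound for the number of sorted placements divided by
      \<open>(real (N n s))\<^sup>2\<close> and by \<open>?m n ^ edges\<close>.\<close>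
    define \<kappa> where "\<kappa> = (\<Prod>x\<in>?nr. 1 / mean (D (?sd x))) / F"
    have F: "0 < F" unfolding F_def by (intro prod_pos) auto
    have \<kappa>: "0 < \<kappa>"
      unfolding \<kappa>_def using F m by (intro divide_pos_pos prod_pos) auto
    have "(\<Prod>x\<in>?I. pmf (offspring_law (D s) (D (\<not> s)) (length x - 1)) (c x)) =
        weight D / F * (\<Prod>x\<in>?nr. 1 / mean (D (?sd x)))"
      unfolding F_def by (intro prod_offspring_eq R c2 D)
    then have "a < weight D * \<kappa>"
      using a by (simp add: \<kappa>_def)
    then have "a / \<kappa> < weight D"
      using \<kappa> by (simp add: pos_divide_less_eq)
    then obtain a' where a': "a / \<kappa> < a'" "a' < weight D"
      using dense by blast
    have a'0: "0 < a'"
      using False \<kappa> a'(1) by (meson divide_nonneg_pos not_less order_le_less_trans)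
    let ?m = "\<lambda>n. real (N n True) * mean (D True)"
    let ?X = "\<lambda>n. (\<Prod>x\<in>?T. real (N n (?sd x) - card ?T) / real (N n (?sd x))) *
        (\<Prod>x\<in>?nr. real (N n (?sd x)) / ?m n) / F * a'"
    \<comment> \<open>By the ratio hypothesis, the edges counted from either side are asymptotically
      equally many, so \<open>?m n\<close> can be compared with the vertex counts of both
      sides.\<close>
    have NM: "(\<lambda>n. real (N n b) / ?m n) \<longlonglongrightarrow> 1 / mean (D b)" for b
    proof (cases b)
      case True
      have "real (N n True) / ?m n = 1 / mean (D True)" for n
        using pos[of n True] by simp
      then show ?thesis using True by simp
    next
      case False
      have "(\<lambda>n. real (N n False) / real (N n True) / mean (D True)) \<longlonglongrightarrow> mean (D True) / mean (D False) / mean (D True)"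
        using m[of True] by (intro tendsto_divide ratio tendsto_const) auto
      moreover have "mean (D True) / mean (D False) / mean (D True) = 1 / mean (D False)"
        using m[of True] by simp
      ultimately show ?thesis
        using False by simp
    qed
    have "?X \<longlonglongrightarrow> (\<Prod>x\<in>?T. 1) * (\<Prod>x\<in>?nr. 1 / mean (D (?sd x))) / F * a'"
      using F by (intro tendsto_intros tendsto_prod NM tendsto_diff_ratio lim) auto
    moreover have "a < (\<Prod>x\<in>?T. 1) * (\<Prod>x\<in>?nr. 1 / mean (D (?sd x))) / F * a'"
    proof -
      have "(\<Prod>x\<in>?T. 1) * (\<Prod>x\<in>?nr. 1 / mean (D (?sd x))) / F * a' = \<kappa> * a'"
        by (simp add: \<kappa>_def)
      then show ?thesis
        using a'(1) \<kappa> by (simp only: pos_divide_less_eq mult.commute)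
    qed
    ultimately have X: "\<forall>\<^sub>F n in sequentially. a < ?X n"
      by (rule order_tendstoD)
    have "\<forall>\<^sub>F n in sequentially. \<forall>\<phi>. admissible (N n) \<phi> \<longrightarrow>
        a' < measure (L n) {H. exact H \<phi>} * ?m n ^ edges"
      using pb[unfolded pattern_bound_def, rule_format, OF forest_pattern[of R c, OF R c2] a'(2)] .
    with X show ?thesis
    proof eventually_elim
      case (elim n)
      interpret L: prob_space "L n" by (rule prob)
      have mn: "0 < ?m n" using pos m by simp
      \<comment> \<open>The two roots leave the square in the denominator; the vertex counts of all
        other nodes cancel against the second product.\<close>
      have "?X n = real (\<Prod>x\<in>?T. N n (?sd x) - card ?T) / (F * (real (N n s))\<^sup>2 * ?m n ^ edges) * a'"
      proof -
        have "(\<Prod>x\<in>?T. real (N n (?sd x) - card ?T) / real (N n (?sd x))) =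
            real (\<Prod>x\<in>?T. N n (?sd x) - card ?T) / ((real (N n s))\<^sup>2 * (\<Prod>x\<in>?nr. real (N n (?sd x))))"
          unfolding prod_dividef by (subst prod_forest_nodes[of R c, OF R c2, where f = "\<lambda>b. real (N n b)"]) simp
        moreover have "(\<Prod>x\<in>?nr. real (N n (?sd x)) / ?m n) = (\<Prod>x\<in>?nr. real (N n (?sd x))) / ?m n ^ edges"
          unfolding prod_dividef forest_edges[of R c, OF R c2] by simp
        moreover have "(\<Prod>x\<in>?nr. real (N n (?sd x))) \<noteq> 0"
          using pos fin by (intro prod_pos[THEN less_imp_neq, THEN not_sym]) auto
        moreover have "x / (y * z) * (z / w) / F * a' = x / (F * y * w) * a'" if "z \<noteq> 0" for x y z w :: real
          using that by simp
        ultimately show ?thesis by (simp only:)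
      qed
      also have "\<dots> \<le> real ((\<Prod>x\<in>?I. fact (c x)) * card (sorted_maps R c s (N n))) / (F * (real (N n s))\<^sup>2 * ?m n ^ edges) * a'"
        using card_sorted_maps[of R c, OF R c2, where N = "N n" and s = s] F mn a'0
        by (intro mult_right_mono divide_right_mono of_nat_mono) auto
      also have "\<dots> = (\<Sum>\<phi>\<in>sorted_maps R c s (N n). a' / ?m n ^ edges) / (real (N n s))\<^sup>2"
        using F by (simp add: F_def field_simps)
      also have "\<dots> \<le> (\<Sum>\<phi>\<in>sorted_maps R c s (N n). ?P n \<phi>) / (real (N n s))\<^sup>2"
      proof (intro divide_right_mono sum_mono)
        fix \<phi> assume \<phi>: "\<phi> \<in> sorted_maps R c s (N n)"
        have "admissible (N n) \<phi>"
          unfolding admissible_def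
        proof
          show "\<forall>x\<in>?T. \<phi> x < N n (?sd x)"
            using \<phi> by (auto simp: sorted_maps_def[of R c, OF R c2] forest_maps_def dest: PiE_mem)
          have "inj_on (\<lambda>x. (odd (length x), \<phi> x)) ?T"
            using \<phi> by (simp add: sorted_maps_def[of R c, OF R c2])
          then show "inj_on (\<lambda>x. (?sd x, \<phi> x)) ?T"
            by (auto simp: inj_on_def)
        qed
        then have "a' / ?m n ^ edges \<le> measure (L n) {H. exact H \<phi>}"
          using elim(2) mn by (simp add: pos_divide_le_eq less_imp_le)
        also have "\<dots> \<le> ?P n \<phi>"
          using sorted_exact_imp_forest_emb[of R c, OF R c2 \<phi>] by (intro L.finite_measure_mono) (auto simp: sets)
        finally show "a' / ?m n ^ edges \<le> ?P n \<phi>" .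
      qed simp
      also have "\<dots> \<le> (\<Sum>\<phi>\<in>forest_maps (N n) s R c. ?P n \<phi>) / (real (N n s))\<^sup>2"
        by (intro divide_right_mono sum_mono2 finm) (auto simp: sorted_maps_def[of R c, OF R c2])
      finally show ?case using elim(1) by simp
    qed
  qed
qed

section \<open>Limits\<close>

text \<open>Points halfway between integers are continuity points of a law on the naturals, and a
  point probability is the increment of the distribution function between two of them.\<close>

lemma pmf_tendsto_of_weak_conv:
  assumes "weak_conv_m (\<lambda>n. real_law (P n)) (real_law D)"
  shows "(\<lambda>n. pmf (P n) k) \<longlonglongrightarrow> pmf D k"
proof -
  define F where "F D x = measure_pmf.prob D {j. real j \<le> x}" for D :: "nat pmf" and x
  have F: "F D x = cdf (real_law D) x" for D x
    by (simp add: F_def cdf_real_law)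
  have int: "{j. real j \<le> real k - 1 / 2} = {..<k}" "{j. real j \<le> real k + 1 / 2} = {..<Suc k}" for k
    by auto
  have cont: "isCont (cdf (real_law D)) x" if x: "\<And>j. x \<noteq> real j" for x
  proof -
    interpret real_distribution "real_law D"
      unfolding real_law_def real_distribution_def real_distribution_axioms_def
      by (auto intro: measure_pmf.prob_space_distr)
    have "measure (real_law D) {x} = measure_pmf.prob D (real -` {x})"
      unfolding real_law_def by (subst measure_distr) auto
    also have "real -` {x} = {}" using x by auto
    finally show ?thesis
      by (simp add: isCont_cdf)
  qed
  have lim: "(\<lambda>n. F (P n) x) \<longlonglongrightarrow> F D x" if "\<And>j. x \<noteq> real j" for x
    using assms cont[OF that] unfolding F weak_conv_m_def weak_conv_def by blast
  have ne: "real k - 1 / 2 \<noteq> real j" "real k + 1 / 2 \<noteq> real j" for j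
  proof -
    have "real (2 * k) \<noteq> real (2 * j + 1)" "real (2 * k + 1) \<noteq> real (2 * j)"
      unfolding of_nat_eq_iff by presburger+
    then show "real k - 1 / 2 \<noteq> real j" "real k + 1 / 2 \<noteq> real j"
      by auto
  qed
  have "pmf E k = F E (real k + 1 / 2) - F E (real k - 1 / 2)" for E
    unfolding F_def int by (simp add: measure_measure_pmf_finite)
  then show ?thesis
    using tendsto_diff[OF lim lim, OF ne(2) ne(1)] by simp
qed

lemma
  shows integrable_nat_pmf_iff: "integrable (measure_pmf D) real \<longleftrightarrow> summable (\<lambda>k. pmf D k * real k)"
    and mean_eq_suminf: "summable (\<lambda>k. pmf D k * real k) \<Longrightarrow> mean D = (\<Sum>k. pmf D k * real k)"
proof -
  have i: "integrable (measure_pmf D) real \<longleftrightarrow> integrable (count_space UNIV) (\<lambda>k. pmf D k * real k)"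
    unfolding measure_pmf_eq_density by (subst integrable_density) auto
  then show eq: "integrable (measure_pmf D) real \<longleftrightarrow> summable (\<lambda>k. pmf D k * real k)"
    by (simp add: integrable_count_space_nat_iff)
  assume s: "summable (\<lambda>k. pmf D k * real k)"
  have "mean D = (\<integral>k. pmf D k * real k \<partial>count_space UNIV)"
    unfolding measure_pmf_eq_density by (subst integral_density) auto
  also have "\<dots> = (\<Sum>k. pmf D k * real k)"
    using s i eq by (intro integral_count_space_nat) simp
  finally show "mean D = (\<Sum>k. pmf D k * real k)" .
qed

lemma mean_partial_sums:
  assumes "has_pos_finite_mean D"
  shows "(\<lambda>M. \<Sum>k\<le>M. real k * pmf D k) \<longlonglongrightarrow> mean D"
proof -
  have s: "summable (\<lambda>k. pmf D k * real k)"
    using assms integrable_nat_pmf_iff by (auto simp: has_pos_finite_mean_def)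
  have "(\<lambda>M. \<Sum>k\<le>M. pmf D k * real k) \<longlonglongrightarrow> (\<Sum>k. pmf D k * real k)"
    by (rule summable_LIMSEQ'[OF s])
  then show ?thesis
    using mean_eq_suminf[OF s] by (simp add: mult.commute)
qed

lemma
  assumes "0 < r"
  shows mean_poisson: "mean (poisson_pmf r) = r"
    and has_pos_finite_mean_poisson: "has_pos_finite_mean (poisson_pmf r)"
proof -
  have "(\<lambda>k. r * exp (- r) * (r ^ k / fact k)) sums (r * exp (- r) * exp r)"
    using exp_converges[of r] by (intro sums_mult) (simp add: scaleR_conv_of_real field_simps)
  moreover have "r * exp (- r) * (r ^ k / fact k) = pmf (poisson_pmf r) (Suc k) * real (Suc k)" for k
    using assms by (simp add: field_simps del: of_nat_Suc)
  moreover have "r * exp (- r) * exp r = r"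
    by (simp add: exp_minus)
  ultimately have "(\<lambda>k. pmf (poisson_pmf r) (Suc k) * real (Suc k)) sums r"
    by (simp only:)
  then have "(\<lambda>k. pmf (poisson_pmf r) k * real k) sums r"
    by (subst (asm) sums_Suc_iff) simp
  then have s: "summable (\<lambda>k. pmf (poisson_pmf r) k * real k)" "(\<Sum>k. pmf (poisson_pmf r) k * real k) = r"
    by (auto simp: sums_iff)
  then show m: "mean (poisson_pmf r) = r"
    by (simp add: mean_eq_suminf)
  show "has_pos_finite_mean (poisson_pmf r)"
    unfolding has_pos_finite_mean_def m using s(1) assms integrable_nat_pmf_iff by blast
qed

text \<open>The bound \<open>1 + x \<le> exp x\<close> at \<open>x = z / (1 - z)\<close> gives
  \<open>exp (- (z / (1 - z))) \<le> 1 - z\<close> for \<open>z < 1\<close>, and \<open>z n\<close>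
  tends to zero because \<open>m n\<close> grows.\<close>

lemma tendsto_exp_power:
  fixes z :: "nat \<Rightarrow> real" and m :: "nat \<Rightarrow> nat"
  assumes "(\<lambda>n. real (m n) * z n) \<longlonglongrightarrow> u" "filterlim m at_top sequentially"
  obtains g where "g \<longlonglongrightarrow> exp (- u)" "\<forall>\<^sub>F n in sequentially. g n \<le> (1 - z n) ^ m n \<and> z n < 1"
proof -
  have M: "filterlim (\<lambda>n. real (m n)) at_top sequentially"
    using assms(2) by (rule filterlim_compose[OF filterlim_real_sequentially])
  have "(\<lambda>n. real (m n) * z n / real (m n)) \<longlonglongrightarrow> 0"
    by (rule real_tendsto_divide_at_top[OF assms(1) M])
  moreover have "\<forall>\<^sub>F n in sequentially. real (m n) * z n / real (m n) = z n"
    using filterlim_at_top[THEN iffD1, OF assms(2), rule_format, of 1] by eventually_elim auto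
  ultimately have z: "z \<longlonglongrightarrow> 0"
    by (rule Lim_transform_eventually)
  have "(\<lambda>n. exp (- (real (m n) * z n / (1 - z n)))) \<longlonglongrightarrow> exp (- (u / (1 - 0)))"
    by (intro tendsto_intros assms(1) z) auto
  then have lim: "(\<lambda>n. exp (- (real (m n) * z n / (1 - z n)))) \<longlonglongrightarrow> exp (- u)"
    by simp
  have "\<forall>\<^sub>F n in sequentially. z n < 1"
    using z by (rule order_tendstoD) simp
  then have "\<forall>\<^sub>F n in sequentially. exp (- (real (m n) * z n / (1 - z n))) \<le> (1 - z n) ^ m n \<and> z n < 1"
  proof eventually_elim
    case (elim n)
    have "exp (- (z n / (1 - z n))) \<le> 1 - z n"
    proof -
      have "1 + z n / (1 - z n) \<le> exp (z n / (1 - z n))"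
        by (rule exp_ge_add_one_self)
      moreover have "1 + z n / (1 - z n) = 1 / (1 - z n)"
        using elim by (simp add: field_simps)
      ultimately show ?thesis
        using elim by (simp add: exp_minus field_simps)
    qed
    then have "exp (- (z n / (1 - z n))) ^ m n \<le> (1 - z n) ^ m n"
      by (intro power_mono) auto
    moreover have "exp (- (z n / (1 - z n))) ^ m n = exp (- (real (m n) * z n / (1 - z n)))"
      by (simp add: exp_of_nat_mult[symmetric])
    ultimately show ?case using elim by simp
  qed
  with lim show thesis by (rule that)
qed

text \<open>Since \<open>N choose Suc j\<close> is \<open>N / Suc j\<close> times
  \<open>N - 1 choose j\<close>, a ratio of two binomials tending to one remains. It scales the
  probability that a random set of size \<open>Suc j\<close> meets a fixed set of size
  \<open>b\<close> in one given point.\<close>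

lemma tendsto_binomial_ratio:
  assumes "filterlim N at_top sequentially"
  shows "(\<lambda>n. real (N n) * real (N n - b choose j) / real (N n choose Suc j)) \<longlonglongrightarrow> real (Suc j)"
proof -
  \<comment> \<open>The leading coefficient of \<open>N - k choose j\<close> as a polynomial in
    \<open>N\<close>, the same for every \<open>k\<close>; it equals
    \<open>1 / fact j\<close>.\<close>
  define l :: real where "l = (\<Prod>i = 0..<j. 1 / real (j - i))"
  have l: "l \<noteq> 0" by (auto simp: l_def)
  have C: "(\<lambda>n. real (N n - k choose j) / real (N n) ^ j) \<longlonglongrightarrow> l" for k
  proof -
    have "(\<lambda>n. \<Prod>i = 0..<j. real (N n - (k + i)) / real (N n) * (1 / real (j - i))) \<longlonglongrightarrow> (\<Prod>i = 0..<j. 1 * (1 / real (j - i)))"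
      by (intro tendsto_prod tendsto_mult tendsto_const tendsto_diff_ratio assms)
    then have "(\<lambda>n. \<Prod>i = 0..<j. real (N n - (k + i)) / real (N n) * (1 / real (j - i))) \<longlonglongrightarrow> l"
      by (simp add: l_def)
    moreover have "\<forall>\<^sub>F n in sequentially.
        (\<Prod>i = 0..<j. real (N n - (k + i)) / real (N n) * (1 / real (j - i))) = real (N n - k choose j) / real (N n) ^ j"
      using filterlim_at_top[THEN iffD1, OF assms, rule_format, of "k + j + 1"]
    proof eventually_elim
      case (elim n)
      then have "real (N n - k choose j) = (\<Prod>i = 0..<j. real (N n - k - i) / real (j - i))"
        by (intro binomial_altdef_of_nat) auto
      then have "real (N n - k choose j) / real (N n) ^ j = (\<Prod>i = 0..<j. real (N n - k - i) / real (j - i)) / (\<Prod>i = 0..<j. real (N n))"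
        by simp
      also have "\<dots> = (\<Prod>i = 0..<j. real (N n - k - i) / real (j - i) / real (N n))"
        by (rule prod_dividef[symmetric])
      finally show ?case
        by (simp add: mult.commute)
    qed
    ultimately show ?thesis
      by (rule Lim_transform_eventually)
  qed
  have "(\<lambda>n. real (Suc j) * ((real (N n - b choose j) / real (N n) ^ j) / (real (N n - 1 choose j) / real (N n) ^ j)))
      \<longlonglongrightarrow> real (Suc j) * (l / l)"
    by (intro tendsto_intros C l)
  then have "(\<lambda>n. real (Suc j) * ((real (N n - b choose j) / real (N n) ^ j) / (real (N n - 1 choose j) / real (N n) ^ j)))
      \<longlonglongrightarrow> real (Suc j)"
    using l by simp
  moreover have "\<forall>\<^sub>F n in sequentially.
      real (Suc j) * ((real (N n - b choose j) / real (N n) ^ j) / (real (N n - 1 choose j) / real (N n) ^ j)) =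
      real (N n) * real (N n - b choose j) / real (N n choose Suc j)"
    using filterlim_at_top[THEN iffD1, OF assms, rule_format, of "Suc j"]
  proof eventually_elim
    case (elim n)
    then obtain k where k: "N n = Suc k" by (cases "N n") auto
    have "real (Suc j) * real (Suc k choose Suc j) = real (Suc k) * real (k choose j)"
      using Suc_times_binomial[of j k] by (metis of_nat_mult)
    moreover have "0 < real (Suc k choose Suc j)" "0 < real (k choose j)"
      using elim k by (auto intro!: zero_less_binomial simp del: binomial_Suc_Suc)
    ultimately have "real (Suc j) / real (k choose j) = real (Suc k) / real (Suc k choose Suc j)"
      by (simp add: field_simps del: of_nat_Suc binomial_Suc_Suc)
    moreover have "real (Suc j) * ((real (N n - b choose j) / real (N n) ^ j) / (real (N n - 1 choose j) / real (N n) ^ j))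
        = real (N n - b choose j) * (real (Suc j) / real (k choose j))"
      by (simp add: k del: of_nat_Suc binomial_Suc_Suc)
    ultimately show ?case
      by (simp add: k mult.commute del: of_nat_Suc binomial_Suc_Suc)
  qed
  ultimately show ?thesis
    by (rule Lim_transform_eventually)
qed

section \<open>Random subsets\<close>

lemma measure_uniform_subset:
  assumes "k \<le> m"
  shows "measure_pmf.prob (uniform_subset m k) A = real (card ({S. S \<subseteq> {..<m} \<and> card S = k} \<inter> A)) / real (m choose k)"
proof -
  have c: "card {S. S \<subseteq> {..<m} \<and> card S = k} = m choose k"
    using n_subsets[of "{..<m}" k] by simp
  then have "0 < card {S. S \<subseteq> {..<m} \<and> card S = k}"
    using assms by (simp only: zero_less_binomial)
  then have "{S. S \<subseteq> {..<m} \<and> card S = k} \<noteq> {}" "finite {S. S \<subseteq> {..<m} \<and> card S = k}"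
    unfolding card_gt_0_iff by blast+
  then show ?thesis
    unfolding uniform_subset_def by (simp add: measure_pmf_of_set c)
qed

lemma uniform_subset_contains:
  assumes "k \<le> m" "w < m"
  shows "measure_pmf.prob (uniform_subset m k) {S. w \<in> S} = real k / real m"
proof -
  have "measure_pmf.prob (uniform_subset m k) {S. w \<notin> S} = real (m - 1 choose k) / real (m choose k)"
  proof -
    have "{S. S \<subseteq> {..<m} \<and> card S = k} \<inter> {S. w \<notin> S} = {S. S \<subseteq> {..<m} - {w} \<and> card S = k}"
      by auto
    then show ?thesis
      using assms n_subsets[of "{..<m} - {w}" k] by (simp add: measure_uniform_subset)
  qed
  also have "\<dots> = 1 - real k / real m"
  proof -
    have "real (m - k) * real (m choose k) = real m * real (m - 1 choose k)"
      using binomial_absorb_comp[of m k] by (metis of_nat_mult)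
    moreover have "0 < real (m choose k)" "0 < real m" using assms by auto
    ultimately show ?thesis
      using assms(1) by (simp add: field_simps of_nat_diff)
  qed
  finally show ?thesis
    using measure_pmf.prob_compl[of "{S. w \<in> S}" "uniform_subset m k"]
    by (simp add: Compl_eq_Diff_UNIV[symmetric] Collect_neg_eq[symmetric])
qed

text \<open>Besides \<open>w\<close>, the remaining \<open>j\<close> elements may be chosen freely
  outside \<open>W\<close>.\<close>

lemma uniform_subset_meets_once:
  assumes "Suc j \<le> m" "W \<subseteq> {..<m}" "w \<in> W"
  shows "real (m - card W choose j) / real (m choose Suc j)
    \<le> measure_pmf.prob (uniform_subset m (Suc j)) {S. S \<inter> W = {w}}"
proof -
  have fin: "finite W" using assms finite_subset by blast
  have "m - card W choose j = card {S. S \<subseteq> {..<m} - W \<and> card S = j}"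
    using n_subsets[of "{..<m} - W" j] assms fin by (simp add: card_Diff_subset)
  also have "\<dots> = card (insert w ` {S. S \<subseteq> {..<m} - W \<and> card S = j})"
    using assms(3) by (intro card_image[symmetric] inj_onI) (metis Diff_iff insert_ident mem_Collect_eq subsetD)
  also have "\<dots> \<le> card ({S. S \<subseteq> {..<m} \<and> card S = Suc j} \<inter> {S. S \<inter> W = {w}})"
  proof (rule card_mono)
    show "finite ({S. S \<subseteq> {..<m} \<and> card S = Suc j} \<inter> {S. S \<inter> W = {w}})"
      by (rule finite_subset[of _ "Pow {..<m}"]) auto
    show "insert w ` {S. S \<subseteq> {..<m} - W \<and> card S = j} \<subseteq> {S. S \<subseteq> {..<m} \<and> card S = Suc j} \<inter> {S. S \<inter> W = {w}}"
    proof (rule image_subsetI)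
      fix S assume S: "S \<in> {S. S \<subseteq> {..<m} - W \<and> card S = j}"
      then have "finite S" "w \<notin> S"
        using assms(3) by (auto intro: finite_subset)
      then show "insert w S \<in> {S. S \<subseteq> {..<m} \<and> card S = Suc j} \<inter> {S. S \<inter> W = {w}}"
        using S assms by auto
    qed
  qed
  finally have "real (m - card W choose j) \<le> real (card ({S. S \<subseteq> {..<m} \<and> card S = Suc j} \<inter> {S. S \<inter> W = {w}}))"
    by (rule of_nat_mono)
  then show ?thesis
    unfolding measure_uniform_subset[OF assms(1)] by (intro divide_right_mono) auto
qed

lemma measure_bind_pmf: "measure_pmf.prob (bind_pmf P U) A = (\<integral>k. measure_pmf.prob (U k) A \<partial>measure_pmf P)"
proof -
  have "emeasure (measure_pmf (bind_pmf P U)) A = (\<integral>\<^sup>+k. ennreal (measure_pmf.prob (U k) A) \<partial>measure_pmf P)"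
    by (simp add: measure_pmf.emeasure_eq_measure[symmetric])
  also have "\<dots> = ennreal (\<integral>k. measure_pmf.prob (U k) A \<partial>measure_pmf P)"
    by (intro nn_integral_eq_integral measure_pmf.integrable_const_bound[of _ 1]) auto
  finally show ?thesis
    by (simp add: measure_pmf.emeasure_eq_measure integral_nonneg_AE)
qed

text \<open>Keeping finitely many values of the first draw is how set sizes are truncated.\<close>

lemma measure_bind_pmf_ge:
  fixes P :: "nat pmf"
  assumes "finite F"
  shows "(\<Sum>k\<in>F. pmf P k * measure_pmf.prob (U k) A) \<le> measure_pmf.prob (bind_pmf P U) A"
proof -
  have "(\<Sum>k\<in>F. pmf P k * measure_pmf.prob (U k) A) =
      (\<integral>k. (if k \<in> F then measure_pmf.prob (U k) A else 0) \<partial>measure_pmf P)"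
    by (subst integral_measure_pmf[of F]) (use assms in \<open>auto split: if_splits simp: mult.commute intro!: sum.cong\<close>)
  also have "\<dots> \<le> (\<integral>k. measure_pmf.prob (U k) A \<partial>measure_pmf P)"
    by (intro integral_mono measure_pmf.integrable_const_bound[of _ 1]) auto
  finally show ?thesis
    by (simp add: measure_bind_pmf)
qed

section \<open>The active and the passive model\<close>

context pattern
begin

lemma card_leaf: "x \<in> T - I \<Longrightarrow> card (nb x) = 1"
  using leaf by fastforce

lemma edges_split: "edges = (\<Sum>x\<in>{x \<in> I. sd x}. card (nb x)) + card {x \<in> T - I. sd x}"
  and edges_split': "edges = (\<Sum>x\<in>{x \<in> I. \<not> sd x}. card (nb x)) + card {x \<in> T - I. \<not> sd x}"
proof -
  have *: "(\<Sum>x\<in>{x \<in> T. B x}. card (nb x)) = (\<Sum>x\<in>{x \<in> I. B x}. card (nb x)) + card {x \<in> T - I. B x}" for B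
  proof -
    have "{x \<in> T. B x} = {x \<in> I. B x} \<union> {x \<in> T - I. B x}"
      using IT by auto
    then have "(\<Sum>x\<in>{x \<in> T. B x}. card (nb x)) = (\<Sum>x\<in>{x \<in> I. B x}. card (nb x)) + (\<Sum>x\<in>{x \<in> T - I. B x}. card (nb x))"
      using fin IT finite_subset[OF IT fin] by (simp only:) (rule sum.union_disjoint, auto)
    moreover have "(\<Sum>x\<in>{x \<in> T - I. B x}. card (nb x)) = (\<Sum>x\<in>{x \<in> T - I. B x}. 1)"
      by (intro sum.cong refl) (use card_leaf in auto)
    ultimately show ?thesis by simp
  qed
  show "edges = (\<Sum>x\<in>{x \<in> I. sd x}. card (nb x)) + card {x \<in> T - I. sd x}"
    unfolding edges_def by (rule *)
  show "edges = (\<Sum>x\<in>{x \<in> I. \<not> sd x}. card (nb x)) + card {x \<in> T - I. \<not> sd x}"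
    unfolding edges_eq by (rule *)
qed

lemma weight_split:
  "weight D =
    (\<Prod>x\<in>{x \<in> I. sd x}. fact (card (nb x)) * pmf (D True) (card (nb x))) *
    (\<Prod>x\<in>{x \<in> I. \<not> sd x}. fact (card (nb x)) * pmf (D False) (card (nb x))) *
    mean (D True) ^ card {x \<in> T - I. sd x} * mean (D False) ^ card {x \<in> T - I. \<not> sd x}"
proof -
  have *: "(\<Prod>x\<in>A. f (sd x) x) = (\<Prod>x\<in>{x \<in> A. sd x}. f True x) * (\<Prod>x\<in>{x \<in> A. \<not> sd x}. f False x)"
    if "finite A" for A and f :: "bool \<Rightarrow> nat list \<Rightarrow> real"
  proof -
    have "(\<Prod>x\<in>A. f (sd x) x) = (\<Prod>x\<in>{x \<in> A. sd x} \<union> {x \<in> A. \<not> sd x}. f (sd x) x)"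
      by (rule prod.cong) auto
    also have "\<dots> = (\<Prod>x\<in>{x \<in> A. sd x}. f (sd x) x) * (\<Prod>x\<in>{x \<in> A. \<not> sd x}. f (sd x) x)"
      using that by (intro prod.union_disjoint) auto
    finally show ?thesis by simp
  qed
  have "finite I" "finite (T - I)" using fin IT finite_subset by auto
  then show ?thesis
    unfolding weight_def
    by (simp only: *[of I "\<lambda>b x. fact (card (nb x)) * pmf (D b) (card (nb x))"] *[of "T - I" "\<lambda>b x. mean (D b)"]
         prod_constant mult.assoc)
qed

lemma admissible_nb:
  assumes "admissible N \<phi>" "x \<in> T"
  shows "\<phi> ` nb x \<subseteq> {..<N (\<not> sd x)}" "inj_on \<phi> (nb x)"
proof -
  show "\<phi> ` nb x \<subseteq> {..<N (\<not> sd x)}"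
    using assms nb_T nb_side by (fastforce simp: admissible_def)
  show "inj_on \<phi> (nb x)"
  proof (rule inj_onI)
    fix y z assume "y \<in> nb x" "z \<in> nb x" "\<phi> y = \<phi> z"
    then show "y = z"
      using assms nb_T[OF assms(2)] nb_side[OF assms(2)]
        inj_onD[of "\<lambda>x. (sd x, \<phi> x)" T y z] by (auto simp: admissible_def)
  qed
qed

lemma admissible_inj:
  assumes "admissible N \<phi>" "x \<in> T" "y \<in> T" "sd x = sd y" "\<phi> x = \<phi> y"
  shows "x = y"
  using assms inj_onD[of "\<lambda>x. (sd x, \<phi> x)" T x y] by (auto simp: admissible_def)

text \<open>The sets drawn by the vertices of \<open>part1\<close> are independent, and one
  condition on each ensures exactness: an inner node draws its prescribed set, a leaf meets the set
  \<open>W\<close> of images of inner nodes of \<open>part2\<close> only in its neighbour, and any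
  other vertex avoids \<open>W\<close>. The sizes drawn by leaves are cut off at
  \<open>M\<close>.\<close>

lemma active_exact_ge:
  assumes adm: "admissible (\<lambda>s. if s then n1 else n2) \<phi>"
    and supp: "set_pmf P \<subseteq> {..n2}" and M: "M \<le> n2" and n2: "0 < n2"
    and q: "real (card {x \<in> I. \<not> sd x}) * (mean P / real n2) \<le> 1"
  shows "(\<Prod>x\<in>{x \<in> I. sd x}. pmf P (card (nb x)) * fact (card (nb x)) / real n2 ^ card (nb x)) *
    (\<Sum>j<M. pmf P (Suc j) * (real (n2 - card {x \<in> I. \<not> sd x} choose j) / real (n2 choose Suc j))) ^ card {x \<in> T - I. sd x} *
    (1 - real (card {x \<in> I. \<not> sd x}) * (mean P / real n2)) ^ n1
    \<le> measure_pmf.prob (active_law n1 n2 P) {H. exact H \<phi>}"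
proof -
  define J where "J = {x \<in> I. \<not> sd x}"
  define W where "W = \<phi> ` J"
  define T1 where "T1 = {x \<in> T. sd x}"
  define Q where "Q = bind_pmf P (uniform_subset n2)"
  define q0 where "q0 = 1 - real (card J) * (mean P / real n2)"
  define l where "l = (\<Sum>j<M. pmf P (Suc j) * (real (n2 - card J choose j) / real (n2 choose Suc j)))"
  have J: "J \<subseteq> T" "finite J"
    using IT fin by (auto simp: J_def intro: finite_subset[OF _ fin])
  have injJ: "inj_on \<phi> J"
    by (rule inj_onI) (use admissible_inj[OF adm] J in \<open>auto simp: J_def\<close>)
  have W: "W \<subseteq> {..<n2}" "card W = card J" "finite W"
    using adm J IT card_image[OF injJ] by (auto simp: W_def J_def admissible_def dest!: subsetD)
  have T1: "finite T1" using fin by (simp add: T1_def)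
  have injT1: "inj_on \<phi> T1"
    by (rule inj_onI) (use admissible_inj[OF adm] in \<open>auto simp: T1_def\<close>)
  have T1_sub: "\<phi> ` T1 \<subseteq> {..<n1}"
    using adm by (auto simp: T1_def admissible_def)
  have q0: "0 \<le> q0" "q0 \<le> 1"
    using q by (auto simp: q0_def J_def intro!: mult_nonneg_nonneg)
  have contains: "measure_pmf.prob Q {S. w \<in> S} = mean P / real n2" if "w < n2" for w
  proof -
    have "measure_pmf.prob Q {S. w \<in> S} = (\<integral>k. real k / real n2 \<partial>measure_pmf P)"
      unfolding Q_def measure_bind_pmf
      by (rule integral_cong_AE) (use that supp in \<open>auto simp: AE_measure_pmf_iff uniform_subset_contains\<close>)
    then show ?thesis by simp
  qed
  \<comment> \<open>Union bound over \<open>W\<close>; each of its points is drawn with probability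
    \<open>mean P / real n2\<close>.\<close>
  have avoid: "q0 \<le> measure_pmf.prob Q {S. S \<inter> W = {}}"
  proof -
    have "measure_pmf.prob Q (\<Union>w\<in>W. {S. w \<in> S}) \<le> (\<Sum>w\<in>W. measure_pmf.prob Q {S. w \<in> S})"
      using W(3) by (intro measure_pmf.finite_measure_subadditive_finite) auto
    also have "\<dots> = real (card J) * (mean P / real n2)"
      using W by (subst sum.cong[OF refl contains]) auto
    finally have "q0 \<le> 1 - measure_pmf.prob Q (\<Union>w\<in>W. {S. w \<in> S})"
      by (simp add: q0_def)
    also have "\<dots> = measure_pmf.prob Q (UNIV - (\<Union>w\<in>W. {S. w \<in> S}))"
      using measure_pmf.prob_compl[of "\<Union>w\<in>W. {S. w \<in> S}" Q] by simp
    also have "UNIV - (\<Union>w\<in>W. {S. w \<in> S}) = {S. S \<inter> W = {}}"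
      by auto
    finally show ?thesis .
  qed
  \<comment> \<open>Decomposition by the size \<open>Suc j\<close> of the drawn set; the empty set
    does not meet \<open>W\<close>.\<close>
  have once: "l \<le> measure_pmf.prob Q {S. S \<inter> W = {w}}" if "w \<in> W" for w
  proof -
    have "l \<le> (\<Sum>j<M. pmf P (Suc j) * measure_pmf.prob (uniform_subset n2 (Suc j)) {S. S \<inter> W = {w}})"
      unfolding l_def W(2)[symmetric] using M W(1) that
      by (intro sum_mono mult_left_mono uniform_subset_meets_once) auto
    also have "\<dots> = (\<Sum>k\<in>Suc ` {..<M}. pmf P k * measure_pmf.prob (uniform_subset n2 k) {S. S \<inter> W = {w}})"
      by (subst sum.reindex) auto
    also have "\<dots> \<le> measure_pmf.prob Q {S. S \<inter> W = {w}}"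
      unfolding Q_def by (rule measure_bind_pmf_ge) simp
    finally show ?thesis .
  qed
  have single: "pmf P (card S) * fact (card S) / real n2 ^ card S \<le> measure_pmf.prob Q {S}" if S: "S \<subseteq> {..<n2}" for S
  proof -
    let ?d = "card S"
    have d: "?d \<le> n2" using card_mono[of "{..<n2}" S] S by simp
    have "{S'. S' \<subseteq> {..<n2} \<and> card S' = ?d} \<inter> {S} = {S}" using S by auto
    then have "measure_pmf.prob (uniform_subset n2 ?d) {S} = 1 / real (n2 choose ?d)"
      by (simp add: measure_uniform_subset[OF d])
    \<comment> \<open>A prescribed set of size \<open>?d\<close> has probability one over a binomial
      coefficient, and the latter is at most \<open>n2 ^ ?d / fact ?d\<close>.\<close>
    moreover have "fact ?d / real n2 ^ ?d \<le> 1 / real (n2 choose ?d)"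
    proof -
      have "real ((n2 choose ?d) * fact ?d) \<le> real (n2 ^ ?d)"
        by (rule of_nat_mono) (rule binomial_fact_pow)
      moreover have "0 < real (n2 choose ?d)" using d by simp
      ultimately show ?thesis
        using n2 by (simp add: field_simps)
    qed
    ultimately have "pmf P ?d * (fact ?d / real n2 ^ ?d) \<le> (\<Sum>k\<in>{?d}. pmf P k * measure_pmf.prob (uniform_subset n2 k) {S})"
      by (simp only: sum.insert finite.emptyI empty_iff not_False_eq_True sum.empty add_0_right) (intro mult_left_mono, auto)
    also have "\<dots> \<le> measure_pmf.prob Q {S}"
      unfolding Q_def by (rule measure_bind_pmf_ge) simp
    finally show ?thesis by simp
  qed
  define B where "B v = (if v \<in> \<phi> ` T1
      then (let x = the_inv_into T1 \<phi> v in if x \<in> I then {\<phi> ` nb x} else {S. S \<inter> W = \<phi> ` nb x})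
      else {S. S \<inter> W = {}})" for v
  have B_T1: "B (\<phi> x) = (if x \<in> I then {\<phi> ` nb x} else {S. S \<inter> W = \<phi> ` nb x})" if "x \<in> T1" for x
    using that the_inv_into_f_f[OF injT1 that] by (auto simp: B_def Let_def)
  have B_out: "B v = {S. S \<inter> W = {}}" if "v \<notin> \<phi> ` T1" for v
    using that by (simp add: B_def)
  let ?h = "\<lambda>S. simple_bigraph {..<n1} {..<n2} {(v, w). v < n1 \<and> w \<in> S v}"
  have exact: "exact (?h S) \<phi>" if S: "\<And>v. v < n1 \<Longrightarrow> S v \<in> B v" for S
  proof -
    have N1: "nbrs (?h S) True v = {w. w < n2 \<and> w \<in> S v}" if "v < n1" for v
      using that by (auto simp: nbrs_def nbrs1_def simple_bigraph_def)
    have N2: "nbrs (?h S) False w = {v. v < n1 \<and> w \<in> S v}" if "w < n2" for w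
      using that by (auto simp: nbrs_def nbrs2_def simple_bigraph_def)
    show ?thesis
      unfolding exact_def
    proof
      fix x assume x: "x \<in> I"
      then have xT: "x \<in> T" using IT by auto
      show "nbrs (?h S) (sd x) (\<phi> x) = \<phi> ` nb x"
      proof (cases "sd x")
        case True
        then have "x \<in> T1" "\<phi> x < n1" using xT adm by (auto simp: T1_def admissible_def)
        then have "S (\<phi> x) = \<phi> ` nb x"
          using S[of "\<phi> x"] B_T1[of x] x by auto
        then show ?thesis
          using N1[OF \<open>\<phi> x < n1\<close>] admissible_nb(1)[OF adm xT] True by auto
      next
        case False
        then have w: "\<phi> x < n2" "x \<in> J" "\<phi> x \<in> W" using xT x adm by (auto simp: J_def W_def admissible_def)
        \<comment> \<open>An inner node of \<open>part2\<close> draws nothing; its neighbourhood is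
          read off from the drawn sets, and all of these are controlled on \<open>W\<close>.\<close>
        have mem: "\<phi> x \<in> S (\<phi> y) \<longleftrightarrow> x \<in> nb y" if y: "y \<in> T1" for y
        proof -
          have "\<phi> y < n1" using y T1_sub by auto
          then have "S (\<phi> y) \<in> B (\<phi> y)" by (rule S)
          then have "\<phi> x \<in> S (\<phi> y) \<longleftrightarrow> \<phi> x \<in> \<phi> ` nb y"
            using B_T1[OF y] w(3) by (auto split: if_splits)
          also have "\<dots> \<longleftrightarrow> x \<in> nb y"
          proof
            assume "\<phi> x \<in> \<phi> ` nb y"
            then obtain z where z: "z \<in> nb y" "\<phi> x = \<phi> z" by auto
            have "y \<in> T" "sd y" using y by (auto simp: T1_def)
            then have "z \<in> T" "\<not> sd z" using nb_T nb_side z(1) by blast+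
            then have "x = z"
              using admissible_inj[OF adm xT _ _ z(2)] False by auto
            then show "x \<in> nb y" using z by simp
          qed auto
          finally show ?thesis .
        qed
        have "v \<in> \<phi> ` T1" if "v < n1" "\<phi> x \<in> S v" for v
          using S[OF that(1)] B_out[of v] w(3) that(2) by auto
        then have "{v. v < n1 \<and> \<phi> x \<in> S v} = \<phi> ` {y \<in> T1. x \<in> nb y}"
          using mem T1_sub by auto
        also have "{y \<in> T1. x \<in> nb y} = nb x"
          using nb_sym nb_T nb_side xT False by (fastforce simp: T1_def)
        finally show ?thesis
          using N2[OF w(1)] False by simp
      qed
    qed
  qed
  have "(\<Prod>x\<in>{x \<in> I. sd x}. pmf P (card (nb x)) * fact (card (nb x)) / real n2 ^ card (nb x)) * l ^ card {x \<in> T - I. sd x} * q0 ^ n1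
    \<le> (\<Prod>x\<in>{x \<in> I. sd x}. measure_pmf.prob Q (B (\<phi> x))) * (\<Prod>x\<in>{x \<in> T - I. sd x}. measure_pmf.prob Q (B (\<phi> x))) *
      (\<Prod>v\<in>{..<n1} - \<phi> ` T1. measure_pmf.prob Q (B v))"
  proof (intro mult_mono)
    show "(\<Prod>x\<in>{x \<in> I. sd x}. pmf P (card (nb x)) * fact (card (nb x)) / real n2 ^ card (nb x))
        \<le> (\<Prod>x\<in>{x \<in> I. sd x}. measure_pmf.prob Q (B (\<phi> x)))"
    proof (intro prod_mono conjI)
      fix x assume x: "x \<in> {x \<in> I. sd x}"
      then have xT: "x \<in> T" "x \<in> T1" using IT by (auto simp: T1_def)
      have "\<phi> ` nb x \<subseteq> {..<n2}" using admissible_nb(1)[OF adm xT(1)] x by simp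
      from single[OF this] show "pmf P (card (nb x)) * fact (card (nb x)) / real n2 ^ card (nb x) \<le> measure_pmf.prob Q (B (\<phi> x))"
        using B_T1[OF xT(2)] x card_image[OF admissible_nb(2)[OF adm xT(1)]] by simp
    qed auto
    have "l ^ card {x \<in> T - I. sd x} = (\<Prod>x\<in>{x \<in> T - I. sd x}. l)" by simp
    also have "\<dots> \<le> (\<Prod>x\<in>{x \<in> T - I. sd x}. measure_pmf.prob Q (B (\<phi> x)))"
    proof (intro prod_mono conjI)
      fix x assume x: "x \<in> {x \<in> T - I. sd x}"
      then obtain y where y: "y \<in> I" "nb x = {y}" using leaf by blast
      have "\<not> sd y" using nb_side[of x y] x y by auto
      then have "\<phi> y \<in> W" using y by (auto simp: W_def J_def)
      then show "l \<le> measure_pmf.prob Q (B (\<phi> x))"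
        using once[of "\<phi> y"] B_T1[of x] x y by (auto simp: T1_def)
      show "0 \<le> l" unfolding l_def by (intro sum_nonneg mult_nonneg_nonneg divide_nonneg_nonneg) auto
    qed
    finally show "l ^ card {x \<in> T - I. sd x} \<le> (\<Prod>x\<in>{x \<in> T - I. sd x}. measure_pmf.prob Q (B (\<phi> x)))" .
    \<comment> \<open>As \<open>q0\<close> is at most one, raising the exponent to the full vertex
      count only loses a little and removes the dependence on the placement.\<close>
    have "q0 ^ n1 \<le> q0 ^ card ({..<n1} - \<phi> ` T1)"
      using q0 card_mono[of "{..<n1}" "{..<n1} - \<phi> ` T1"] by (intro power_decreasing) auto
    also have "\<dots> = (\<Prod>v\<in>{..<n1} - \<phi> ` T1. q0)" by simp
    also have "\<dots> \<le> (\<Prod>v\<in>{..<n1} - \<phi> ` T1. measure_pmf.prob Q (B v))"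
      using q0 avoid B_out by (intro prod_mono) auto
    finally show "q0 ^ n1 \<le> (\<Prod>v\<in>{..<n1} - \<phi> ` T1. measure_pmf.prob Q (B v))" .
    show "0 \<le> l ^ card {x \<in> T - I. sd x}"
      unfolding l_def by (intro zero_le_power sum_nonneg mult_nonneg_nonneg divide_nonneg_nonneg) auto
  qed (use q0 in \<open>auto intro!: prod_nonneg mult_nonneg_nonneg\<close>)
  also have "\<dots> = (\<Prod>v<n1. measure_pmf.prob Q (B v))"
  proof -
    have "T1 = {x \<in> I. sd x} \<union> {x \<in> T - I. sd x}" using IT by (auto simp: T1_def)
    then have "(\<Prod>x\<in>{x \<in> I. sd x}. measure_pmf.prob Q (B (\<phi> x))) * (\<Prod>x\<in>{x \<in> T - I. sd x}. measure_pmf.prob Q (B (\<phi> x)))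
        = (\<Prod>x\<in>T1. measure_pmf.prob Q (B (\<phi> x)))"
      using fin IT finite_subset[OF IT fin] by (simp only:) (rule prod.union_disjoint[symmetric], auto)
    also have "\<dots> = (\<Prod>v\<in>\<phi> ` T1. measure_pmf.prob Q (B v))"
      by (simp add: prod.reindex[OF injT1])
    finally show ?thesis
      using prod.subset_diff[OF T1_sub, of "\<lambda>v. measure_pmf.prob Q (B v)"] by (simp add: mult.commute)
  qed
  also have "\<dots> = measure_pmf.prob (Pi_pmf {..<n1} {} (\<lambda>_. Q)) (Pi {..<n1} B)"
    by (rule measure_Pi_pmf_Pi[symmetric]) simp
  also have "\<dots> \<le> measure_pmf.prob (Pi_pmf {..<n1} {} (\<lambda>_. Q)) (?h -` {H. exact H \<phi>})"
    by (intro measure_pmf.finite_measure_mono) (auto intro: exact)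
  also have "\<dots> = measure_pmf.prob (active_law n1 n2 P) {H. exact H \<phi>}"
    by (simp add: active_law_def Q_def)
  finally show ?thesis
    unfolding l_def q0_def J_def .
qed

end

text \<open>Poisson weights \<open>fact k * pmf k\<close> are
  \<open>\<theta> ^ k * exp (- \<theta>)\<close>, so the contributions of \<open>part2\<close>
  collect to \<open>\<theta> ^ edges\<close> and one exponential per inner node. The exponentials
  come from outside vertices avoiding those nodes, the powers from comparing the number of edges
  with \<open>n2\<close>.\<close>

lemma active_pattern_bound:
  fixes n1 n2 :: "nat \<Rightarrow> nat" and P :: "nat \<Rightarrow> nat pmf"
  assumes pos: "\<And>n. 0 < n1 n" "\<And>n. 0 < n2 n"
    and lim: "filterlim n1 at_top sequentially" "filterlim n2 at_top sequentially"
    and ratio: "(\<lambda>n. real (n2 n) / real (n1 n)) \<longlonglongrightarrow> \<beta>" "0 < \<beta>"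
    and supp: "\<And>n. set_pmf (P n) \<subseteq> {..n2 n}"
    and D1: "has_pos_finite_mean D1"
    and mean: "(\<lambda>n. mean (P n)) \<longlonglongrightarrow> mean D1"
    and pmf: "\<And>k. (\<lambda>n. pmf (P n) k) \<longlonglongrightarrow> pmf D1 k"
  shows "pattern_bound (\<lambda>n. measure_pmf (active_law (n1 n) (n2 n) (P n))) (\<lambda>n s. if s then n1 n else n2 n)
    (\<lambda>s. if s then D1 else poisson_pmf (mean D1 / \<beta>))"
  unfolding pattern_bound_def
proof (intro allI impI)
  fix T I nb sd a
  let ?D = "\<lambda>s. if s then D1 else poisson_pmf (mean D1 / \<beta>)"
  assume pat: "pattern T I nb sd" and a: "a < pattern.weight T I nb sd ?D"
  interpret pattern T I nb sd by (rule pat)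
  define \<theta> where "\<theta> = mean D1 / \<beta>"
  define J where "J = {x \<in> I. sd x}"
  define K where "K = {x \<in> T - I. sd x}"
  define b where "b = card {x \<in> I. \<not> sd x}"
  define A where "A = (\<Prod>x\<in>J. fact (card (nb x)) * pmf D1 (card (nb x)))"
  have m: "0 < mean D1" using D1 by (simp add: has_pos_finite_mean_def)
  then have l0: "0 < \<theta>" using ratio by (simp add: \<theta>_def)
  have weight: "weight ?D = A * mean D1 ^ card K * \<theta> ^ edges * exp (- (real b * \<theta>))"
  proof -
    have "(\<Prod>x\<in>{x \<in> I. \<not> sd x}. fact (card (nb x)) * pmf (poisson_pmf \<theta>) (card (nb x))) =
        (\<Prod>x\<in>{x \<in> I. \<not> sd x}. \<theta> ^ card (nb x) * exp (- \<theta>))"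
      using l0 by (intro prod.cong) auto
    also have "\<dots> = \<theta> ^ (\<Sum>x\<in>{x \<in> I. \<not> sd x}. card (nb x)) * exp (- \<theta>) ^ b"
      by (simp add: prod.distrib power_sum b_def)
    also have "exp (- \<theta>) ^ b = exp (- (real b * \<theta>))"
      by (simp add: exp_of_nat_mult[symmetric])
    finally show ?thesis
      unfolding weight_split edges_split' using l0
      by (simp add: A_def J_def K_def \<theta>_def[symmetric] mean_poisson power_add)
  qed
  have "(\<lambda>M. A * (\<Sum>k\<le>M. real k * pmf D1 k) ^ card K * \<theta> ^ edges * exp (- (real b * \<theta>))) \<longlonglongrightarrow> weight ?D"
    unfolding weight by (intro tendsto_intros mean_partial_sums D1)
  then have "\<forall>\<^sub>F M in sequentially. a < A * (\<Sum>k\<le>M. real k * pmf D1 k) ^ card K * \<theta> ^ edges * exp (- (real b * \<theta>))"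
    using a by (rule order_tendstoD)
  \<comment> \<open>Cap on the sizes drawn at leaves: the truncated mean is already large enough for
    \<open>a\<close>.\<close>
  then obtain M where M: "a < A * (\<Sum>k\<le>M. real k * pmf D1 k) ^ card K * \<theta> ^ edges * exp (- (real b * \<theta>))"
    by (auto simp: eventually_sequentially)
  define z where "z n = real b * (mean (P n) / real (n2 n))" for n
  have inv: "(\<lambda>n. real (n1 n) / real (n2 n)) \<longlonglongrightarrow> 1 / \<beta>"
  proof -
    have "(\<lambda>n. 1 / (real (n2 n) / real (n1 n))) \<longlonglongrightarrow> 1 / \<beta>"
      by (intro tendsto_divide tendsto_const ratio) (use ratio in auto)
    then show ?thesis by simp
  qed
  have "(\<lambda>n. real b * (mean (P n) * (real (n1 n) / real (n2 n)))) \<longlonglongrightarrow> real b * (mean D1 * (1 / \<beta>))"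
    by (intro tendsto_mult tendsto_const mean inv)
  then have nz: "(\<lambda>n. real (n1 n) * z n) \<longlonglongrightarrow> real b * \<theta>"
    by (simp add: z_def \<theta>_def mult_ac)
  obtain g where g: "g \<longlonglongrightarrow> exp (- (real b * \<theta>))" "\<forall>\<^sub>F n in sequentially. g n \<le> (1 - z n) ^ n1 n \<and> z n < 1"
    by (rule tendsto_exp_power[OF nz lim(1)])
  let ?l = "\<lambda>n. \<Sum>j<M. pmf (P n) (Suc j) * (real (n2 n - b choose j) / real (n2 n choose Suc j))"
  let ?m = "\<lambda>n. real (n1 n) * mean D1"
  \<comment> \<open>The bound of \<open>active_exact_ge\<close> times \<open>?m n ^ edges\<close>,
    with \<open>g n\<close> for the avoidance factor and the powers of \<open>n2\<close>
    redistributed so that every factor converges: a leaf of \<open>part1\<close> receives one power,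
    while the edges take all of them through \<open>?m n / n2\<close>.\<close>
  let ?X = "\<lambda>n. (\<Prod>x\<in>J. pmf (P n) (card (nb x)) * fact (card (nb x))) * (real (n2 n) * ?l n) ^ card K *
      (?m n / real (n2 n)) ^ edges * g n"
  have "(\<lambda>n. \<Sum>j<M. pmf (P n) (Suc j) * (real (n2 n) * real (n2 n - b choose j) / real (n2 n choose Suc j)))
      \<longlonglongrightarrow> (\<Sum>j<M. pmf D1 (Suc j) * real (Suc j))"
    by (intro tendsto_sum tendsto_mult pmf tendsto_binomial_ratio lim)
  moreover have "(\<Sum>j<M. pmf (P n) (Suc j) * (real (n2 n) * real (n2 n - b choose j) / real (n2 n choose Suc j))) = real (n2 n) * ?l n" for n
    by (simp add: sum_distrib_left mult_ac del: binomial_Suc_Suc)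
  moreover have "(\<Sum>j<M. pmf D1 (Suc j) * real (Suc j)) = (\<Sum>k\<le>M. real k * pmf D1 k)"
    by (simp add: sum.atMost_shift mult.commute del: of_nat_Suc)
  ultimately have l: "(\<lambda>n. real (n2 n) * ?l n) \<longlonglongrightarrow> (\<Sum>k\<le>M. real k * pmf D1 k)"
    by simp
  have ml: "(\<lambda>n. ?m n / real (n2 n)) \<longlonglongrightarrow> \<theta>"
    using tendsto_mult[OF inv tendsto_const[of "mean D1"]] by (simp add: \<theta>_def)
  have "?X \<longlonglongrightarrow> (\<Prod>x\<in>J. pmf D1 (card (nb x)) * fact (card (nb x))) * (\<Sum>k\<le>M. real k * pmf D1 k) ^ card K * \<theta> ^ edges * exp (- (real b * \<theta>))"
    by (intro tendsto_intros tendsto_prod pmf l ml g)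
  then have "\<forall>\<^sub>F n in sequentially. a < ?X n"
    using M by (intro order_tendstoD) (simp_all add: A_def mult.commute)
  then show "\<forall>\<^sub>F n in sequentially. \<forall>\<phi>. admissible (\<lambda>s. if s then n1 n else n2 n) \<phi> \<longrightarrow>
      a < measure_pmf.prob (active_law (n1 n) (n2 n) (P n)) {H. exact H \<phi>} *
        (real (if True then n1 n else n2 n) * mean (if True then D1 else poisson_pmf (mean D1 / \<beta>))) ^ edges"
    using g(2) filterlim_at_top[THEN iffD1, OF lim(2), rule_format, of M]
  proof eventually_elim
    case (elim n)
    show ?case
    proof (intro allI impI)
      fix \<phi> assume adm: "admissible (\<lambda>s. if s then n1 n else n2 n) \<phi>"
      have "?X n \<le> (\<Prod>x\<in>J. pmf (P n) (card (nb x)) * fact (card (nb x))) * (real (n2 n) * ?l n) ^ card K *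
          (?m n / real (n2 n)) ^ edges * (1 - z n) ^ n1 n"
        using elim m by (intro mult_left_mono) (auto intro!: mult_nonneg_nonneg prod_nonneg sum_nonneg zero_le_power simp del: binomial_Suc_Suc)
      also have "\<dots> = ((\<Prod>x\<in>J. pmf (P n) (card (nb x)) * fact (card (nb x)) / real (n2 n) ^ card (nb x)) *
          ?l n ^ card K * (1 - z n) ^ n1 n) * ?m n ^ edges"
      proof -
        have "(\<Prod>x\<in>J. pmf (P n) (card (nb x)) * fact (card (nb x)) / real (n2 n) ^ card (nb x)) =
            (\<Prod>x\<in>J. pmf (P n) (card (nb x)) * fact (card (nb x))) / real (n2 n) ^ (\<Sum>x\<in>J. card (nb x))"
          by (simp only: prod_dividef power_sum)
        moreover have "edges = (\<Sum>x\<in>J. card (nb x)) + card K"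
          using edges_split by (simp add: J_def K_def)
        moreover have "x * (y * l) ^ k * (mm / y) ^ (i + k) * w = x / y ^ i * l ^ k * w * mm ^ (i + k)"
          if "y \<noteq> 0" for x y l mm w :: real and i k
          using that by (simp add: power_mult_distrib power_divide power_add)
        ultimately show ?thesis
          using pos(2)[of n] by simp
      qed
      also have "\<dots> \<le> measure_pmf.prob (active_law (n1 n) (n2 n) (P n)) {H. exact H \<phi>} * ?m n ^ edges"
        using active_exact_ge[OF adm supp, of M] elim pos m
        by (intro mult_right_mono) (auto simp: J_def K_def b_def z_def)
      finally show "a < measure_pmf.prob (active_law (n1 n) (n2 n) (P n)) {H. exact H \<phi>} *
        (real (if True then n1 n else n2 n) * mean (if True then D1 else poisson_pmf (mean D1 / \<beta>))) ^ edges"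
        using elim by simp
    qed
  qed
qed

text \<open>Here the graph itself is the underlying randomness, explored with sorted neighbour
  lists.\<close>

lemma exchangeable_limit:
  fixes L :: "nat \<Rightarrow> (nat, nat) bigraph measure"
  assumes prob: "\<And>n. prob_space (L n)" and sets: "\<And>n. sets (L n) = UNIV"
    and pos: "\<And>n. 0 < n1 n" "\<And>n. 0 < n2 n"
    and lim: "filterlim n1 at_top sequentially" "filterlim n2 at_top sequentially"
    and ratio: "(\<lambda>n. real (n2 n) / real (n1 n)) \<longlonglongrightarrow> mean D1 / mean D2"
    and D: "has_pos_finite_mean D1" "has_pos_finite_mean D2"
    and pb: "pattern_bound L (\<lambda>n s. if s then n1 n else n2 n) (\<lambda>s. if s then D1 else D2)"
    and parts: "\<And>n. AE H in L n. part1 H = {..<n1 n} \<and> part2 H = {..<n2 n}"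
  shows "weak_conv_m (\<lambda>n. X1_law (n1 n) (L n)) (real_law D1)"
    and "weak_conv_m (\<lambda>n. X2_law (n2 n) (L n)) (real_law D2)"
    and "local_conv_in_prob TYPE('h) L (\<lambda>_. intersection_graph) (gw_space D1 D2) clique_tree"
proof -
  let ?N = "\<lambda>n s. if s then n1 n else n2 n" and ?D = "\<lambda>s. if s then D1 else D2"
  let ?nb = "\<lambda>n H s u. sorted_list_of_set (nbrs H s u)"
  have fb: "forest_bound L ?nb ?N ?D"
  proof (rule forest_bound_of_pattern_bound[OF prob sets _ _ _ _ pb])
    show "filterlim (\<lambda>n. ?N n s) at_top sequentially" for s
      using lim by (cases s) auto
  qed (use pos ratio D in auto)
  have L: "L n = distr (L n) (count_space UNIV) (\<lambda>H. H)" for n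
    by (rule distr_id2[symmetric]) (simp add: sets)
  have graph: "AE H in L n. part1 H = {..<?N n True} \<and> part2 H = {..<?N n False} \<and>
      (\<forall>s u. u < ?N n s \<longrightarrow> set (?nb n H s u) = nbrs H s u)" for n
    using parts[of n] by eventually_elim (auto simp: nbrs_def nbrs1_def nbrs2_def)
  have pos': "0 < ?N n s" for n s using pos by simp
  note * = local_limit[OF prob sets pos' fb L graph]
  show "weak_conv_m (\<lambda>n. X1_law (n1 n) (L n)) (real_law D1)"
    using *(1) by simp
  show "weak_conv_m (\<lambda>n. X2_law (n2 n) (L n)) (real_law D2)"
    using *(2) by simp
  show "local_conv_in_prob TYPE('h) L (\<lambda>_. intersection_graph) (gw_space D1 D2) clique_tree"
    using *(3) by simp
qed

section \<open>The degree law of the active model\<close>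

lemma real_distribution_degree_law:
  assumes "prob_space L" "sets L = UNIV" "0 < n"
  shows "real_distribution (degree_law s n L)"
proof -
  interpret pair_prob_space L "measure_pmf (pmf_of_set {..<n})"
    using assms(1) by (simp add: pair_prob_space_def pair_sigma_finite_def prob_space_imp_sigma_finite
      measure_pmf.prob_space_axioms)
  show ?thesis
    unfolding degree_law_def real_distribution_def real_distribution_axioms_def
    using prob_space_distr[OF measurable_degree[OF assms]] by simp
qed

lemma real_distribution_real_law: "real_distribution (real_law D)"
  unfolding real_law_def real_distribution_def real_distribution_axioms_def
  by (auto intro: measure_pmf.prob_space_distr)

text \<open>Translates hypotheses on the degree of a random vertex into hypotheses on
  \<open>P\<close>: each vertex of \<open>part1\<close> has a degree distributed as
  \<open>P\<close>, so averaging over the vertex changes nothing.\<close>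

lemma degree_law_active:
  assumes supp: "set_pmf P \<subseteq> {..n2}" and n1: "0 < n1"
  shows "degree_law True n1 (measure_pmf (active_law n1 n2 P)) = real_law P"
proof (rule cdf_unique[OF real_distribution_degree_law real_distribution_real_law], goal_cases)
  case 4
  show ?case
  proof
    fix x
    let ?Q = "bind_pmf P (uniform_subset n2)"
    let ?L = "active_law n1 n2 P"
    let ?E = "\<lambda>u. {H. real (card (nbrs H True u)) \<le> x}"
    let ?A = "{S. real (card {w. w < n2 \<and> w \<in> S}) \<le> x}"
    have U: "measure_pmf.prob (uniform_subset n2 k) ?A = of_bool (real k \<le> x)" if "k \<le> n2" for k
    proof -
      have "{w. w < n2 \<and> w \<in> S} = S" if "S \<subseteq> {..<n2}" for S using that by auto
      then have "{S. S \<subseteq> {..<n2} \<and> card S = k} \<inter> ?A = (if real k \<le> x then {S. S \<subseteq> {..<n2} \<and> card S = k} else {})"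
        by auto
      then show ?thesis
        using that measure_uniform_subset[OF that, of ?A] n_subsets[of "{..<n2}" k] zero_less_binomial[OF that]
        by (simp del: zero_less_binomial_iff)
    qed
    have "measure_pmf.prob ?L (?E u) = measure_pmf.prob P {k. real k \<le> x}" if u: "u < n1" for u
    proof -
      have "measure_pmf.prob ?L (?E u) = measure_pmf.prob (Pi_pmf {..<n1} {} (\<lambda>_. ?Q)) {S. S u \<in> ?A}"
        using u by (simp add: active_law_def vimage_def nbrs_def nbrs1_def simple_bigraph_def)
      also have "\<dots> = measure_pmf.prob (map_pmf (\<lambda>S. S u) (Pi_pmf {..<n1} {} (\<lambda>_. ?Q))) ?A"
        by (simp add: vimage_def)
      also have "\<dots> = measure_pmf.prob ?Q ?A"
        using u by (simp add: Pi_pmf_component)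
      also have "\<dots> = (\<integral>k. indicator {k. real k \<le> x} k \<partial>measure_pmf P)"
        unfolding measure_bind_pmf
        by (rule integral_cong_AE) (use supp in \<open>auto simp: AE_measure_pmf_iff U indicator_def\<close>)
      finally show ?thesis by simp
    qed
    note E = this
    have "cdf (degree_law True n1 (measure_pmf ?L)) x =
        (\<integral>H. real (card {u. u < n1 \<and> real (card (nbrs H True u)) \<le> x}) / real n1 \<partial>measure_pmf ?L)"
      by (rule cdf_degree_law) (use n1 in \<open>auto intro: measure_pmf.prob_space_axioms\<close>)
    also have "\<dots> = (\<integral>H. (\<Sum>u<n1. indicator (?E u) H) / real n1 \<partial>measure_pmf ?L)"
      by (intro Bochner_Integration.integral_cong refl arg_cong2[where f = "(/)"])
         (simp add: indicator_def sum.If_cases Int_def)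
    also have "\<dots> = (\<Sum>u<n1. measure_pmf.prob ?L (?E u)) / real n1"
      by (subst integral_divide_zero, subst Bochner_Integration.integral_sum) 
         (auto intro!: measure_pmf.integrable_const_bound[of _ 1] simp: indicator_def)
    also have "\<dots> = measure_pmf.prob P {k. real k \<le> x}"
      using n1 E by simp
    finally show "cdf (degree_law True n1 (measure_pmf ?L)) x = cdf (real_law P) x"
      by (simp add: cdf_real_law)
  qed
qed (use n1 in \<open>auto intro: measure_pmf.prob_space_axioms\<close>)

lemma mean_real_law: "(\<integral>x. x \<partial>real_law P) = mean P"
  unfolding real_law_def by (subst integral_distr) auto

lemma active_limit:
  fixes n1 n2 :: "nat \<Rightarrow> nat" and P :: "nat \<Rightarrow> nat pmf"
  assumes pos: "\<And>n. 0 < n1 n" "\<And>n. 0 < n2 n"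
    and lim: "filterlim n1 at_top sequentially" "filterlim n2 at_top sequentially"
    and ratio: "(\<lambda>n. real (n2 n) / real (n1 n)) \<longlonglongrightarrow> \<beta>" "0 < \<beta>"
    and supp: "\<And>n. set_pmf (P n) \<subseteq> {..n2 n}" and L: "\<And>n. L n = measure_pmf (active_law (n1 n) (n2 n) (P n))"
    and D1: "has_pos_finite_mean D1"
    and mean: "(\<lambda>n. \<integral>x. x \<partial>X1_law (n1 n) (L n)) \<longlonglongrightarrow> mean D1"
    and conv: "weak_conv_m (\<lambda>n. X1_law (n1 n) (L n)) (real_law D1)"
    and D2: "D2 = poisson_pmf (mean D1 / \<beta>)"
  shows "pattern_bound L (\<lambda>n s. if s then n1 n else n2 n) (\<lambda>s. if s then D1 else D2)"
    and "has_pos_finite_mean D2" and "mean D1 / mean D2 = \<beta>"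
    and "AE H in L n. part1 H = {..<n1 n} \<and> part2 H = {..<n2 n}"
proof -
  have X: "X1_law (n1 n) (L n) = real_law (P n)" for n
    unfolding X1_law_eq L by (rule degree_law_active[OF supp pos(1)])
  have m: "0 < mean D1" using D1 by (simp add: has_pos_finite_mean_def)
  show "pattern_bound L (\<lambda>n s. if s then n1 n else n2 n) (\<lambda>s. if s then D1 else D2)"
    unfolding L[abs_def] D2
    by (rule active_pattern_bound[OF pos lim ratio supp D1])
       (use mean conv in \<open>simp_all add: X mean_real_law pmf_tendsto_of_weak_conv\<close>)
  show "has_pos_finite_mean D2" "mean D1 / mean D2 = \<beta>"
    unfolding D2 using m ratio(2) by (simp_all add: mean_poisson has_pos_finite_mean_poisson)
  show "AE H in L n. part1 H = {..<n1 n} \<and> part2 H = {..<n2 n}"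
    unfolding L by (auto simp: AE_measure_pmf_iff active_law_def simple_bigraph_def)
qed

section \<open>The passive model by exchange of the two sides\<close>

definition swap_bigraph :: "('a, 'b) bigraph \<Rightarrow> ('b, 'a) bigraph" where
  "swap_bigraph H = \<lparr>part1 = part2 H, part2 = part1 H, mult = (\<lambda>u w. mult H w u)\<rparr>"

lemma nbrs_swap: "nbrs (swap_bigraph H) s u = nbrs H (\<not> s) u"
  by (simp add: nbrs_def nbrs1_def nbrs2_def swap_bigraph_def)

lemma passive_law_eq:
  "measure_pmf (passive_law n1 n2 P) = distr (measure_pmf (active_law n2 n1 P)) (count_space UNIV) swap_bigraph"
proof -
  have "passive_law n1 n2 P = map_pmf swap_bigraph (active_law n2 n1 P)"
    unfolding passive_law_def active_law_def pmf.map_comp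
    by (intro map_pmf_cong refl) (auto simp: swap_bigraph_def simple_bigraph_def fun_eq_iff)
  then show ?thesis
    by (simp add: map_pmf_rep_eq)
qed

lemma degree_law_swap:
  assumes "prob_space L" "sets L = UNIV" "0 < n"
  shows "degree_law s n (distr L (count_space UNIV) swap_bigraph) = degree_law (\<not> s) n L"
proof -
  have "space L = UNIV"
    using assms(2) by (metis UNIV_I sets.sets_into_space top.extremum_uniqueI)
  then have h: "swap_bigraph \<in> measurable L (count_space UNIV)"
    by (auto simp: measurable_def assms(2))
  have d: "prob_space (distr L (count_space UNIV) swap_bigraph)" "sets (distr L (count_space UNIV) swap_bigraph) = UNIV"
    using prob_space.prob_space_distr[OF assms(1) h] by auto
  have "cdf (degree_law s n (distr L (count_space UNIV) swap_bigraph)) = cdf (degree_law (\<not> s) n L)"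
    unfolding cdf_degree_law[OF d assms(3), abs_def] cdf_degree_law[OF assms, abs_def]
    by (subst integral_distr[OF h]) (simp_all add: nbrs_swap)
  then show ?thesis
    by (intro cdf_unique real_distribution_degree_law d assms)
qed

text \<open>\<open>forest_bound\<close> treats both sides alike, whereas the normalisation of
  \<open>pattern_bound\<close> refers to \<open>part1\<close>; hence the exchange is carried out at
  this level.\<close>

lemma forest_bound_swap:
  assumes "forest_bound M nb N D"
  shows "forest_bound M (\<lambda>n \<omega> s. nb n \<omega> (\<not> s)) (\<lambda>n s. N n (\<not> s)) (\<lambda>s. D (\<not> s))"
proof -
  have eq: "(\<not> (s \<longleftrightarrow> b)) = ((\<not> s) \<longleftrightarrow> b)" for s b by auto
  have "forest_emb (\<lambda>s. nb' (\<not> s)) s R c \<phi> = forest_emb nb' (\<not> s) R c \<phi>" for nb' s R c \<phi>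
    unfolding forest_emb_def eq by (rule refl)
  note emb = this
  have maps: "forest_maps (\<lambda>s. N' (\<not> s)) s R c = forest_maps N' (\<not> s) R c" for N' s R c
    unfolding forest_maps_def eq by (rule refl)
  show ?thesis
    unfolding forest_bound_def
  proof (intro allI impI)
    fix s R c a
    assume "0 < R" "c [] = 2"
      "a < (\<Prod>x\<in>forest_inner R c. pmf (offspring_law (D (\<not> s)) (D (\<not> \<not> s)) (length x - 1)) (c x))"
    with assms[unfolded forest_bound_def, THEN spec, of "\<not> s", THEN spec, of R, THEN spec, of c, THEN spec, of a]
    show "\<forall>\<^sub>F n in sequentially. a < (\<Sum>\<phi>\<in>forest_maps (\<lambda>s. N n (\<not> s)) s R c.
        measure (M n) {\<omega>. forest_emb (\<lambda>s. nb n \<omega> (\<not> s)) s R c \<phi>}) / (real (N n (\<not> s)))\<^sup>2"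
      unfolding emb maps by blast
  qed
qed

text \<open>The passive model is the active one seen from the other side, with limiting ratio
  \<open>1 / \<beta>\<close>. The bound for \<open>M\<close> covers trees rooted on either side, so
  after the swap it describes neighbourhoods of vertices of \<open>part1\<close>.\<close>

lemma passive_limit:
  fixes n1 n2 :: "nat \<Rightarrow> nat" and P :: "nat \<Rightarrow> nat pmf"
  assumes pos: "\<And>n. 0 < n1 n" "\<And>n. 0 < n2 n"
    and lim: "filterlim n1 at_top sequentially" "filterlim n2 at_top sequentially"
    and ratio: "(\<lambda>n. real (n2 n) / real (n1 n)) \<longlonglongrightarrow> \<beta>" "0 < \<beta>"
    and supp: "\<And>n. set_pmf (P n) \<subseteq> {..n1 n}" and L: "\<And>n. L n = measure_pmf (passive_law (n1 n) (n2 n) (P n))"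
    and D2: "has_pos_finite_mean D2"
    and mean: "(\<lambda>n. \<integral>x. x \<partial>X2_law (n2 n) (L n)) \<longlonglongrightarrow> mean D2"
    and conv: "weak_conv_m (\<lambda>n. X2_law (n2 n) (L n)) (real_law D2)"
    and D1: "D1 = poisson_pmf (\<beta> * mean D2)"
  shows "weak_conv_m (\<lambda>n. X1_law (n1 n) (L n)) (real_law D1)"
    and "weak_conv_m (\<lambda>n. X2_law (n2 n) (L n)) (real_law D2)"
    and "local_conv_in_prob TYPE('h) L (\<lambda>_. intersection_graph) (gw_space D1 D2) clique_tree"
proof -
  define M where "M n = measure_pmf (active_law (n2 n) (n1 n) (P n))" for n
  have LM: "L n = distr (M n) (count_space UNIV) swap_bigraph" for n
    unfolding L M_def by (rule passive_law_eq)
  have prob: "prob_space (M n)" and sets: "sets (M n) = UNIV" for n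
    by (simp_all add: M_def measure_pmf.prob_space_axioms)
  have X: "X2_law (n2 n) (L n) = X1_law (n2 n) (M n)" for n
    unfolding X1_law_eq X2_law_eq LM using degree_law_swap[OF prob sets pos(2), of False n n] by simp
  have inv: "(\<lambda>n. real (n1 n) / real (n2 n)) \<longlonglongrightarrow> 1 / \<beta>"
  proof -
    have "(\<lambda>n. 1 / (real (n2 n) / real (n1 n))) \<longlonglongrightarrow> 1 / \<beta>"
      by (intro tendsto_divide tendsto_const ratio) (use ratio in auto)
    then show ?thesis by simp
  qed
  have b: "0 < 1 / \<beta>" using ratio by simp
  have D1': "D1 = poisson_pmf (mean D2 / (1 / \<beta>))" by (simp add: D1 mult.commute)
  note active = active_limit[OF pos(2,1) lim(2,1) inv b supp M_def D2 mean[unfolded X] conv[unfolded X] D1']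
  let ?N = "\<lambda>n s. if s then n2 n else n1 n" and ?D = "\<lambda>s. if s then D2 else D1"
  have "forest_bound M (\<lambda>n H s u. sorted_list_of_set (nbrs H s u)) ?N ?D"
  proof (rule forest_bound_of_pattern_bound[OF prob sets _ _ _ _ active(1)])
    show "filterlim (\<lambda>n. ?N n s) at_top sequentially" for s
      using lim by (cases s) auto
  qed (use pos inv active(2,3) D2 in auto)
  from forest_bound_swap[OF this]
  have fb: "forest_bound M (\<lambda>n H s u. sorted_list_of_set (nbrs H (\<not> s) u)) (\<lambda>n s. ?N n (\<not> s)) (\<lambda>s. ?D (\<not> s))" .
  have graph: "AE H in M n. part1 (swap_bigraph H) = {..<?N n (\<not> True)} \<and> part2 (swap_bigraph H) = {..<?N n (\<not> False)} \<and>
      (\<forall>s u. u < ?N n (\<not> s) \<longrightarrow> set (sorted_list_of_set (nbrs H (\<not> s) u)) = nbrs (swap_bigraph H) s u)" for n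
    using active(4)[of n]
    by eventually_elim (auto simp: nbrs_swap nbrs_def nbrs1_def nbrs2_def swap_bigraph_def)
  have pos': "0 < ?N n (\<not> s)" for n s using pos by simp
  note * = local_limit[OF prob sets pos' fb LM graph]
  show "weak_conv_m (\<lambda>n. X1_law (n1 n) (L n)) (real_law D1)"
    using *(1) by simp
  show "weak_conv_m (\<lambda>n. X2_law (n2 n) (L n)) (real_law D2)"
    by (rule conv)
  show "local_conv_in_prob TYPE('h) L (\<lambda>_. intersection_graph) (gw_space D1 D2) clique_tree"
    using *(3) by simp
qed

section \<open>The configuration model\<close>

lemma perfect_matchings_iff:
  "m \<in> perfect_matchings A B \<longleftrightarrow> m \<subseteq> A \<times> B \<and> (\<forall>a\<in>A. \<exists>b. (a, b) \<in> m) \<and> (\<forall>b\<in>B. \<exists>a. (a, b) \<in> m) \<and>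
     (\<forall>a b b'. (a, b) \<in> m \<longrightarrow> (a, b') \<in> m \<longrightarrow> b = b') \<and> (\<forall>a a' b. (a, b) \<in> m \<longrightarrow> (a', b) \<in> m \<longrightarrow> a = a')"
  (is "?L \<longleftrightarrow> ?R")
proof
  assume ?L
  then have sub: "m \<subseteq> A \<times> B" and e: "\<And>a. a \<in> A \<Longrightarrow> \<exists>!b. (a, b) \<in> m" "\<And>b. b \<in> B \<Longrightarrow> \<exists>!a. (a, b) \<in> m"
    by (simp_all add: perfect_matchings_def)
  have "b = b'" if "(a, b) \<in> m" "(a, b') \<in> m" for a b b'
    using that sub e(1)[of a] by auto
  moreover have "a = a'" if "(a, b) \<in> m" "(a', b) \<in> m" for a a' b
    using that sub e(2)[of b] by auto
  ultimately show ?R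
    using sub ex1_implies_ex[OF e(1)] ex1_implies_ex[OF e(2)] by simp
next
  assume R: ?R
  then have "\<exists>!b. (a, b) \<in> m" if "a \<in> A" for a
    using that by metis
  moreover have "\<exists>!a. (a, b) \<in> m" if "b \<in> B" for b
    using R that by metis
  ultimately show ?L
    using R by (simp add: perfect_matchings_def)
qed

lemma perfect_matchings_insert:
  assumes m: "m \<in> perfect_matchings (A - {a}) (B - {b})" and ab: "a \<in> A" "b \<in> B"
  shows "insert (a, b) m \<in> perfect_matchings A B"
proof -
  have sub: "m \<subseteq> (A - {a}) \<times> (B - {b})"
    and e: "\<And>x. x \<in> A \<Longrightarrow> x \<noteq> a \<Longrightarrow> \<exists>y. (x, y) \<in> m" "\<And>y. y \<in> B \<Longrightarrow> y \<noteq> b \<Longrightarrow> \<exists>x. (x, y) \<in> m"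
    and u: "\<And>x y y'. (x, y) \<in> m \<Longrightarrow> (x, y') \<in> m \<Longrightarrow> y = y'" "\<And>x x' y. (x, y) \<in> m \<Longrightarrow> (x', y) \<in> m \<Longrightarrow> x = x'"
    using m unfolding perfect_matchings_iff by simp_all
  have out: "(a, y) \<notin> m" "(x, b) \<notin> m" for x y
    using sub by auto
  show ?thesis
    unfolding perfect_matchings_iff
  proof (intro conjI ballI allI impI)
    show "insert (a, b) m \<subseteq> A \<times> B" using sub ab by auto
    show "\<exists>y. (x, y) \<in> insert (a, b) m" if "x \<in> A" for x
      using e(1)[OF that] by (cases "x = a") auto
    show "\<exists>x. (x, y) \<in> insert (a, b) m" if "y \<in> B" for y
      using e(2)[OF that] by (cases "y = b") auto
    show "y = y'" if "(x, y) \<in> insert (a, b) m" "(x, y') \<in> insert (a, b) m" for x y y'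
      using that out u(1)[of x y y'] by auto
    show "x = x'" if "(x, y) \<in> insert (a, b) m" "(x', y) \<in> insert (a, b) m" for x x' y
      using that out u(2)[of x y x'] by auto
  qed
qed

lemma perfect_matchings_remove:
  assumes m: "m \<in> perfect_matchings A B" and ab: "(a, b) \<in> m"
  shows "m - {(a, b)} \<in> perfect_matchings (A - {a}) (B - {b})"
proof -
  have sub: "m \<subseteq> A \<times> B"
    and e: "\<And>x. x \<in> A \<Longrightarrow> \<exists>y. (x, y) \<in> m" "\<And>y. y \<in> B \<Longrightarrow> \<exists>x. (x, y) \<in> m"
    and u: "\<And>x y y'. (x, y) \<in> m \<Longrightarrow> (x, y') \<in> m \<Longrightarrow> y = y'" "\<And>x x' y. (x, y) \<in> m \<Longrightarrow> (x', y) \<in> m \<Longrightarrow> x = x'"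
    using m unfolding perfect_matchings_iff by simp_all
  show ?thesis
    unfolding perfect_matchings_iff
  proof (intro conjI ballI allI impI)
    show "m - {(a, b)} \<subseteq> (A - {a}) \<times> (B - {b})"
      using sub u(1)[OF ab] u(2)[OF ab] by auto
    show "\<exists>y. (x, y) \<in> m - {(a, b)}" if "x \<in> A - {a}" for x
      using e(1)[of x] that by auto
    show "\<exists>x. (x, y) \<in> m - {(a, b)}" if "y \<in> B - {b}" for y
      using e(2)[of y] that by auto
    show "y = y'" if "(x, y) \<in> m - {(a, b)}" "(x, y') \<in> m - {(a, b)}" for x y y'
      using that u(1)[of x y y'] by simp
    show "x = x'" if "(x, y) \<in> m - {(a, b)}" "(x', y) \<in> m - {(a, b)}" for x x' y
      using that u(2)[of x y x'] by simp
  qed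
qed

lemma perfect_matchings_notin: "m \<in> perfect_matchings (A - {a}) (B - {b}) \<Longrightarrow> (a, b) \<notin> m"
  unfolding perfect_matchings_iff by blast

lemma inj_insert_matching: "inj_on (insert (a, b)) (perfect_matchings (A - {a}) (B - {b}))"
  by (rule inj_onI) (metis insert_ident perfect_matchings_notin)

text \<open>Matchings are split by the partner of one element; removing that pair leaves matchings
  of sets smaller by one.\<close>

lemma card_perfect_matchings:
  assumes "finite A" "finite B" "card A = card B"
  shows "card (perfect_matchings A B) = fact (card A)"
  using assms
proof (induction A arbitrary: B rule: finite_induct)
  case empty
  then have "B = {}" by simp
  then have "perfect_matchings ({} :: 'a set) B = {{}}"
    by (simp add: perfect_matchings_def)
  then show ?case by simp
next
  case (insert a A)
  let ?P = "\<lambda>b. insert (a, b) ` perfect_matchings A (B - {b})"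
  have A: "insert a A - {a} = A" using insert.hyps by auto
  have eq: "perfect_matchings (insert a A) B = (\<Union>b\<in>B. ?P b)"
  proof (intro equalityI subsetI)
    fix m assume m: "m \<in> perfect_matchings (insert a A) B"
    have "\<forall>x\<in>insert a A. \<exists>y. (x, y) \<in> m" "m \<subseteq> insert a A \<times> B"
      using m[unfolded perfect_matchings_iff] by simp_all
    then obtain b where b: "b \<in> B" "(a, b) \<in> m"
      by blast
    have "m = insert (a, b) (m - {(a, b)})" using b by auto
    moreover have "m - {(a, b)} \<in> perfect_matchings A (B - {b})"
      using perfect_matchings_remove[OF m b(2)] A by simp
    ultimately show "m \<in> (\<Union>b\<in>B. ?P b)" using b(1) by blast
  next
    fix m assume "m \<in> (\<Union>b\<in>B. ?P b)"
    then show "m \<in> perfect_matchings (insert a A) B"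
      using perfect_matchings_insert[of _ "insert a A" a B] A by auto
  qed
  have card_P: "card (?P b) = fact (card A)" if "b \<in> B" for b
  proof -
    have "card (?P b) = card (perfect_matchings A (B - {b}))"
      using inj_insert_matching[of a b "insert a A" B] A by (simp add: card_image)
    also have "\<dots> = fact (card A)"
      using insert that by (intro insert.IH) auto
    finally show ?thesis .
  qed
  have "card (\<Union>b\<in>B. ?P b) = (\<Sum>b\<in>B. card (?P b))"
  proof (rule card_UN_disjoint)
    show "\<forall>b\<in>B. finite (?P b)"
      using insert by (auto intro!: finite_imageI finite_perfect_matchings)
    show "\<forall>b\<in>B. \<forall>b'\<in>B. b \<noteq> b' \<longrightarrow> ?P b \<inter> ?P b' = {}"
    proof (intro ballI impI, rule ccontr)
      fix b b' assume b: "b \<in> B" "b' \<in> B" "b \<noteq> b'" and "?P b \<inter> ?P b' \<noteq> {}"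
      then obtain m where "m \<in> ?P b \<inter> ?P b'"
        by (metis all_not_in_conv)
      then have m: "m \<in> ?P b" "m \<in> ?P b'"
        by (simp_all only: Int_iff)
      then have "m \<in> perfect_matchings (insert a A) B" "(a, b) \<in> m" "(a, b') \<in> m"
        using b(1) unfolding eq by blast+
      then show False
        using b(3) by (auto simp: perfect_matchings_iff)
    qed
  qed (use insert in auto)
  then have "card (perfect_matchings (insert a A) B) = card B * fact (card A)"
    unfolding eq using card_P by simp
  also have "card B = card (insert a A)"
    using insert.prems by simp
  also have "card (insert a A) * fact (card A) = fact (card (insert a A))"
    using insert.hyps by simp
  finally show ?case .
qed

text \<open>Every matching of the remaining elements can be completed by the prescribed pairs, which
  do not interfere because \<open>f\<close> and \<open>g\<close> are injective.\<close>

lemma card_matchings_extending: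
  assumes "finite A" "finite B" "card A = card B" "finite Y"
    "inj_on f Y" "inj_on g Y" "f ` Y \<subseteq> A" "g ` Y \<subseteq> B"
  shows "fact (card A - card Y) \<le> card {m \<in> perfect_matchings A B. \<forall>y\<in>Y. (f y, g y) \<in> m}"
  using assms(4,1-3,5-)
proof (induction Y arbitrary: A B rule: finite_induct)
  case empty
  then show ?case by (simp add: card_perfect_matchings)
next
  case (insert y Y)
  let ?A = "A - {f y}" and ?B = "B - {g y}"
  let ?S = "{m \<in> perfect_matchings ?A ?B. \<forall>y\<in>Y. (f y, g y) \<in> m}"
  let ?S' = "{m \<in> perfect_matchings A B. \<forall>y\<in>insert y Y. (f y, g y) \<in> m}"
  have "f ` Y \<subseteq> ?A" "g ` Y \<subseteq> ?B"
    using insert.prems insert.hyps by (simp_all add: subset_Diff_insert)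
  then have "fact (card ?A - card Y) \<le> card ?S"
    using insert.prems by (intro insert.IH) auto
  also have "card ?S = card (insert (f y, g y) ` ?S)"
    by (rule card_image[symmetric], rule inj_on_subset[OF inj_insert_matching]) auto
  also have "\<dots> \<le> card ?S'"
  proof (rule card_mono)
    show "finite ?S'"
      using insert by (intro finite_Collect_conjI disjI1) (auto intro: finite_perfect_matchings)
    show "insert (f y, g y) ` ?S \<subseteq> ?S'"
      using insert.prems by (auto intro: perfect_matchings_insert)
  qed
  finally show ?case
    using insert by simp
qed

text \<open>A falling factorial with \<open>k\<close> factors is at most \<open>n ^ k\<close>; this
  turns the share of matchings with prescribed pairs into a negative power of the number of
  half-edges.\<close>

lemma fact_le_power_mult: "k \<le> n \<Longrightarrow> (fact n :: nat) \<le> n ^ k * fact (n - k)"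
proof (induction k)
  case (Suc k)
  then have "(fact n :: nat) \<le> n ^ k * fact (n - k)" by simp
  also have "n - k = Suc (n - Suc k)" using Suc.prems by simp
  then have "(fact (n - k) :: nat) = (n - k) * fact (n - Suc k)" by (metis fact_Suc of_nat_id)
  also have "n ^ k * ((n - k) * fact (n - Suc k)) \<le> n ^ k * (n * fact (n - Suc k))"
    by (intro mult_left_mono mult_right_mono) auto
  finally show ?case by (simp add: mult_ac)
qed simp

text \<open>The index shift behind ports: if the parent sits at position \<open>h\<close> and
  nowhere else, deleting it moves all later positions down by one.\<close>

lemma remove1_map_skip:
  assumes "h \<le> k" "f h = p" "\<And>j. j < k \<Longrightarrow> f (if j < h then j else Suc j) \<noteq> p"
  shows "remove1 p (map f [0..<Suc k]) = map (\<lambda>j. f (if j < h then j else Suc j)) [0..<k]"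
proof -
  have "[0..<Suc k] = [0..<h] @ [h..<Suc k]"
    using assms(1) upt_add_eq_append[of 0 h "Suc k - h"] by (simp del: upt_Suc)
  also have "[h..<Suc k] = h # [Suc h..<Suc k]"
    using assms(1) by (simp add: upt_conv_Cons del: upt_Suc)
  finally have u: "[0..<Suc k] = [0..<h] @ h # [Suc h..<Suc k]" .
  have "f j \<noteq> p" if "j < h" for j
    using assms(3)[of j] assms(1) that by simp
  then have "p \<notin> set (map f [0..<h])"
    by fastforce
  then have "remove1 p (map f [0..<Suc k]) = map f [0..<h] @ map f [Suc h..<Suc k]"
    unfolding u using assms(2) by (simp add: remove1_append)
  also have "[Suc h..<Suc k] = map Suc [h..<k]"
    by (simp add: map_Suc_upt)
  also have "map f [0..<h] @ map f (map Suc [h..<k]) = map (\<lambda>j. f (if j < h then j else Suc j)) ([0..<h] @ [h..<k])"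
    by simp
  also have "[0..<h] @ [h..<k] = [0..<k]"
    using assms(1) upt_add_eq_append[of 0 h "k - h"] by simp
  finally show ?thesis .
qed

definition mated :: "('v \<times> 'v) set \<Rightarrow> bool \<Rightarrow> 'v \<Rightarrow> 'v \<Rightarrow> bool" where
  "mated m s h h' \<longleftrightarrow> (if s then (h, h') \<in> m else (h', h) \<in> m)"

text \<open>Half-edges come with an order, so siblings need no sorting and no sibling factorials
  appear. A multiple edge repeats its end in the list; injectivity excludes this inside an embedded
  tree.\<close>

definition half_edge_nbrs :: "(bool \<Rightarrow> nat \<Rightarrow> nat) \<Rightarrow> ((nat \<times> nat) \<times> (nat \<times> nat)) set \<Rightarrow> bool \<Rightarrow> nat \<Rightarrow> nat list" where
  "half_edge_nbrs d m s u = map (\<lambda>i. fst (THE h. mated m s (u, i) h)) [0..<d s u]"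

text \<open>The cap \<open>K\<close> on leaf degrees limits the number of half-edges per vertex, and
  hence the collisions in the greedy count.\<close>

locale config_forest =
  fixes N :: "bool \<Rightarrow> nat" and d :: "bool \<Rightarrow> nat \<Rightarrow> nat"
    and R :: nat and c :: "nat list \<Rightarrow> nat" and s :: bool and K :: nat
  assumes sums: "(\<Sum>u<N True. d True u) = (\<Sum>u<N False. d False u)"
    and R: "0 < R" and c2: "c [] = 2"
begin

abbreviation "TN \<equiv> forest_nodes R c"
abbreviation "TI \<equiv> forest_inner R c"
abbreviation "NR \<equiv> {x \<in> TN. length x \<noteq> 1}"
abbreviation "tsd x \<equiv> (s = odd (length x))"
abbreviation "HE b \<equiv> half_edges (N b) (d b)"
abbreviation "PM \<equiv> perfect_matchings (HE True) (HE False)"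

definition total :: nat where "total = (\<Sum>u<N True. d True u)"

lemma total_eq: "total = (\<Sum>u<N b. d b u)"
  using sums by (cases b) (simp_all add: total_def)

lemma HE_iff: "h \<in> HE b \<longleftrightarrow> fst h < N b \<and> snd h < d b (fst h)"
  by (cases h) (auto simp: half_edges_def)

lemma finite_HE: "finite (HE b)"
  by (simp add: half_edges_def)

lemma card_HE: "card (HE b) = total"
  unfolding half_edges_def total_eq[of b] by (subst card_SigmaI) auto

lemma finite_PM: "finite PM"
  by (rule finite_perfect_matchings) (auto simp: finite_HE card_HE)

lemma card_PM: "card PM = fact total"
  by (subst card_perfect_matchings) (auto simp: finite_HE card_HE)

lemma PM_nonempty: "PM \<noteq> {}"
  by (rule perfect_matchings_nonempty) (auto simp: finite_HE card_HE)

lemma mated_HE: "m \<in> PM \<Longrightarrow> mated m b h h' \<Longrightarrow> h \<in> HE b \<and> h' \<in> HE (\<not> b)"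
  unfolding perfect_matchings_iff mated_def by (cases b) auto

lemma mated_unique:
  assumes "m \<in> PM" "mated m b h h1" "mated m b h h2"
  shows "h1 = h2"
proof -
  from assms(1)[unfolded perfect_matchings_iff]
  have u: "\<forall>a b b'. (a, b) \<in> m \<longrightarrow> (a, b') \<in> m \<longrightarrow> b = b'" "\<forall>a a' b. (a, b) \<in> m \<longrightarrow> (a', b) \<in> m \<longrightarrow> a = a'"
    by simp_all
  show ?thesis
    using u(1)[THEN spec, THEN spec, THEN spec, of h h1 h2] u(2)[THEN spec, THEN spec, THEN spec, of h1 h h2] assms(2,3)
    by (cases b) (simp_all add: mated_def)
qed

lemma mated_exists: "m \<in> PM \<Longrightarrow> h \<in> HE b \<Longrightarrow> \<exists>h'. mated m b h h'"
  unfolding perfect_matchings_iff mated_def by (cases b) auto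

lemma mated_flip: "mated m (\<not> b) h' h \<longleftrightarrow> mated m b h h'"
  by (cases b) (auto simp: mated_def)

lemma the_mate: "m \<in> PM \<Longrightarrow> mated m b h h' \<Longrightarrow> (THE h'. mated m b h h') = h'"
  using mated_unique by (intro the_equality) auto

lemma child: "x \<in> TI \<Longrightarrow> x @ [j] \<in> TN \<longleftrightarrow> j < c x"
  by (rule child_in_forest[of R c]) (use R c2 in auto)

lemma parent: "x \<in> NR \<Longrightarrow> butlast x \<in> TI"
  using parent_in_forest[of R c x] R c2 by auto

lemma TI_TN: "TI \<subseteq> TN"
  by (rule forest_inner_subset[of R c]) (use R c2 in auto)

lemma root_inner: "x \<in> TN \<Longrightarrow> length x = 1 \<Longrightarrow> x \<in> TI"
  using R by (auto simp: forest_nodes_def forest_inner_def)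

lemma nonempty: "x \<in> TN \<Longrightarrow> x \<noteq> []"
  by (simp add: forest_nodes_def)

lemma finite_TN: "finite TN" by (rule finite_forest_nodes)

lemma parent_side: "x \<in> TN \<Longrightarrow> tsd (butlast x) \<longleftrightarrow> \<not> tsd x"
  using nonempty[of x] by (cases x rule: rev_cases) auto

text \<open>
  A choice for a node is a vertex together with the half-edge leading to the parent (the port); at
  the leaves the degrees are truncated at \<open>K\<close>.
\<close>
definition choices :: "nat list \<Rightarrow> (nat \<times> nat) set" where
  "choices x =
     (if x \<in> TI then
        if length x = 1 then {u. u < N (tsd x) \<and> d (tsd x) u = c x} \<times> {0}
        else {u. u < N (tsd x) \<and> d (tsd x) u = Suc (c x)} \<times> {..<Suc (c x)}
      else (SIGMA u:{u. u < N (tsd x) \<and> d (tsd x) u \<le> K}. {..<d (tsd x) u}))"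

definition good :: "(nat list \<Rightarrow> nat \<times> nat) set" where
  "good = {\<psi> \<in> PiE TN choices. inj_on (\<lambda>x. (tsd x, fst (\<psi> x))) TN}"

text \<open>Children occupy, in order, the half-edges other than the one leading to the parent. A
  root has no parent, and its second component is a dummy zero.\<close>

definition port :: "(nat list \<Rightarrow> nat \<times> nat) \<Rightarrow> nat list \<Rightarrow> nat \<Rightarrow> nat" where
  "port \<psi> x j = (if length x = 1 \<or> j < snd (\<psi> x) then j else Suc j)"

text \<open>The half-edge that the choice \<open>\<psi> y\<close> must be matched with for
  \<open>y\<close> to become the right child of its parent.\<close>

definition parent_half :: "(nat list \<Rightarrow> nat \<times> nat) \<Rightarrow> nat list \<Rightarrow> nat \<times> nat" where
  "parent_half \<psi> y = (fst (\<psi> (butlast y)), port \<psi> (butlast y) (last y))"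

definition linked :: "((nat \<times> nat) \<times> (nat \<times> nat)) set \<Rightarrow> (nat list \<Rightarrow> nat \<times> nat) \<Rightarrow> bool" where
  "linked m \<psi> \<longleftrightarrow> (\<forall>y\<in>NR. mated m (tsd y) (\<psi> y) (parent_half \<psi> y))"

lemma finite_choices: "finite (choices x)"
  by (auto simp: choices_def)

lemma finite_good: "finite good"
  by (rule finite_subset[of _ "PiE TN choices"]) (auto simp: good_def intro!: finite_PiE finite_TN finite_choices)

lemma good_choices: "\<psi> \<in> good \<Longrightarrow> x \<in> TN \<Longrightarrow> \<psi> x \<in> choices x"
  by (auto simp: good_def)

lemma good_inj: "\<psi> \<in> good \<Longrightarrow> x \<in> TN \<Longrightarrow> y \<in> TN \<Longrightarrow> tsd x = tsd y \<Longrightarrow> fst (\<psi> x) = fst (\<psi> y) \<Longrightarrow> x = y"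
  by (auto simp: good_def dest: inj_onD)

lemma good_lt: "\<psi> \<in> good \<Longrightarrow> x \<in> TN \<Longrightarrow> fst (\<psi> x) < N (tsd x)"
  using good_choices[of \<psi> x] by (auto simp: choices_def split: if_splits)

lemma good_root: "\<psi> \<in> good \<Longrightarrow> x \<in> TN \<Longrightarrow> length x = 1 \<Longrightarrow> snd (\<psi> x) = 0 \<and> d (tsd x) (fst (\<psi> x)) = c x"
  using good_choices[of \<psi> x] root_inner[of x] by (auto simp: choices_def split: if_splits)

lemma good_inner: "\<psi> \<in> good \<Longrightarrow> x \<in> TI \<Longrightarrow> length x \<noteq> 1 \<Longrightarrow>
    snd (\<psi> x) \<le> c x \<and> d (tsd x) (fst (\<psi> x)) = Suc (c x)"
  using good_choices[OF _ subsetD[OF TI_TN], of \<psi> x] by (auto simp: choices_def mem_Times_iff)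

lemma good_half_edge: "\<psi> \<in> good \<Longrightarrow> x \<in> NR \<Longrightarrow> \<psi> x \<in> HE (tsd x)"
  using good_choices[of \<psi> x] by (auto simp: choices_def HE_iff split: if_splits)

lemma parent_half_in:
  assumes "\<psi> \<in> good" "y \<in> NR"
  shows "parent_half \<psi> y \<in> HE (\<not> tsd y)"
proof -
  have p: "butlast y \<in> TI" by (rule parent[OF assms(2)])
  then have pT: "butlast y \<in> TN" using TI_TN by auto
  have "last y < c (butlast y)"
    using child[OF p, of "last y"] assms(2) nonempty by simp
  moreover have "tsd (butlast y) \<longleftrightarrow> \<not> tsd y"
    using parent_side assms(2) by auto
  ultimately show ?thesis
    using good_lt[OF assms(1) pT] good_root[OF assms(1) pT] good_inner[OF assms(1) p]
    by (cases "length (butlast y) = 1") (auto simp: HE_iff parent_half_def port_def simp del: length_butlast)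
qed

definition endpoint :: "(nat list \<Rightarrow> nat \<times> nat) \<Rightarrow> bool \<Rightarrow> nat list \<Rightarrow> nat \<times> nat" where
  "endpoint \<psi> b y = (if tsd y = b then \<psi> y else parent_half \<psi> y)"

lemma endpoint_in:
  assumes "\<psi> \<in> good" "y \<in> NR"
  shows "endpoint \<psi> b y \<in> HE b"
proof (cases "b = tsd y")
  case True
  show ?thesis
    unfolding True endpoint_def using good_half_edge[OF assms] by simp
next
  case False
  then have "endpoint \<psi> b y = parent_half \<psi> y"
    unfolding endpoint_def by (intro if_not_P) auto
  moreover have "b = (\<not> tsd y)" using False by blast
  ultimately show ?thesis
    using parent_half_in[OF assms] by (simp only:)
qed

lemma linked_iff: "linked m \<psi> \<longleftrightarrow> (\<forall>y\<in>NR. (endpoint \<psi> True y, endpoint \<psi> False y) \<in> m)"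
proof -
  have "mated m (tsd y) (\<psi> y) (parent_half \<psi> y) \<longleftrightarrow> (endpoint \<psi> True y, endpoint \<psi> False y) \<in> m" for y
  proof -
    define b where "b = tsd y"
    show ?thesis
      unfolding mated_def endpoint_def b_def[symmetric] by (cases b) simp_all
  qed
  then show ?thesis by (simp add: linked_def)
qed

text \<open>No half-edge is claimed twice: distinct nodes of one side sit at distinct vertices,
  siblings use distinct ports of their parent, and \<open>port\<close> skips the half-edge that a
  node reserves for its own parent, which settles the mixed case.\<close>

lemma endpoint_inj:
  assumes \<psi>: "\<psi> \<in> good"
  shows "inj_on (endpoint \<psi> b) NR"
proof -
  have mixed: False if y: "y \<in> NR" "y' \<in> NR" "tsd y = b" "tsd y' \<noteq> b" "\<psi> y = parent_half \<psi> y'" for y y'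
  proof -
    have p: "butlast y' \<in> TN" using parent[OF y(2)] TI_TN by auto
    have "tsd (butlast y') = tsd y" using parent_side[of y'] y by auto
    then have "y = butlast y'"
      using good_inj[OF \<psi>, of y "butlast y'"] y p by (auto simp: parent_half_def)
    then have "snd (\<psi> y) = port \<psi> y (last y')"
      using arg_cong[OF y(5), of snd] by (simp only: parent_half_def snd_conv)
    moreover have "length y \<noteq> 1" using y by simp
    ultimately show False by (auto simp: port_def split: if_splits)
  qed
  have par: "y = y'" if y: "y \<in> NR" "y' \<in> NR" "tsd y = tsd y'" "parent_half \<psi> y = parent_half \<psi> y'" for y y'
  proof -
    have p: "butlast y \<in> TN" "butlast y' \<in> TN" using parent[OF y(1)] parent[OF y(2)] TI_TN by auto
    have "tsd (butlast y) = tsd (butlast y')" using parent_side[of y] parent_side[of y'] y by auto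
    then have b: "butlast y = butlast y'"
      using good_inj[OF \<psi> p] y by (auto simp: parent_half_def)
    then have "port \<psi> (butlast y) (last y) = port \<psi> (butlast y) (last y')"
      using y(4) by (simp add: parent_half_def)
    then have "last y = last y'"
      by (auto simp: port_def split: if_splits)
    then show ?thesis
      using b y nonempty by (metis (no_types, lifting) append_butlast_last_id mem_Collect_eq)
  qed
  show ?thesis
  proof (rule inj_onI)
    fix y y' assume y: "y \<in> NR" "y' \<in> NR" and eq: "endpoint \<psi> b y = endpoint \<psi> b y'"
    consider "tsd y = b" "tsd y' = b" | "tsd y = b" "tsd y' \<noteq> b" | "tsd y \<noteq> b" "tsd y' = b" | "tsd y \<noteq> b" "tsd y' \<noteq> b"
      by blast
    then show "y = y'"
    proof cases
      case 1
      then show ?thesis using good_inj[OF \<psi>, of y y'] y eq by (auto simp: endpoint_def)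
    next
      case 2
      then show ?thesis using mixed[OF y 2] eq by (simp add: endpoint_def)
    next
      case 3
      then show ?thesis using mixed[OF y(2,1) 3(2,1)] eq by (simp add: endpoint_def)
    next
      case 4
      then have "tsd y = tsd y'" by auto
      then show ?thesis using par[OF y] 4 eq by (simp add: endpoint_def)
    qed
  qed
qed

text \<open>One matched pair is prescribed for each node other than a root, which leaves at least
  \<open>fact (total - card NR)\<close> of the \<open>fact total\<close> matchings.\<close>

lemma linked_prob:
  assumes "\<psi> \<in> good"
  shows "1 / real total ^ card NR \<le> real (card {m \<in> PM. linked m \<psi>}) / real (card PM)"
proof -
  have fin: "finite NR" using finite_TN by simp
  have "fact (card (HE True) - card NR) \<le> card {m \<in> PM. \<forall>y\<in>NR. (endpoint \<psi> True y, endpoint \<psi> False y) \<in> m}"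
    by (rule card_matchings_extending)
       (use endpoint_inj[OF assms] endpoint_in[OF assms] fin in \<open>auto simp: finite_HE card_HE\<close>)
  then have 1: "fact (total - card NR) \<le> card {m \<in> PM. linked m \<psi>}"
    by (simp add: card_HE linked_iff)
  have "card NR \<le> total"
    using card_inj_on_le[OF endpoint_inj[OF assms, of True], of "HE True"] endpoint_in[OF assms]
    by (auto simp: finite_HE card_HE)
  then have "fact total \<le> total ^ card NR * (fact (total - card NR) :: nat)"
    by (rule fact_le_power_mult)
  also have "\<dots> \<le> total ^ card NR * card {m \<in> PM. linked m \<psi>}"
    using 1 by (rule mult_left_mono) simp
  finally have "real (card PM) \<le> real (total ^ card NR * card {m \<in> PM. linked m \<psi>})"
    unfolding card_PM by (rule of_nat_mono)
  moreover have "0 < real (card PM)" by (simp add: card_PM)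
  ultimately have le: "real (card PM) \<le> real total ^ card NR * real (card {m \<in> PM. linked m \<psi>})" and PM: "0 < real (card PM)"
    by simp_all
  show ?thesis
  \<comment> \<open>If the power vanishes, the left side is zero by the convention for
    division.\<close>
  proof (cases "real total ^ card NR = 0")
    case False
    then have "0 < real total ^ card NR"
      using zero_le_power[of "real total" "card NR"] by linarith
    then have "real (card PM) / real total ^ card NR \<le> real (card {m \<in> PM. linked m \<psi>})"
      unfolding pos_divide_le_eq[OF \<open>0 < real total ^ card NR\<close>] using le by (simp only: mult.commute)
    then show ?thesis
      unfolding pos_le_divide_eq[OF PM] by simp
  qed (simp only: division_ring_divide_zero, simp)
qed

definition vertex_map :: "(nat list \<Rightarrow> nat \<times> nat) \<Rightarrow> nat list \<Rightarrow> nat" where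
  "vertex_map \<psi> = (\<lambda>x\<in>TN. fst (\<psi> x))"

text \<open>Reading the mates of the half-edges in order lists the children, interrupted by the
  parent at the port; deleting the parent restores the order of the children. Injectivity is part of
  being \<open>good\<close>.\<close>

lemma linked_imp_forest_emb:
  assumes m: "m \<in> PM" and \<psi>: "\<psi> \<in> good" and l: "linked m \<psi>"
  shows "forest_emb (half_edge_nbrs d m) s R c (vertex_map \<psi>)"
proof -
  let ?\<phi> = "vertex_map \<psi>"
  have v: "?\<phi> x = fst (\<psi> x)" if "x \<in> TN" for x
    using that by (simp add: vertex_map_def)
  have inj: "inj_on (\<lambda>x. (odd (length x), ?\<phi> x)) TN"
    by (rule inj_onI) (use good_inj[OF \<psi>] v in auto)
  have mate_child: "fst (THE h. mated m (tsd x) (fst (\<psi> x), port \<psi> x j) h) = ?\<phi> (x @ [j])"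
    if x: "x \<in> TI" "j < c x" for x j
  proof -
    have y: "x @ [j] \<in> TN" "x @ [j] \<in> NR"
      using child[OF x(1)] x nonempty[of x] TI_TN by auto
    then have "mated m (tsd (x @ [j])) (\<psi> (x @ [j])) (fst (\<psi> x), port \<psi> x j)"
      using l by (auto simp: linked_def parent_half_def)
    note A = this
    have e: "tsd (x @ [j]) \<longleftrightarrow> \<not> tsd x" by auto
    have "mated m (tsd x) (fst (\<psi> x), port \<psi> x j) (\<psi> (x @ [j]))"
      using A unfolding e mated_flip .
    then show ?thesis
      using the_mate[OF m] v[OF y(1)] by simp
  qed
  have "let l = half_edge_nbrs d m (tsd x) (?\<phi> x)
         in if length x = 1 then l = children c ?\<phi> x
            else ?\<phi> (butlast x) \<in> set l \<and> remove1 (?\<phi> (butlast x)) l = children c ?\<phi> x"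
    if x: "x \<in> TI" for x
  proof (cases "length x = 1")
    case True
    have xT: "x \<in> TN" using x TI_TN by auto
    then have "half_edge_nbrs d m (tsd x) (?\<phi> x) = map (\<lambda>i. fst (THE h. mated m (tsd x) (fst (\<psi> x), i) h)) [0..<c x]"
      using good_root[OF \<psi> xT True] v[OF xT] by (simp add: half_edge_nbrs_def)
    also have "\<dots> = children c ?\<phi> x"
      unfolding children_def using mate_child[OF x] True by (intro map_cong) (auto simp: port_def)
    finally show ?thesis
      using True by (simp add: Let_def)
  next
    case False
    have xT: "x \<in> TN" using x TI_TN by auto
    then have xN: "x \<in> NR" using False by auto
    have pT: "butlast x \<in> TN" using parent[OF xN] TI_TN by auto
    define f where "f i = fst (THE h. mated m (tsd x) (fst (\<psi> x), i) h)" for i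
    define h where "h = snd (\<psi> x)"
    have hc: "h \<le> c x" and dx: "d (tsd x) (fst (\<psi> x)) = Suc (c x)"
      using good_inner[OF \<psi> x False] by (auto simp: h_def)
    have l': "half_edge_nbrs d m (tsd x) (?\<phi> x) = map f [0..<Suc (c x)]"
      unfolding half_edge_nbrs_def v[OF xT] dx f_def by (rule refl)
    have "mated m (tsd x) (fst (\<psi> x), h) (parent_half \<psi> x)"
      using l xN by (simp add: linked_def h_def)
    then have fh: "f h = ?\<phi> (butlast x)"
      using the_mate[OF m] v[OF pT] by (simp add: f_def parent_half_def)
    have fj: "f (if j < h then j else Suc j) = ?\<phi> (x @ [j])" if "j < c x" for j
      using mate_child[OF x that] False by (simp add: f_def port_def h_def)
    have ne: "f (if j < h then j else Suc j) \<noteq> ?\<phi> (butlast x)" if j: "j < c x" for j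
    proof
      assume "f (if j < h then j else Suc j) = ?\<phi> (butlast x)"
      then have "?\<phi> (x @ [j]) = ?\<phi> (butlast x)" using fj[OF j] by simp
      moreover have "odd (length (x @ [j])) = odd (length (butlast x))"
        using nonempty[OF xT] by (cases x rule: rev_cases) auto
      ultimately have "x @ [j] = butlast x"
        using inj_onD[OF inj, of "x @ [j]" "butlast x"] child[OF x] j pT by auto
      then have "length (x @ [j]) = length (butlast x)" by (rule arg_cong)
      then show False by simp
    qed
    have "remove1 (?\<phi> (butlast x)) (map f [0..<Suc (c x)]) = map (\<lambda>j. f (if j < h then j else Suc j)) [0..<c x]"
      by (rule remove1_map_skip[OF hc fh ne])
    also have "\<dots> = children c ?\<phi> x"
      unfolding children_def using fj by (intro map_cong) auto
    finally have "remove1 (?\<phi> (butlast x)) (half_edge_nbrs d m (tsd x) (?\<phi> x)) = children c ?\<phi> x"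
      unfolding l' .
    moreover have "?\<phi> (butlast x) \<in> set (half_edge_nbrs d m (tsd x) (?\<phi> x))"
      unfolding l' fh[symmetric] using hc by (auto simp del: upt_Suc)
    ultimately show ?thesis
      using False by (simp add: Let_def)
  qed
  then show ?thesis
    unfolding forest_emb_def using inj by blast
qed

text \<open>For a fixed matching the ports are not free: the choice at a parent fixes the half-edge
  towards a child, and its unique mate is the choice at the child. The induction starts at the
  roots, whose vertices are read off the vertex map.\<close>

lemma linked_vertex_map_inj:
  assumes m: "m \<in> PM" and \<psi>: "\<psi> \<in> good" "\<psi>' \<in> good" and l: "linked m \<psi>" "linked m \<psi>'"
    and eq: "vertex_map \<psi> = vertex_map \<psi>'"
  shows "\<psi> = \<psi>'"
proof -
  have fst_eq: "fst (\<psi> x) = fst (\<psi>' x)" if "x \<in> TN" for x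
    using fun_cong[OF eq, of x] that by (simp add: vertex_map_def)
  have "\<psi> x = \<psi>' x" if "x \<in> TN" for x
    using that
  proof (induction x rule: rev_induct)
    case Nil
    then show ?case using nonempty by blast
  next
    case (snoc j x)
    show ?case
    proof (cases "length (x @ [j]) = 1")
      case True
      then show ?thesis
        using good_root[OF \<psi>(1) snoc.prems] good_root[OF \<psi>(2) snoc.prems] fst_eq[OF snoc.prems]
        by (simp add: prod_eq_iff)
    next
      case False
      then have y: "x @ [j] \<in> NR" using snoc.prems by simp
      then have "x \<in> TN" using parent[OF y] TI_TN by auto
      then have "\<psi> x = \<psi>' x" by (rule snoc.IH)
      then have "parent_half \<psi> (x @ [j]) = parent_half \<psi>' (x @ [j])"
        by (simp add: parent_half_def port_def)
      moreover have "mated m (\<not> tsd (x @ [j])) (parent_half \<psi> (x @ [j])) (\<psi> (x @ [j]))"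
        "mated m (\<not> tsd (x @ [j])) (parent_half \<psi>' (x @ [j])) (\<psi>' (x @ [j]))"
        using l y unfolding mated_flip linked_def by blast+
      ultimately show ?thesis
        using mated_unique[OF m] by metis
    qed
  qed
  then show ?thesis
    using \<psi> by (intro PiE_ext[where k = TN and s = choices]) (auto simp: good_def)
qed

text \<open>Double counting of pairs of a good choice and a matching that links it: for a fixed
  matching, the linked choices inject into the embedded maps.\<close>

lemma expected_embeddings_ge:
  "real (card good) / real total ^ card NR \<le>
     (\<Sum>\<phi>\<in>forest_maps N s R c. measure_pmf.prob (pmf_of_set PM) {m. forest_emb (half_edge_nbrs d m) s R c \<phi>})"
proof -
  let ?Phi = "forest_maps N s R c"
  let ?E = "\<lambda>m \<phi>. forest_emb (half_edge_nbrs d m) s R c \<phi>"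
  have fin: "finite ?Phi"
    unfolding forest_maps_def by (intro finite_PiE finite_forest_nodes) auto
  have double: "(\<Sum>a\<in>A. real (card {b \<in> B. Q a b})) = (\<Sum>b\<in>B. real (card {a \<in> A. Q a b}))"
    if "finite A" "finite B" for A :: "'x set" and B :: "'y set" and Q
  proof -
    have "(\<Sum>a\<in>A. real (card {b \<in> B. Q a b})) = (\<Sum>a\<in>A. \<Sum>b\<in>B. of_bool (Q a b))"
      using that by (simp add: of_bool_def sum.If_cases Int_def)
    also have "\<dots> = (\<Sum>b\<in>B. \<Sum>a\<in>A. of_bool (Q a b))"
      by (rule sum.swap)
    also have "\<dots> = (\<Sum>b\<in>B. real (card {a \<in> A. Q a b}))"
      using that by (simp add: of_bool_def sum.If_cases Int_def)
    finally show ?thesis .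
  qed
  have "real (card good) / real total ^ card NR = (\<Sum>\<psi>\<in>good. 1 / real total ^ card NR)"
    by simp
  also have "\<dots> \<le> (\<Sum>\<psi>\<in>good. real (card {m \<in> PM. linked m \<psi>}) / real (card PM))"
    by (intro sum_mono linked_prob)
  also have "\<dots> = (\<Sum>m\<in>PM. real (card {\<psi> \<in> good. linked m \<psi>})) / real (card PM)"
    unfolding sum_divide_distrib[symmetric] by (subst double) (simp_all add: finite_good finite_PM)
  also have "\<dots> \<le> (\<Sum>m\<in>PM. real (card {\<phi> \<in> ?Phi. ?E m \<phi>})) / real (card PM)"
  proof (intro divide_right_mono sum_mono of_nat_mono)
    fix m assume m: "m \<in> PM"
    show "card {\<psi> \<in> good. linked m \<psi>} \<le> card {\<phi> \<in> ?Phi. ?E m \<phi>}"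
    proof (rule card_inj_on_le[where f = vertex_map])
      show "inj_on vertex_map {\<psi> \<in> good. linked m \<psi>}"
        by (rule inj_onI) (use linked_vertex_map_inj[OF m] in auto)
      show "vertex_map ` {\<psi> \<in> good. linked m \<psi>} \<subseteq> {\<phi> \<in> ?Phi. ?E m \<phi>}"
        using linked_imp_forest_emb[OF m] good_lt by (auto simp: forest_maps_def vertex_map_def)
    qed (use fin in simp)
  qed simp
  also have "\<dots> = (\<Sum>\<phi>\<in>?Phi. real (card {m \<in> PM. ?E m \<phi>})) / real (card PM)"
    by (subst double) (simp_all add: fin finite_PM)
  also have "\<dots> = (\<Sum>\<phi>\<in>?Phi. measure_pmf.prob (pmf_of_set PM) {m. ?E m \<phi>})"
    unfolding sum_divide_distrib
    by (intro sum.cong refl) (simp add: measure_pmf_of_set[OF PM_nonempty finite_PM] Int_def)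
  finally show ?thesis .
qed

text \<open>The first factor bounds the options at a node that share a vertex, namely its ports: at
  most \<open>K\<close> at a leaf and at most \<open>Suc (c x)\<close> at an inner node. The bound
  does not depend on the graph, so it is negligible in the limit.\<close>

definition collision_bound :: nat where
  "collision_bound = Suc (K + (\<Sum>x\<in>TI. Suc (c x))) * card TN"

lemma card_good_ge: "(\<Prod>x\<in>TN. card (choices x) - collision_bound) \<le> card good"
proof -
  let ?B = "Suc (K + (\<Sum>x\<in>TI. Suc (c x)))"
  have "(\<Prod>x\<in>TN. card (choices x) - ?B * card TN) \<le> card {\<psi> \<in> PiE TN choices. inj_on (\<lambda>x. (tsd x, fst (\<psi> x))) TN}"
  proof (rule card_inj_choices_ge[where K = ?B])
    fix x w assume x: "x \<in> TN"
    have c: "c x < ?B" if "x \<in> TI"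
      using member_le_sum[OF that, of "\<lambda>x. Suc (c x)"] finite_forest_inner[of R c] by simp
    have "{a \<in> choices x. (tsd x, fst a) = w} \<subseteq> {snd w} \<times> {..<?B}"
      using c by (auto simp: choices_def split: if_splits)
    then have "card {a \<in> choices x. (tsd x, fst a) = w} \<le> card ({snd w} \<times> {..<?B})"
      by (intro card_mono) auto
    then show "card {a \<in> choices x. (tsd x, fst a) = w} \<le> ?B" by simp
  qed (use finite_TN finite_choices in auto)
  then show ?thesis
    by (simp add: good_def collision_bound_def)
qed

text \<open>Grouping the vertices for a leaf by degree turns the number of half-edges into a
  truncated first moment.\<close>

lemma card_choices:
  "card (choices x) =
     (if x \<in> TI then
        if length x = 1 then card {u. u < N (tsd x) \<and> d (tsd x) u = c x}
        else Suc (c x) * card {u. u < N (tsd x) \<and> d (tsd x) u = Suc (c x)}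
      else (\<Sum>k\<le>K. k * card {u. u < N (tsd x) \<and> d (tsd x) u = k}))"
proof -
  have "card (SIGMA u:{u. u < N b \<and> d b u \<le> K}. {..<d b u}) = (\<Sum>k\<le>K. k * card {u. u < N b \<and> d b u = k})" for b
  proof -
    have "card (SIGMA u:{u. u < N b \<and> d b u \<le> K}. {..<d b u}) = (\<Sum>u\<in>{u. u < N b \<and> d b u \<le> K}. d b u)"
      by (subst card_SigmaI) auto
    also have "\<dots> = (\<Sum>k\<le>K. \<Sum>u\<in>{u \<in> {u. u < N b \<and> d b u \<le> K}. d b u = k}. d b u)"
      by (rule sum.group[symmetric]) auto
    also have "\<dots> = (\<Sum>k\<le>K. k * card {u. u < N b \<and> d b u = k})"
    proof (intro sum.cong refl)
      fix k assume "k \<in> {..K}"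
      then have "{u \<in> {u. u < N b \<and> d b u \<le> K}. d b u = k} = {u. u < N b \<and> d b u = k}" by auto
      then show "(\<Sum>u\<in>{u \<in> {u. u < N b \<and> d b u \<le> K}. d b u = k}. d b u) = k * card {u. u < N b \<and> d b u = k}"
        by simp
    qed
    finally show ?thesis .
  qed
  then show ?thesis
    by (simp add: choices_def card_cartesian_product mult.commute)
qed

end

section \<open>Limits of the counts in the configuration model\<close>

lemma tendsto_diff_ratio':
  fixes a N :: "nat \<Rightarrow> nat"
  assumes "(\<lambda>n. real (a n) / real (N n)) \<longlonglongrightarrow> l" "filterlim N at_top sequentially"
  shows "(\<lambda>n. real (a n - k) / real (N n)) \<longlonglongrightarrow> l"
proof -
  have N: "filterlim (\<lambda>n. real (N n)) at_top sequentially"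
    using assms(2) by (rule filterlim_compose[OF filterlim_real_sequentially])
  have z: "(\<lambda>n. real k / real (N n)) \<longlonglongrightarrow> 0"
    by (rule real_tendsto_divide_at_top[OF tendsto_const N])
  have "(\<lambda>n. real (a n) / real (N n) - real k / real (N n)) \<longlonglongrightarrow> l - 0"
    by (intro tendsto_diff assms(1) z)
  then have lower: "(\<lambda>n. real (a n) / real (N n) - real k / real (N n)) \<longlonglongrightarrow> l"
    by simp
  have le1: "real (a n) / real (N n) - real k / real (N n) \<le> real (a n - k) / real (N n)" for n
    unfolding diff_divide_distrib[symmetric] by (intro divide_right_mono) auto
  have le2: "real (a n - k) / real (N n) \<le> real (a n) / real (N n)" for n
    by (intro divide_right_mono) auto
  show ?thesis
    by (rule tendsto_sandwich[OF always_eventually[OF allI[OF le1]] always_eventually[OF allI[OF le2]] lower assms(1)])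
qed

lemma pmf_map_uniform:
  assumes "0 < n"
  shows "pmf (map_pmf f (pmf_of_set {..<n})) k = real (card {u. u < n \<and> f u = k}) / real n"
proof -
  have "{..<n} \<inter> f -` {k} = {u. u < n \<and> f u = k}" by auto
  then show ?thesis
    using assms by (simp add: pmf_map measure_pmf_of_set lessThan_empty_iff)
qed

lemma mean_map_uniform:
  assumes "0 < n"
  shows "mean (map_pmf f (pmf_of_set {..<n})) = real (\<Sum>u<n. f u) / real n"
  using assms by (simp add: integral_pmf_of_set lessThan_empty_iff)

lemma (in config_forest) half_edge_nbrs_eq:
  assumes m: "m \<in> PM" and u: "u < N b"
    and H: "H = \<lparr>part1 = {..<N True}, part2 = {..<N False}, mult = (\<lambda>u w. card {(i, j). ((u, i), (w, j)) \<in> m})\<rparr>"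
  shows "set (half_edge_nbrs d m b u) = nbrs H b u"
proof -
  have "m \<subseteq> HE True \<times> HE False"
    using m by (simp add: perfect_matchings_def)
  then have finm: "finite m"
    using finite_HE finite_subset by blast
  have mult: "card {(i, j). ((u, i), (w, j)) \<in> m} > 0 \<longleftrightarrow> (\<exists>i j. ((u, i), (w, j)) \<in> m)" for u w
  proof -
    have "{(i, j). ((u, i), (w, j)) \<in> m} \<subseteq> (\<lambda>((u, i), (w, j)). (i, j)) ` m"
      by force
    then have "finite {(i, j). ((u, i), (w, j)) \<in> m}"
      using finm finite_subset by blast
    then show ?thesis
      by (auto simp: card_gt_0_iff)
  qed
  have "v \<in> nbrs H b u \<longleftrightarrow> v < N (\<not> b) \<and> (\<exists>i j. mated m b (u, i) (v, j))" for v
    using u by (cases b) (auto simp: nbrs_def nbrs1_def nbrs2_def H mult mated_def)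
  also have "\<dots> v \<longleftrightarrow> v \<in> set (half_edge_nbrs d m b u)" for v
  proof
    assume "v < N (\<not> b) \<and> (\<exists>i j. mated m b (u, i) (v, j))"
    then obtain i j where ij: "mated m b (u, i) (v, j)" by blast
    then have "i < d b u"
      using mated_HE[OF m ij] by (simp add: HE_iff)
    then show "v \<in> set (half_edge_nbrs d m b u)"
      using the_mate[OF m ij] by (auto simp: half_edge_nbrs_def intro!: image_eqI[of _ _ i])
  next
    assume "v \<in> set (half_edge_nbrs d m b u)"
    then obtain i where i: "i < d b u" "v = fst (THE h. mated m b (u, i) h)"
      by (auto simp: half_edge_nbrs_def)
    have "(u, i) \<in> HE b" using i u by (simp add: HE_iff)
    then obtain h where h: "mated m b (u, i) h"
      using mated_exists[OF m] by blast
    then have "v = fst h" using the_mate[OF m h] i by simp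
    then show "v < N (\<not> b) \<and> (\<exists>i j. mated m b (u, i) (v, j))"
      using mated_HE[OF m h] h by (cases h) (auto simp: HE_iff)
  qed
  finally show ?thesis by blast
qed

text \<open>The choices at a node are counted relative to the vertices at a root and to the
  half-edges elsewhere. The quotients tend to a degree probability at a root, to a size-biased
  probability at other inner nodes, and at leaves to a truncated mean over the mean, which
  approaches one as the cap grows.\<close>

lemma config_limit:
  fixes n1 n2 :: "nat \<Rightarrow> nat" and d1 d2 :: "nat \<Rightarrow> nat \<Rightarrow> nat"
  assumes pos: "\<And>n. 0 < n1 n" "\<And>n. 0 < n2 n"
    and lim: "filterlim n1 at_top sequentially" "filterlim n2 at_top sequentially"
    and sums: "\<And>n. (\<Sum>u<n1 n. d1 n u) = (\<Sum>v<n2 n. d2 n v)"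
    and L: "\<And>n. L n = measure_pmf (config_law (n1 n) (n2 n) (d1 n) (d2 n))"
    and D: "has_pos_finite_mean D1" "has_pos_finite_mean D2"
    and mean: "(\<lambda>n. mean (map_pmf (d1 n) (pmf_of_set {..<n1 n}))) \<longlonglongrightarrow> mean D1"
      "(\<lambda>n. mean (map_pmf (d2 n) (pmf_of_set {..<n2 n}))) \<longlonglongrightarrow> mean D2"
    and conv: "weak_conv_m (\<lambda>n. real_law (map_pmf (d1 n) (pmf_of_set {..<n1 n}))) (real_law D1)"
      "weak_conv_m (\<lambda>n. real_law (map_pmf (d2 n) (pmf_of_set {..<n2 n}))) (real_law D2)"
  shows "weak_conv_m (\<lambda>n. X1_law (n1 n) (L n)) (real_law D1)"
    and "weak_conv_m (\<lambda>n. X2_law (n2 n) (L n)) (real_law D2)"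
    and "local_conv_in_prob TYPE('h) L (\<lambda>_. intersection_graph) (gw_space D1 D2) clique_tree"
proof -
  define N where "N n b = (if b then n1 n else n2 n)" for n b
  define d where "d n b = (if b then d1 n else d2 n)" for n b
  define E where "E b = (if b then D1 else D2)" for b
  define P where "P n = pmf_of_set (perfect_matchings (half_edges (N n True) (d n True)) (half_edges (N n False) (d n False)))" for n
  define h where "h n m = \<lparr>part1 = {..<N n True}, part2 = {..<N n False},
      mult = (\<lambda>u w. card {(i, j). ((u, i), (w, j)) \<in> m})\<rparr>" for n and m :: "((nat \<times> nat) \<times> (nat \<times> nat)) set"
  let ?M = "\<lambda>n. measure_pmf (P n)" and ?nb = "\<lambda>n. half_edge_nbrs (d n)"
  have NP: "0 < N n b" for n b using pos by (simp add: N_def)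
  have NL: "filterlim (\<lambda>n. N n b) at_top sequentially" for b
    using lim by (cases b) (auto simp: N_def)
  have sums': "(\<Sum>u<N n True. d n True u) = (\<Sum>u<N n False. d n False u)" for n
    using sums by (simp add: N_def d_def)
  have ED: "has_pos_finite_mean (E b)" for b using D by (simp add: E_def)
  then have mE: "0 < mean (E b)" for b by (simp add: has_pos_finite_mean_def)
  have pmf: "(\<lambda>n. real (card {u. u < N n b \<and> d n b u = k}) / real (N n b)) \<longlonglongrightarrow> pmf (E b) k" for b k
  proof -
    have "(\<lambda>n. pmf (map_pmf (d n b) (pmf_of_set {..<N n b})) k) \<longlonglongrightarrow> pmf (E b) k"
      by (rule pmf_tendsto_of_weak_conv) (use conv in \<open>cases b; simp add: N_def d_def E_def\<close>)
    then show ?thesis by (simp add: pmf_map_uniform[OF NP])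
  qed
  have total: "(\<lambda>n. real (\<Sum>u<N n True. d n True u) / real (N n b)) \<longlonglongrightarrow> mean (E b)" for b
  proof -
    have "(\<lambda>n. mean (map_pmf (d n b) (pmf_of_set {..<N n b}))) \<longlonglongrightarrow> mean (E b)"
      using mean by (cases b) (simp_all add: N_def d_def E_def)
    then have "(\<lambda>n. real (\<Sum>u<N n b. d n b u) / real (N n b)) \<longlonglongrightarrow> mean (E b)"
      by (simp only: mean_map_uniform[OF NP])
    then show ?thesis
      using sums' by (cases b) simp_all
  qed
  have fb: "forest_bound ?M ?nb N E"
    unfolding forest_bound_def
  proof (intro allI impI)
    fix s R and c :: "nat list \<Rightarrow> nat" and a
    assume R: "0 < R" and c2: "c [] = 2"
      and a: "a < (\<Prod>x\<in>forest_inner R c. pmf (offspring_law (E s) (E (\<not> s)) (length x - 1)) (c x))"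
    let ?T = "forest_nodes R c" and ?I = "forest_inner R c" and ?sd = "\<lambda>x. s = odd (length x)"
    let ?off = "\<lambda>x. pmf (offspring_law (E s) (E (\<not> s)) (length x - 1)) (c x)"
    have sub: "?I \<subseteq> ?T" and finT: "finite ?T"
      using forest_inner_subset[of R c] R c2 finite_forest_nodes by auto
    \<comment> \<open>The limit in \<open>n\<close> of the factor of a node, for a fixed cap
      \<open>K\<close>.\<close>
    define v where "v K x = (if x \<in> ?I then ?off x else (\<Sum>k\<le>K. real k * pmf (E (?sd x)) k) / mean (E (?sd x)))" for K x
    have "(\<lambda>K. \<Prod>x\<in>?T. v K x) \<longlonglongrightarrow> (\<Prod>x\<in>?T. if x \<in> ?I then ?off x else mean (E (?sd x)) / mean (E (?sd x)))"
    proof (intro tendsto_prod)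
      fix x
      show "(\<lambda>K. v K x) \<longlonglongrightarrow> (if x \<in> ?I then ?off x else mean (E (?sd x)) / mean (E (?sd x)))"
      proof (cases "x \<in> ?I")
        case False
        have "(\<lambda>K. (\<Sum>k\<le>K. real k * pmf (E (?sd x)) k) / mean (E (?sd x))) \<longlonglongrightarrow> mean (E (?sd x)) / mean (E (?sd x))"
          using mE[of "?sd x"] by (intro tendsto_divide tendsto_const mean_partial_sums ED) auto
        then show ?thesis
          unfolding v_def if_not_P[OF False] .
      qed (simp add: v_def)
    qed
    moreover have "(\<Prod>x\<in>?T. if x \<in> ?I then ?off x else mean (E (?sd x)) / mean (E (?sd x))) = (\<Prod>x\<in>?I. ?off x)"
      using mE by (intro prod.mono_neutral_cong_right finT sub) (auto simp: less_le)
    ultimately have "(\<lambda>K. \<Prod>x\<in>?T. v K x) \<longlonglongrightarrow> (\<Prod>x\<in>?I. ?off x)"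
      by simp
    then have "\<forall>\<^sub>F K in sequentially. a < (\<Prod>x\<in>?T. v K x)"
      using a by (rule order_tendstoD)
    then obtain K where K: "a < (\<Prod>x\<in>?T. v K x)"
      by (auto simp: eventually_sequentially)
    have cf: "config_forest (N n) (d n) R c" for n
      using sums' R c2 by unfold_locales
    let ?ch = "\<lambda>n x. card (config_forest.choices (N n) (d n) R c s K x)"
    let ?cb = "config_forest.collision_bound R c K"
    let ?tot = "\<lambda>n. config_forest.total (N n) (d n)"
    let ?good = "\<lambda>n. config_forest.good (N n) (d n) R c s K"
    let ?NR = "{x \<in> ?T. length x \<noteq> 1}"
    have tot: "(\<lambda>n. real (?tot n) / real (N n b)) \<longlonglongrightarrow> mean (E b)" for b
      using total by (simp add: config_forest.total_def[OF cf])
    \<comment> \<open>The two roots supply the square in \<open>forest_bound\<close>; every other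
      node comes with one matched pair of half-edges, of probability about
      \<open>1 / total\<close>.\<close>
    let ?den = "\<lambda>n x. if length x = 1 then real (N n s) else real (?tot n)"
    have factor: "(\<lambda>n. real (?ch n x - ?cb) / ?den n x) \<longlonglongrightarrow> v K x" if x: "x \<in> ?T" for x
    proof -
      let ?b = "?sd x"
      let ?w = "if x \<in> ?I then if length x = 1 then pmf (E ?b) (c x) else real (Suc (c x)) * pmf (E ?b) (Suc (c x))
          else (\<Sum>k\<le>K. real k * pmf (E ?b) k)"
      have "(\<lambda>n. real (?ch n x) / real (N n ?b)) \<longlonglongrightarrow> ?w"
      proof (cases "x \<in> ?I")
        case True
        show ?thesis
        proof (cases "length x = 1")
          case l: True
          then show ?thesis
            using pmf[of ?b "c x"] True by (simp add: config_forest.card_choices[OF cf])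
        next
          case False
          have "(\<lambda>n. real (Suc (c x)) * (real (card {u. u < N n ?b \<and> d n ?b u = Suc (c x)}) / real (N n ?b))) \<longlonglongrightarrow>
              real (Suc (c x)) * pmf (E ?b) (Suc (c x))"
            by (intro tendsto_mult tendsto_const pmf)
          then show ?thesis
            using False True by (simp add: config_forest.card_choices[OF cf] del: of_nat_Suc mult_Suc)
        qed
      next
        case False
        have "(\<lambda>n. \<Sum>k\<le>K. real k * (real (card {u. u < N n ?b \<and> d n ?b u = k}) / real (N n ?b))) \<longlonglongrightarrow>
            (\<Sum>k\<le>K. real k * pmf (E ?b) k)"
          by (intro tendsto_sum tendsto_mult tendsto_const pmf)
        then show ?thesis
          using False by (simp add: config_forest.card_choices[OF cf] sum_divide_distrib)
      qed
      then have w: "(\<lambda>n. real (?ch n x - ?cb) / real (N n ?b)) \<longlonglongrightarrow> ?w"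
        by (rule tendsto_diff_ratio'[OF _ NL])
      show ?thesis
      proof (cases "length x = 1")
        case True
        then have "x \<in> ?I" "?b = s"
          using config_forest.root_inner[OF cf x] by auto
        then show ?thesis
          using w True pmf_offspring[OF ED ED, of s "\<not> s" 0] by (simp add: v_def)
      next
        case False
        have "(\<lambda>n. (real (?ch n x - ?cb) / real (N n ?b)) / (real (?tot n) / real (N n ?b))) \<longlonglongrightarrow> ?w / mean (E ?b)"
          using mE[of ?b] by (intro tendsto_divide w tot) auto
        moreover have "(real (?ch n x - ?cb) / real (N n ?b)) / (real (?tot n) / real (N n ?b)) = real (?ch n x - ?cb) / ?den n x" for n
          using NP[of n ?b] False by simp
        moreover have "?w / mean (E ?b) = v K x"
        proof (cases "x \<in> ?I")
          case True
          have "length x > 1"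
            using False config_forest.nonempty[OF cf x] by (cases "length x") auto
          then have e: "E ?b = (if odd (length x - 1) then E (\<not> s) else E s)" "length x - 1 \<noteq> 0"
            by (auto intro: arg_cong[of _ _ E])
          show ?thesis
            using True False e(2) pmf_offspring[OF ED ED, of s "\<not> s" "length x - 1" "c x"]
            unfolding v_def e(1)[symmetric] by simp
        qed (simp add: v_def)
        ultimately show ?thesis by simp
      qed
    qed
    have "(\<lambda>n. \<Prod>x\<in>?T. real (?ch n x - ?cb) / ?den n x) \<longlonglongrightarrow> (\<Prod>x\<in>?T. v K x)"
      by (intro tendsto_prod factor)
    then have "\<forall>\<^sub>F n in sequentially. a < (\<Prod>x\<in>?T. real (?ch n x - ?cb) / ?den n x)"
      using K by (rule order_tendstoD)
    then show "\<forall>\<^sub>F n in sequentially. a < (\<Sum>\<phi>\<in>forest_maps (N n) s R c.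
        measure_pmf.prob (P n) {m. forest_emb (half_edge_nbrs (d n) m) s R c \<phi>}) / (real (N n s))\<^sup>2"
    proof eventually_elim
      case (elim n)
      have den: "(\<Prod>x\<in>?T. ?den n x) = (real (N n s))\<^sup>2 * real (?tot n) ^ card ?NR"
      proof -
        have "?T \<inter> {x. length x = 1} = {[0], [1]}" "?T \<inter> - {x. length x = 1} = ?NR"
          using forest_roots[of R c] R c2 by auto
        then show ?thesis
          using finT by (simp add: prod.If_cases power2_eq_square)
      qed
      have "(\<Prod>x\<in>?T. real (?ch n x - ?cb) / ?den n x) = real (\<Prod>x\<in>?T. ?ch n x - ?cb) / (real (?tot n) ^ card ?NR) / (real (N n s))\<^sup>2"
        unfolding prod_dividef den by (simp add: mult.commute)
      also have "\<dots> \<le> real (card (?good n)) / (real (?tot n) ^ card ?NR) / (real (N n s))\<^sup>2"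
        by (intro divide_right_mono of_nat_mono config_forest.card_good_ge[OF cf]) auto
      also have "\<dots> \<le> (\<Sum>\<phi>\<in>forest_maps (N n) s R c.
        measure_pmf.prob (P n) {m. forest_emb (half_edge_nbrs (d n) m) s R c \<phi>}) / (real (N n s))\<^sup>2"
        unfolding P_def by (intro divide_right_mono config_forest.expected_embeddings_ge[OF cf]) auto
      finally show ?case using elim by simp
    qed
  qed
  have Lh: "L n = distr (?M n) (count_space UNIV) (h n)" for n
  proof -
    have "config_law (n1 n) (n2 n) (d1 n) (d2 n) = map_pmf (h n) (P n)"
      by (simp add: config_law_def h_def[abs_def] P_def N_def d_def)
    then show ?thesis by (simp add: L map_pmf_rep_eq)
  qed
  have graph: "AE m in ?M n. part1 (h n m) = {..<N n True} \<and> part2 (h n m) = {..<N n False} \<and>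
      (\<forall>s u. u < N n s \<longrightarrow> set (?nb n m s u) = nbrs (h n m) s u)" for n
  proof -
    \<comment> \<open>An arbitrary forest, chosen only to obtain the facts about matchings from the
      locale.\<close>
    have "config_forest (N n) (d n) 1 (\<lambda>_. 2)"
      using sums' by unfold_locales auto
    then interpret config_forest "N n" "d n" 1 "\<lambda>_. 2" True 0 .
    have "set_pmf (P n) = PM"
      unfolding P_def using PM_nonempty finite_PM by simp
    then show ?thesis
      using half_edge_nbrs_eq[OF _ _ h_def] by (auto simp: AE_measure_pmf_iff h_def)
  qed
  note * = local_limit[OF measure_pmf.prob_space_axioms sets_measure_pmf NP fb Lh graph]
  show "weak_conv_m (\<lambda>n. X1_law (n1 n) (L n)) (real_law D1)"
    using *(1) by (simp add: N_def E_def)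
  show "weak_conv_m (\<lambda>n. X2_law (n2 n) (L n)) (real_law D2)"
    using *(2) by (simp add: N_def E_def)
  show "local_conv_in_prob TYPE('h) L (\<lambda>_. intersection_graph) (gw_space D1 D2) clique_tree"
    using *(3) by (simp add: E_def)
qed

section \<open>The inhomogeneous model\<close>

text \<open>The weights at the places of the pattern form a sample from the product law indexed by
  \<open>T\<close>. Given them, each of the remaining weights contributes its factor independently,
  which yields a power of a single integral.\<close>

lemma nn_integral_PiM_marginal:
  fixes \<mu> :: "'a measure"
  assumes \<mu>: "prob_space \<mu>" and fin: "finite K" "finite T" and \<iota>: "inj_on \<iota> T" "\<iota> ` T \<subseteq> K"
    and F: "F \<in> borel_measurable (Pi\<^sub>M T (\<lambda>_. \<mu>))"
    and H: "(\<lambda>(a, u). H a u) \<in> borel_measurable (Pi\<^sub>M T (\<lambda>_. \<mu>) \<Otimes>\<^sub>M \<mu>)"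
  shows "(\<integral>\<^sup>+z. F (\<lambda>t\<in>T. z (\<iota> t)) * (\<Prod>v\<in>K - \<iota> ` T. H (\<lambda>t\<in>T. z (\<iota> t)) (z v)) \<partial>Pi\<^sub>M K (\<lambda>_. \<mu>))
    = (\<integral>\<^sup>+a. F a * (\<integral>\<^sup>+u. H a u \<partial>\<mu>) ^ card (K - \<iota> ` T) \<partial>Pi\<^sub>M T (\<lambda>_. \<mu>))"
proof -
  interpret \<mu>: prob_space \<mu> by fact
  interpret product_sigma_finite "\<lambda>_. \<mu>"
    by (simp add: product_sigma_finite_def \<mu>.sigma_finite_measure_axioms)
  let ?J = "\<iota> ` T"
  define R where "R = K - ?J"
  define res where "res z = (\<lambda>t\<in>T. z (\<iota> t))" for z :: "'b \<Rightarrow> 'a"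
  have K: "K = ?J \<union> R" "?J \<inter> R = {}" "finite ?J" "finite R"
    using \<iota> fin by (auto simp: R_def)
  have res: "res \<in> measurable (Pi\<^sub>M L (\<lambda>_. \<mu>)) (Pi\<^sub>M T (\<lambda>_. \<mu>))" if "?J \<subseteq> L" for L
    unfolding res_def using that by (intro measurable_restrict measurable_component_singleton) auto
  let ?f = "\<lambda>z. F (res z) * (\<Prod>v\<in>R. H (res z) (z v))"
  have resK: "res \<in> measurable (Pi\<^sub>M K (\<lambda>_. \<mu>)) (Pi\<^sub>M T (\<lambda>_. \<mu>))"
    using \<iota>(2) by (rule res)
  have f: "?f \<in> borel_measurable (Pi\<^sub>M (?J \<union> R) (\<lambda>_. \<mu>))"
    unfolding K(1)[symmetric]
  proof (intro borel_measurable_times_ennreal borel_measurable_prod_ennreal)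
    show "(\<lambda>z. F (res z)) \<in> borel_measurable (Pi\<^sub>M K (\<lambda>_. \<mu>))"
      by (rule measurable_compose[OF resK F])
    fix v assume "v \<in> R"
    then have "(\<lambda>z. z v) \<in> measurable (Pi\<^sub>M K (\<lambda>_. \<mu>)) \<mu>"
      by (intro measurable_component_singleton) (auto simp: R_def)
    then have "(\<lambda>z. (res z, z v)) \<in> measurable (Pi\<^sub>M K (\<lambda>_. \<mu>)) (Pi\<^sub>M T (\<lambda>_. \<mu>) \<Otimes>\<^sub>M \<mu>)"
      using resK by (intro measurable_Pair)
    from measurable_compose[OF this H]
    show "(\<lambda>z. H (res z) (z v)) \<in> borel_measurable (Pi\<^sub>M K (\<lambda>_. \<mu>))" by simp
  qed
  let ?\<Psi> = "\<lambda>a. F a * (\<integral>\<^sup>+u. H a u \<partial>\<mu>) ^ card R"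
  have \<Psi>: "?\<Psi> \<in> borel_measurable (Pi\<^sub>M T (\<lambda>_. \<mu>))"
    by (intro borel_measurable_times_ennreal F borel_measurable_power_ennreal \<mu>.borel_measurable_nn_integral H)
  have "(\<integral>\<^sup>+z. ?f z \<partial>Pi\<^sub>M K (\<lambda>_. \<mu>)) = (\<integral>\<^sup>+x. \<integral>\<^sup>+y. ?f (merge ?J R (x, y)) \<partial>Pi\<^sub>M R (\<lambda>_. \<mu>) \<partial>Pi\<^sub>M ?J (\<lambda>_. \<mu>))"
    using product_nn_integral_fold[OF K(2,3,4) f] K(1) by simp
  also have "\<dots> = (\<integral>\<^sup>+x. ?\<Psi> (res x) \<partial>Pi\<^sub>M ?J (\<lambda>_. \<mu>))"
  proof (rule nn_integral_cong)
    fix x assume x: "x \<in> space (Pi\<^sub>M ?J (\<lambda>_. \<mu>))"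
    have r: "res (merge ?J R (x, y)) = res x" for y
      by (auto simp: res_def merge_def)
    have m: "merge ?J R (x, y) v = y v" if "v \<in> R" for y v
      using that K(2) by (auto simp: merge_def)
    have rx: "res x \<in> space (Pi\<^sub>M T (\<lambda>_. \<mu>))"
      using measurable_space[OF res x] by simp
    have Hx: "H (res x) \<in> borel_measurable \<mu>"
      using measurable_compose[OF measurable_Pair1'[OF rx] H] by simp
    have "(\<integral>\<^sup>+y. ?f (merge ?J R (x, y)) \<partial>Pi\<^sub>M R (\<lambda>_. \<mu>)) = (\<integral>\<^sup>+y. F (res x) * (\<Prod>v\<in>R. H (res x) (y v)) \<partial>Pi\<^sub>M R (\<lambda>_. \<mu>))"
      unfolding r by (intro nn_integral_cong arg_cong2[where f = "(*)"] prod.cong refl) (simp add: m)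
    also have "\<dots> = F (res x) * (\<integral>\<^sup>+y. (\<Prod>v\<in>R. H (res x) (y v)) \<partial>Pi\<^sub>M R (\<lambda>_. \<mu>))"
      by (intro nn_integral_cmult borel_measurable_prod_ennreal measurable_compose[OF _ Hx] measurable_component_singleton)
    also have "(\<integral>\<^sup>+y. (\<Prod>v\<in>R. H (res x) (y v)) \<partial>Pi\<^sub>M R (\<lambda>_. \<mu>)) = (\<Prod>v\<in>R. \<integral>\<^sup>+u. H (res x) u \<partial>\<mu>)"
      by (rule product_nn_integral_prod[OF K(4)]) (rule Hx)
    finally show "(\<integral>\<^sup>+y. ?f (merge ?J R (x, y)) \<partial>Pi\<^sub>M R (\<lambda>_. \<mu>)) = ?\<Psi> (res x)"
      by simp
  qed
  also have "\<dots> = (\<integral>\<^sup>+a. ?\<Psi> a \<partial>distr (Pi\<^sub>M ?J (\<lambda>_. \<mu>)) (Pi\<^sub>M T (\<lambda>_. \<mu>)) res)"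
    by (rule nn_integral_distr[symmetric], rule res[OF subset_refl], use \<Psi> in simp)
  also have "distr (Pi\<^sub>M ?J (\<lambda>_. \<mu>)) (Pi\<^sub>M T (\<lambda>_. \<mu>)) res = Pi\<^sub>M T (\<lambda>_. \<mu>)"
    unfolding res_def[abs_def] by (rule distr_PiM_reindex[OF \<mu> \<iota>(1)]) auto
  finally show ?thesis
    unfolding R_def res_def .
qed

text \<open>The clamping is the one performed by \<open>bernoulli_pmf\<close>. It keeps the value a
  probability for all real weights, since nonnegativity holds only almost everywhere.\<close>

definition edge_prob :: "real \<Rightarrow> real \<Rightarrow> real \<Rightarrow> real" where
  "edge_prob c x y = min 1 (max 0 (x * y / c))"

lemma edge_prob_bounds: "0 \<le> edge_prob c x y" "edge_prob c x y \<le> 1"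
  by (auto simp: edge_prob_def)

lemma edge_prob_le: "0 < c \<Longrightarrow> edge_prob c x y \<le> \<bar>x\<bar> * \<bar>y\<bar> / c"
proof -
  assume c: "0 < c"
  have "x * y / c \<le> \<bar>x * y\<bar> / c" using c by (intro divide_right_mono) auto
  moreover have "0 \<le> \<bar>x * y\<bar> / c" using c by simp
  ultimately show ?thesis by (auto simp: edge_prob_def abs_mult)
qed

lemma measurable_edge_prob [measurable (raw)]:
  assumes [measurable]: "f \<in> borel_measurable M" "g \<in> borel_measurable M"
  shows "(\<lambda>z. edge_prob c (f z) (g z)) \<in> borel_measurable M"
  unfolding edge_prob_def by simp

lemma pmf_bernoulli_clamp:
  "pmf (bernoulli_pmf (min z 1)) b = (if b then min 1 (max 0 z) else 1 - min 1 (max 0 z))"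
  by (auto simp: bernoulli_pmf.rep_eq pmf_bernoulli_True min_def max_def)

text \<open>Only finitely many edge sets are possible, and the probability of each is a finite
  product of measurable functions of the weights.\<close>

lemma measurable_weighted_law:
  assumes "sets \<mu>1 = sets borel" "sets \<mu>2 = sets borel"
  shows "(\<lambda>(x, y). measure_pmf (weighted_law n1 n2 x y))
    \<in> (\<Pi>\<^sub>M v\<in>{..<n1}. \<mu>1) \<Otimes>\<^sub>M (\<Pi>\<^sub>M w\<in>{..<n2}. \<mu>2) \<rightarrow>\<^sub>M subprob_algebra (count_space UNIV)"
proof (rule measurable_subprob_algebra)
  fix A :: "(nat, nat) bigraph set"
  let ?I = "{..<n1} \<times> {..<n2}"
  let ?q = "\<lambda>x y (v, w). bernoulli_pmf (min (x v * y w / sqrt (real n1 * real n2)) 1)"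
  let ?E = "{e. \<forall>vw. vw \<notin> ?I \<longrightarrow> e vw = False}"
  let ?g = "\<lambda>e. simple_bigraph {..<n1} {..<n2} {vw. e vw}"
  let ?N = "(\<Pi>\<^sub>M v\<in>{..<n1}. \<mu>1) \<Otimes>\<^sub>M (\<Pi>\<^sub>M w\<in>{..<n2}. \<mu>2)"
  have fin: "finite ?E"
    using finite_PiE_dflt[of ?I "\<lambda>_. UNIV :: bool set" False] by (simp add: PiE_dflt_def)
  have eq: "emeasure (measure_pmf (weighted_law n1 n2 x y)) A
      = (\<Sum>e\<in>?E \<inter> ?g -` A. ennreal (\<Prod>vw\<in>?I. pmf (?q x y vw) (e vw)))" for x y
  proof -
    let ?F = "Pi_pmf ?I False (?q x y)"
    have "set_pmf ?F \<subseteq> ?E" by (rule set_Pi_pmf_subset) simp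
    then have "emeasure ?F (?g -` A) = emeasure ?F (?E \<inter> ?g -` A)"
      by (intro emeasure_eq_AE) (auto simp: AE_measure_pmf_iff)
    also have "\<dots> = (\<Sum>e\<in>?E \<inter> ?g -` A. ennreal (pmf ?F e))"
      using fin by (subst emeasure_measure_pmf_finite) auto
    also have "\<dots> = (\<Sum>e\<in>?E \<inter> ?g -` A. ennreal (\<Prod>vw\<in>?I. pmf (?q x y vw) (e vw)))"
      by (intro sum.cong refl) (subst pmf_Pi, auto)
    finally show ?thesis by (simp add: weighted_law_def)
  qed
  have "(\<lambda>p. pmf (?q (fst p) (snd p) vw) b) \<in> borel_measurable ?N" if vw: "vw \<in> ?I" for vw b
  proof -
    obtain v w where [simp]: "vw = (v, w)" "v < n1" "w < n2" using vw by auto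
    have "(\<lambda>p. fst p v) \<in> measurable ?N \<mu>1" "(\<lambda>p. snd p w) \<in> measurable ?N \<mu>2"
      by (auto intro!: measurable_compose[OF measurable_fst] measurable_compose[OF measurable_snd] measurable_component_singleton)
    then have [measurable]: "(\<lambda>p. fst p v) \<in> borel_measurable ?N" "(\<lambda>p. snd p w) \<in> borel_measurable ?N"
      using measurable_cong_sets[OF refl assms(1)] measurable_cong_sets[OF refl assms(2)] by blast+
    show ?thesis
      by (simp add: pmf_bernoulli_clamp)
  qed
  then show "(\<lambda>p. emeasure (case p of (x, y) \<Rightarrow> measure_pmf (weighted_law n1 n2 x y)) A) \<in> borel_measurable ?N"
    unfolding case_prod_beta eq
    by (intro borel_measurable_sum measurable_compose[OF _ measurable_ennreal] borel_measurable_prod) auto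
qed (auto intro: prob_space_imp_subprob_space measure_pmf.prob_space_axioms)

section \<open>Exact placements given all weights\<close>

context pattern
begin

abbreviation "T1 \<equiv> {t \<in> T. sd t}"
abbreviation "T2 \<equiv> {t \<in> T. \<not> sd t}"
abbreviation "I1 \<equiv> {t \<in> I. sd t}"
abbreviation "I2 \<equiv> {t \<in> I. \<not> sd t}"

text \<open>Pairs of leaves are required to be non-adjacent as well. This costs nothing in the
  limit, as single edge probabilities vanish, and gives a product over all placed pairs.\<close>

definition inner_prob :: "real \<Rightarrow> (nat list \<Rightarrow> real) \<Rightarrow> (nat list \<Rightarrow> real) \<Rightarrow> real" where
  "inner_prob c a b = (\<Prod>t\<in>T1. \<Prod>u\<in>T2. if u \<in> nb t then edge_prob c (a t) (b u) else 1 - edge_prob c (a t) (b u))"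

text \<open>Given the weights, edges are independent and exactness is a condition on each pair:
  present if prescribed, absent if it touches an inner node otherwise, free in all other cases. The
  pairs split into four blocks by whether their ends are placed; the block of outside pairs
  contributes one.\<close>

lemma weighted_exact_ge:
  fixes x y :: "nat \<Rightarrow> real"
  assumes adm: "admissible (\<lambda>s. if s then n1 else n2) \<phi>"
  defines "c \<equiv> sqrt (real n1 * real n2)"
  shows "inner_prob c (\<lambda>t. x (\<phi> t)) (\<lambda>u. y (\<phi> u)) *
      (\<Prod>w\<in>{..<n2} - \<phi> ` T2. \<Prod>t\<in>I1. 1 - edge_prob c (x (\<phi> t)) (y w)) *
      (\<Prod>v\<in>{..<n1} - \<phi> ` T1. \<Prod>u\<in>I2. 1 - edge_prob c (x v) (y (\<phi> u)))
    \<le> measure_pmf.prob (weighted_law n1 n2 x y) {H. exact H \<phi>}"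
proof -
  let ?p = "\<lambda>v w. edge_prob c (x v) (y w)"
  let ?q = "\<lambda>(v, w). bernoulli_pmf (min (x v * y w / sqrt (real n1 * real n2)) 1)"
  define E where "E = {(\<phi> t, \<phi> u) |t u. t \<in> T1 \<and> u \<in> nb t}"
  define B where "B = (\<lambda>(v, w). if (v, w) \<in> E then {True} else if v \<in> \<phi> ` I1 \<or> w \<in> \<phi> ` I2 then {False} else UNIV)"
  define f where "f v w = measure_pmf.prob (?q (v, w)) (B (v, w))" for v w
  let ?J1 = "\<phi> ` T1" and ?J2 = "\<phi> ` T2"
  let ?R1 = "{..<n1} - ?J1" and ?R2 = "{..<n2} - ?J2"
  have inj1: "inj_on \<phi> T1" and inj2: "inj_on \<phi> T2"
    by (rule inj_onI, use admissible_inj[OF adm] in auto)+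
  have J: "?J1 \<subseteq> {..<n1}" "?J2 \<subseteq> {..<n2}"
    using adm by (auto simp: admissible_def)
  have I: "I1 \<subseteq> T1" "I2 \<subseteq> T2" using IT by auto
  have nbT2: "u \<in> T2" if "t \<in> T1" "u \<in> nb t" for t u
    using that nb_T nb_side by blast
  have E_iff: "(\<phi> t, \<phi> u) \<in> E \<longleftrightarrow> u \<in> nb t" if tu: "t \<in> T1" "u \<in> T2" for t u
  proof
    assume "(\<phi> t, \<phi> u) \<in> E"
    then obtain t' u' where e: "t' \<in> T1" "u' \<in> nb t'" "\<phi> t = \<phi> t'" "\<phi> u = \<phi> u'"
      by (auto simp: E_def)
    then have "t = t'" "u = u'"
      using inj_onD[OF inj1 e(3)] inj_onD[OF inj2 e(4)] tu nbT2[OF e(1,2)] by auto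
    then show "u \<in> nb t" using e by simp
  qed (use tu in \<open>auto simp: E_def\<close>)
  have E_sub: "E \<subseteq> ?J1 \<times> ?J2"
    unfolding E_def using nbT2 by blast
  have q: "measure_pmf.prob (?q (v, w)) {True} = ?p v w" "measure_pmf.prob (?q (v, w)) {False} = 1 - ?p v w" for v w
    by (simp_all add: measure_pmf_single pmf_bernoulli_clamp edge_prob_def c_def)
  have p01: "0 \<le> 1 - ?p v w" "1 - ?p v w \<le> 1" "0 \<le> ?p v w" for v w
    using edge_prob_bounds by auto
  \<comment> \<open>A pair of leaves is free for exactness, so there the factor in
    \<open>inner_prob\<close> is only a lower bound.\<close>
  have f_in: "0 \<le> (if u \<in> nb t then ?p (\<phi> t) (\<phi> u) else 1 - ?p (\<phi> t) (\<phi> u)) \<and>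
      (if u \<in> nb t then ?p (\<phi> t) (\<phi> u) else 1 - ?p (\<phi> t) (\<phi> u)) \<le> f (\<phi> t) (\<phi> u)" if "t \<in> T1" "u \<in> T2" for t u
    using E_iff[OF that] p01 q[of "\<phi> t" "\<phi> u"] by (auto simp: f_def B_def)
  have f_R2: "f (\<phi> t) w = (if t \<in> I then 1 - ?p (\<phi> t) w else 1)" if t: "t \<in> T1" and w: "w \<in> ?R2" for t w
  proof -
    have "(\<phi> t, w) \<notin> E" "w \<notin> \<phi> ` I2" using w E_sub I by auto
    moreover have "\<phi> t \<in> \<phi> ` I1 \<longleftrightarrow> t \<in> I"
      using t inj_on_image_mem_iff[OF inj1 t I(1)] by auto
    ultimately show ?thesis
      using q[of "\<phi> t" w] by (auto simp: f_def B_def)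
  qed
  have f_R1: "f v (\<phi> u) = (if u \<in> I then 1 - ?p v (\<phi> u) else 1)" if u: "u \<in> T2" and v: "v \<in> ?R1" for u v
  proof -
    have "(v, \<phi> u) \<notin> E" "v \<notin> \<phi> ` I1" using v E_sub I by auto
    moreover have "\<phi> u \<in> \<phi> ` I2 \<longleftrightarrow> u \<in> I"
      using u inj_on_image_mem_iff[OF inj2 u I(2)] by auto
    ultimately show ?thesis
      using q[of v "\<phi> u"] by (auto simp: f_def B_def)
  qed
  have f_R12: "f v w = 1" if "v \<in> ?R1" "w \<in> ?R2" for v w
  proof -
    have "(v, w) \<notin> E" "v \<notin> \<phi> ` I1" "w \<notin> \<phi> ` I2" using that E_sub I by auto
    then show ?thesis by (simp add: f_def B_def)
  qed
  have exact: "exact (simple_bigraph {..<n1} {..<n2} {vw. e vw}) \<phi>"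
    if e: "\<And>v w. v < n1 \<Longrightarrow> w < n2 \<Longrightarrow> e (v, w) \<in> B (v, w)" for e
    unfolding exact_def
  proof
    fix t assume t: "t \<in> I"
    then have tT: "t \<in> T" using IT by auto
    show "nbrs (simple_bigraph {..<n1} {..<n2} {vw. e vw}) (sd t) (\<phi> t) = \<phi> ` nb t"
    proof (cases "sd t")
      case True
      then have t1: "t \<in> T1" "\<phi> t \<in> \<phi> ` I1" "\<phi> t < n1" using t tT J by auto
      have "w < n2 \<and> e (\<phi> t, w) \<longleftrightarrow> w \<in> \<phi> ` nb t" for w
      proof -
        have "(\<phi> t, w) \<in> E \<longleftrightarrow> w \<in> \<phi> ` nb t"
        proof
          assume wE: "(\<phi> t, w) \<in> E"
          then obtain u where u: "u \<in> T2" "w = \<phi> u" using E_sub by auto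
          then show "w \<in> \<phi> ` nb t" using E_iff[OF t1(1) u(1)] wE by simp
        next
          assume "w \<in> \<phi> ` nb t"
          then show "(\<phi> t, w) \<in> E" using E_iff[OF t1(1) nbT2[OF t1(1)]] by auto
        qed
        moreover have "w < n2" if "(\<phi> t, w) \<in> E" using that E_sub J by auto
        moreover have "e (\<phi> t, w) \<longleftrightarrow> (\<phi> t, w) \<in> E" if "w < n2"
          using e[OF t1(3) that] t1(2) by (auto simp: B_def split: if_splits)
        ultimately show ?thesis by blast
      qed
      then show ?thesis
        using True t1(3) by (auto simp: nbrs_def nbrs1_def simple_bigraph_def)
    next
      case False
      then have t2: "t \<in> T2" "\<phi> t \<in> \<phi> ` I2" "\<phi> t < n2" using t tT J by auto
      have nb2: "u \<in> T1 \<and> t \<in> nb u" if "u \<in> nb t" for u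
        using that nb_T[OF tT] nb_side[OF tT] nb_sym[OF tT] t2 by auto
      have "v < n1 \<and> e (v, \<phi> t) \<longleftrightarrow> v \<in> \<phi> ` nb t" for v
      proof -
        have "(v, \<phi> t) \<in> E \<longleftrightarrow> v \<in> \<phi> ` nb t"
        proof
          assume vE: "(v, \<phi> t) \<in> E"
          then obtain u where u: "u \<in> T1" "v = \<phi> u" using E_sub by auto
          then have "t \<in> nb u" using E_iff[OF u(1) t2(1)] vE by simp
          then show "v \<in> \<phi> ` nb t" using nb_sym u by auto
        next
          assume "v \<in> \<phi> ` nb t"
          then show "(v, \<phi> t) \<in> E" using nb2 E_iff[OF _ t2(1)] by auto
        qed
        moreover have "v < n1" if "(v, \<phi> t) \<in> E" using that E_sub J by auto
        moreover have "e (v, \<phi> t) \<longleftrightarrow> (v, \<phi> t) \<in> E" if "v < n1"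
          using e[OF that t2(3)] t2(2) by (auto simp: B_def split: if_splits)
        ultimately show ?thesis by blast
      qed
      then show ?thesis
        using False t2(3) by (auto simp: nbrs_def nbrs2_def simple_bigraph_def)
    qed
  qed
  have R2: "(\<Prod>v\<in>?J1. \<Prod>w\<in>?R2. f v w) = (\<Prod>w\<in>?R2. \<Prod>t\<in>I1. 1 - ?p (\<phi> t) w)"
  proof -
    have "(\<Prod>v\<in>?J1. \<Prod>w\<in>?R2. f v w) = (\<Prod>w\<in>?R2. \<Prod>v\<in>?J1. f v w)"
      by (rule prod.swap)
    also have "\<dots> = (\<Prod>w\<in>?R2. \<Prod>t\<in>T1. if t \<in> I then 1 - ?p (\<phi> t) w else 1)"
      by (intro prod.cong refl) (simp add: prod.reindex[OF inj1] f_R2)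
    also have "\<dots> = (\<Prod>w\<in>?R2. \<Prod>t\<in>I1. 1 - ?p (\<phi> t) w)"
      using fin I(1) by (intro prod.cong refl prod.mono_neutral_cong_right) auto
    finally show ?thesis .
  qed
  have R1: "(\<Prod>v\<in>?R1. \<Prod>w\<in>?J2. f v w) = (\<Prod>v\<in>?R1. \<Prod>u\<in>I2. 1 - ?p v (\<phi> u))"
  proof -
    have "(\<Prod>v\<in>?R1. \<Prod>w\<in>?J2. f v w) = (\<Prod>v\<in>?R1. \<Prod>u\<in>T2. if u \<in> I then 1 - ?p v (\<phi> u) else 1)"
      by (intro prod.cong refl) (simp add: prod.reindex[OF inj2] f_R1)
    also have "\<dots> = (\<Prod>v\<in>?R1. \<Prod>u\<in>I2. 1 - ?p v (\<phi> u))"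
      using fin I(2) by (intro prod.cong refl prod.mono_neutral_cong_right) auto
    finally show ?thesis .
  qed
  have "inner_prob c (\<lambda>t. x (\<phi> t)) (\<lambda>u. y (\<phi> u)) \<le> (\<Prod>t\<in>T1. \<Prod>u\<in>T2. f (\<phi> t) (\<phi> u))"
    unfolding inner_prob_def using f_in by (intro prod_mono conjI prod_nonneg ballI) auto
  also have "\<dots> = (\<Prod>v\<in>?J1. \<Prod>w\<in>?J2. f v w)"
    by (simp add: prod.reindex[OF inj1] prod.reindex[OF inj2])
  finally have inner: "inner_prob c (\<lambda>t. x (\<phi> t)) (\<lambda>u. y (\<phi> u)) \<le> (\<Prod>v\<in>?J1. \<Prod>w\<in>?J2. f v w)" .
  have "(\<Prod>v<n1. \<Prod>w<n2. f v w) = (\<Prod>v\<in>?J1. \<Prod>w\<in>?J2. f v w) * (\<Prod>v\<in>?J1. \<Prod>w\<in>?R2. f v w) * (\<Prod>v\<in>?R1. \<Prod>w\<in>?J2. f v w)"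
  proof -
    have w: "(\<Prod>w<n2. f v w) = (\<Prod>w\<in>?J2. f v w) * (\<Prod>w\<in>?R2. f v w)" for v
      using prod.subset_diff[OF J(2), of "f v"] by (simp add: mult.commute)
    have "(\<Prod>v<n1. \<Prod>w<n2. f v w) = (\<Prod>v\<in>?J1. \<Prod>w<n2. f v w) * (\<Prod>v\<in>?R1. \<Prod>w<n2. f v w)"
      using prod.subset_diff[OF J(1), of "\<lambda>v. \<Prod>w<n2. f v w"] by (simp add: mult.commute)
    moreover have "(\<Prod>v\<in>?R1. \<Prod>w<n2. f v w) = (\<Prod>v\<in>?R1. \<Prod>w\<in>?J2. f v w)"
    proof (rule prod.cong[OF refl])
      fix v assume v: "v \<in> ?R1"
      have "(\<Prod>w\<in>?R2. f v w) = (\<Prod>w\<in>?R2. 1)"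
        by (intro prod.cong refl f_R12 v)
      then show "(\<Prod>w<n2. f v w) = (\<Prod>w\<in>?J2. f v w)"
        unfolding w by (simp only: prod.neutral_const mult_1_right)
    qed
    ultimately show ?thesis
      by (simp add: w prod.distrib)
  qed
  then have "inner_prob c (\<lambda>t. x (\<phi> t)) (\<lambda>u. y (\<phi> u)) *
      (\<Prod>w\<in>?R2. \<Prod>t\<in>I1. 1 - ?p (\<phi> t) w) * (\<Prod>v\<in>?R1. \<Prod>u\<in>I2. 1 - ?p v (\<phi> u)) \<le> (\<Prod>v<n1. \<Prod>w<n2. f v w)"
    unfolding R1 R2 using inner p01 by (simp only:) (intro mult_right_mono prod_nonneg ballI; simp)
  also have "(\<Prod>v<n1. \<Prod>w<n2. f v w) = (\<Prod>vw\<in>{..<n1} \<times> {..<n2}. measure_pmf.prob (?q vw) (B vw))"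
    by (simp add: f_def prod.cartesian_product case_prod_unfold)
  also have "\<dots> = measure_pmf.prob (Pi_pmf ({..<n1} \<times> {..<n2}) False ?q) (Pi ({..<n1} \<times> {..<n2}) B)"
    by (rule measure_Pi_pmf_Pi[symmetric]) simp
  also have "\<dots> \<le> measure_pmf.prob (Pi_pmf ({..<n1} \<times> {..<n2}) False ?q)
      ((\<lambda>e. simple_bigraph {..<n1} {..<n2} {vw. e vw}) -` {H. exact H \<phi>})"
    by (intro measure_pmf.finite_measure_mono) (auto intro!: exact)
  also have "\<dots> = measure_pmf.prob (weighted_law n1 n2 x y) {H. exact H \<phi>}"
    by (simp add: weighted_law_def)
  finally show ?thesis .
qed

end

text \<open>Weierstrass's product inequality, proved by adding one factor at a time.\<close>

lemma prod_one_minus_ge: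
  fixes p :: "'i \<Rightarrow> real"
  assumes "finite S" "\<And>t. t \<in> S \<Longrightarrow> 0 \<le> p t \<and> p t \<le> 1"
  shows "1 - (\<Sum>t\<in>S. p t) \<le> (\<Prod>t\<in>S. 1 - p t)"
  using assms
proof (induction S rule: finite_induct)
  case (insert t S)
  have "(\<Prod>t\<in>S. 1 - p t) \<le> 1" "0 \<le> (\<Prod>t\<in>S. 1 - p t)"
    using insert.prems by (auto intro!: prod_le_1 prod_nonneg)
  then have "p t * (\<Prod>t\<in>S. 1 - p t) \<le> p t * 1"
    using insert.prems[of t] by (intro mult_left_mono) auto
  then show ?case
    using insert by (simp add: algebra_simps)
qed simp

text \<open>An outside vertex of weight \<open>u\<close> misses all inner nodes with probability at
  least one minus a term linear in its weight, so after integration only the first moment of the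
  weight enters.\<close>

lemma nn_integral_avoid_ge:
  fixes \<mu> :: "real measure" and p :: "'i \<Rightarrow> real \<Rightarrow> real"
  assumes \<mu>: "prob_space \<mu>" "integrable \<mu> (\<lambda>u. \<bar>u\<bar>)" and S: "finite S"
    and p: "\<And>t u. t \<in> S \<Longrightarrow> 0 \<le> p t u \<and> p t u \<le> 1 \<and> p t u \<le> k t * \<bar>u\<bar>"
    and meas: "\<And>t. t \<in> S \<Longrightarrow> p t \<in> borel_measurable \<mu>"
  shows "ennreal (max 0 (1 - (\<Sum>t\<in>S. k t * (\<integral>u. \<bar>u\<bar> \<partial>\<mu>)))) \<le> (\<integral>\<^sup>+u. ennreal (\<Prod>t\<in>S. 1 - p t u) \<partial>\<mu>)"
proof -
  interpret prob_space \<mu> by fact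
  have p01: "0 \<le> (\<Prod>t\<in>S. 1 - p t u)" "(\<Prod>t\<in>S. 1 - p t u) \<le> 1" for u
    using p by (auto intro!: prod_nonneg prod_le_1)
  have int: "integrable \<mu> (\<lambda>u. \<Prod>t\<in>S. 1 - p t u)"
    by (rule integrable_const_bound[of _ 1]) (use p01 meas in auto)
  have "1 - (\<Sum>t\<in>S. k t * (\<integral>u. \<bar>u\<bar> \<partial>\<mu>)) = (\<integral>u. 1 - (\<Sum>t\<in>S. k t * \<bar>u\<bar>) \<partial>\<mu>)"
    using \<mu>(2) by (simp add: prob_space)
  also have "\<dots> \<le> (\<integral>u. (\<Prod>t\<in>S. 1 - p t u) \<partial>\<mu>)"
  proof (rule integral_mono[OF _ int])
    fix u
    have "1 - (\<Sum>t\<in>S. k t * \<bar>u\<bar>) \<le> 1 - (\<Sum>t\<in>S. p t u)"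
      using p by (intro diff_left_mono sum_mono) auto
    also have "\<dots> \<le> (\<Prod>t\<in>S. 1 - p t u)"
      by (rule prod_one_minus_ge[OF S]) (use p in auto)
    finally show "1 - (\<Sum>t\<in>S. k t * \<bar>u\<bar>) \<le> (\<Prod>t\<in>S. 1 - p t u)" .
  qed (use \<mu>(2) in auto)
  finally have "max 0 (1 - (\<Sum>t\<in>S. k t * (\<integral>u. \<bar>u\<bar> \<partial>\<mu>))) \<le> (\<integral>u. (\<Prod>t\<in>S. 1 - p t u) \<partial>\<mu>)"
    using p01 by (auto intro!: integral_nonneg_AE)
  then show ?thesis
    using int p01 by (subst nn_integral_eq_integral) (auto intro!: ennreal_leI)
qed

section \<open>Integration over the weights\<close>

context pattern
begin

text \<open>Lower bound for the probability of exactness given only the weights \<open>a\<close> and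
  \<open>b\<close> at the pattern, with \<open>e1\<close> and \<open>e2\<close> for the mean
  weights. The exponents count all vertices instead of the outside ones, so the bound is the same
  for every placement.\<close>

definition inner_bound :: "nat \<Rightarrow> nat \<Rightarrow> real \<Rightarrow> real \<Rightarrow> (nat list \<Rightarrow> real) \<Rightarrow> (nat list \<Rightarrow> real) \<Rightarrow> real" where
  "inner_bound n1 n2 e1 e2 a b = (let c = sqrt (real n1 * real n2) in
     inner_prob c a b * max 0 (1 - (\<Sum>t\<in>I1. \<bar>a t\<bar> / c * e2)) ^ n2 * max 0 (1 - (\<Sum>u\<in>I2. \<bar>b u\<bar> / c * e1)) ^ n1)"

lemma inner_prob_bounds: "0 \<le> inner_prob c a b"
  unfolding inner_prob_def using edge_prob_bounds by (intro prod_nonneg ballI) auto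

context
  fixes \<mu>1 \<mu>2 :: "real measure"
  assumes prob: "prob_space \<mu>1" "prob_space \<mu>2" and sets: "sets \<mu>1 = sets borel" "sets \<mu>2 = sets borel"
    and int: "integrable \<mu>1 (\<lambda>x. \<bar>x\<bar>)" "integrable \<mu>2 (\<lambda>x. \<bar>x\<bar>)"
begin

abbreviation (input) "PT1 \<equiv> Pi\<^sub>M T1 (\<lambda>_. \<mu>1)"
abbreviation (input) "PT2 \<equiv> Pi\<^sub>M T2 (\<lambda>_. \<mu>2)"

lemma measurable_T1: "f \<in> measurable M PT1 \<Longrightarrow> t \<in> T1 \<Longrightarrow> (\<lambda>p. f p t) \<in> borel_measurable M"
  using measurable_compose[OF _ measurable_component_singleton, of f M T1 "\<lambda>_. \<mu>1" t]
    measurable_cong_sets[OF refl sets(1), of M] by auto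

lemma measurable_T2: "f \<in> measurable M PT2 \<Longrightarrow> t \<in> T2 \<Longrightarrow> (\<lambda>p. f p t) \<in> borel_measurable M"
  using measurable_compose[OF _ measurable_component_singleton, of f M T2 "\<lambda>_. \<mu>2" t]
    measurable_cong_sets[OF refl sets(2), of M] by auto

lemma measurable_inner_prob:
  assumes f: "f \<in> measurable M PT1" and g: "g \<in> measurable M PT2"
  shows "(\<lambda>p. inner_prob c (f p) (g p)) \<in> borel_measurable M"
  unfolding inner_prob_def
proof (intro borel_measurable_prod)
  fix t u assume t: "t \<in> T1" and u: "u \<in> T2"
  have "(\<lambda>p. edge_prob c (f p t) (g p u)) \<in> borel_measurable M"
    by (intro measurable_edge_prob measurable_T1[OF f t] measurable_T2[OF g u])
  then show "(\<lambda>p. if u \<in> nb t then edge_prob c (f p t) (g p u) else 1 - edge_prob c (f p t) (g p u)) \<in> borel_measurable M"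
    by (cases "u \<in> nb t") auto
qed

lemma measurable_inner_bound:
  assumes f: "f \<in> measurable M PT1" and g: "g \<in> measurable M PT2"
  shows "(\<lambda>p. inner_bound n1 n2 e1 e2 (f p) (g p)) \<in> borel_measurable M"
proof -
  have [measurable]: "(\<lambda>p. inner_prob c (f p) (g p)) \<in> borel_measurable M" for c
    by (rule measurable_inner_prob[OF f g])
  have [measurable]: "(\<lambda>p. \<Sum>t\<in>I1. \<bar>f p t\<bar> / c * e) \<in> borel_measurable M" for c e
    using IT by (intro borel_measurable_sum borel_measurable_times borel_measurable_divide borel_measurable_abs measurable_T1[OF f]) auto
  have [measurable]: "(\<lambda>p. \<Sum>t\<in>I2. \<bar>g p t\<bar> / c * e) \<in> borel_measurable M" for c e
    using IT by (intro borel_measurable_sum borel_measurable_times borel_measurable_divide borel_measurable_abs measurable_T2[OF g]) auto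
  show ?thesis
    unfolding inner_bound_def Let_def by measurable
qed

text \<open>Each outside weight interacts only with the weights at the pattern nodes of the opposite
  side. Outside weights can therefore be averaged one side at a time, with the weights of the other
  side frozen, and Fubini connects the two rounds.\<close>

lemma inhomog_exact_ge:
  assumes adm: "admissible (\<lambda>s. if s then n1 else n2) \<phi>" and n: "0 < n1" "0 < n2"
  shows "(\<integral>\<^sup>+b. \<integral>\<^sup>+a. ennreal (inner_bound n1 n2 (\<integral>x. \<bar>x\<bar> \<partial>\<mu>1) (\<integral>y. \<bar>y\<bar> \<partial>\<mu>2) a b) \<partial>PT1 \<partial>PT2)
    \<le> emeasure (inhomog_law n1 n2 \<mu>1 \<mu>2) {H. exact H \<phi>}"
proof -
  interpret M1: prob_space \<mu>1 by (rule prob)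
  interpret M2: prob_space \<mu>2 by (rule prob)
  let ?N1 = "Pi\<^sub>M {..<n1} (\<lambda>_. \<mu>1)" and ?N2 = "Pi\<^sub>M {..<n2} (\<lambda>_. \<mu>2)"
  interpret N1: prob_space ?N1 by (intro prob_space_PiM prob)
  interpret N2: prob_space ?N2 by (intro prob_space_PiM prob)
  interpret P2: prob_space PT2 by (intro prob_space_PiM prob)
  interpret N1P2: pair_sigma_finite ?N1 PT2 ..
  interpret N12: pair_prob_space ?N1 ?N2 ..
  define c where "c = sqrt (real n1 * real n2)"
  have c: "0 < c" using n by (simp add: c_def)
  define G where "G a u = ennreal (\<Prod>t\<in>I1. 1 - edge_prob c (a t) u)" for a :: "nat list \<Rightarrow> real" and u
  define H where "H b v = ennreal (\<Prod>t\<in>I2. 1 - edge_prob c v (b t))" for b :: "nat list \<Rightarrow> real" and v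
  define g where "g a = (\<integral>\<^sup>+u. G a u \<partial>\<mu>2)" for a
  define hh where "hh b = (\<integral>\<^sup>+v. H b v \<partial>\<mu>1)" for b
  define R1 where "R1 = {..<n1} - \<phi> ` T1"
  define R2 where "R2 = {..<n2} - \<phi> ` T2"
  define r1 where "r1 x = (\<lambda>t\<in>T1. x (\<phi> t))" for x :: "nat \<Rightarrow> real"
  define r2 where "r2 y = (\<lambda>t\<in>T2. y (\<phi> t))" for y :: "nat \<Rightarrow> real"
  have inj1: "inj_on \<phi> T1" and inj2: "inj_on \<phi> T2"
    by (rule inj_onI, use admissible_inj[OF adm] in auto)+
  have J: "\<phi> ` T1 \<subseteq> {..<n1}" "\<phi> ` T2 \<subseteq> {..<n2}"
    using adm by (auto simp: admissible_def)
  have r1: "r1 \<in> measurable ?N1 PT1" and r2: "r2 \<in> measurable ?N2 PT2"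
    unfolding r1_def r2_def using J by (auto intro!: measurable_restrict measurable_component_singleton)
  have borel1: "f \<in> borel_measurable M" if "f \<in> measurable M \<mu>1" for f and M :: "'x measure"
    using that measurable_cong_sets[OF refl sets(1)] by blast
  have borel2: "f \<in> borel_measurable M" if "f \<in> measurable M \<mu>2" for f and M :: "'x measure"
    using that measurable_cong_sets[OF refl sets(2)] by blast
  have Gm: "(\<lambda>p. G (f p) (k p)) \<in> borel_measurable M" if f: "f \<in> measurable M PT1" and k: "k \<in> measurable M \<mu>2"
    for f k and M :: "'x measure"
    unfolding G_def using IT
    by (intro measurable_compose[OF _ measurable_ennreal] borel_measurable_prod borel_measurable_diff
        borel_measurable_const measurable_edge_prob measurable_T1[OF f] borel2 k) auto
  have Hm: "(\<lambda>p. H (f p) (k p)) \<in> borel_measurable M" if f: "f \<in> measurable M PT2" and k: "k \<in> measurable M \<mu>1"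
    for f k and M :: "'x measure"
    unfolding H_def using IT
    by (intro measurable_compose[OF _ measurable_ennreal] borel_measurable_prod borel_measurable_diff
        borel_measurable_const measurable_edge_prob measurable_T2[OF f] borel1 k) auto
  have im: "(\<lambda>p. ennreal (inner_prob c (f p) (k p))) \<in> borel_measurable M"
    if "f \<in> measurable M PT1" "k \<in> measurable M PT2" for f k and M :: "'x measure"
    by (intro measurable_compose[OF _ measurable_ennreal] measurable_inner_prob that)
  have gm: "g \<in> borel_measurable PT1"
    unfolding g_def by (intro M2.borel_measurable_nn_integral) (simp add: case_prod_unfold Gm)
  have v_m: "(\<lambda>x. x v) \<in> measurable ?N1 \<mu>1" if "v \<in> R1" for v
    using that by (intro measurable_component_singleton) (auto simp: R1_def)
  have w_m: "(\<lambda>y. y w) \<in> measurable ?N2 \<mu>2" if "w \<in> R2" for w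
    using that by (intro measurable_component_singleton) (auto simp: R2_def)
  let ?W = "\<lambda>x y. ennreal (inner_prob c (r1 x) (r2 y)) * (\<Prod>v\<in>R1. H (r2 y) (x v)) * (\<Prod>w\<in>R2. G (r1 x) (y w))"
  have Wm: "(\<lambda>p. ?W (fst p) (snd p)) \<in> borel_measurable (?N1 \<Otimes>\<^sub>M ?N2)"
    by (intro borel_measurable_times_ennreal borel_measurable_prod_ennreal im Gm Hm
        measurable_compose[OF measurable_fst r1] measurable_compose[OF measurable_snd r2]
        measurable_compose[OF measurable_fst v_m] measurable_compose[OF measurable_snd w_m])
  let ?Z = "\<lambda>x b. ennreal (inner_prob c (r1 x) b) * (\<Prod>v\<in>R1. H b (x v)) * g (r1 x) ^ card R2"
  have Zm: "(\<lambda>(x, b). ?Z x b) \<in> borel_measurable (?N1 \<Otimes>\<^sub>M PT2)"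
    unfolding case_prod_unfold
    by (intro borel_measurable_times_ennreal borel_measurable_prod_ennreal borel_measurable_power_ennreal im Hm
        measurable_compose[OF measurable_compose[OF measurable_fst r1] gm]
        measurable_compose[OF measurable_fst r1] measurable_snd measurable_compose[OF measurable_fst v_m])
  \<comment> \<open>\<open>g a\<close> and \<open>hh b\<close> are the averaged probabilities that
    an outside vertex misses the inner nodes; they exceed their linear bounds, and powers of a base
    at most one decrease when the exponent grows to the full vertex count.\<close>
  have lower: "ennreal (inner_bound n1 n2 (\<integral>x. \<bar>x\<bar> \<partial>\<mu>1) (\<integral>y. \<bar>y\<bar> \<partial>\<mu>2) a b)
      \<le> ennreal (inner_prob c a b) * g a ^ card R2 * hh b ^ card R1" for a b
  proof -
    let ?A = "max 0 (1 - (\<Sum>t\<in>I1. \<bar>a t\<bar> / c * (\<integral>y. \<bar>y\<bar> \<partial>\<mu>2)))"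
    let ?B = "max 0 (1 - (\<Sum>u\<in>I2. \<bar>b u\<bar> / c * (\<integral>x. \<bar>x\<bar> \<partial>\<mu>1)))"
    have finI: "finite I1" "finite I2" using finite_subset[OF IT fin] by auto
    have em2: "edge_prob c \<alpha> \<in> borel_measurable \<mu>2" for \<alpha>
      by (rule measurable_edge_prob[OF borel_measurable_const[of \<alpha>] borel2[OF measurable_ident[unfolded id_def]]])
    have em1: "(\<lambda>v. edge_prob c v \<alpha>) \<in> borel_measurable \<mu>1" for \<alpha>
      by (rule measurable_edge_prob[OF borel1[OF measurable_ident[unfolded id_def]] borel_measurable_const[of \<alpha>]])
    have A: "ennreal ?A \<le> g a"
      unfolding g_def G_def
      by (rule nn_integral_avoid_ge[OF prob(2) int(2) finI(1)])
         (use edge_prob_bounds edge_prob_le[OF c] em2 in \<open>auto simp: times_divide_eq_left\<close>)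
    have B: "ennreal ?B \<le> hh b"
      unfolding hh_def H_def
      by (rule nn_integral_avoid_ge[OF prob(1) int(1) finI(2)])
         (use edge_prob_bounds edge_prob_le[OF c] em1 in \<open>auto simp: mult.commute\<close>)
    have A1: "?A \<le> 1" "?B \<le> 1"
      using c by (auto intro!: sum_nonneg mult_nonneg_nonneg integral_nonneg_AE)
    have R: "card R1 \<le> n1" "card R2 \<le> n2"
      using card_mono[of "{..<n1}" R1] card_mono[of "{..<n2}" R2] by (auto simp: R1_def R2_def)
    have "ennreal (?A ^ n2) \<le> ennreal (?A ^ card R2)"
      using A1 R by (intro ennreal_leI power_decreasing) auto
    also have "\<dots> = ennreal ?A ^ card R2" by (rule ennreal_power[symmetric]) simp
    also have "\<dots> \<le> g a ^ card R2" by (intro power_mono A) simp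
    finally have A': "ennreal (?A ^ n2) \<le> g a ^ card R2" .
    have "ennreal (?B ^ n1) \<le> ennreal (?B ^ card R1)"
      using A1 R by (intro ennreal_leI power_decreasing) auto
    also have "\<dots> = ennreal ?B ^ card R1" by (rule ennreal_power[symmetric]) simp
    also have "\<dots> \<le> hh b ^ card R1" by (intro power_mono B) simp
    finally have B': "ennreal (?B ^ n1) \<le> hh b ^ card R1" .
    have "ennreal (inner_bound n1 n2 (\<integral>x. \<bar>x\<bar> \<partial>\<mu>1) (\<integral>y. \<bar>y\<bar> \<partial>\<mu>2) a b) = ennreal (inner_prob c a b) * ennreal (?A ^ n2) * ennreal (?B ^ n1)"
      unfolding inner_bound_def Let_def c_def[symmetric] using inner_prob_bounds by (simp add: ennreal_mult)
    also have "\<dots> \<le> ennreal (inner_prob c a b) * g a ^ card R2 * hh b ^ card R1"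
      by (intro mult_mono A' B') auto
    finally show ?thesis .
  qed
  have "(\<integral>\<^sup>+b. \<integral>\<^sup>+a. ennreal (inner_bound n1 n2 (\<integral>x. \<bar>x\<bar> \<partial>\<mu>1) (\<integral>y. \<bar>y\<bar> \<partial>\<mu>2) a b) \<partial>PT1 \<partial>PT2)
      \<le> (\<integral>\<^sup>+b. \<integral>\<^sup>+a. ennreal (inner_prob c a b) * g a ^ card R2 * hh b ^ card R1 \<partial>PT1 \<partial>PT2)"
    by (intro nn_integral_mono lower)
  \<comment> \<open>Read from right to left, the outside weights of \<open>part1\<close> are
    averaged; the exchange of integrals that follows allows the same for
    \<open>part2\<close>.\<close>
  also have "\<dots> = (\<integral>\<^sup>+b. \<integral>\<^sup>+x. ?Z x b \<partial>?N1 \<partial>PT2)"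
  proof (rule nn_integral_cong)
    fix b assume b: "b \<in> space PT2"
    have bm: "(\<lambda>_. b) \<in> measurable M PT2" for M :: "'x measure" by (rule measurable_const[OF b])
    have "(\<integral>\<^sup>+x. (\<lambda>a. ennreal (inner_prob c a b) * g a ^ card R2) (\<lambda>t\<in>T1. x (\<phi> t)) *
        (\<Prod>v\<in>{..<n1} - \<phi> ` T1. (\<lambda>a. H b) (\<lambda>t\<in>T1. x (\<phi> t)) (x v)) \<partial>?N1)
      = (\<integral>\<^sup>+a. (\<lambda>a. ennreal (inner_prob c a b) * g a ^ card R2) a * (\<integral>\<^sup>+u. (\<lambda>a. H b) a u \<partial>\<mu>1) ^ card ({..<n1} - \<phi> ` T1) \<partial>PT1)"
    proof (rule nn_integral_PiM_marginal[OF prob(1) _ _ inj1 J(1)])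
      show "(\<lambda>a. ennreal (inner_prob c a b) * g a ^ card R2) \<in> borel_measurable PT1"
        by (intro borel_measurable_times_ennreal borel_measurable_power_ennreal im gm bm measurable_ident[unfolded id_def])
      show "(\<lambda>(a, u). H b u) \<in> borel_measurable (PT1 \<Otimes>\<^sub>M \<mu>1)"
        unfolding case_prod_unfold by (intro Hm bm measurable_snd)
    qed (use fin in auto)
    then show "(\<integral>\<^sup>+a. ennreal (inner_prob c a b) * g a ^ card R2 * hh b ^ card R1 \<partial>PT1) = (\<integral>\<^sup>+x. ?Z x b \<partial>?N1)"
      by (simp add: r1_def R1_def hh_def mult_ac)
  qed
  also have "\<dots> = (\<integral>\<^sup>+x. \<integral>\<^sup>+b. ?Z x b \<partial>PT2 \<partial>?N1)"
    by (rule N1P2.Fubini'[OF Zm])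
  also have "\<dots> = (\<integral>\<^sup>+x. \<integral>\<^sup>+y. ?W x y \<partial>?N2 \<partial>?N1)"
  proof (rule nn_integral_cong)
    fix x assume x: "x \<in> space ?N1"
    have rx: "r1 x \<in> space PT1" by (rule measurable_space[OF r1 x])
    have xm: "(\<lambda>_. r1 x) \<in> measurable M PT1" for M :: "'x measure" by (rule measurable_const[OF rx])
    have xv: "(\<lambda>_. x v) \<in> measurable M \<mu>1" if "v \<in> R1" for v and M :: "'x measure"
      by (rule measurable_const) (rule measurable_space[OF v_m[OF that] x])
    have "(\<integral>\<^sup>+y. (\<lambda>b. ennreal (inner_prob c (r1 x) b) * (\<Prod>v\<in>R1. H b (x v))) (\<lambda>t\<in>T2. y (\<phi> t)) *
        (\<Prod>w\<in>{..<n2} - \<phi> ` T2. (\<lambda>b. G (r1 x)) (\<lambda>t\<in>T2. y (\<phi> t)) (y w)) \<partial>?N2)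
      = (\<integral>\<^sup>+b. (\<lambda>b. ennreal (inner_prob c (r1 x) b) * (\<Prod>v\<in>R1. H b (x v))) b *
        (\<integral>\<^sup>+u. (\<lambda>b. G (r1 x)) b u \<partial>\<mu>2) ^ card ({..<n2} - \<phi> ` T2) \<partial>PT2)"
    proof (rule nn_integral_PiM_marginal[OF prob(2) _ _ inj2 J(2)])
      show "(\<lambda>b. ennreal (inner_prob c (r1 x) b) * (\<Prod>v\<in>R1. H b (x v))) \<in> borel_measurable PT2"
        by (intro borel_measurable_times_ennreal borel_measurable_prod_ennreal im Hm xm xv measurable_ident[unfolded id_def])
      show "(\<lambda>(b, u). G (r1 x) u) \<in> borel_measurable (PT2 \<Otimes>\<^sub>M \<mu>2)"
        unfolding case_prod_unfold by (intro Gm xm measurable_snd)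
    qed (use fin in auto)
    then show "(\<integral>\<^sup>+b. ?Z x b \<partial>PT2) = (\<integral>\<^sup>+y. ?W x y \<partial>?N2)"
      by (simp add: r2_def R2_def g_def mult_ac)
  qed
  also have "\<dots> = (\<integral>\<^sup>+p. ?W (fst p) (snd p) \<partial>(?N1 \<Otimes>\<^sub>M ?N2))"
    using N2.nn_integral_fst[OF Wm] by simp
  also have "\<dots> \<le> (\<integral>\<^sup>+p. emeasure (case p of (x, y) \<Rightarrow> measure_pmf (weighted_law n1 n2 x y)) {H. exact H \<phi>} \<partial>(?N1 \<Otimes>\<^sub>M ?N2))"
  proof (rule nn_integral_mono)
    fix p :: "(nat \<Rightarrow> real) \<times> (nat \<Rightarrow> real)"
    obtain x y where p: "p = (x, y)" by (cases p)
    have inner: "inner_prob c (r1 x) (r2 y) = inner_prob c (\<lambda>t. x (\<phi> t)) (\<lambda>u. y (\<phi> u))"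
      unfolding inner_prob_def by (intro prod.cong refl) (auto simp: r1_def r2_def)
    have Hp: "(\<Prod>v\<in>R1. H (r2 y) (x v)) = ennreal (\<Prod>v\<in>R1. \<Prod>u\<in>I2. 1 - edge_prob c (x v) (y (\<phi> u)))"
    proof -
      have "H (r2 y) (x v) = ennreal (\<Prod>u\<in>I2. 1 - edge_prob c (x v) (y (\<phi> u)))" for v
        unfolding H_def using IT by (intro arg_cong[of _ _ ennreal] prod.cong refl) (auto simp: r2_def)
      then show ?thesis
        using edge_prob_bounds by (simp add: prod_ennreal prod_nonneg)
    qed
    have Gp: "(\<Prod>w\<in>R2. G (r1 x) (y w)) = ennreal (\<Prod>w\<in>R2. \<Prod>t\<in>I1. 1 - edge_prob c (x (\<phi> t)) (y w))"
    proof -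
      have "G (r1 x) (y w) = ennreal (\<Prod>t\<in>I1. 1 - edge_prob c (x (\<phi> t)) (y w))" for w
        unfolding G_def using IT by (intro arg_cong[of _ _ ennreal] prod.cong refl) (auto simp: r1_def)
      then show ?thesis
        using edge_prob_bounds by (simp add: prod_ennreal prod_nonneg)
    qed
    have "?W x y = ennreal (inner_prob c (\<lambda>t. x (\<phi> t)) (\<lambda>u. y (\<phi> u)) *
      (\<Prod>w\<in>R2. \<Prod>t\<in>I1. 1 - edge_prob c (x (\<phi> t)) (y w)) * (\<Prod>v\<in>R1. \<Prod>u\<in>I2. 1 - edge_prob c (x v) (y (\<phi> u))))"
      unfolding inner Hp Gp using edge_prob_bounds inner_prob_bounds
      by (simp add: ennreal_mult prod_nonneg mult_ac)
    also have "\<dots> \<le> ennreal (measure_pmf.prob (weighted_law n1 n2 x y) {H. exact H \<phi>})"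
      unfolding R1_def R2_def c_def by (intro ennreal_leI weighted_exact_ge adm)
    finally show "?W (fst p) (snd p) \<le> emeasure (case p of (x, y) \<Rightarrow> measure_pmf (weighted_law n1 n2 x y)) {H. exact H \<phi>}"
      by (simp add: p measure_pmf.emeasure_eq_measure)
  qed
  also have "\<dots> = emeasure (inhomog_law n1 n2 \<mu>1 \<mu>2) {H. exact H \<phi>}"
    unfolding inhomog_law_def
    by (rule emeasure_bind[symmetric, OF _ measurable_weighted_law[OF sets]]) (simp_all add: N12.not_empty)
  finally show ?thesis .
qed

end

end

section \<open>Mixed Poisson laws\<close>

lemma power_le_fact_mult_exp:
  fixes x :: real
  assumes "0 \<le> x"
  shows "x ^ k * exp (- x) \<le> fact k"
proof -
  have s: "(\<lambda>k. x ^ k / fact k) sums exp x"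
    using exp_converges[of x] by (simp add: scaleR_conv_of_real field_simps)
  have "(\<Sum>k\<in>{k}. x ^ k / fact k) \<le> (\<Sum>k. x ^ k / fact k)"
    by (rule sum_le_suminf[OF sums_summable[OF s]]) (use assms in auto)
  then have "x ^ k / fact k \<le> exp x"
    using sums_unique[OF s] by simp
  then show ?thesis
    by (simp add: exp_minus field_simps)
qed

text \<open>The mean comes from summing over \<open>k\<close> under the integral, where a Poisson
  law of rate \<open>\<kappa> * x\<close> has mean \<open>\<kappa> * x\<close>. The integral
  identity presents the weight of an inner node as an average over its random rate.\<close>

lemma
  fixes \<mu> :: "real measure"
  assumes \<mu>: "prob_space \<mu>" "sets \<mu> = sets borel" "AE x in \<mu>. 0 \<le> x" "integrable \<mu> (\<lambda>x. x)"
    and k0: "0 < \<kappa>" and pos: "0 < (\<integral>x. x \<partial>\<mu>)"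
    and D: "D = mixed_poisson (distr \<mu> borel (\<lambda>x. \<kappa> * x))"
  shows nn_integral_mixed_poisson: "(\<integral>\<^sup>+x. ennreal ((\<kappa> * x) ^ k * exp (- (\<kappa> * x))) \<partial>\<mu>) = ennreal (fact k * pmf D k)"
    and mean_mixed_poisson: "mean D = \<kappa> * (\<integral>x. x \<partial>\<mu>)"
    and has_pos_finite_mean_mixed_poisson: "has_pos_finite_mean D"
proof -
  interpret prob_space \<mu> by fact
  have meas: "(\<lambda>x. \<kappa> * x) \<in> borel_measurable \<mu>"
    by (intro borel_measurable_times borel_measurable_const borel_measurable_integrable[OF \<mu>(4)])
  let ?\<nu> = "distr \<mu> borel (\<lambda>x. \<kappa> * x)"
  have \<nu>: "prob_space ?\<nu>" "sets ?\<nu> = sets borel" "AE x in ?\<nu>. 0 \<le> x"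
    using prob_space_distr[OF meas] \<mu>(3) k0
    by (auto simp: AE_distr_iff[OF meas] elim!: eventually_mono)
  have pmf: "fact k * pmf D k = (\<integral>x. (\<kappa> * x) ^ k * exp (- (\<kappa> * x)) \<partial>\<mu>)" for k
    unfolding D pmf_mixed_poisson[OF \<nu>] by (subst integral_distr[OF meas]) (simp_all add: mult.commute)
  have m[measurable]: "(\<lambda>x. (\<kappa> * x) ^ k * exp (- (\<kappa> * x))) \<in> borel_measurable \<mu>" for k
  proof (rule measurable_compose[OF meas])
    show "(\<lambda>z. z ^ k * exp (- z)) \<in> borel_measurable (borel :: real measure)"
      by measurable
  qed
  show nn: "(\<integral>\<^sup>+x. ennreal ((\<kappa> * x) ^ k * exp (- (\<kappa> * x))) \<partial>\<mu>) = ennreal (fact k * pmf D k)" for k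
    unfolding pmf
  proof (rule nn_integral_eq_integral)
    show "integrable \<mu> (\<lambda>x. (\<kappa> * x) ^ k * exp (- (\<kappa> * x)))"
    proof (rule integrable_const_bound[of _ "fact k"])
      show "AE x in \<mu>. norm ((\<kappa> * x) ^ k * exp (- (\<kappa> * x))) \<le> fact k"
        using \<mu>(3)
      proof eventually_elim
        case (elim x)
        then have "0 \<le> \<kappa> * x" using k0 by simp
        then show ?case using power_le_fact_mult_exp[of "\<kappa> * x" k] by (simp add: abs_mult)
      qed
    qed (rule m)
    show "AE x in \<mu>. 0 \<le> (\<kappa> * x) ^ k * exp (- (\<kappa> * x))"
      using \<mu>(3) k0 by (auto elim!: eventually_mono)
  qed
  have sums: "(\<lambda>k. x ^ k / fact k * exp (- x) * real k) sums x" if "0 \<le> x" for x :: real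
  \<comment> \<open>The Poisson series is available for positive rates; at rate zero every term
    vanishes, the one for \<open>k = 0\<close> through the factor \<open>real k\<close>.\<close>
  proof (cases "x = 0")
    case True
    have "x ^ k / fact k * exp (- x) * real k = 0" for k
      using True by (cases k) auto
    note h = this
    show ?thesis unfolding h using True sums_zero by simp
  next
    case False
    then have "0 < x" using that by simp
    then have "summable (\<lambda>k. pmf (poisson_pmf x) k * real k)" "(\<Sum>k. pmf (poisson_pmf x) k * real k) = x"
      using has_pos_finite_mean_poisson[of x] mean_poisson[of x] integrable_nat_pmf_iff mean_eq_suminf
      by (auto simp: has_pos_finite_mean_def)
    then show ?thesis
      using \<open>0 < x\<close> by (simp add: sums_iff)
  qed
  have "(\<Sum>k. ennreal (pmf D k * real k)) = (\<Sum>k. \<integral>\<^sup>+x. ennreal ((\<kappa> * x) ^ k / fact k * exp (- (\<kappa> * x)) * real k) \<partial>\<mu>)"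
  proof (rule suminf_cong)
    fix k
    have "ennreal (pmf D k * real k) = ennreal (real k / fact k) * ennreal (fact k * pmf D k)"
      by (simp add: ennreal_mult[symmetric] mult.commute)
    also have "\<dots> = (\<integral>\<^sup>+x. ennreal (real k / fact k) * ennreal ((\<kappa> * x) ^ k * exp (- (\<kappa> * x))) \<partial>\<mu>)"
      unfolding nn[symmetric] by (rule nn_integral_cmult[symmetric]) measurable
    also have "\<dots> = (\<integral>\<^sup>+x. ennreal ((\<kappa> * x) ^ k / fact k * exp (- (\<kappa> * x)) * real k) \<partial>\<mu>)"
      by (intro nn_integral_cong) (simp add: ennreal_mult'[symmetric] mult_ac)
    finally show "ennreal (pmf D k * real k) = (\<integral>\<^sup>+x. ennreal ((\<kappa> * x) ^ k / fact k * exp (- (\<kappa> * x)) * real k) \<partial>\<mu>)" .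
  qed
  also have "\<dots> = (\<integral>\<^sup>+x. (\<Sum>k. ennreal ((\<kappa> * x) ^ k / fact k * exp (- (\<kappa> * x)) * real k)) \<partial>\<mu>)"
    using meas by (intro nn_integral_suminf[symmetric]) auto
  also have "\<dots> = (\<integral>\<^sup>+x. ennreal (\<kappa> * x) \<partial>\<mu>)"
  proof (rule nn_integral_cong_AE)
    show "AE x in \<mu>. (\<Sum>k. ennreal ((\<kappa> * x) ^ k / fact k * exp (- (\<kappa> * x)) * real k)) = ennreal (\<kappa> * x)"
      using \<mu>(3)
    proof eventually_elim
      case (elim x)
      then have "0 \<le> \<kappa> * x" using k0 by simp
      then show ?case
        using sums[of "\<kappa> * x"] by (subst suminf_ennreal2) (auto simp: sums_iff)
    qed
  qed
  also have "\<dots> = ennreal (\<kappa> * (\<integral>x. x \<partial>\<mu>))"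
    using \<mu>(3,4) k0 by (subst nn_integral_eq_integral) (auto elim!: eventually_mono)
  finally have s: "(\<Sum>k. ennreal (pmf D k * real k)) = ennreal (\<kappa> * (\<integral>x. x \<partial>\<mu>))" .
  have summ: "summable (\<lambda>k. pmf D k * real k)"
    by (rule summable_suminf_not_top) (use s in auto)
  have eq: "ennreal (\<Sum>k. pmf D k * real k) = ennreal (\<kappa> * (\<integral>x. x \<partial>\<mu>))"
    unfolding s[symmetric] by (rule suminf_ennreal2[OF _ summ, symmetric]) simp
  have nonneg: "0 \<le> (\<Sum>k. pmf D k * real k)" "0 \<le> \<kappa> * (\<integral>x. x \<partial>\<mu>)"
    using suminf_nonneg[OF summ] k0 pos by simp_all
  show mean: "mean D = \<kappa> * (\<integral>x. x \<partial>\<mu>)"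
    by (rule trans[OF mean_eq_suminf[OF summ] iffD1[OF ennreal_inj[OF nonneg] eq]])
  have "integrable (measure_pmf D) real"
    by (rule iffD2[OF integrable_nat_pmf_iff summ])
  then show "has_pos_finite_mean D"
    unfolding has_pos_finite_mean_def mean using k0 pos by simp
qed

text \<open>Once \<open>c n\<close> exceeds the absolute value of \<open>x * y\<close>, the cap at
  one is inactive and only the clamping at zero remains.\<close>

lemma tendsto_edge_prob:
  assumes c: "filterlim c at_top sequentially" and m: "(\<lambda>n. m n / c n) \<longlonglongrightarrow> r"
    and m0: "\<And>n. 0 \<le> m n"
  shows "(\<lambda>n. m n * edge_prob (c n) x y) \<longlonglongrightarrow> max 0 (x * y * r)"
    and "(\<lambda>n. edge_prob (c n) x y) \<longlonglongrightarrow> 0"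
proof -
  have cp: "\<forall>\<^sub>F n in sequentially. max 1 \<bar>x * y\<bar> \<le> c n"
    using filterlim_at_top[THEN iffD1, OF c, rule_format] .
  have "(\<lambda>n. max 0 (x * y * (m n / c n))) \<longlonglongrightarrow> max 0 (x * y * r)"
    by (intro tendsto_max tendsto_const tendsto_mult m)
  moreover have "\<forall>\<^sub>F n in sequentially. max 0 (x * y * (m n / c n)) = m n * edge_prob (c n) x y"
    using cp
  proof eventually_elim
    case (elim n)
    then have "x * y \<le> c n" "0 < c n" using abs_ge_self[of "x * y"] by linarith+
    then have "x * y / c n \<le> 1" by (simp add: divide_le_eq)
    then have "edge_prob (c n) x y = max 0 (x * y / c n)"
      by (simp add: edge_prob_def)
    then show ?case
      using m0[of n] by (simp add: max_mult_distrib_left mult_ac)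
  qed
  ultimately show "(\<lambda>n. m n * edge_prob (c n) x y) \<longlonglongrightarrow> max 0 (x * y * r)"
    by (rule Lim_transform_eventually)
  have "(\<lambda>n. min 1 (max 0 (x * y / c n))) \<longlonglongrightarrow> min 1 (max 0 0)"
    by (intro tendsto_min tendsto_max tendsto_const real_tendsto_divide_at_top[OF tendsto_const c])
  then show "(\<lambda>n. edge_prob (c n) x y) \<longlonglongrightarrow> 0"
    by (simp add: edge_prob_def)
qed

context pattern
begin

text \<open>A product over edges of one factor for each end regroups by nodes, since a node occurs
  once per incident edge.\<close>

lemma prod_edges_split:
  fixes f g :: "nat list \<Rightarrow> real"
  shows "(\<Prod>t\<in>T1. \<Prod>u\<in>T2. if u \<in> nb t then f t * g u else 1) = (\<Prod>t\<in>T1. f t ^ card (nb t)) * (\<Prod>u\<in>T2. g u ^ card (nb u))"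
proof -
  have nb12: "T2 \<inter> {u. u \<in> nb t} = nb t" if "t \<in> T1" for t
    using that nb_T nb_side by blast
  have nb21: "T1 \<inter> {t. u \<in> nb t} = nb u" if "u \<in> T2" for u
    using that nb_T nb_side nb_sym by blast
  have "(\<Prod>t\<in>T1. \<Prod>u\<in>T2. if u \<in> nb t then f t * g u else 1) =
      (\<Prod>t\<in>T1. \<Prod>u\<in>T2. if u \<in> nb t then f t else 1) * (\<Prod>t\<in>T1. \<Prod>u\<in>T2. if u \<in> nb t then g u else 1)"
    unfolding prod.distrib[symmetric] by (simp add: if_distrib cong: if_cong)
  also have "(\<Prod>t\<in>T1. \<Prod>u\<in>T2. if u \<in> nb t then f t else 1) = (\<Prod>t\<in>T1. f t ^ card (nb t))"
    using fin nb12 by (intro prod.cong refl) (simp add: prod.If_cases)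
  also have "(\<Prod>t\<in>T1. \<Prod>u\<in>T2. if u \<in> nb t then g u else 1) = (\<Prod>u\<in>T2. \<Prod>t\<in>T1. if u \<in> nb t then g u else 1)"
    by (rule prod.swap)
  also have "\<dots> = (\<Prod>u\<in>T2. g u ^ card (nb u))"
    using fin nb21 by (intro prod.cong refl) (simp add: prod.If_cases)
  finally show ?thesis .
qed

lemma weight_eq_prod:
  "weight D = (\<Prod>t\<in>T1. if t \<in> I then fact (card (nb t)) * pmf (D True) (card (nb t)) else mean (D True)) *
     (\<Prod>t\<in>T2. if t \<in> I then fact (card (nb t)) * pmf (D False) (card (nb t)) else mean (D False))"
proof -
  let ?w = "\<lambda>t. if t \<in> I then fact (card (nb t)) * pmf (D (sd t)) (card (nb t)) else mean (D (sd t))"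
  have "weight D = (\<Prod>t\<in>I. ?w t) * (\<Prod>t\<in>T - I. ?w t)"
    by (simp add: weight_def)
  also have "\<dots> = (\<Prod>t\<in>T. ?w t)"
    using prod.subset_diff[OF IT fin, of ?w] by (simp add: mult.commute)
  also have "\<dots> = (\<Prod>t\<in>T1 \<union> T2. ?w t)"
    by (rule prod.cong) auto
  also have "\<dots> = (\<Prod>t\<in>T1. ?w t) * (\<Prod>t\<in>T2. ?w t)"
    using fin by (intro prod.union_disjoint) auto
  also have "(\<Prod>t\<in>T1. ?w t) = (\<Prod>t\<in>T1. if t \<in> I then fact (card (nb t)) * pmf (D True) (card (nb t)) else mean (D True))"
    by (rule prod.cong) auto
  also have "(\<Prod>t\<in>T2. ?w t) = (\<Prod>t\<in>T2. if t \<in> I then fact (card (nb t)) * pmf (D False) (card (nb t)) else mean (D False))"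
    by (rule prod.cong) auto
  finally show ?thesis .
qed

end

text \<open>Given the weights at the pattern, the scaled bound has a lower limit that is a product
  over nodes: each end of an edge contributes its weight, and each inner node an exponential for
  having no further neighbours. Each node then integrates separately to its mixed Poisson
  weight.\<close>

lemma inhomog_pattern_bound:
  fixes n1 n2 :: "nat \<Rightarrow> nat" and \<mu>1 \<mu>2 :: "real measure"
  assumes pos: "\<And>n. 0 < n1 n" "\<And>n. 0 < n2 n"
    and lim: "filterlim n1 at_top sequentially" "filterlim n2 at_top sequentially"
    and ratio: "(\<lambda>n. real (n2 n) / real (n1 n)) \<longlonglongrightarrow> \<beta>" "0 < \<beta>"
    and \<mu>1: "prob_space \<mu>1" "sets \<mu>1 = sets borel" "AE x in \<mu>1. 0 \<le> x" "integrable \<mu>1 (\<lambda>x. x)" "0 < (\<integral>x. x \<partial>\<mu>1)"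
    and \<mu>2: "prob_space \<mu>2" "sets \<mu>2 = sets borel" "AE x in \<mu>2. 0 \<le> x" "integrable \<mu>2 (\<lambda>x. x)" "0 < (\<integral>x. x \<partial>\<mu>2)"
    and D1: "D1 = mixed_poisson (distr \<mu>1 borel (\<lambda>x. sqrt \<beta> * (\<integral>y. y \<partial>\<mu>2) * x))"
    and D2: "D2 = mixed_poisson (distr \<mu>2 borel (\<lambda>y. (\<integral>x. x \<partial>\<mu>1) / sqrt \<beta> * y))"
  shows "pattern_bound (\<lambda>n. inhomog_law (n1 n) (n2 n) \<mu>1 \<mu>2) (\<lambda>n s. if s then n1 n else n2 n) (\<lambda>s. if s then D1 else D2)"
  unfolding pattern_bound_def
proof (intro allI impI)
  fix T I nb sd a0
  let ?D = "\<lambda>s. if s then D1 else D2"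
  assume pat: "pattern T I nb sd" and a0: "a0 < pattern.weight T I nb sd ?D"
  interpret pattern T I nb sd by (rule pat)
  define e1 where "e1 = (\<integral>x. x \<partial>\<mu>1)"
  define e2 where "e2 = (\<integral>x. x \<partial>\<mu>2)"
  define \<theta> where "\<theta> = sqrt \<beta>"
  \<comment> \<open>Limiting mean degree per unit weight of a vertex of \<open>part1\<close>, with
    \<open>\<kappa>2\<close> for \<open>part2\<close>. Their product is the limit of
    \<open>m n / c n\<close>, so the scaled edge probability tends to the product of the two
    rates.\<close>
  define \<kappa>1 where "\<kappa>1 = \<theta> * e2"
  define \<kappa>2 where "\<kappa>2 = e1 / \<theta>"
  define c where "c n = sqrt (real (n1 n) * real (n2 n))" for n
  define m where "m n = real (n1 n) * mean D1" for n
  have e: "0 < e1" "0 < e2" and \<theta>: "0 < \<theta>" using \<mu>1(5) \<mu>2(5) ratio(2) by (auto simp: e1_def e2_def \<theta>_def)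
  then have \<kappa>: "0 < \<kappa>1" "0 < \<kappa>2" "\<kappa>1 * \<kappa>2 = e1 * e2" by (auto simp: \<kappa>1_def \<kappa>2_def)
  have D1': "D1 = mixed_poisson (distr \<mu>1 borel (\<lambda>x. \<kappa>1 * x))"
    and D2': "D2 = mixed_poisson (distr \<mu>2 borel (\<lambda>x. \<kappa>2 * x))"
    by (simp_all add: D1 D2 \<kappa>1_def \<kappa>2_def \<theta>_def e1_def e2_def)
  note mix1 = nn_integral_mixed_poisson[OF \<mu>1(1-4) \<kappa>(1) \<mu>1(5) D1'] mean_mixed_poisson[OF \<mu>1(1-4) \<kappa>(1) \<mu>1(5) D1']
  note mix2 = nn_integral_mixed_poisson[OF \<mu>2(1-4) \<kappa>(2) \<mu>2(5) D2'] mean_mixed_poisson[OF \<mu>2(1-4) \<kappa>(2) \<mu>2(5) D2']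
  have abs1: "(\<integral>x. \<bar>x\<bar> \<partial>\<mu>1) = e1" and abs2: "(\<integral>x. \<bar>x\<bar> \<partial>\<mu>2) = e2"
    unfolding e1_def e2_def using \<mu>1(2,3) \<mu>2(2,3)
    by (auto intro!: integral_cong_AE elim!: eventually_mono simp: measurable_cong_sets[OF \<mu>1(2) refl] measurable_cong_sets[OF \<mu>2(2) refl])
  have ints: "integrable \<mu>1 (\<lambda>x. \<bar>x\<bar>)" "integrable \<mu>2 (\<lambda>x. \<bar>x\<bar>)"
    using \<mu>1(4) \<mu>2(4) by auto
  have c0: "0 < c n" for n using pos[of n] by (simp add: c_def)
  have n2c: "(\<lambda>n. real (n2 n) / c n) \<longlonglongrightarrow> \<theta>" and n1c: "(\<lambda>n. real (n1 n) / c n) \<longlonglongrightarrow> 1 / \<theta>"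
  proof -
    have s: "real (n2 n) / c n = sqrt (real (n2 n) / real (n1 n))" for n
      using pos[of n] by (simp add: c_def real_sqrt_mult real_sqrt_divide field_simps)
    have s': "real (n1 n) / c n = 1 / sqrt (real (n2 n) / real (n1 n))" for n
      using pos[of n] by (simp add: c_def real_sqrt_mult real_sqrt_divide field_simps)
    show "(\<lambda>n. real (n2 n) / c n) \<longlonglongrightarrow> \<theta>"
      unfolding s \<theta>_def by (intro tendsto_intros ratio)
    show "(\<lambda>n. real (n1 n) / c n) \<longlonglongrightarrow> 1 / \<theta>"
      unfolding s' \<theta>_def using ratio(2) by (intro tendsto_divide tendsto_const tendsto_real_sqrt ratio(1)) auto
  qed
  have ctop: "filterlim c at_top sequentially"
  proof (rule filterlim_at_top_mono)
    show "filterlim (\<lambda>n. sqrt (real (n1 n))) at_top sequentially"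
      by (rule filterlim_compose[OF sqrt_at_top filterlim_compose[OF filterlim_real_sequentially lim(1)]])
    show "\<forall>\<^sub>F n in sequentially. sqrt (real (n1 n)) \<le> c n"
    proof (rule always_eventually, rule allI)
      fix n
      have "real (n1 n) * 1 \<le> real (n1 n) * real (n2 n)"
        using pos(2)[of n] by (intro mult_left_mono) auto
      then show "sqrt (real (n1 n)) \<le> c n" by (simp add: c_def)
    qed
  qed
  have m0: "0 \<le> m n" for n
    using mix1(2) \<kappa> e by (simp add: m_def e1_def)
  have mc: "(\<lambda>n. m n / c n) \<longlonglongrightarrow> \<kappa>1 * \<kappa>2"
  proof -
    have "(\<lambda>n. mean D1 * (real (n1 n) / c n)) \<longlonglongrightarrow> mean D1 * (1 / \<theta>)"
      by (intro tendsto_mult tendsto_const n1c)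
    moreover have "mean D1 * (1 / \<theta>) = \<kappa>1 * \<kappa>2"
      using mix1(2) \<theta> by (simp add: e1_def[symmetric] \<kappa>2_def)
    ultimately show ?thesis by (simp add: m_def mult.commute)
  qed
  let ?P1 = "Pi\<^sub>M T1 (\<lambda>_. \<mu>1)" and ?P2 = "Pi\<^sub>M T2 (\<lambda>_. \<mu>2)"
  interpret M1: prob_space \<mu>1 by (rule \<mu>1)
  interpret M2: prob_space \<mu>2 by (rule \<mu>2)
  interpret P1: prob_space ?P1 by (intro prob_space_PiM \<mu>1)
  interpret P2: prob_space ?P2 by (intro prob_space_PiM \<mu>2)
  interpret S1: product_sigma_finite "\<lambda>_. \<mu>1" by (simp add: product_sigma_finite_def M1.sigma_finite_measure_axioms)
  interpret S2: product_sigma_finite "\<lambda>_. \<mu>2" by (simp add: product_sigma_finite_def M2.sigma_finite_measure_axioms)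
  define Q where "Q n b a = ennreal (inner_bound (n1 n) (n2 n) e1 e2 a b * m n ^ edges)" for n b a
  \<comment> \<open>A leaf has a single edge and may have further neighbours outside the pattern, so
    it carries its rate but no exponential.\<close>
  define \<alpha> where "\<alpha> t x = (\<kappa>1 * x) ^ card (nb t) * (if t \<in> I then exp (- (\<kappa>1 * x)) else 1)" for t x
  define \<gamma> where "\<gamma> t x = (\<kappa>2 * x) ^ card (nb t) * (if t \<in> I then exp (- (\<kappa>2 * x)) else 1)" for t x
  have Qm: "(\<lambda>p. Q n (fst p) (snd p)) \<in> borel_measurable (?P2 \<Otimes>\<^sub>M ?P1)" for n
    unfolding Q_def
    by (intro measurable_compose[OF _ measurable_ennreal] borel_measurable_times borel_measurable_const
        measurable_inner_bound[OF \<mu>1(1) \<mu>2(1) \<mu>1(2) \<mu>2(2) ints] measurable_fst measurable_snd)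
  have liminf: "ennreal ((\<Prod>t\<in>T1. \<alpha> t (a t)) * (\<Prod>u\<in>T2. \<gamma> u (b u))) \<le> liminf (\<lambda>n. Q n b a)"
    if a: "\<forall>t\<in>T1. 0 \<le> a t" and b: "\<forall>u\<in>T2. 0 \<le> b u" for a b
  proof -
    define za where "za n = (\<Sum>t\<in>I1. \<bar>a t\<bar> / c n * e2)" for n
    define zb where "zb n = (\<Sum>u\<in>I2. \<bar>b u\<bar> / c n * e1)" for n
    let ?S1 = "\<Sum>t\<in>I1. \<kappa>1 * a t" and ?S2 = "\<Sum>u\<in>I2. \<kappa>2 * b u"
    have "(\<lambda>n. (\<Sum>t\<in>I1. \<bar>a t\<bar> * e2) * (real (n2 n) / c n)) \<longlonglongrightarrow> (\<Sum>t\<in>I1. \<bar>a t\<bar> * e2) * \<theta>"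
      by (intro tendsto_mult tendsto_const n2c)
    moreover have "(\<Sum>t\<in>I1. \<bar>a t\<bar> * e2) * (real (n2 n) / c n) = real (n2 n) * za n" for n
      by (simp add: za_def sum_distrib_left sum_distrib_right field_simps)
    moreover have "(\<Sum>t\<in>I1. \<bar>a t\<bar> * e2) * \<theta> = ?S1"
      unfolding sum_distrib_right using a IT by (intro sum.cong) (auto simp: \<kappa>1_def)
    ultimately have za: "(\<lambda>n. real (n2 n) * za n) \<longlonglongrightarrow> ?S1" by simp
    have "(\<lambda>n. (\<Sum>u\<in>I2. \<bar>b u\<bar> * e1) * (real (n1 n) / c n)) \<longlonglongrightarrow> (\<Sum>u\<in>I2. \<bar>b u\<bar> * e1) * (1 / \<theta>)"
      by (intro tendsto_mult tendsto_const n1c)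
    moreover have "(\<Sum>u\<in>I2. \<bar>b u\<bar> * e1) * (real (n1 n) / c n) = real (n1 n) * zb n" for n
      by (simp add: zb_def sum_distrib_left sum_distrib_right field_simps)
    moreover have "(\<Sum>u\<in>I2. \<bar>b u\<bar> * e1) * (1 / \<theta>) = ?S2"
      unfolding sum_distrib_right using b IT by (intro sum.cong) (auto simp: \<kappa>2_def)
    ultimately have zb: "(\<lambda>n. real (n1 n) * zb n) \<longlonglongrightarrow> ?S2" by simp
    obtain ga where ga: "ga \<longlonglongrightarrow> exp (- ?S1)" "\<forall>\<^sub>F n in sequentially. ga n \<le> (1 - za n) ^ n2 n \<and> za n < 1"
      by (rule tendsto_exp_power[OF za lim(2)])
    obtain gb where gb: "gb \<longlonglongrightarrow> exp (- ?S2)" "\<forall>\<^sub>F n in sequentially. gb n \<le> (1 - zb n) ^ n1 n \<and> zb n < 1"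
      by (rule tendsto_exp_power[OF zb lim(1)])
    let ?V = "\<lambda>n. \<Prod>t\<in>T1. \<Prod>u\<in>T2. if u \<in> nb t then m n * edge_prob (c n) (a t) (b u) else 1 - edge_prob (c n) (a t) (b u)"
    have V: "inner_prob (c n) a b * m n ^ edges = ?V n" for n
    proof -
      \<comment> \<open>One factor \<open>m n\<close> is handed to each edge, so that every edge
        probability is scaled separately.\<close>
      have "m n ^ edges = (\<Prod>t\<in>T1. \<Prod>u\<in>T2. if u \<in> nb t then m n * 1 else 1)"
        unfolding prod_edges_split edges_def by (simp add: power_sum)
      then show ?thesis
        unfolding inner_prob_def by (simp add: prod.distrib[symmetric] if_distrib mult.commute cong: if_cong prod.cong)
    qed
    have Vlim: "?V \<longlonglongrightarrow> (\<Prod>t\<in>T1. \<Prod>u\<in>T2. if u \<in> nb t then max 0 (a t * b u * (\<kappa>1 * \<kappa>2)) else 1)"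
    proof (intro tendsto_prod)
      fix t u
      have "(\<lambda>n. 1 - edge_prob (c n) (a t) (b u)) \<longlonglongrightarrow> 1 - 0"
        by (intro tendsto_diff tendsto_const tendsto_edge_prob(2)[OF ctop mc m0])
      then show "(\<lambda>n. if u \<in> nb t then m n * edge_prob (c n) (a t) (b u) else 1 - edge_prob (c n) (a t) (b u))
        \<longlonglongrightarrow> (if u \<in> nb t then max 0 (a t * b u * (\<kappa>1 * \<kappa>2)) else 1)"
        using tendsto_edge_prob(1)[OF ctop mc m0, of "a t" "b u"] by (cases "u \<in> nb t") auto
    qed
    have limit: "(\<Prod>t\<in>T1. \<Prod>u\<in>T2. if u \<in> nb t then max 0 (a t * b u * (\<kappa>1 * \<kappa>2)) else 1) * max 0 (exp (- ?S1)) * max 0 (exp (- ?S2))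
        = (\<Prod>t\<in>T1. \<alpha> t (a t)) * (\<Prod>u\<in>T2. \<gamma> u (b u))"
    proof -
      have p1: "(\<Prod>t\<in>T1. \<Prod>u\<in>T2. if u \<in> nb t then max 0 (a t * b u * (\<kappa>1 * \<kappa>2)) else 1) =
          (\<Prod>t\<in>T1. \<Prod>u\<in>T2. if u \<in> nb t then (\<kappa>1 * a t) * (\<kappa>2 * b u) else 1)"
      proof (rule prod.cong[OF refl], rule prod.cong[OF refl])
        fix t u assume t: "t \<in> T1" and u: "u \<in> T2"
        have "0 \<le> a t * b u * (\<kappa>1 * \<kappa>2)" using a b t u \<kappa> by (intro mult_nonneg_nonneg) auto
        then show "(if u \<in> nb t then max 0 (a t * b u * (\<kappa>1 * \<kappa>2)) else 1) = (if u \<in> nb t then (\<kappa>1 * a t) * (\<kappa>2 * b u) else 1)"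
          by (simp add: mult_ac)
      qed
      have p2: "exp (- ?S1) = (\<Prod>t\<in>T1. if t \<in> I then exp (- (\<kappa>1 * a t)) else 1)"
      proof -
        have "exp (- ?S1) = (\<Prod>t\<in>I1. exp (- (\<kappa>1 * a t)))"
          using finite_subset[OF IT fin] by (simp add: exp_sum sum_negf[symmetric])
        also have "\<dots> = (\<Prod>t\<in>T1. if t \<in> I then exp (- (\<kappa>1 * a t)) else 1)"
          using IT fin by (intro prod.mono_neutral_cong_left) auto
        finally show ?thesis .
      qed
      have p3: "exp (- ?S2) = (\<Prod>t\<in>T2. if t \<in> I then exp (- (\<kappa>2 * b t)) else 1)"
      proof -
        have "exp (- ?S2) = (\<Prod>t\<in>I2. exp (- (\<kappa>2 * b t)))"
          using finite_subset[OF IT fin] by (simp add: exp_sum sum_negf[symmetric])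
        also have "\<dots> = (\<Prod>t\<in>T2. if t \<in> I then exp (- (\<kappa>2 * b t)) else 1)"
          using IT fin by (intro prod.mono_neutral_cong_left) auto
        finally show ?thesis .
      qed
      have mx: "max 0 (exp z) = exp z" for z :: real
        by (simp add: max_absorb2)
      show ?thesis
        unfolding p1 mx unfolding p2 p3 prod_edges_split \<alpha>_def \<gamma>_def prod.distrib
        by (simp only: mult_ac)
    qed
    have "(\<lambda>n. ennreal (?V n * max 0 (ga n) * max 0 (gb n))) \<longlonglongrightarrow> ennreal ((\<Prod>t\<in>T1. \<alpha> t (a t)) * (\<Prod>u\<in>T2. \<gamma> u (b u)))"
      unfolding limit[symmetric] by (intro tendsto_ennrealI tendsto_mult Vlim tendsto_max tendsto_const ga gb)
    then have "ennreal ((\<Prod>t\<in>T1. \<alpha> t (a t)) * (\<Prod>u\<in>T2. \<gamma> u (b u))) = liminf (\<lambda>n. ennreal (?V n * max 0 (ga n) * max 0 (gb n)))"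
      by (intro lim_imp_Liminf[symmetric]) auto
    also have "\<dots> \<le> liminf (\<lambda>n. Q n b a)"
    proof (rule Liminf_mono)
      show "\<forall>\<^sub>F n in sequentially. ennreal (?V n * max 0 (ga n) * max 0 (gb n)) \<le> Q n b a"
        using ga(2) gb(2)
      proof eventually_elim
        case (elim n)
        have V0: "0 \<le> ?V n"
          unfolding V[symmetric] using inner_prob_bounds m0 by (intro mult_nonneg_nonneg zero_le_power) auto
        \<comment> \<open>Cutting the lower bounds at zero keeps the multiplication of inequalities
          monotone.\<close>
        have "max 0 (ga n) \<le> max 0 (1 - za n) ^ n2 n" "max 0 (gb n) \<le> max 0 (1 - zb n) ^ n1 n"
          using elim by (auto simp: max_def)
        then have "?V n * max 0 (ga n) * max 0 (gb n) \<le> ?V n * max 0 (1 - za n) ^ n2 n * max 0 (1 - zb n) ^ n1 n"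
          using V0 by (intro mult_mono mult_left_mono mult_nonneg_nonneg) auto
        also have "\<dots> = inner_bound (n1 n) (n2 n) e1 e2 a b * m n ^ edges"
          unfolding V[symmetric] inner_bound_def Let_def c_def[symmetric] za_def zb_def by (simp add: mult_ac)
        finally show ?case
          unfolding Q_def by (rule ennreal_leI)
      qed
    qed
    finally show ?thesis .
  qed
  have ae1: "AE a in ?P1. \<forall>t\<in>T1. 0 \<le> a t"
    using fin \<mu>1 by (intro AE_finite_allI) (auto intro!: AE_PiM_component)
  have ae2: "AE b in ?P2. \<forall>u\<in>T2. 0 \<le> b u"
    using fin \<mu>2 by (intro AE_finite_allI) (auto intro!: AE_PiM_component)
  have \<alpha>m: "\<alpha> t \<in> borel_measurable \<mu>1" and \<gamma>m: "\<gamma> t \<in> borel_measurable \<mu>2" for t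
    unfolding \<alpha>_def \<gamma>_def measurable_cong_sets[OF \<mu>1(2) refl] measurable_cong_sets[OF \<mu>2(2) refl] by (cases "t \<in> I"; simp)+
  have A: "(\<integral>\<^sup>+x. ennreal (\<alpha> t x) \<partial>\<mu>1) = ennreal (if t \<in> I then fact (card (nb t)) * pmf D1 (card (nb t)) else mean D1)" if t: "t \<in> T1" for t
  proof (cases "t \<in> I")
    case True
    then show ?thesis using mix1(1)[of "card (nb t)"] by (simp add: \<alpha>_def)
  next
    case False
    have "(\<integral>\<^sup>+x. ennreal (\<kappa>1 * x) \<partial>\<mu>1) = ennreal (\<integral>x. \<kappa>1 * x \<partial>\<mu>1)"
      using \<mu>1(3,4) \<kappa> by (intro nn_integral_eq_integral) (auto elim!: eventually_mono)
    then show ?thesis using False t card_leaf[of t] mix1(2) by (simp add: \<alpha>_def)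
  qed
  have C: "(\<integral>\<^sup>+x. ennreal (\<gamma> t x) \<partial>\<mu>2) = ennreal (if t \<in> I then fact (card (nb t)) * pmf D2 (card (nb t)) else mean D2)" if t: "t \<in> T2" for t
  proof (cases "t \<in> I")
    case True
    then show ?thesis using mix2(1)[of "card (nb t)"] by (simp add: \<gamma>_def)
  next
    case False
    have "(\<integral>\<^sup>+x. ennreal (\<kappa>2 * x) \<partial>\<mu>2) = ennreal (\<integral>x. \<kappa>2 * x \<partial>\<mu>2)"
      using \<mu>2(3,4) \<kappa> by (intro nn_integral_eq_integral) (auto elim!: eventually_mono)
    then show ?thesis using False t card_leaf[of t] mix2(2) by (simp add: \<gamma>_def)
  qed
  have meanD: "0 \<le> mean D1" "0 \<le> mean D2" by simp_all
  have "ennreal (weight ?D) = (\<Prod>t\<in>T1. \<integral>\<^sup>+x. ennreal (\<alpha> t x) \<partial>\<mu>1) * (\<Prod>u\<in>T2. \<integral>\<^sup>+x. ennreal (\<gamma> u x) \<partial>\<mu>2)"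
  proof -
    have "(\<Prod>t\<in>T1. \<integral>\<^sup>+x. ennreal (\<alpha> t x) \<partial>\<mu>1) = ennreal (\<Prod>t\<in>T1. if t \<in> I then fact (card (nb t)) * pmf D1 (card (nb t)) else mean D1)"
      by (subst prod_ennreal[symmetric]) (auto simp: A intro!: prod.cong)
    moreover have "(\<Prod>t\<in>T2. \<integral>\<^sup>+x. ennreal (\<gamma> t x) \<partial>\<mu>2) = ennreal (\<Prod>t\<in>T2. if t \<in> I then fact (card (nb t)) * pmf D2 (card (nb t)) else mean D2)"
      by (subst prod_ennreal[symmetric]) (auto simp: C intro!: prod.cong)
    ultimately show ?thesis
      unfolding weight_eq_prod by (subst ennreal_mult) (auto intro!: prod_nonneg)
  qed
  also have "\<dots> = (\<integral>\<^sup>+a. (\<Prod>t\<in>T1. ennreal (\<alpha> t (a t))) \<partial>?P1) * (\<integral>\<^sup>+b. (\<Prod>u\<in>T2. ennreal (\<gamma> u (b u))) \<partial>?P2)"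
    using fin \<alpha>m \<gamma>m by (subst S1.product_nn_integral_prod, simp, simp, subst S2.product_nn_integral_prod) auto
  also have "\<dots> = (\<integral>\<^sup>+b. (\<integral>\<^sup>+a. (\<Prod>t\<in>T1. ennreal (\<alpha> t (a t))) \<partial>?P1) * (\<Prod>u\<in>T2. ennreal (\<gamma> u (b u))) \<partial>?P2)"
    by (intro nn_integral_cmult[symmetric] borel_measurable_prod_ennreal measurable_compose[OF _ measurable_ennreal]
        measurable_compose[OF _ \<gamma>m] measurable_component_singleton)
  also have "\<dots> = (\<integral>\<^sup>+b. \<integral>\<^sup>+a. (\<Prod>t\<in>T1. ennreal (\<alpha> t (a t))) * (\<Prod>u\<in>T2. ennreal (\<gamma> u (b u))) \<partial>?P1 \<partial>?P2)"
    by (intro nn_integral_cong nn_integral_multc[symmetric] borel_measurable_prod_ennreal measurable_compose[OF _ measurable_ennreal]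
        measurable_compose[OF _ \<alpha>m] measurable_component_singleton)
  also have "\<dots> \<le> (\<integral>\<^sup>+b. \<integral>\<^sup>+a. liminf (\<lambda>n. Q n b a) \<partial>?P1 \<partial>?P2)"
  proof (rule nn_integral_mono_AE, rule eventually_mono[OF ae2])
    fix b :: "nat list \<Rightarrow> real" assume b: "\<forall>u\<in>T2. 0 \<le> b u"
    show "(\<integral>\<^sup>+a. (\<Prod>t\<in>T1. ennreal (\<alpha> t (a t))) * (\<Prod>u\<in>T2. ennreal (\<gamma> u (b u))) \<partial>?P1) \<le> (\<integral>\<^sup>+a. liminf (\<lambda>n. Q n b a) \<partial>?P1)"
    proof (rule nn_integral_mono_AE, rule eventually_mono[OF ae1])
      fix a :: "nat list \<Rightarrow> real" assume a: "\<forall>t\<in>T1. 0 \<le> a t"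
      have nn: "0 \<le> \<alpha> t (a t)" "0 \<le> \<gamma> u (b u)" if "t \<in> T1" "u \<in> T2" for t u
        using a b \<kappa> that by (auto simp: \<alpha>_def \<gamma>_def)
      have nn1: "0 \<le> \<alpha> t (a t)" if "t \<in> T1" for t using a \<kappa> that by (auto simp: \<alpha>_def)
      have nn2: "0 \<le> \<gamma> t (b t)" if "t \<in> T2" for t using b \<kappa> that by (auto simp: \<gamma>_def)
      have "(\<Prod>t\<in>T1. ennreal (\<alpha> t (a t))) * (\<Prod>u\<in>T2. ennreal (\<gamma> u (b u))) = ennreal ((\<Prod>t\<in>T1. \<alpha> t (a t)) * (\<Prod>u\<in>T2. \<gamma> u (b u)))"
        using prod_ennreal[of T1 "\<lambda>t. \<alpha> t (a t)", OF nn1] prod_ennreal[of T2 "\<lambda>u. \<gamma> u (b u)", OF nn2]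
          ennreal_mult[OF prod_nonneg[of T1 "\<lambda>t. \<alpha> t (a t)", OF nn1] prod_nonneg[of T2 "\<lambda>u. \<gamma> u (b u)", OF nn2]]
        by (simp only:)
      then show "(\<Prod>t\<in>T1. ennreal (\<alpha> t (a t))) * (\<Prod>u\<in>T2. ennreal (\<gamma> u (b u))) \<le> liminf (\<lambda>n. Q n b a)"
        using liminf[OF a b] by simp
    qed
  qed
  \<comment> \<open>Fatou's lemma for the weights of \<open>part1\<close>, and in the next step for
    those of \<open>part2\<close>. The products involve powers of the weights, whose higher moments
    may be infinite.\<close>
  also have "\<dots> \<le> (\<integral>\<^sup>+b. liminf (\<lambda>n. \<integral>\<^sup>+a. Q n b a \<partial>?P1) \<partial>?P2)"
  proof (rule nn_integral_mono, rule nn_integral_liminf)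
    fix b :: "nat list \<Rightarrow> real" and n assume b: "b \<in> space ?P2"
    show "Q n b \<in> borel_measurable ?P1"
      using measurable_compose[OF measurable_Pair1'[OF b] Qm] by simp
  qed
  also have "\<dots> \<le> liminf (\<lambda>n. \<integral>\<^sup>+b. \<integral>\<^sup>+a. Q n b a \<partial>?P1 \<partial>?P2)"
    by (rule nn_integral_liminf, rule P1.borel_measurable_nn_integral) (use Qm in \<open>simp add: case_prod_unfold\<close>)
  finally have final: "ennreal (weight ?D) \<le> liminf (\<lambda>n. \<integral>\<^sup>+b. \<integral>\<^sup>+a. Q n b a \<partial>?P1 \<partial>?P2)" .
  \<comment> \<open>\<open>ennreal\<close> sends negative numbers to zero, so negative
    \<open>a0\<close> are carried along as a separate case.\<close>
  have ev: "\<forall>\<^sub>F n in sequentially. a0 < 0 \<or> ennreal a0 < (\<integral>\<^sup>+b. \<integral>\<^sup>+a. Q n b a \<partial>?P1 \<partial>?P2)"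
  proof (cases "a0 < 0")
    case False
    then have "ennreal a0 < ennreal (weight ?D)"
      using a0 by (subst ennreal_less_iff) auto
    also note final
    finally show ?thesis
      by (auto dest!: less_LiminfD elim!: eventually_mono)
  qed simp
  from ev show "\<forall>\<^sub>F n in sequentially. \<forall>\<phi>. admissible (\<lambda>s. if s then n1 n else n2 n) \<phi> \<longrightarrow>
      a0 < measure (inhomog_law (n1 n) (n2 n) \<mu>1 \<mu>2) {H. exact H \<phi>} *
        (real (if True then n1 n else n2 n) * mean (if True then D1 else D2)) ^ edges"
  proof eventually_elim
    case (elim n)
    show ?case
    proof (intro allI impI)
      fix \<phi> assume adm: "admissible (\<lambda>s. if s then n1 n else n2 n) \<phi>"
      interpret L: prob_space "inhomog_law (n1 n) (n2 n) \<mu>1 \<mu>2"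
        using prob_space_inhomog_law[OF \<mu>1(1) \<mu>2(1) \<mu>1(2) \<mu>2(2)] .
      let ?p = "measure (inhomog_law (n1 n) (n2 n) \<mu>1 \<mu>2) {H. exact H \<phi>}"
      have Qs: "Q n b a = ennreal (inner_bound (n1 n) (n2 n) e1 e2 a b) * ennreal (m n ^ edges)" for a b
        unfolding Q_def using m0 by (intro ennreal_mult'') auto
      have bm1: "(\<lambda>a. ennreal (inner_bound (n1 n) (n2 n) e1 e2 a b)) \<in> borel_measurable ?P1" if "b \<in> space ?P2" for b
        by (intro measurable_compose[OF _ measurable_ennreal] measurable_inner_bound[OF \<mu>1(1) \<mu>2(1) \<mu>1(2) \<mu>2(2) ints]
            measurable_ident[unfolded id_def] measurable_const[OF that])
      have bm2: "(\<lambda>p. ennreal (inner_bound (n1 n) (n2 n) e1 e2 (snd p) (fst p))) \<in> borel_measurable (?P2 \<Otimes>\<^sub>M ?P1)"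
        by (intro measurable_compose[OF _ measurable_ennreal] measurable_inner_bound[OF \<mu>1(1) \<mu>2(1) \<mu>1(2) \<mu>2(2) ints]
            measurable_fst measurable_snd)
      have "(\<integral>\<^sup>+b. \<integral>\<^sup>+a. Q n b a \<partial>?P1 \<partial>?P2) = (\<integral>\<^sup>+b. (\<integral>\<^sup>+a. ennreal (inner_bound (n1 n) (n2 n) e1 e2 a b) \<partial>?P1) * ennreal (m n ^ edges) \<partial>?P2)"
        unfolding Qs by (intro nn_integral_cong nn_integral_multc bm1)
      also have "\<dots> = (\<integral>\<^sup>+b. \<integral>\<^sup>+a. ennreal (inner_bound (n1 n) (n2 n) e1 e2 a b) \<partial>?P1 \<partial>?P2) * ennreal (m n ^ edges)"
        by (intro nn_integral_multc P1.borel_measurable_nn_integral) (use bm2 in \<open>simp add: case_prod_unfold\<close>)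
      also have "\<dots> \<le> emeasure (inhomog_law (n1 n) (n2 n) \<mu>1 \<mu>2) {H. exact H \<phi>} * ennreal (m n ^ edges)"
        using inhomog_exact_ge[OF \<mu>1(1) \<mu>2(1) \<mu>1(2) \<mu>2(2) ints adm pos] unfolding abs1 abs2 by (intro mult_right_mono) auto
      also have "\<dots> = ennreal (?p * m n ^ edges)"
        using m0 by (simp add: L.emeasure_eq_measure ennreal_mult)
      finally have "a0 < 0 \<or> ennreal a0 < ennreal (?p * m n ^ edges)"
        using elim by (auto intro: order_less_le_trans)
      moreover have "0 \<le> ?p * m n ^ edges" using m0 by simp
      ultimately have "a0 < ?p * m n ^ edges"
        by (cases "a0 < 0") (auto simp: ennreal_less_iff)
      then show "a0 < ?p * (real (if True then n1 n else n2 n) * mean (if True then D1 else D2)) ^ edges"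
        by (simp add: m_def)
    qed
  qed
qed

lemma inhomog_parts:
  assumes "prob_space \<mu>1" "prob_space \<mu>2" "sets \<mu>1 = sets borel" "sets \<mu>2 = sets borel"
  shows "AE H in inhomog_law n1 n2 \<mu>1 \<mu>2. part1 H = {..<n1} \<and> part2 H = {..<n2}"
proof -
  have pred: "Measurable.pred (count_space UNIV) (\<lambda>H :: (nat, nat) bigraph. part1 H = {..<n1} \<and> part2 H = {..<n2})"
    by simp
  show ?thesis
    unfolding inhomog_law_def AE_bind[OF measurable_weighted_law[OF assms(3,4)] pred]
    by (rule AE_I2) (auto simp: case_prod_unfold AE_measure_pmf_iff weighted_law_def simple_bigraph_def)
qed

lemma inhomog_limit:
  fixes n1 n2 :: "nat \<Rightarrow> nat" and \<mu>1 \<mu>2 :: "real measure"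
  assumes pos: "\<And>n. 0 < n1 n" "\<And>n. 0 < n2 n"
    and lim: "filterlim n1 at_top sequentially" "filterlim n2 at_top sequentially"
    and ratio: "(\<lambda>n. real (n2 n) / real (n1 n)) \<longlonglongrightarrow> \<beta>" "0 < \<beta>"
    and \<mu>1: "prob_space \<mu>1" "sets \<mu>1 = sets borel" "AE x in \<mu>1. 0 \<le> x" "integrable \<mu>1 (\<lambda>x. x)" "0 < (\<integral>x. x \<partial>\<mu>1)"
    and \<mu>2: "prob_space \<mu>2" "sets \<mu>2 = sets borel" "AE x in \<mu>2. 0 \<le> x" "integrable \<mu>2 (\<lambda>x. x)" "0 < (\<integral>x. x \<partial>\<mu>2)"
    and L: "\<And>n. L n = inhomog_law (n1 n) (n2 n) \<mu>1 \<mu>2"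
    and D1: "D1 = mixed_poisson (distr \<mu>1 borel (\<lambda>x. \<beta> powr (1/2) * x * (\<integral>y. y \<partial>\<mu>2)))"
    and D2: "D2 = mixed_poisson (distr \<mu>2 borel (\<lambda>y. \<beta> powr (-1/2) * y * (\<integral>x. x \<partial>\<mu>1)))"
  shows "weak_conv_m (\<lambda>n. X1_law (n1 n) (L n)) (real_law D1)"
    and "weak_conv_m (\<lambda>n. X2_law (n2 n) (L n)) (real_law D2)"
    and "local_conv_in_prob TYPE('h) L (\<lambda>_. intersection_graph) (gw_space D1 D2) clique_tree"
proof -
  have b: "\<beta> powr (1/2) = sqrt \<beta>" "\<beta> powr (-1/2) = 1 / sqrt \<beta>"
    using ratio(2) by (simp_all add: powr_half_sqrt powr_minus_divide)
  have D1': "D1 = mixed_poisson (distr \<mu>1 borel (\<lambda>x. sqrt \<beta> * (\<integral>y. y \<partial>\<mu>2) * x))"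
    unfolding D1 b by (simp add: mult_ac)
  have D2': "D2 = mixed_poisson (distr \<mu>2 borel (\<lambda>y. (\<integral>x. x \<partial>\<mu>1) / sqrt \<beta> * y))"
    unfolding D2 b by (simp add: mult_ac)
  have k: "0 < sqrt \<beta> * (\<integral>y. y \<partial>\<mu>2)" "0 < (\<integral>x. x \<partial>\<mu>1) / sqrt \<beta>"
    using \<mu>1(5) \<mu>2(5) ratio(2) by simp_all
  note h1 = has_pos_finite_mean_mixed_poisson[OF \<mu>1(1-4) k(1) \<mu>1(5) D1'] mean_mixed_poisson[OF \<mu>1(1-4) k(1) \<mu>1(5) D1']
  note h2 = has_pos_finite_mean_mixed_poisson[OF \<mu>2(1-4) k(2) \<mu>2(5) D2'] mean_mixed_poisson[OF \<mu>2(1-4) k(2) \<mu>2(5) D2']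
  have "mean D1 / mean D2 = sqrt \<beta> * sqrt \<beta>"
    unfolding h1(2) h2(2) using \<mu>1(5) \<mu>2(5) by simp
  also have "\<dots> = \<beta>" using ratio(2) by simp
  finally have r: "(\<lambda>n. real (n2 n) / real (n1 n)) \<longlonglongrightarrow> mean D1 / mean D2"
    using ratio(1) by simp
  have pb: "pattern_bound L (\<lambda>n s. if s then n1 n else n2 n) (\<lambda>s. if s then D1 else D2)"
    unfolding L[abs_def] by (rule inhomog_pattern_bound[OF pos lim ratio \<mu>1 \<mu>2 D1' D2'])
  have prob: "prob_space (L n)" and sets: "sets (L n) = UNIV" for n
    unfolding L using prob_space_inhomog_law[OF \<mu>1(1) \<mu>2(1) \<mu>1(2) \<mu>2(2)] sets_inhomog_law[OF \<mu>1(1) \<mu>2(1) \<mu>1(2) \<mu>2(2)] .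
  have parts: "AE H in L n. part1 H = {..<n1 n} \<and> part2 H = {..<n2 n}" for n
    unfolding L by (rule inhomog_parts[OF \<mu>1(1) \<mu>2(1) \<mu>1(2) \<mu>2(2)])
  note * = exchangeable_limit[OF prob sets pos lim r h1(1) h2(1) pb parts]
  show "weak_conv_m (\<lambda>n. X1_law (n1 n) (L n)) (real_law D1)" by (rule *(1))
  show "weak_conv_m (\<lambda>n. X2_law (n2 n) (L n)) (real_law D2)" by (rule *(2))
  show "local_conv_in_prob TYPE('h) L (\<lambda>_. intersection_graph) (gw_space D1 D2) clique_tree" by (rule *(3))
qed

theorem theorem3p1:
  fixes n1 n2 :: "nat \<Rightarrow> nat" and \<beta> :: real
    and L :: "nat \<Rightarrow> (nat, nat) bigraph measure"  \<comment> \<open>\<open>L n\<close> is the law of the bipartite graph \<open>H\<^sub>n\<close>\<close>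
    and D1 D2 :: "nat pmf"
  assumes pos: "\<And>n. 0 < n1 n" "\<And>n. 0 < n2 n"
    and lim: "filterlim n1 at_top sequentially" "filterlim n2 at_top sequentially"
    and ratio: "(\<lambda>n. real (n2 n) / real (n1 n)) \<longlonglongrightarrow> \<beta>" "0 < \<beta>"
    and model:
     "(\<exists>P :: nat \<Rightarrow> nat pmf.
         (\<forall>n. set_pmf (P n) \<subseteq> {..n2 n} \<and> L n = measure_pmf (active_law (n1 n) (n2 n) (P n))) \<and>
         has_pos_finite_mean D1 \<and>
         (\<lambda>n. \<integral>x. x \<partial>X1_law (n1 n) (L n)) \<longlonglongrightarrow> mean D1 \<and>
         weak_conv_m (\<lambda>n. X1_law (n1 n) (L n)) (real_law D1) \<and>
         D2 = poisson_pmf (mean D1 / \<beta>))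
      \<or>
      (\<exists>P :: nat \<Rightarrow> nat pmf.
         (\<forall>n. set_pmf (P n) \<subseteq> {..n1 n} \<and> L n = measure_pmf (passive_law (n1 n) (n2 n) (P n))) \<and>
         has_pos_finite_mean D2 \<and>
         (\<lambda>n. \<integral>x. x \<partial>X2_law (n2 n) (L n)) \<longlonglongrightarrow> mean D2 \<and>
         weak_conv_m (\<lambda>n. X2_law (n2 n) (L n)) (real_law D2) \<and>
         D1 = poisson_pmf (\<beta> * mean D2))
      \<or>
      (\<exists>\<mu>1 \<mu>2 :: real measure.
         (\<forall>\<mu>\<in>{\<mu>1, \<mu>2}. prob_space \<mu> \<and> sets \<mu> = sets borel \<and> (AE x in \<mu>. 0 \<le> x) \<and>
            integrable \<mu> (\<lambda>x. x) \<and> 0 < (\<integral>x. x \<partial>\<mu>)) \<and>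
         (\<forall>n. L n = inhomog_law (n1 n) (n2 n) \<mu>1 \<mu>2) \<and>
         D1 = mixed_poisson (distr \<mu>1 borel (\<lambda>x. \<beta> powr (1/2) * x * (\<integral>y. y \<partial>\<mu>2))) \<and>
         D2 = mixed_poisson (distr \<mu>2 borel (\<lambda>y. \<beta> powr (-1/2) * y * (\<integral>x. x \<partial>\<mu>1))))
      \<or>
      (\<exists>d1 d2 :: nat \<Rightarrow> nat \<Rightarrow> nat.
         (\<forall>n. (\<Sum>u<n1 n. d1 n u) = (\<Sum>v<n2 n. d2 n v) \<and>
              L n = measure_pmf (config_law (n1 n) (n2 n) (d1 n) (d2 n))) \<and>
         has_pos_finite_mean D1 \<and> has_pos_finite_mean D2 \<and>
         (\<lambda>n. mean (map_pmf (d1 n) (pmf_of_set {..<n1 n}))) \<longlonglongrightarrow> mean D1 \<and>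
         (\<lambda>n. mean (map_pmf (d2 n) (pmf_of_set {..<n2 n}))) \<longlonglongrightarrow> mean D2 \<and>
         weak_conv_m (\<lambda>n. real_law (map_pmf (d1 n) (pmf_of_set {..<n1 n}))) (real_law D1) \<and>
         weak_conv_m (\<lambda>n. real_law (map_pmf (d2 n) (pmf_of_set {..<n2 n}))) (real_law D2))"
  shows "weak_conv_m (\<lambda>n. X1_law (n1 n) (L n)) (real_law D1) \<and>
         weak_conv_m (\<lambda>n. X2_law (n2 n) (L n)) (real_law D2) \<and>
         local_conv_in_prob TYPE('h) L (\<lambda>_. intersection_graph) (gw_space D1 D2) clique_tree"
proof -
  have "weak_conv_m (\<lambda>n. X1_law (n1 n) (L n)) (real_law D1) \<and>
         weak_conv_m (\<lambda>n. X2_law (n2 n) (L n)) (real_law D2) \<and>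
         local_conv_in_prob TYPE('h) L (\<lambda>_. intersection_graph) (gw_space D1 D2) clique_tree"
    using model
  proof (elim disjE exE conjE)
    fix P :: "nat \<Rightarrow> nat pmf"
    assume P: "\<forall>n. set_pmf (P n) \<subseteq> {..n2 n} \<and> L n = measure_pmf (active_law (n1 n) (n2 n) (P n))"
      and D1: "has_pos_finite_mean D1"
      and m: "(\<lambda>n. \<integral>x. x \<partial>X1_law (n1 n) (L n)) \<longlonglongrightarrow> mean D1"
      and w: "weak_conv_m (\<lambda>n. X1_law (n1 n) (L n)) (real_law D1)"
      and D2: "D2 = poisson_pmf (mean D1 / \<beta>)"
    have supp: "set_pmf (P n) \<subseteq> {..n2 n}" and L: "L n = measure_pmf (active_law (n1 n) (n2 n) (P n))" for n
      using P by auto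
    note active = active_limit[OF pos lim ratio supp L D1 m w D2]
    have prob: "prob_space (L n)" and sets: "sets (L n) = UNIV" for n
      unfolding L by (simp_all add: measure_pmf.prob_space_axioms)
    have r: "(\<lambda>n. real (n2 n) / real (n1 n)) \<longlonglongrightarrow> mean D1 / mean D2"
      unfolding active(3) by (rule ratio(1))
    note * = exchangeable_limit[OF prob sets pos lim r D1 active(2) active(1) active(4)]
    show ?thesis
      by (intro conjI *)
  next
    fix P :: "nat \<Rightarrow> nat pmf"
    assume P: "\<forall>n. set_pmf (P n) \<subseteq> {..n1 n} \<and> L n = measure_pmf (passive_law (n1 n) (n2 n) (P n))"
      and D2: "has_pos_finite_mean D2"
      and m: "(\<lambda>n. \<integral>x. x \<partial>X2_law (n2 n) (L n)) \<longlonglongrightarrow> mean D2"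
      and w: "weak_conv_m (\<lambda>n. X2_law (n2 n) (L n)) (real_law D2)"
      and D1: "D1 = poisson_pmf (\<beta> * mean D2)"
    have supp: "set_pmf (P n) \<subseteq> {..n1 n}" and L: "L n = measure_pmf (passive_law (n1 n) (n2 n) (P n))" for n
      using P by auto
    show ?thesis
      by (intro conjI passive_limit[OF pos lim ratio supp L D2 m w D1])
  next
    fix \<mu>1 \<mu>2 :: "real measure"
    assume \<mu>: "\<forall>\<mu>\<in>{\<mu>1, \<mu>2}. prob_space \<mu> \<and> sets \<mu> = sets borel \<and> (AE x in \<mu>. 0 \<le> x) \<and>
            integrable \<mu> (\<lambda>x. x) \<and> 0 < (\<integral>x. x \<partial>\<mu>)"
      and L: "\<forall>n. L n = inhomog_law (n1 n) (n2 n) \<mu>1 \<mu>2"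
      and D1: "D1 = mixed_poisson (distr \<mu>1 borel (\<lambda>x. \<beta> powr (1/2) * x * (\<integral>y. y \<partial>\<mu>2)))"
      and D2: "D2 = mixed_poisson (distr \<mu>2 borel (\<lambda>y. \<beta> powr (-1/2) * y * (\<integral>x. x \<partial>\<mu>1)))"
    have \<mu>1: "prob_space \<mu>1" "sets \<mu>1 = sets borel" "AE x in \<mu>1. 0 \<le> x" "integrable \<mu>1 (\<lambda>x. x)" "0 < (\<integral>x. x \<partial>\<mu>1)"
      and \<mu>2: "prob_space \<mu>2" "sets \<mu>2 = sets borel" "AE x in \<mu>2. 0 \<le> x" "integrable \<mu>2 (\<lambda>x. x)" "0 < (\<integral>x. x \<partial>\<mu>2)"
      using \<mu> by simp_all
    show ?thesis
      by (intro conjI inhomog_limit[OF pos lim ratio \<mu>1 \<mu>2 spec[OF L] D1 D2])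
  next
    fix d1 d2 :: "nat \<Rightarrow> nat \<Rightarrow> nat"
    assume d: "\<forall>n. (\<Sum>u<n1 n. d1 n u) = (\<Sum>v<n2 n. d2 n v) \<and>
              L n = measure_pmf (config_law (n1 n) (n2 n) (d1 n) (d2 n))"
      and D: "has_pos_finite_mean D1" "has_pos_finite_mean D2"
      and m: "(\<lambda>n. mean (map_pmf (d1 n) (pmf_of_set {..<n1 n}))) \<longlonglongrightarrow> mean D1"
        "(\<lambda>n. mean (map_pmf (d2 n) (pmf_of_set {..<n2 n}))) \<longlonglongrightarrow> mean D2"
      and w: "weak_conv_m (\<lambda>n. real_law (map_pmf (d1 n) (pmf_of_set {..<n1 n}))) (real_law D1)"
        "weak_conv_m (\<lambda>n. real_law (map_pmf (d2 n) (pmf_of_set {..<n2 n}))) (real_law D2)"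
    have sums: "(\<Sum>u<n1 n. d1 n u) = (\<Sum>v<n2 n. d2 n v)"
      and L: "L n = measure_pmf (config_law (n1 n) (n2 n) (d1 n) (d2 n))" for n
      using d by auto
    show ?thesis
      by (intro conjI config_limit[OF pos lim sums L D m w])
  qed
  then show ?thesis .
qed

end
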